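(* Let $M$ be a hyperbolic once-punctured torus bundle with fundamental group $\Gamma$, fiber group $F_2 \trianglelefteq \Gamma$, holonomy $\rho:\Gamma\to \mathrm{PSO}(3,1)\subset \mathrm{PGL}(4,\mathbb{R})$ (of its complete hyperbolic structure) and monodromy $\phi\in \mathrm{Out}(F_2)$. Then: (1) The conjugacy class $[\rho|_{F_2}]$ of the holonomy representation restricted to the fundamental group $F_2$ of a once-punctured torus fiber is a smooth point of the character variety $\chi(F_2,\mathrm{PGL}(4,\mathbb{R}))$. (2) $[\rho|_{F_2}]$ is a fixed point of the $\Gamma/F_2$-action on $\chi(F_2,\mathrm{PGL}(4,\mathbb{R}))$ induced by $\phi$. (3) Identifying the tangent space of $\chi(F_2,\mathrm{PGL}(4,\mathbb{R}))$ at $[\rho|_{F_2}]$ with $H^1(F_2;\mathfrak{sl}(4,\mathbb{R})_{\mathrm{Ad}\rho})$, the differential of the $\Gamma/F_2$-action at this fixed point is equal to the group-theoretic action of $\Gamma/F_2$ on $H^1(F_2;\mathfrak{sl}(4,\mathbb{R})_{\mathrm{Ad}\rho})$ appearing in the Lyndon–Hochschild–Serre spectral sequence associated to the $\Gamma$-module $\mathfrak{sl}(4,\mathbb{R})_{\mathrm{Ad}\rho}$ and the normal subgroup $F_2$ of $\Gamma$.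
   Context: A hyperbolic once-punctured torus bundle $M$ is a fiber bundle over $S^1$ with fiber a once-punctured torus $F$ and monodromy $\phi\in \mathrm{SL}(2,\mathbb{Z})$, $|\mathrm{tr}\,\phi|>2$; it carries a unique complete hyperbolic structure. Write $\Gamma=\pi_1(M)$ and let $F_2=\langle a,b\rangle=\pi_1(F)$, a free normal subgroup of rank 2. With $\phi$ also denoting an automorphism of $F_2$ representing the monodromy, $\Gamma=\langle a,b,x \mid xax^{-1}=\phi(a),\ xbx^{-1}=\phi(b)\rangle$, where $x$ is a meridian of the boundary torus, so $\Gamma/F_2$ is infinite cyclic generated by the image of $x$. $\mathrm{PSO}(3,1)$ is the projectivization of the identity component $\mathrm{SO}^0(3,1)$ of the isometry group of the form $x_1y_1+x_2y_2+x_3y_3-x_4y_4$ on $\mathbb{R}^4$; it is the orientation-preserving isometry group of hyperbolic 3-space in the Klein model. The holonomy $\rho$ is the discrete faithful representation $\Gamma\to\mathrm{PSO}(3,1)$ of the complete structure. $\mathfrak{sl}(4,\mathbb{R})_{\mathrm{Ad}\rho}$ is $\mathfrak{sl}(4,\mathbb{R})$ with $\Gamma$-action $gX=\rho(g)X\rho(g)^{-1}$. $\mathrm{Hom}(F_2,\mathrm{PGL}(4,\mathbb{R}))\cong \mathrm{PGL}(4,\mathbb{R})^2$ (via values on $a,b$) is the representation variety, and $\chi(F_2,\mathrm{PGL}(4,\mathbb{R}))$ is the character variety: representations of $F_2$ into $\mathrm{PGL}(4,\mathbb{R})$ modulo conjugation by $\mathrm{PGL}(4,\mathbb{R})$. A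 smooth point is a point near which this quotient is a smooth manifold (with the structure induced from the representation variety). Induced action: the monodromy acts on the representation variety by $(\phi\sigma)(g)=\rho(x)\,\sigma(\phi^{-1}(g))\,\rho(x)^{-1}=\rho(x)\,\sigma(x^{-1}gx)\,\rho(x)^{-1}$ for $g\in F_2$. Replacing $x$ by another element of the coset $xF_2$ gives the same action on conjugacy classes, so this defines an action of $\Gamma/F_2$ on $\chi(F_2,\mathrm{PGL}(4,\mathbb{R}))$ with generator $[\sigma]\mapsto[\phi\sigma]$. Tangent space identification: a smooth path $\rho_t$ of representations of $F_2$ with $\rho_0=\rho|_{F_2}$ corresponds to the crossed homomorphism $f(g)=\frac{d}{dt}\big|_{t=0}\rho_t(g)\rho(g)^{-1}$ (i.e. $f(gh)=f(g)+gf(h)$), and coboundaries $f(g)=(1-g)X$ correspond to paths obtained by conjugation; this identifies the tangent space to the character variety at $[\rho|_{F_2}]$ with $H^1(F_2;\mathfrak{sl}(4,\mathbb{R})_{\mathrm{Ad}\rho})$. Group-theoretic action: for $\gamma\in\Gamma$ and a 1-cocycle $f:F_2\to \mathfrak{sl}(4,\mathbb{R})_{\mathrm{Ad}\rho}$, $(\gamma f)(g)=\gamma f(\gamma^{-1}g\gamma)$; this induces an action of $\Gamma$ on $H^1(F_2;\mathfrak{sl}(4,\mathbb{R})_{\mathrm{Ad}\rho})$ that factors through $\Gamma/F_2$ and is the one in the spectral sequence $E_2^{p,q}=H^p(\Gamma/F_2;H^q(F_2;\mathfrak{sl}(4,\mathbb{R})_{\mathrm{Ad}\rho}))\Rightarrow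 H^{p+q}(\Gamma;\mathfrak{sl}(4,\mathbb{R})_{\mathrm{Ad}\rho})$. *)

theory Defs
  imports "HOL-Analysis.Analysis" "HOL-Algebra.Generated_Groups"
begin

section \<open>Smooth maps and quotient spaces\<close>

text \<open>\<open>Ck_on k S f\<close>: on the open set \<open>S\<close>, all iterated directional derivatives of \<open>f\<close> of order
  at most \<open>k\<close> exist (as Frechet derivatives) and are continuous.\<close>

fun Ck_on :: "nat \<Rightarrow> 'a::real_normed_vector set \<Rightarrow> ('a \<Rightarrow> 'b::real_normed_vector) \<Rightarrow> bool" where
  "Ck_on 0 S f \<longleftrightarrow> continuous_on S f"
| "Ck_on (Suc k) S f \<longleftrightarrow> (\<forall>y\<in>S. f differentiable (at y)) \<and>
     (\<forall>v. Ck_on k S (\<lambda>y. frechet_derivative f (at y) v))"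

definition smooth_on :: "'a::real_normed_vector set \<Rightarrow> ('a \<Rightarrow> 'b::real_normed_vector) \<Rightarrow> bool" where
  "smooth_on S f \<longleftrightarrow> open S \<and> (\<forall>k. Ck_on k S f)"

definition quotient_topology :: "'a topology \<Rightarrow> ('a \<Rightarrow> 'b) \<Rightarrow> 'b topology" where
  "quotient_topology X q =
     topology (\<lambda>U. U \<subseteq> q ` topspace X \<and> openin X {p \<in> topspace X. q p \<in> U})"

lemma openin_quotient_topology:
  "openin (quotient_topology X q) U \<longleftrightarrow>
     U \<subseteq> q ` topspace X \<and> openin X {p \<in> topspace X. q p \<in> U}"
proof -
  have "istopology (\<lambda>U. U \<subseteq> q ` topspace X \<and> openin X {p \<in> topspace X. q p \<in> U})"
    unfolding istopology_def
  proof (intro conjI allI impI)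
    fix S T
    assume S: "S \<subseteq> q ` topspace X \<and> openin X {p \<in> topspace X. q p \<in> S}"
      and T: "T \<subseteq> q ` topspace X \<and> openin X {p \<in> topspace X. q p \<in> T}"
    show "S \<inter> T \<subseteq> q ` topspace X" using S by blast
    have "{p \<in> topspace X. q p \<in> S \<inter> T} = {p \<in> topspace X. q p \<in> S} \<inter> {p \<in> topspace X. q p \<in> T}"
      by blast
    then show "openin X {p \<in> topspace X. q p \<in> S \<inter> T}" using S T by auto
  next
    fix K
    assume K: "\<forall>S\<in>K. S \<subseteq> q ` topspace X \<and> openin X {p \<in> topspace X. q p \<in> S}"
    show "\<Union>K \<subseteq> q ` topspace X" using K by blast
    have "{p \<in> topspace X. q p \<in> \<Union>K} = (\<Union>S\<in>K. {p \<in> topspace X. q p \<in> S})" by blast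
    then show "openin X {p \<in> topspace X. q p \<in> \<Union>K}" using K by auto
  qed
  then show ?thesis unfolding quotient_topology_def by (simp add: topology_inverse')
qed

lemma quotient_map_quotient_topology: "quotient_map X (quotient_topology X q) q"
proof -
  have "topspace (quotient_topology X q) = q ` topspace X"
  proof
    show "topspace (quotient_topology X q) \<subseteq> q ` topspace X"
      using openin_quotient_topology[of X q "topspace (quotient_topology X q)"] by simp
    have "{p \<in> topspace X. q p \<in> q ` topspace X} = topspace X" by blast
    then have "openin (quotient_topology X q) (q ` topspace X)"
      by (simp add: openin_quotient_topology)
    then show "q ` topspace X \<subseteq> topspace (quotient_topology X q)" by (rule openin_subset)
  qed
  then show ?thesis unfolding quotient_map_def by (simp add: openin_quotient_topology)
qed

section \<open>The projective general linear group and hyperbolic isometries\<close>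

type_synonym mat4 = "real^4^4"

definition GL4 :: "mat4 monoid" where
  "GL4 = \<lparr>carrier = {A. invertible A}, mult = (**), one = mat 1\<rparr>"

definition scalars4 :: "mat4 set" where
  "scalars4 = {c *\<^sub>R mat 1 | c. c \<noteq> 0}"

text \<open>An element of \<open>PGL4\<close> is the set of all matrices representing it.\<close>

definition PGL4 :: "mat4 set monoid" where
  "PGL4 = GL4 Mod scalars4"

lemma group_GL4: "group GL4"
proof (rule groupI)
  fix A assume "A \<in> carrier GL4"
  then show "\<exists>B\<in>carrier GL4. B \<otimes>\<^bsub>GL4\<^esub> A = \<one>\<^bsub>GL4\<^esub>"
    unfolding GL4_def by (auto simp: invertible_def)
next
  show "\<one>\<^bsub>GL4\<^esub> \<in> carrier GL4"
    by (auto simp: GL4_def invertible_def intro: exI[of _ "mat 1"])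
qed (auto simp: GL4_def invertible_mult matrix_mul_assoc)

lemma scaleR_mat_mult: "(c *\<^sub>R mat 1) ** A = c *\<^sub>R (A::mat4)" "A ** (c *\<^sub>R mat 1) = c *\<^sub>R A"
  by (auto simp: vec_eq_iff matrix_matrix_mult_def mat_def if_distrib if_distribR sum.delta sum.delta' cong: if_cong)

lemma scalars4_normal: "scalars4 \<lhd> GL4"
proof -
  interpret GL: group GL4 by (rule group_GL4)
  have inv1: "invertible (c *\<^sub>R mat 1 :: mat4)" if "c \<noteq> 0" for c :: real
    unfolding invertible_def using that
    by (intro exI[of _ "inverse c *\<^sub>R mat 1"]) (auto simp: scaleR_mat_mult)
  have sub: "scalars4 \<subseteq> carrier GL4" using inv1 by (auto simp: scalars4_def GL4_def)
  have "subgroup scalars4 GL4"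
  proof (rule GL.subgroupI)
    show "scalars4 \<subseteq> carrier GL4" by (rule sub)
    show "scalars4 \<noteq> {}" by (auto simp: scalars4_def intro: exI[of _ 1])
  next
    fix A assume "A \<in> scalars4"
    then obtain c where c: "A = c *\<^sub>R mat 1" "c \<noteq> 0" by (auto simp: scalars4_def)
    have "inverse c *\<^sub>R mat 1 \<in> scalars4" using c by (auto simp: scalars4_def)
    moreover have "inv\<^bsub>GL4\<^esub> A = inverse c *\<^sub>R mat 1"
      using c sub calculation \<open>A \<in> scalars4\<close>
      by (intro GL.inv_equality) (auto simp: GL4_def scaleR_mat_mult)
    ultimately show "inv\<^bsub>GL4\<^esub> A \<in> scalars4" by simp
  next
    fix A B assume "A \<in> scalars4" "B \<in> scalars4"
    then show "A \<otimes>\<^bsub>GL4\<^esub> B \<in> scalars4" by (auto simp: scalars4_def GL4_def scaleR_mat_mult)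
  qed
  moreover have "A \<otimes>\<^bsub>GL4\<^esub> S \<otimes>\<^bsub>GL4\<^esub> inv\<^bsub>GL4\<^esub> A = S" if "A \<in> carrier GL4" "S \<in> scalars4" for A S
  proof -
    have "A \<otimes>\<^bsub>GL4\<^esub> S = S \<otimes>\<^bsub>GL4\<^esub> A" using that by (auto simp: scalars4_def GL4_def scaleR_mat_mult)
    then show ?thesis using that sub by (auto simp: GL.m_assoc)
  qed
  ultimately show ?thesis by (simp add: GL.normal_inv_iff)
qed

lemma group_PGL4: "group PGL4"
  unfolding PGL4_def using scalars4_normal by (rule normal.factorgroup_is_group)

definition pgl :: "mat4 \<Rightarrow> mat4 set" where
  "pgl A = scalars4 #>\<^bsub>GL4\<^esub> A"

definition PGL4_top :: "mat4 set topology" where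
  "PGL4_top = quotient_topology (top_of_set (carrier GL4)) pgl"

definition lorentz :: "real^4 \<Rightarrow> real^4 \<Rightarrow> real" where
  "lorentz u v = u$1 * v$1 + u$2 * v$2 + u$3 * v$3 - u$4 * v$4"

definition O31 :: "mat4 set" where
  "O31 = {A. \<forall>u v. lorentz (A *v u) (A *v v) = lorentz u v}"

definition SO31_0 :: "mat4 set" where
  "SO31_0 = connected_component_set O31 (mat 1)"

definition PSO31 :: "mat4 set set" where
  "PSO31 = pgl ` SO31_0"

definition sl4 :: "mat4 set" where
  "sl4 = {X. trace X = 0}"

text \<open>The adjoint action of an element of \<open>PGL4\<close>; it does not depend on the representing matrix.\<close>

definition Ad :: "mat4 set \<Rightarrow> mat4 \<Rightarrow> mat4" where
  "Ad K X = (let A = (SOME A. A \<in> K) in A ** X ** matrix_inv A)"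

section \<open>Hyperbolic once-punctured torus bundles\<close>

text \<open>Words in \<open>a\<close>, \<open>b\<close> and their inverses: the letter \<open>(s, e)\<close> is \<open>a\<close> if \<open>s\<close> and \<open>b\<close> otherwise,
  inverted unless \<open>e\<close>.\<close>

definition letter_val :: "('g, 'm) monoid_scheme \<Rightarrow> 'g \<Rightarrow> 'g \<Rightarrow> bool \<times> bool \<Rightarrow> 'g" where
  "letter_val G a b l =
     (let y = (if fst l then a else b) in if snd l then y else inv\<^bsub>G\<^esub> y)"

definition word_val :: "('g, 'm) monoid_scheme \<Rightarrow> 'g \<Rightarrow> 'g \<Rightarrow> (bool \<times> bool) list \<Rightarrow> 'g" where
  "word_val G a b w = foldr (\<lambda>l y. letter_val G a b l \<otimes>\<^bsub>G\<^esub> y) w \<one>\<^bsub>G\<^esub>"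

definition reduced_word :: "(bool \<times> bool) list \<Rightarrow> bool" where
  "reduced_word w \<longleftrightarrow> successively (\<lambda>l m. \<not> (fst l = fst m \<and> snd l \<noteq> snd m)) w"

definition free_on_pair :: "('g, 'm) monoid_scheme \<Rightarrow> 'g set \<Rightarrow> 'g \<Rightarrow> 'g \<Rightarrow> bool" where
  "free_on_pair G F a b \<longleftrightarrow> a \<in> carrier G \<and> b \<in> carrier G \<and> F = generate G {a, b} \<and>
     (\<forall>w. w \<noteq> [] \<longrightarrow> reduced_word w \<longrightarrow> word_val G a b w \<noteq> \<one>\<^bsub>G\<^esub>)"

text \<open>\<open>G\<close> is the fundamental group of the bundle, \<open>F = \<langle>a, b\<rangle>\<close> that of the fibre; \<open>\<phi>\<close> is conjugation
  by \<open>x\<close>, and \<open>A\<close> is the matrix of \<open>\<phi>\<close> on the abelianization of \<open>F\<close> with respect to \<open>a, b\<close>.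
  The boundary of the fibre represents a conjugate of the commutator of \<open>a\<close> and \<open>b\<close>; the last
  clause says that \<open>x\<close> lies in the corresponding peripheral subgroup of \<open>G\<close>.\<close>

definition punctured_torus_bundle_group ::
  "('g, 'm) monoid_scheme \<Rightarrow> 'g set \<Rightarrow> 'g \<Rightarrow> 'g \<Rightarrow> 'g \<Rightarrow> ('g \<Rightarrow> 'g) \<Rightarrow> int^2^2 \<Rightarrow> bool" where
  "punctured_torus_bundle_group G F a b x \<phi> A \<longleftrightarrow>
     group G \<and> F \<lhd> G \<and> free_on_pair G F a b \<and>
     x \<in> carrier G \<and>
     carrier (G Mod F) = generate (G Mod F) {F #>\<^bsub>G\<^esub> x} \<and> infinite (carrier (G Mod F)) \<and>
     \<phi> \<in> iso (G\<lparr>carrier := F\<rparr>) (G\<lparr>carrier := F\<rparr>) \<and>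
     (\<forall>g\<in>F. x \<otimes>\<^bsub>G\<^esub> g \<otimes>\<^bsub>G\<^esub> inv\<^bsub>G\<^esub> x = \<phi> g) \<and>
     (\<exists>c\<in>derived G F. \<phi> a = a [^]\<^bsub>G\<^esub> (A$1$1) \<otimes>\<^bsub>G\<^esub> b [^]\<^bsub>G\<^esub> (A$2$1) \<otimes>\<^bsub>G\<^esub> c) \<and>
     (\<exists>c\<in>derived G F. \<phi> b = a [^]\<^bsub>G\<^esub> (A$1$2) \<otimes>\<^bsub>G\<^esub> b [^]\<^bsub>G\<^esub> (A$2$2) \<otimes>\<^bsub>G\<^esub> c) \<and>
     det A = 1 \<and> \<bar>trace A\<bar> > 2 \<and>
     (\<exists>g\<in>F. let c = g \<otimes>\<^bsub>G\<^esub> (a \<otimes>\<^bsub>G\<^esub> b \<otimes>\<^bsub>G\<^esub> inv\<^bsub>G\<^esub> a \<otimes>\<^bsub>G\<^esub> inv\<^bsub>G\<^esub> b) \<otimes>\<^bsub>G\<^esub> inv\<^bsub>G\<^esub> g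
             in x \<otimes>\<^bsub>G\<^esub> c = c \<otimes>\<^bsub>G\<^esub> x)"

text \<open>The bundle itself: the mapping torus of the action of \<open>A\<close> on the punctured torus
  \<open>(\<real>\<^sup>2 - \<int>\<^sup>2) / \<int>\<^sup>2\<close>, as a quotient of \<open>(\<real>\<^sup>2 - \<int>\<^sup>2) \<times> \<real>\<close> by the translations in \<open>\<int>\<^sup>2\<close> and by
  \<open>(p, t) \<mapsto> (A p, t + 1)\<close>.\<close>

definition int_points :: "(real^2) set" where
  "int_points = {p. \<forall>i. p$i \<in> \<int>}"

definition bundle_rel :: "int^2^2 \<Rightarrow> (real^2) \<times> real \<Rightarrow> (real^2) \<times> real \<Rightarrow> bool" where
  "bundle_rel A y z \<longleftrightarrow> (\<exists>n::nat.
     (snd z = snd y + real n \<and> fst z - (((*v) (map_matrix real_of_int A)) ^^ n) (fst y) \<in> int_points) \<or>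
     (snd y = snd z + real n \<and> fst y - (((*v) (map_matrix real_of_int A)) ^^ n) (fst z) \<in> int_points))"

definition bundle_space :: "int^2^2 \<Rightarrow> ((real^2) \<times> real) set topology" where
  "bundle_space A =
     quotient_topology (top_of_set ((- int_points) \<times> UNIV))
       (\<lambda>y. {z \<in> (- int_points) \<times> UNIV. bundle_rel A y z})"

text \<open>Klein model: hyperbolic space is the set of lines on which the form is negative. Since the
  members of \<open>\<rho> \<gamma>\<close> are all the matrices representing it, the orbits below absorb rescaling of
  vectors, so that this is the quotient of hyperbolic space by the image of \<open>\<rho>\<close>.\<close>

definition hyperbolic_quotient ::
  "('g, 'm) monoid_scheme \<Rightarrow> ('g \<Rightarrow> mat4 set) \<Rightarrow> (real^4) set topology" where
  "hyperbolic_quotient G \<rho> =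
     quotient_topology (top_of_set {u. lorentz u u < 0})
       (\<lambda>u. {B *v u | B \<gamma>. \<gamma> \<in> carrier G \<and> B \<in> \<rho> \<gamma>})"

definition holonomy_of_complete_structure ::
  "('g, 'm) monoid_scheme \<Rightarrow> int^2^2 \<Rightarrow> ('g \<Rightarrow> mat4 set) \<Rightarrow> bool" where
  "holonomy_of_complete_structure G A \<rho> \<longleftrightarrow>
     \<rho> \<in> hom G PGL4 \<and> \<rho> ` carrier G \<subseteq> PSO31 \<and> inj_on \<rho> (carrier G) \<and>
     subtopology PGL4_top (\<rho> ` carrier G) = discrete_topology (\<rho> ` carrier G) \<and>
     hyperbolic_quotient G \<rho> homeomorphic_space bundle_space A"

section \<open>Representation variety and character variety\<close>

definition Reps :: "('g, 'm) monoid_scheme \<Rightarrow> 'g set \<Rightarrow> ('g \<Rightarrow> mat4 set) set" where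
  "Reps G F = hom (G\<lparr>carrier := F\<rparr>) PGL4 \<inter> extensional F"

definition Reps_top ::
  "('g, 'm) monoid_scheme \<Rightarrow> 'g set \<Rightarrow> 'g \<Rightarrow> 'g \<Rightarrow> ('g \<Rightarrow> mat4 set) topology" where
  "Reps_top G F a b =
     pullback_topology (Reps G F) (\<lambda>\<sigma>. (\<sigma> a, \<sigma> b)) (prod_topology PGL4_top PGL4_top)"

definition rep_of ::
  "('g, 'm) monoid_scheme \<Rightarrow> 'g set \<Rightarrow> 'g \<Rightarrow> 'g \<Rightarrow> mat4 \<times> mat4 \<Rightarrow> ('g \<Rightarrow> mat4 set)" where
  "rep_of G F a b AB =
     the_inv_into (Reps G F) (\<lambda>\<sigma>. (\<sigma> a, \<sigma> b)) (pgl (fst AB), pgl (snd AB))"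

definition conj_class :: "'g set \<Rightarrow> ('g \<Rightarrow> mat4 set) \<Rightarrow> ('g \<Rightarrow> mat4 set) set" where
  "conj_class F \<sigma> =
     {(\<lambda>g\<in>F. h \<otimes>\<^bsub>PGL4\<^esub> \<sigma> g \<otimes>\<^bsub>PGL4\<^esub> inv\<^bsub>PGL4\<^esub> h) | h. h \<in> carrier PGL4}"

definition char_variety ::
  "('g, 'm) monoid_scheme \<Rightarrow> 'g set \<Rightarrow> 'g \<Rightarrow> 'g \<Rightarrow> ('g \<Rightarrow> mat4 set) set topology" where
  "char_variety G F a b = quotient_topology (Reps_top G F a b) (conj_class F)"

text \<open>A chart \<open>\<kappa>\<close> on the open set \<open>U\<close> for the manifold structure induced from the representation
  variety: the projection from the representation variety is a smooth submersion in this chart.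
  Smoothness and submersivity are tested on the preimage under the submersion
  \<open>GL4 \<times> GL4 \<rightarrow> PGL4 \<times> PGL4 \<cong> Hom(F, PGL4)\<close>. The model space is a linear subspace \<open>V\<close> of
  \<open>mat4 \<times> mat4\<close>: this leaves the dimension of the manifold free, as it cannot exceed
  \<open>dim (PGL4 \<times> PGL4) = 30\<close>.\<close>

definition char_chart ::
  "('g, 'm) monoid_scheme \<Rightarrow> 'g set \<Rightarrow> 'g \<Rightarrow> 'g \<Rightarrow> ('g \<Rightarrow> mat4 set) set set \<Rightarrow>
   (('g \<Rightarrow> mat4 set) set \<Rightarrow> mat4 \<times> mat4) \<Rightarrow> (mat4 \<times> mat4) set \<Rightarrow> bool" where
  "char_chart G F a b U \<kappa> V \<longleftrightarrow>
     openin (char_variety G F a b) U \<and> subspace V \<and> openin (top_of_set V) (\<kappa> ` U) \<and>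
     homeomorphic_map (subtopology (char_variety G F a b) U) (top_of_set (\<kappa> ` U)) \<kappa> \<and>
     (let W = {AB \<in> carrier GL4 \<times> carrier GL4. conj_class F (rep_of G F a b AB) \<in> U};
          \<Phi> = (\<lambda>AB. \<kappa> (conj_class F (rep_of G F a b AB)))
      in smooth_on W \<Phi> \<and> (\<forall>AB\<in>W. range (frechet_derivative \<Phi> (at AB)) = V))"

definition smooth_point ::
  "('g, 'm) monoid_scheme \<Rightarrow> 'g set \<Rightarrow> 'g \<Rightarrow> 'g \<Rightarrow> ('g \<Rightarrow> mat4 set) set \<Rightarrow> bool" where
  "smooth_point G F a b P \<longleftrightarrow> (\<exists>U \<kappa> V. char_chart G F a b U \<kappa> V \<and> P \<in> U)"

text \<open>The action on representations of \<open>F\<close> and, for a coset \<open>C\<close> of \<open>F\<close>, the induced action on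
  conjugacy classes; taking all \<open>\<gamma> \<in> C\<close> and all members of the class avoids any choice.\<close>

definition rep_act ::
  "('g, 'm) monoid_scheme \<Rightarrow> 'g set \<Rightarrow> ('g \<Rightarrow> mat4 set) \<Rightarrow> 'g \<Rightarrow> ('g \<Rightarrow> mat4 set) \<Rightarrow> ('g \<Rightarrow> mat4 set)" where
  "rep_act G F \<rho> \<gamma> \<sigma> =
     (\<lambda>g\<in>F. \<rho> \<gamma> \<otimes>\<^bsub>PGL4\<^esub> \<sigma> (inv\<^bsub>G\<^esub> \<gamma> \<otimes>\<^bsub>G\<^esub> g \<otimes>\<^bsub>G\<^esub> \<gamma>) \<otimes>\<^bsub>PGL4\<^esub> inv\<^bsub>PGL4\<^esub> (\<rho> \<gamma>))"

definition char_act ::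
  "('g, 'm) monoid_scheme \<Rightarrow> 'g set \<Rightarrow> ('g \<Rightarrow> mat4 set) \<Rightarrow> 'g set \<Rightarrow>
   ('g \<Rightarrow> mat4 set) set \<Rightarrow> ('g \<Rightarrow> mat4 set) set" where
  "char_act G F \<rho> C P = {rep_act G F \<rho> \<gamma> \<sigma> | \<gamma> \<sigma>. \<gamma> \<in> C \<and> \<sigma> \<in> P}"

lemma char_act_conj_class:
  assumes F: "F \<lhd> G" and \<rho>: "\<rho> \<in> hom G PGL4" and \<sigma>: "\<sigma> \<in> Reps G F"
    and C: "C \<in> carrier (G Mod F)" and \<gamma>: "\<gamma> \<in> C"
  shows "char_act G F \<rho> C (conj_class F \<sigma>) = conj_class F (rep_act G F \<rho> \<gamma> \<sigma>)"
proof -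
  interpret N: normal F G by (rule F)
  interpret P: group PGL4 by (rule group_PGL4)
  interpret R: group_hom G PGL4 \<rho> using \<rho> by (unfold_locales)
  have FG: "g \<in> carrier G" if "g \<in> F" for g using that by (rule N.mem_carrier)
  have \<sigma>c: "\<sigma> g \<in> carrier PGL4" if "g \<in> F" for g
    using \<sigma> that by (auto simp: Reps_def hom_def Pi_iff)
  have \<sigma>m: "\<sigma> (g \<otimes>\<^bsub>G\<^esub> h) = \<sigma> g \<otimes>\<^bsub>PGL4\<^esub> \<sigma> h" if "g \<in> F" "h \<in> F" for g h
    using \<sigma> that by (auto simp: Reps_def hom_def)
  have \<sigma>i: "\<sigma> (inv\<^bsub>G\<^esub> g) = inv\<^bsub>PGL4\<^esub> (\<sigma> g)" if g: "g \<in> F" for g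
  proof -
    have "\<sigma> \<one>\<^bsub>G\<^esub> \<otimes>\<^bsub>PGL4\<^esub> \<sigma> \<one>\<^bsub>G\<^esub> = \<sigma> \<one>\<^bsub>G\<^esub>" using \<sigma>m[of "\<one>\<^bsub>G\<^esub>" "\<one>\<^bsub>G\<^esub>"] by simp
    then have "\<sigma> \<one>\<^bsub>G\<^esub> = \<one>\<^bsub>PGL4\<^esub>" using \<sigma>c by simp
    then have "\<sigma> (inv\<^bsub>G\<^esub> g) \<otimes>\<^bsub>PGL4\<^esub> \<sigma> g = \<one>\<^bsub>PGL4\<^esub>" using \<sigma>m[of "inv\<^bsub>G\<^esub> g" g] g FG by simp
    then show ?thesis using \<sigma>c g by (simp add: P.inv_equality)
  qed
  have sF: "inv\<^bsub>G\<^esub> g \<in> F" "g \<otimes>\<^bsub>G\<^esub> h \<in> F" if "g \<in> F" "h \<in> F" for g h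
    using that N.subgroup_axioms by (auto intro: subgroup.m_closed)
  obtain y where y: "y \<in> carrier G" "C = F #>\<^bsub>G\<^esub> y"
    using C by (auto simp: FactGroup_def RCOSETS_def)
  have \<gamma>G: "\<gamma> \<in> carrier G" using \<gamma> y FG by (auto simp: r_coset_def)
  have C\<gamma>: "C = F #>\<^bsub>G\<^esub> \<gamma>" using y \<gamma> N.repr_independence[OF _ y(1)] N.is_subgroup by simp
  have CF: "C = \<gamma> <#\<^bsub>G\<^esub> F" using C\<gamma> N.coset_eq \<gamma>G by simp
  have canc: "inv\<^bsub>PGL4\<^esub> p \<otimes>\<^bsub>PGL4\<^esub> (p \<otimes>\<^bsub>PGL4\<^esub> q) = q" "p \<otimes>\<^bsub>PGL4\<^esub> (inv\<^bsub>PGL4\<^esub> p \<otimes>\<^bsub>PGL4\<^esub> q) = q"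
    if "p \<in> carrier PGL4" "q \<in> carrier PGL4" for p q
    using that by (simp_all flip: P.m_assoc)
  have cj: "inv\<^bsub>G\<^esub> \<delta> \<otimes>\<^bsub>G\<^esub> g \<otimes>\<^bsub>G\<^esub> \<delta> \<in> F" if "\<delta> \<in> carrier G" "g \<in> F" for \<delta> g
    using N.inv_op_closed1[OF that] .
  have key: "rep_act G F \<rho> (\<gamma> \<otimes>\<^bsub>G\<^esub> k) (\<lambda>g\<in>F. h \<otimes>\<^bsub>PGL4\<^esub> \<sigma> g \<otimes>\<^bsub>PGL4\<^esub> inv\<^bsub>PGL4\<^esub> h)
      = (\<lambda>g\<in>F. m \<otimes>\<^bsub>PGL4\<^esub> rep_act G F \<rho> \<gamma> \<sigma> g \<otimes>\<^bsub>PGL4\<^esub> inv\<^bsub>PGL4\<^esub> m)"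
    if k: "k \<in> F" and h: "h \<in> carrier PGL4"
      and m: "m = \<rho> \<gamma> \<otimes>\<^bsub>PGL4\<^esub> \<rho> k \<otimes>\<^bsub>PGL4\<^esub> h \<otimes>\<^bsub>PGL4\<^esub> inv\<^bsub>PGL4\<^esub> (\<sigma> k) \<otimes>\<^bsub>PGL4\<^esub> inv\<^bsub>PGL4\<^esub> (\<rho> \<gamma>)"
    for k h m
  proof
    fix g
    show "rep_act G F \<rho> (\<gamma> \<otimes>\<^bsub>G\<^esub> k) (\<lambda>g\<in>F. h \<otimes>\<^bsub>PGL4\<^esub> \<sigma> g \<otimes>\<^bsub>PGL4\<^esub> inv\<^bsub>PGL4\<^esub> h) g
      = (\<lambda>g\<in>F. m \<otimes>\<^bsub>PGL4\<^esub> rep_act G F \<rho> \<gamma> \<sigma> g \<otimes>\<^bsub>PGL4\<^esub> inv\<^bsub>PGL4\<^esub> m) g"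
    proof (cases "g \<in> F")
      case True
      let ?u = "inv\<^bsub>G\<^esub> \<gamma> \<otimes>\<^bsub>G\<^esub> g \<otimes>\<^bsub>G\<^esub> \<gamma>"
      have u: "?u \<in> F" using cj \<gamma>G True by blast
      have e: "inv\<^bsub>G\<^esub> (\<gamma> \<otimes>\<^bsub>G\<^esub> k) \<otimes>\<^bsub>G\<^esub> g \<otimes>\<^bsub>G\<^esub> (\<gamma> \<otimes>\<^bsub>G\<^esub> k) = inv\<^bsub>G\<^esub> k \<otimes>\<^bsub>G\<^esub> ?u \<otimes>\<^bsub>G\<^esub> k"
        using \<gamma>G FG k True by (simp add: N.inv_mult_group N.m_assoc)
      have eu: "\<sigma> (inv\<^bsub>G\<^esub> k \<otimes>\<^bsub>G\<^esub> ?u \<otimes>\<^bsub>G\<^esub> k)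
          = inv\<^bsub>PGL4\<^esub> (\<sigma> k) \<otimes>\<^bsub>PGL4\<^esub> \<sigma> ?u \<otimes>\<^bsub>PGL4\<^esub> \<sigma> k"
        using u k \<sigma>m \<sigma>i sF by metis
      have inF: "inv\<^bsub>G\<^esub> k \<otimes>\<^bsub>G\<^esub> ?u \<otimes>\<^bsub>G\<^esub> k \<in> F" using u k sF by metis
      have c: "\<rho> \<gamma> \<in> carrier PGL4" "\<rho> k \<in> carrier PGL4" "\<sigma> k \<in> carrier PGL4" "\<sigma> ?u \<in> carrier PGL4"
        using \<gamma>G FG k u \<sigma>c by auto
      show ?thesis
        using True c h inF k \<gamma>G FG unfolding rep_act_def m
        by (simp add: e eu canc P.m_assoc P.inv_mult_group)
    qed (simp add: rep_act_def)
  qed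
  show ?thesis
  proof
    show "char_act G F \<rho> C (conj_class F \<sigma>) \<subseteq> conj_class F (rep_act G F \<rho> \<gamma> \<sigma>)"
    proof
      fix \<tau> assume "\<tau> \<in> char_act G F \<rho> C (conj_class F \<sigma>)"
      then obtain \<delta> h where \<delta>: "\<delta> \<in> C" and h: "h \<in> carrier PGL4"
        and \<tau>: "\<tau> = rep_act G F \<rho> \<delta> (\<lambda>g\<in>F. h \<otimes>\<^bsub>PGL4\<^esub> \<sigma> g \<otimes>\<^bsub>PGL4\<^esub> inv\<^bsub>PGL4\<^esub> h)"
        by (auto simp: char_act_def conj_class_def)
      obtain k where k: "k \<in> F" "\<delta> = \<gamma> \<otimes>\<^bsub>G\<^esub> k" using \<delta> CF by (auto simp: l_coset_def)
      show "\<tau> \<in> conj_class F (rep_act G F \<rho> \<gamma> \<sigma>)"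
        unfolding conj_class_def \<tau> k(2) key[OF k(1) h refl]
        by (rule CollectI, rule exI, rule conjI, rule refl)
          (use k(1) h FG \<gamma>G \<sigma>c in simp)
    qed
  next
    show "conj_class F (rep_act G F \<rho> \<gamma> \<sigma>) \<subseteq> char_act G F \<rho> C (conj_class F \<sigma>)"
    proof
      fix \<tau> assume "\<tau> \<in> conj_class F (rep_act G F \<rho> \<gamma> \<sigma>)"
      then obtain m where m: "m \<in> carrier PGL4"
        and \<tau>: "\<tau> = (\<lambda>g\<in>F. m \<otimes>\<^bsub>PGL4\<^esub> rep_act G F \<rho> \<gamma> \<sigma> g \<otimes>\<^bsub>PGL4\<^esub> inv\<^bsub>PGL4\<^esub> m)"
        by (auto simp: conj_class_def)
      define h where "h = inv\<^bsub>PGL4\<^esub> (\<rho> \<gamma>) \<otimes>\<^bsub>PGL4\<^esub> m \<otimes>\<^bsub>PGL4\<^esub> \<rho> \<gamma>"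
      have 1: "\<one>\<^bsub>G\<^esub> \<in> F" by simp
      have "\<sigma> \<one>\<^bsub>G\<^esub> = \<one>\<^bsub>PGL4\<^esub>" using \<sigma>m[OF 1 1] \<sigma>c[OF 1] by simp
      then have "m = \<rho> \<gamma> \<otimes>\<^bsub>PGL4\<^esub> \<rho> \<one>\<^bsub>G\<^esub> \<otimes>\<^bsub>PGL4\<^esub> h \<otimes>\<^bsub>PGL4\<^esub> inv\<^bsub>PGL4\<^esub> (\<sigma> \<one>\<^bsub>G\<^esub>) \<otimes>\<^bsub>PGL4\<^esub> inv\<^bsub>PGL4\<^esub> (\<rho> \<gamma>)"
        using m \<gamma>G by (simp add: h_def P.m_assoc canc)
      from key[OF 1 _ this] have "\<tau> = rep_act G F \<rho> \<gamma> (\<lambda>g\<in>F. h \<otimes>\<^bsub>PGL4\<^esub> \<sigma> g \<otimes>\<^bsub>PGL4\<^esub> inv\<^bsub>PGL4\<^esub> h)"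
        using m \<gamma>G \<tau> by (simp add: h_def)
      moreover have "(\<lambda>g\<in>F. h \<otimes>\<^bsub>PGL4\<^esub> \<sigma> g \<otimes>\<^bsub>PGL4\<^esub> inv\<^bsub>PGL4\<^esub> h) \<in> conj_class F \<sigma>"
        unfolding conj_class_def
        by (rule CollectI, rule exI, rule conjI, rule refl) (use m \<gamma>G in \<open>simp add: h_def\<close>)
      ultimately show "\<tau> \<in> char_act G F \<rho> C (conj_class F \<sigma>)"
        using \<gamma> unfolding char_act_def by blast
    qed
  qed
qed
section \<open>First cohomology of the fibre group\<close>

text \<open>Cochains are functions on \<open>F\<close>, extended by zero outside \<open>F\<close>.\<close>

definition Z1 :: "('g, 'm) monoid_scheme \<Rightarrow> 'g set \<Rightarrow> ('g \<Rightarrow> mat4 set) \<Rightarrow> ('g \<Rightarrow> mat4) set" where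
  "Z1 G F \<rho> = {f. (\<forall>g\<in>F. f g \<in> sl4) \<and> (\<forall>g. g \<notin> F \<longrightarrow> f g = 0) \<and>
     (\<forall>g\<in>F. \<forall>h\<in>F. f (g \<otimes>\<^bsub>G\<^esub> h) = f g + Ad (\<rho> g) (f h))}"

definition B1 :: "'g set \<Rightarrow> ('g \<Rightarrow> mat4 set) \<Rightarrow> ('g \<Rightarrow> mat4) set" where
  "B1 F \<rho> = {(\<lambda>g. if g \<in> F then X - Ad (\<rho> g) X else 0) | X. X \<in> sl4}"

definition h1_class :: "'g set \<Rightarrow> ('g \<Rightarrow> mat4 set) \<Rightarrow> ('g \<Rightarrow> mat4) \<Rightarrow> ('g \<Rightarrow> mat4) set" where
  "h1_class F \<rho> f = {(\<lambda>g. f g + d g) | d. d \<in> B1 F \<rho>}"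

definition H1 :: "('g, 'm) monoid_scheme \<Rightarrow> 'g set \<Rightarrow> ('g \<Rightarrow> mat4 set) \<Rightarrow> ('g \<Rightarrow> mat4) set set" where
  "H1 G F \<rho> = h1_class F \<rho> ` Z1 G F \<rho>"

definition cocycle_act ::
  "('g, 'm) monoid_scheme \<Rightarrow> 'g set \<Rightarrow> ('g \<Rightarrow> mat4 set) \<Rightarrow> 'g \<Rightarrow> ('g \<Rightarrow> mat4) \<Rightarrow> ('g \<Rightarrow> mat4)" where
  "cocycle_act G F \<rho> \<gamma> f =
     (\<lambda>g. if g \<in> F then Ad (\<rho> \<gamma>) (f (inv\<^bsub>G\<^esub> \<gamma> \<otimes>\<^bsub>G\<^esub> g \<otimes>\<^bsub>G\<^esub> \<gamma>)) else 0)"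

definition h1_act ::
  "('g, 'm) monoid_scheme \<Rightarrow> 'g set \<Rightarrow> ('g \<Rightarrow> mat4 set) \<Rightarrow> 'g set \<Rightarrow>
   ('g \<Rightarrow> mat4) set \<Rightarrow> ('g \<Rightarrow> mat4) set" where
  "h1_act G F \<rho> C z = {cocycle_act G F \<rho> \<gamma> f | \<gamma> f. \<gamma> \<in> C \<and> f \<in> z}"

section \<open>The tangent space of the character variety\<close>

text \<open>The velocity at time 0 of a path \<open>p\<close> in \<open>PGL4\<close> through the identity, under the identification
  of the Lie algebra of \<open>PGL4\<close> (matrices modulo scalar ones) with \<open>sl4\<close>: it is the derivative of a
  lift to matrices whose derivative is traceless.\<close>

definition pgl_velocity :: "(real \<Rightarrow> mat4 set) \<Rightarrow> mat4 \<Rightarrow> bool" where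
  "pgl_velocity p X \<longleftrightarrow> X \<in> sl4 \<and>
     (\<exists>B. B 0 = mat 1 \<and> (\<forall>\<^sub>F t in nhds 0. B t \<in> p t) \<and> (B has_vector_derivative X) (at 0))"

definition smooth_rep_path ::
  "('g, 'm) monoid_scheme \<Rightarrow> 'g set \<Rightarrow> 'g \<Rightarrow> 'g \<Rightarrow> (real \<Rightarrow> 'g \<Rightarrow> mat4 set) \<Rightarrow> bool" where
  "smooth_rep_path G F a b \<sigma> \<longleftrightarrow> (\<exists>\<epsilon>>0.
     (\<forall>t\<in>{-\<epsilon><..<\<epsilon>}. \<sigma> t \<in> Reps G F) \<and>
     (\<forall>g\<in>{a, b}. \<exists>B. smooth_on {-\<epsilon><..<\<epsilon>} B \<and> (\<forall>t\<in>{-\<epsilon><..<\<epsilon>}. B t \<in> \<sigma> t g)))"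

definition path_cocycle ::
  "'g set \<Rightarrow> ('g \<Rightarrow> mat4 set) \<Rightarrow> (real \<Rightarrow> 'g \<Rightarrow> mat4 set) \<Rightarrow> ('g \<Rightarrow> mat4) \<Rightarrow> bool" where
  "path_cocycle F \<rho> \<sigma> f \<longleftrightarrow> (\<forall>g. g \<notin> F \<longrightarrow> f g = 0) \<and>
     (\<forall>g\<in>F. pgl_velocity (\<lambda>t. \<sigma> t g \<otimes>\<^bsub>PGL4\<^esub> inv\<^bsub>PGL4\<^esub> (\<rho> g)) (f g))"

text \<open>\<open>D\<close> is the linear isomorphism from \<open>H1\<close> to the tangent space \<open>V\<close> at the class of \<open>\<rho>\<close>, read in
  the chart \<open>\<kappa>\<close>, that sends the class of the cocycle of a smooth path of representations to the
  velocity of the corresponding path of conjugacy classes. As every cocycle comes from a path,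
  this determines \<open>D\<close>.\<close>

definition tangent_identification ::
  "('g, 'm) monoid_scheme \<Rightarrow> 'g set \<Rightarrow> 'g \<Rightarrow> 'g \<Rightarrow> ('g \<Rightarrow> mat4 set) \<Rightarrow>
   (('g \<Rightarrow> mat4 set) set \<Rightarrow> mat4 \<times> mat4) \<Rightarrow> (mat4 \<times> mat4) set \<Rightarrow>
   (('g \<Rightarrow> mat4) set \<Rightarrow> mat4 \<times> mat4) \<Rightarrow> bool" where
  "tangent_identification G F a b \<rho> \<kappa> V D \<longleftrightarrow>
     bij_betw D (H1 G F \<rho>) V \<and>
     (\<forall>f\<in>Z1 G F \<rho>. \<forall>f'\<in>Z1 G F \<rho>. \<forall>r s::real.
        D (h1_class F \<rho> (\<lambda>g. r *\<^sub>R f g + s *\<^sub>R f' g)) =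
          r *\<^sub>R D (h1_class F \<rho> f) + s *\<^sub>R D (h1_class F \<rho> f')) \<and>
     (\<forall>\<sigma>. smooth_rep_path G F a b \<sigma> \<longrightarrow> \<sigma> 0 = restrict \<rho> F \<longrightarrow>
        (\<exists>f\<in>Z1 G F \<rho>. path_cocycle F \<rho> \<sigma> f \<and>
           ((\<lambda>t. \<kappa> (conj_class F (\<sigma> t))) has_vector_derivative D (h1_class F \<rho> f)) (at 0))) \<and>
     (\<forall>f\<in>Z1 G F \<rho>. \<exists>\<sigma>. smooth_rep_path G F a b \<sigma> \<and> \<sigma> 0 = restrict \<rho> F \<and> path_cocycle F \<rho> \<sigma> f)"

end

theory Submission
  imports Defs
begin

text \<open>The holonomy lifts uniquely to time-oriented Lorentz matrices. Restricted to the fibre it is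
  irreducible on \<open>\<real>\<^sup>4\<close> with scalar commutant: an invariant line is impossible because the stabiliser
  of a timelike vector meets a discrete group in a finite group, that of a null line is virtually
  metabelian, and in that of a spacelike line the commuting meridian and boundary of the fibre would
  generate, up to squares, a discrete group of rank two in a one-parameter group of isometries of the
  hyperbolic plane.

  A matrix commuting with both generators up to sign is then a scalar, and by compactness of the unit
  sphere of matrices this makes conjugation of pairs near the holonomy free and proper modulo
  scalars. A linear complement of the orbit directions is thus a slice, by the inverse function
  theorem, which gives a chart. In any chart the kernel of the derivative of the projection from the
  representation variety consists of the infinitesimal conjugations and rescalings. Every pair of
  traceless matrices is the velocity at the generators of a path of representations, and the
  velocities of a path form a cocycle, so the derivative descends to an isomorphism from \<open>H1\<close>.
  Applying \<open>\<gamma>\<close> to a path of representations applies \<open>\<gamma>\<close> to its cocycle of velocities, and the chain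
  rule gives the differential of the action.\<close>

section \<open>Calculus of smooth maps\<close>

text \<open>Computations are made on pairs of invertible matrices rather than on classes. The price
  is a larger acting group, conjugations together with two independent rescalings, so that an
  element fixing a pair projectively need only commute with it up to scalars. In a limit,
  determinants force these scalars to have absolute value 1, and time orientation removes the sign
  -1; hence the form of the rigidity condition. Irreducibility needs more than a discrete free
  group, which may be Fuchsian and fix a spacelike line. The meridian \<open>x\<close> normalises
  \<open>F\<close>, so it carries an \<open>F\<close>-invariant line to another one: if the two
  differ they span an invariant plane, and otherwise \<open>x\<close> and the boundary
  \<open>c\<close> both preserve the line. Over the reals, irreducibility alone does not make the
  commutant scalar. What supplies a real eigenvalue is a null eigenvector of \<open>M a\<close>
  whose line is kept by every matrix commuting with \<open>M a\<close>. The chart in the statement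
  is arbitrary, so the kernel of its derivative is compared with that of the slice chart through a
  local section of the projection.\<close>

lemma Ck_on_cong:
  assumes "open S" "\<And>y. y \<in> S \<Longrightarrow> f y = g y" "Ck_on k S f"
  shows "Ck_on k S g"
  using assms(2,3)
proof (induction k arbitrary: f g)
  case 0
  then show ?case using continuous_on_cong[of S S f g] by simp
next
  case (Suc k)
  have fd: "f differentiable (at y)" if "y \<in> S" for y using Suc.prems that by simp
  have gd: "(g has_derivative frechet_derivative f (at y)) (at y)" if "y \<in> S" for y
    using fd[OF that] assms(1) that Suc.prems(1)
    by (metis frechet_derivative_works has_derivative_transform_within_open)
  have eq: "frechet_derivative f (at y) = frechet_derivative g (at y)" if "y \<in> S" for y
    using gd[OF that] by (rule frechet_derivative_at)
  have "Ck_on k S (\<lambda>y. frechet_derivative g (at y) v)" for v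
    by (rule Suc.IH[of "\<lambda>y. frechet_derivative f (at y) v"]) (use eq Suc.prems in auto)
  with gd show ?case by (auto simp: differentiable_def)
qed

lemma Ck_on_SucI:
  assumes "open S" "\<And>y. y \<in> S \<Longrightarrow> (f has_derivative f' y) (at y)" "\<And>v. Ck_on k S (\<lambda>y. f' y v)"
  shows "Ck_on (Suc k) S f"
proof -
  have "Ck_on k S (\<lambda>y. frechet_derivative f (at y) v)" for v
    by (rule Ck_on_cong[OF assms(1) _ assms(3)[of v]]) (simp add: frechet_derivative_at[OF assms(2)])
  then show ?thesis using assms(2) by (auto simp: differentiable_def)
qed

lemma Ck_on_SucD:
  assumes "Ck_on (Suc k) S f"
  shows "y \<in> S \<Longrightarrow> (f has_derivative frechet_derivative f (at y)) (at y)"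
    "Ck_on k S (\<lambda>y. frechet_derivative f (at y) v)"
  using assms frechet_derivative_works by auto

lemma Ck_on_Suc_imp: "Ck_on (Suc k) S f \<Longrightarrow> Ck_on k S f"
proof (induction k arbitrary: f)
  case 0
  then show ?case
    by (auto intro!: continuous_at_imp_continuous_on differentiable_imp_continuous_within)
qed simp

lemma Ck_on_continuous: "Ck_on k S f \<Longrightarrow> continuous_on S f"
  by (induction k) (use Ck_on_Suc_imp in auto)

lemma Ck_on_subset: "Ck_on k S f \<Longrightarrow> T \<subseteq> S \<Longrightarrow> Ck_on k T f"
  by (induction k arbitrary: f) (auto intro: continuous_on_subset)

text \<open>The derivative at a point depends only on a neighbourhood, so the iterated condition can
  be checked on neighbourhoods that vary with the point. It glues the local formulas for the slice
  coordinate.\<close>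

lemma Ck_on_local:
  assumes "\<And>y. y \<in> S \<Longrightarrow> \<exists>N. open N \<and> y \<in> N \<and> Ck_on k N f"
  shows "Ck_on k S f"
  using assms
proof (induction k arbitrary: f)
  case 0
  have "continuous (at y within S) f" if "y \<in> S" for y
    using 0[OF that] by (metis Ck_on.simps(1) continuous_at_imp_continuous_within continuous_on_eq_continuous_at)
  then show ?case by (simp add: continuous_on_eq_continuous_within)
next
  case (Suc k)
  have "Ck_on k S (\<lambda>y. frechet_derivative f (at y) v)" for v
    by (rule Suc.IH) (use Suc.prems in fastforce)
  moreover have "f differentiable (at y)" if "y \<in> S" for y using Suc.prems[OF that] by auto
  ultimately show ?case by simp
qed

lemma Ck_on_const: "open S \<Longrightarrow> Ck_on k S (\<lambda>y. c)"
proof (induction k arbitrary: c)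
  case (Suc k)
  show ?case by (rule Ck_on_SucI[where f' = "\<lambda>y v. 0"]) (use Suc in auto)
qed simp

lemma Ck_on_bounded_linear:
  assumes h: "bounded_linear h" and "open S"
  shows "Ck_on k S f \<Longrightarrow> Ck_on k S (\<lambda>y. h (f y))"
proof (induction k arbitrary: f)
  case 0
  then show ?case using h by (simp add: bounded_linear.continuous_on)
next
  case (Suc k)
  show ?case
    by (rule Ck_on_SucI[where f' = "\<lambda>y v. h (frechet_derivative f (at y) v)"])
      (use Suc Ck_on_SucD[OF Suc.prems] assms in \<open>auto intro: bounded_linear.has_derivative\<close>)
qed

lemma Ck_on_id: "open S \<Longrightarrow> Ck_on k S (\<lambda>y. y)"
proof (cases k)
  case (Suc j)
  assume "open S"
  then show ?thesis unfolding Suc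
    by (intro Ck_on_SucI[where f' = "\<lambda>y v. v"]) (auto intro: Ck_on_const)
qed auto

lemma Ck_on_linear: "bounded_linear h \<Longrightarrow> open S \<Longrightarrow> Ck_on k S h"
  using Ck_on_bounded_linear[OF _ _ Ck_on_id] by auto

lemma Ck_on_add:
  assumes "open S" shows "Ck_on k S f \<Longrightarrow> Ck_on k S g \<Longrightarrow> Ck_on k S (\<lambda>y. f y + g y)"
proof (induction k arbitrary: f g)
  case (Suc k)
  show ?case
    by (rule Ck_on_SucI[where f' = "\<lambda>y v. frechet_derivative f (at y) v + frechet_derivative g (at y) v"])
      (use Suc Ck_on_SucD[OF Suc.prems(1)] Ck_on_SucD[OF Suc.prems(2)] assms in
        \<open>auto intro: has_derivative_add\<close>)
qed (auto intro: continuous_intros)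

lemma Ck_on_sum:
  assumes "open S" "finite I" "\<And>i. i \<in> I \<Longrightarrow> Ck_on k S (f i)"
  shows "Ck_on k S (\<lambda>y. \<Sum>i\<in>I. f i y)"
  using assms(2,3)
  by (induction I rule: finite_induct) (auto intro: Ck_on_add Ck_on_const assms(1))

lemma Ck_on_bilinear:
  assumes "bounded_bilinear mul" "open S"
  shows "Ck_on k S f \<Longrightarrow> Ck_on k S g \<Longrightarrow> Ck_on k S (\<lambda>y. mul (f y) (g y))"
proof (induction k arbitrary: f g)
  case 0
  then show ?case using bounded_bilinear.continuous_on[OF assms(1)] by auto
next
  case (Suc k)
  have l: "Ck_on k S f" "Ck_on k S g" using Suc.prems Ck_on_Suc_imp by auto
  show ?case
    by (rule Ck_on_SucI[where f' = "\<lambda>y v. mul (f y) (frechet_derivative g (at y) v)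
        + mul (frechet_derivative f (at y) v) (g y)"])
      (use Suc Ck_on_SucD[OF Suc.prems(1)] Ck_on_SucD[OF Suc.prems(2)] assms l in
        \<open>auto intro!: bounded_bilinear.FDERIV Ck_on_add\<close>)
qed

lemma Ck_on_Pair:
  assumes "open S" "Ck_on k S f" "Ck_on k S g"
  shows "Ck_on k S (\<lambda>y. (f y, g y))"
proof -
  have "Ck_on k S (\<lambda>y. (f y, 0) + (0, g y))"
    by (intro Ck_on_add Ck_on_bounded_linear[of "\<lambda>u. (u, 0)"] Ck_on_bounded_linear[of "\<lambda>u. (0, u)"])
      (use assms in \<open>auto intro!: bounded_linear_Pair bounded_linear_zero bounded_linear_ident\<close>)
  then show ?thesis by simp
qed

lemma linear_basis_expansion:
  fixes h :: "'a::euclidean_space \<Rightarrow> 'b::real_vector"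
  assumes "linear h" shows "h w = (\<Sum>i\<in>Basis. (w \<bullet> i) *\<^sub>R h i)"
proof -
  have "h w = h (\<Sum>i\<in>Basis. (w \<bullet> i) *\<^sub>R i)" by (simp add: euclidean_representation)
  also have "\<dots> = (\<Sum>i\<in>Basis. (w \<bullet> i) *\<^sub>R h i)"
    using assms by (simp add: linear_sum linear_scale)
  finally show ?thesis .
qed

lemma Ck_on_compose:
  fixes f :: "'b::euclidean_space \<Rightarrow> 'c::real_normed_vector" and g :: "'a::real_normed_vector \<Rightarrow> 'b"
  assumes "open S"
  shows "Ck_on k T f \<Longrightarrow> Ck_on k S g \<Longrightarrow> g ` S \<subseteq> T \<Longrightarrow> Ck_on k S (\<lambda>y. f (g y))"
proof (induction k arbitrary: f g)
  case 0
  then show ?case by (auto intro: continuous_on_compose2)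
next
  case (Suc k)
  let ?Df = "\<lambda>y. frechet_derivative f (at (g y))" and ?Dg = "\<lambda>y. frechet_derivative g (at y)"
  have l: "Ck_on k S g" using Suc.prems(2) by (rule Ck_on_Suc_imp)
  have D: "((\<lambda>y. f (g y)) has_derivative (\<lambda>v. ?Df y (?Dg y v))) (at y)" if "y \<in> S" for y
    using Ck_on_SucD(1)[OF Suc.prems(1), of "g y"] Ck_on_SucD(1)[OF Suc.prems(2), of y] that Suc.prems(3)
    by (auto intro: has_derivative_compose)
  \<comment> \<open>The direction \<open>?Dg y v\<close> moves with \<open>y\<close>, while
    \<open>Ck_on\<close> only controls derivatives in fixed directions. Expanding it in the basis
    leaves products of a coordinate of \<open>?Dg y v\<close> with a derivative of \<open>f\<close>
    in a fixed direction, and the induction hypothesis applies to the latter.\<close>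
  have "Ck_on k S (\<lambda>y. ?Df y (?Dg y v))" for v
  proof (rule Ck_on_cong[OF assms])
    show "(\<Sum>i\<in>Basis. (?Dg y v \<bullet> i) *\<^sub>R ?Df y i) = ?Df y (?Dg y v)" if "y \<in> S" for y
    proof (rule linear_basis_expansion[symmetric])
      show "linear (?Df y)" using Ck_on_SucD(1)[OF Suc.prems(1), of "g y"] that Suc.prems(3)
        by (auto intro: has_derivative_linear)
    qed
    show "Ck_on k S (\<lambda>y. \<Sum>i\<in>Basis. (?Dg y v \<bullet> i) *\<^sub>R ?Df y i)"
    proof (intro Ck_on_sum assms Ck_on_bilinear[OF bounded_bilinear_scaleR])
      fix i :: 'b
      show "Ck_on k S (\<lambda>y. ?Dg y v \<bullet> i)"
        by (rule Ck_on_bounded_linear[OF bounded_linear_inner_left assms])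
          (rule Ck_on_SucD(2)[OF Suc.prems(2)])
      show "Ck_on k S (\<lambda>y. ?Df y i)"
        by (rule Suc.IH[of "\<lambda>z. frechet_derivative f (at z) i"])
          (use Suc.prems l Ck_on_SucD(2)[OF Suc.prems(1)] in auto)
    qed auto
  qed
  then show ?case by (intro Ck_on_SucI[OF assms D]) auto
qed

text \<open>A factor that is merely continuous may be frozen at \<open>y\<close> because the other
  factor vanishes there: its variation contributes only a product of two small quantities. This
  allows an inverse to be differentiated when nothing but its continuity is known.\<close>

lemma has_derivative_bilinear_vanishing:
  assumes P: "bounded_bilinear mul" and u: "continuous (at y) u"
    and w: "(w has_derivative w') (at y)" and w0: "w y = 0"
  shows "((\<lambda>z. mul (u z) (w z)) has_derivative (\<lambda>v. mul (u y) (w' v))) (at y)"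
proof -
  interpret bounded_bilinear mul by (rule P)
  interpret W: bounded_linear w' using w by (rule has_derivative_bounded_linear)
  have bl: "bounded_linear (\<lambda>v. mul (u y) (w' v))"
    using bounded_linear_right W.bounded_linear_axioms by (rule bounded_linear_compose)
  obtain B where B: "B > 0" "\<And>a b. norm (mul a b) \<le> norm a * norm b * B"
    using pos_bounded by blast
  obtain C where C: "C > 0" "\<And>v. norm (w' v) \<le> norm v * C" using W.pos_bounded by blast
  define r where "r h = norm (w (y + h) - w y - w' h) / norm h" for h
  define q where "q h = (norm (u (y + h)) * B) * r h + norm (u (y + h) - u y) * (C * B)" for h
  have r0: "(r \<longlongrightarrow> 0) (at 0)" using w unfolding has_derivative_at r_def by simp
  have uc: "((\<lambda>h. u (y + h)) \<longlongrightarrow> u y) (at 0)"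
    using u unfolding continuous_at using LIM_offset_zero by blast
  have "((\<lambda>h. norm (u (y + h) - u y)) \<longlongrightarrow> 0) (at 0)"
    using tendsto_norm_zero[OF LIM_zero[OF uc]] .
  then have "(q \<longlongrightarrow> (norm (u y) * B) * 0 + 0 * (C * B)) (at 0)"
    unfolding q_def by (intro tendsto_intros uc r0)
  then have q0: "(q \<longlongrightarrow> 0) (at 0)" by simp
  have bnd: "norm (norm (mul (u (y + h)) (w (y + h)) - mul (u y) (w y) - mul (u y) (w' h)) / norm h) \<le> q h"
    for h
  proof (cases "h = 0")
    case False
    have "mul (u (y + h)) (w (y + h)) - mul (u y) (w y) - mul (u y) (w' h)
        = mul (u (y + h)) (w (y + h) - w y - w' h) + mul (u (y + h) - u y) (w' h)"
      by (simp add: w0 diff_left diff_right zero_right)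
    also have "norm \<dots> \<le> norm (u (y + h)) * norm (w (y + h) - w y - w' h) * B
        + norm (u (y + h) - u y) * (norm h * C) * B"
    proof -
      have "norm (mul (u (y + h) - u y) (w' h)) \<le> norm (u (y + h) - u y) * norm (w' h) * B" by (rule B)
      also have "\<dots> \<le> norm (u (y + h) - u y) * (norm h * C) * B"
        using B(1) C(2)[of h] by (intro mult_right_mono mult_left_mono) auto
      finally show ?thesis using B(2) norm_triangle_ineq add_mono order_trans by blast
    qed
    finally show ?thesis using False by (simp add: q_def r_def field_simps)
  qed (use B C in \<open>auto simp: q_def r_def w0 W.zero zero_right\<close>)
  have "((\<lambda>h. norm (mul (u (y + h)) (w (y + h)) - mul (u y) (w y) - mul (u y) (w' h)) / norm h) \<longlongrightarrow> 0) (at 0)"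
    by (rule Lim_null_comparison[OF _ q0]) (use bnd in auto)
  then show ?thesis using bl by (simp add: has_derivative_at)
qed

text \<open>The resolvent identity \<open>J y - J z = J y (f z - f y) J z\<close> is all that is needed of inversion; it
  covers both inverse matrices and inverse operators.\<close>

lemma
  fixes mul :: "'b::real_normed_vector \<Rightarrow> 'b \<Rightarrow> 'b"
  assumes P: "bounded_bilinear mul" and S: "open S"
    and J: "\<And>y z. y \<in> S \<Longrightarrow> z \<in> S \<Longrightarrow> J y - J z = mul (mul (J y) (f z - f y)) (J z)"
  shows continuous_on_inverse_like: "continuous_on S f \<Longrightarrow> continuous_on S J"
    and has_derivative_inverse_like: "y \<in> S \<Longrightarrow> continuous_on S f \<Longrightarrow> (f has_derivative f') (at y) \<Longrightarrow>
      (J has_derivative (\<lambda>v. - mul (mul (J y) (f' v)) (J y))) (at y)"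
    and Ck_on_inverse_like: "Ck_on k S f \<Longrightarrow> Ck_on k S J"
proof -
  interpret bounded_bilinear mul by (rule P)
  have cont: "continuous_on S J" if f: "continuous_on S f"
    and J: "\<And>y z. y \<in> S \<Longrightarrow> z \<in> S \<Longrightarrow> J y - J z = mul (mul (J y) (f z - f y)) (J z)" for f J
  proof -
    obtain B where B: "B > 0" "\<And>a b. norm (mul a b) \<le> norm a * norm b * B"
      using pos_bounded by blast
    have "(J \<longlongrightarrow> J z) (at z)" if z: "z \<in> S" for z
    proof -
      define q where "q y = norm (f z - f y) * B * norm (J z) * B" for y
      have fz: "(f \<longlongrightarrow> f z) (at z)"
        using f z S by (simp add: continuous_on_eq_continuous_at continuous_at)
      have q0: "(q \<longlongrightarrow> 0) (at z)"
      proof -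
        have "(q \<longlongrightarrow> norm (f z - f z) * B * norm (J z) * B) (at z)"
          unfolding q_def by (intro tendsto_intros fz)
        then show ?thesis by simp
      qed
      have bnd: "norm (J y - J z) \<le> norm (J y) * q y" if "y \<in> S" for y
      proof -
        have "norm (J y - J z) \<le> norm (mul (J y) (f z - f y)) * norm (J z) * B"
          using J[OF that z] B(2) by metis
        also have "\<dots> \<le> (norm (J y) * norm (f z - f y) * B) * norm (J z) * B"
          using B by (intro mult_right_mono) auto
        finally show ?thesis by (simp add: q_def mult_ac)
      qed
      \<comment> \<open>Once \<open>q y < 1/2\<close>, the estimate \<open>bnd\<close> lets half of
        \<open>norm (J y)\<close> be absorbed on the left, which bounds \<open>J\<close> near
        \<open>z\<close> before its continuity is known.\<close>
      have ev: "\<forall>\<^sub>F y in at z. norm (J y - J z) \<le> (2 * norm (J z)) * q y"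
      proof -
        have "\<forall>\<^sub>F y in at z. q y < 1/2" using q0 by (rule order_tendstoD) simp
        moreover have "\<forall>\<^sub>F y in at z. y \<in> S" using S z by (rule eventually_at_in_open')
        ultimately show ?thesis
        proof eventually_elim
          case (elim y)
          have q: "q y \<ge> 0" using B by (simp add: q_def)
          have "norm (J y) \<le> norm (J z) + norm (J y - J z)" by (metis norm_triangle_sub)
          also have "\<dots> \<le> norm (J z) + norm (J y) * (1/2)"
            using bnd[of y] elim mult_left_mono[of "q y" "1/2" "norm (J y)"] by auto
          finally have "norm (J y) \<le> 2 * norm (J z)" by simp
          then show ?case using bnd[of y] elim q mult_right_mono order_trans by blast
        qed
      qed
      have "((\<lambda>y. (2 * norm (J z)) * q y) \<longlongrightarrow> 0) (at z)"
        using tendsto_mult_left[OF q0] by (simp add: tendsto_mult_right_zero q0)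
      then have "((\<lambda>y. J y - J z) \<longlongrightarrow> 0) (at z)" using ev by (rule Lim_null_comparison[rotated])
      then show ?thesis by (simp add: LIM_zero_iff)
    qed
    then show ?thesis using S by (simp add: continuous_on_eq_continuous_at continuous_at)
  qed
  have der: "(J has_derivative (\<lambda>v. - mul (mul (J y) (f' v)) (J y))) (at y)"
    if y: "y \<in> S" and c: "continuous_on S f" and f: "(f has_derivative f') (at y)"
    and J: "\<And>y z. y \<in> S \<Longrightarrow> z \<in> S \<Longrightarrow> J y - J z = mul (mul (J y) (f z - f y)) (J z)" for f J y f'
  proof -
    have "continuous (at y) J" using cont[OF c J] S y by (simp add: continuous_on_eq_continuous_at)
    moreover have "((\<lambda>z. mul (f y - f z) (J y)) has_derivative (\<lambda>v. mul (- f' v) (J y))) (at y)"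
      by (rule bounded_linear.has_derivative[OF bounded_linear_left])
        (use f in \<open>auto intro!: derivative_eq_intros\<close>)
    ultimately have "((\<lambda>z. mul (J z) (mul (f y - f z) (J y))) has_derivative
        (\<lambda>v. mul (J y) (mul (- f' v) (J y)))) (at y)"
      by (intro has_derivative_bilinear_vanishing[OF P]) (auto simp: zero_left)
    have sym: "mul (mul (J z) (f y - f z)) (J y) = J z - J y" if "z \<in> S" for z
      using J[OF that y] by simp
    \<comment> \<open>By the resolvent identity, \<open>J z\<close> is \<open>J y\<close> minus the
      product of \<open>J y\<close>, \<open>f z - f y\<close> and \<open>J z\<close>; the middle
      factor vanishes at \<open>z = y\<close>, so continuity of \<open>J\<close> is enough to
      differentiate the product.\<close>
    have "((\<lambda>z. mul (J y) (f z - f y)) has_derivative (\<lambda>v. mul (J y) (f' v))) (at y)"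
      by (rule bounded_linear.has_derivative[OF bounded_linear_right])
        (use f in \<open>auto intro!: derivative_eq_intros\<close>)
    moreover have fl: "bounded_bilinear (\<lambda>a b. mul b a)" by (rule flip)
    ultimately have "((\<lambda>z. mul (mul (J y) (f z - f y)) (J z)) has_derivative
        (\<lambda>v. mul (mul (J y) (f' v)) (J y))) (at y)"
      using \<open>continuous (at y) J\<close>
      by (intro has_derivative_bilinear_vanishing[OF fl]) (auto simp: zero_right)
    then have "((\<lambda>z. J y - mul (mul (J y) (f z - f y)) (J z)) has_derivative
        (\<lambda>v. - mul (mul (J y) (f' v)) (J y))) (at y)"
      by (auto intro!: derivative_eq_intros)
    then show ?thesis
      by (rule has_derivative_transform_within_open[OF _ S y]) (use J[OF y] in \<open>auto simp: algebra_simps\<close>)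
  qed
  show "continuous_on S J" if "continuous_on S f" using cont[OF that J] .
  show "(J has_derivative (\<lambda>v. - mul (mul (J y) (f' v)) (J y))) (at y)"
    if "y \<in> S" "continuous_on S f" "(f has_derivative f') (at y)"
    using der[OF that J] .
  show "Ck_on k S J" if "Ck_on k S f"
    using that
  proof (induction k)
    case 0
    then show ?case using cont[OF _ J] by simp
  next
    case (Suc k)
    have Jk: "Ck_on k S J" using Suc Ck_on_Suc_imp by blast
    have "Ck_on k S (\<lambda>y. - mul (mul (J y) (frechet_derivative f (at y) v)) (J y))" for v
      by (intro Ck_on_bounded_linear[OF bounded_linear_minus[OF bounded_linear_ident] S]
          Ck_on_bilinear[OF P S] Jk Ck_on_SucD(2)[OF Suc.prems])
    moreover have "(J has_derivative (\<lambda>v. - mul (mul (J y) (frechet_derivative f (at y) v)) (J y))) (at y)"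
      if "y \<in> S" for y
      using der[OF that Ck_on_continuous[OF Suc.prems] Ck_on_SucD(1)[OF Suc.prems that] J] .
    ultimately show ?case by (intro Ck_on_SucI[OF S]) auto
  qed
qed

section \<open>The inverse function theorem with a smooth inverse\<close>

lemma Ck_on_blinfun:
  fixes f :: "'a::real_normed_vector \<Rightarrow> 'b::euclidean_space \<Rightarrow>\<^sub>L 'c::real_normed_vector"
  assumes "open S" "\<And>v. Ck_on k S (\<lambda>y. blinfun_apply (f y) v)"
  shows "Ck_on k S f"
proof -
  \<comment> \<open>\<open>c i w\<close> is the rank one operator sending \<open>v\<close> to
    \<open>(v \<bullet> i) *\<^sub>R w\<close>. An operator on a finite-dimensional space is the sum
    of these over its values on the basis, so smoothness of the values gives smoothness in operator
    norm.\<close>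
  define c :: "'b \<Rightarrow> 'c \<Rightarrow> 'b \<Rightarrow>\<^sub>L 'c"
    where "c i w = blinfun_scaleR_left w o\<^sub>L blinfun_inner_left i" for i w
  have c: "bounded_linear (c i)" for i
    unfolding c_def
    by (rule bounded_linear_compose[OF bounded_bilinear.bounded_linear_left
          [OF bounded_bilinear_blinfun_compose] bounded_linear_blinfun_scaleR_left])
  have "f y = (\<Sum>i\<in>Basis. c i (blinfun_apply (f y) i))" for y
    by (rule blinfun_eqI, subst linear_basis_expansion[of "blinfun_apply (f y)"])
      (auto simp: c_def blinfun.sum_left blinfun_inner_left.rep_eq
        intro: bounded_linear.linear blinfun.bounded_linear_right)
  moreover have "Ck_on k S (\<lambda>y. \<Sum>i\<in>Basis. c i (blinfun_apply (f y) i))"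
    by (intro Ck_on_sum Ck_on_bounded_linear[OF c] assms) auto
  ultimately show ?thesis by simp
qed

text \<open>Bootstrapping: the inverse function theorem yields a differentiable \<open>g\<close>
  whose derivative \<open>J y\<close> inverts \<open>f' (g y)\<close>. If \<open>g\<close> is of
  class k, so is \<open>f'\<close> composed with \<open>g\<close>, hence so is \<open>J\<close> by
  the resolvent identity, and \<open>g\<close> is of class k + 1. Bijectivity of the derivatives is
  recorded because the slice chart must be a submersion on its whole domain.\<close>

lemma smooth_inverse_function:
  fixes f :: "'a::euclidean_space \<Rightarrow> 'a"
  assumes f: "smooth_on S f" and x0: "x0 \<in> S" and inj: "inj (frechet_derivative f (at x0))"
  obtains U V g where "open U" "U \<subseteq> S" "x0 \<in> U" "open V" "homeomorphism U V f g" "smooth_on V g"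
    "\<And>y. y \<in> V \<Longrightarrow> bij (frechet_derivative g (at y))"
proof -
  define f' where "f' y = Blinfun (frechet_derivative f (at y))" for y
  have S: "open S" and fk: "Ck_on k S f" for k using f by (auto simp: smooth_on_def)
  have fd: "(f has_derivative frechet_derivative f (at y)) (at y)" if "y \<in> S" for y
    using Ck_on_SucD(1)[OF fk that] .
  have f'a: "blinfun_apply (f' y) = frechet_derivative f (at y)" if "y \<in> S" for y
    unfolding f'_def using has_derivative_bounded_linear[OF fd[OF that]]
    by (rule bounded_linear_Blinfun_apply)
  have f'k: "Ck_on k S f'" for k
  proof (rule Ck_on_blinfun[OF S])
    show "Ck_on k S (\<lambda>y. blinfun_apply (f' y) v)" for v
      by (rule Ck_on_cong[OF S _ Ck_on_SucD(2)[OF fk[of "Suc k"], of v]]) (simp add: f'a)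
  qed
  have lin: "linear (frechet_derivative f (at x0))" using fd[OF x0] by (rule has_derivative_linear)
  obtain h where h: "linear h" "h \<circ> frechet_derivative f (at x0) = id"
    using linear_injective_left_inverse[OF lin inj] by blast
  have "Blinfun h o\<^sub>L f' x0 = id_blinfun"
    using h f'a[OF x0] by (intro blinfun_eqI)
      (auto simp: bounded_linear_Blinfun_apply linear_conv_bounded_linear fun_eq_iff)
  then obtain U V g g' where U: "open U" "U \<subseteq> S" "x0 \<in> U" "open V" "homeomorphism U V f g"
    and g: "\<And>y. y \<in> V \<Longrightarrow> (g has_derivative (g' y)) (at y)"
    and g': "\<And>y. y \<in> V \<Longrightarrow> g' y = inv_into UNIV (blinfun_apply (f' (g y)))"
    and b: "\<And>y. y \<in> V \<Longrightarrow> bij (blinfun_apply (f' (g y)))"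
    using inverse_function_theorem[OF S _ Ck_on_continuous[OF f'k] x0] fd f'a by (metis (no_types, lifting))
  define J where "J y = Blinfun (g' y)" for y
  have Ja: "blinfun_apply (J y) = g' y" if "y \<in> V" for y
    unfolding J_def using has_derivative_bounded_linear[OF g[OF that]]
    by (rule bounded_linear_Blinfun_apply)
  have gV: "g ` V \<subseteq> S" using U by (auto simp: homeomorphism_def)
  have gc: "Ck_on 0 V g" using U by (simp add: homeomorphism_def)
  have J: "J y - J z = (J y o\<^sub>L (f' (g z) - f' (g y))) o\<^sub>L J z" if "y \<in> V" "z \<in> V" for y z
  proof (rule blinfun_eqI)
    fix v
    have "blinfun_apply (f' (g z)) (g' z v) = v"
      using b[OF that(2)] g'[OF that(2)] by (simp add: bij_is_surj surj_f_inv_f)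
    moreover have "g' y (blinfun_apply (f' (g y)) w) = w" for w
      using b[OF that(1)] g'[OF that(1)] by (simp add: bij_is_inj)
    ultimately show "blinfun_apply (J y - J z) v
        = blinfun_apply ((J y o\<^sub>L (f' (g z) - f' (g y))) o\<^sub>L J z) v"
      using that has_derivative_linear[OF g[OF that(1)]]
      by (simp add: Ja blinfun.diff_left linear_diff)
  qed
  have "Ck_on k V g" for k
  proof (induction k)
    case (Suc k)
    have "Ck_on k V (\<lambda>y. f' (g y))" by (rule Ck_on_compose[OF U(4) f'k Suc gV])
    then have "Ck_on k V J"
      using Ck_on_inverse_like[OF bounded_bilinear_blinfun_compose U(4), of J "\<lambda>y. f' (g y)"] J by blast
    then have "Ck_on k V (\<lambda>y. blinfun_apply (J y) v)" for v
      by (rule Ck_on_bounded_linear[OF blinfun.bounded_linear_left U(4)])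
    then have "Ck_on k V (\<lambda>y. g' y v)" for v
      by (rule Ck_on_cong[OF U(4), rotated]) (simp add: Ja)
    with g show ?case by (intro Ck_on_SucI[OF U(4)]) auto
  qed (use gc in auto)
  then have "smooth_on V g" using U by (simp add: smooth_on_def)
  moreover have "bij (frechet_derivative g (at y))" if "y \<in> V" for y
    using frechet_derivative_at[OF g[OF that]] g'[OF that] b[OF that] bij_imp_bij_inv by metis
  ultimately show ?thesis using U that by blast
qed

section \<open>Matrix multiplication and inversion\<close>

lemma bounded_bilinear_matrix_mult:
  "bounded_bilinear ((**) :: real^'n^'m \<Rightarrow> real^'p^'n \<Rightarrow> real^'p^'m)"
proof -
  have "bilinear ((**) :: real^'n^'m \<Rightarrow> real^'p^'n \<Rightarrow> real^'p^'m)"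
    unfolding bilinear_def
    by (auto intro!: linearI simp: vec_eq_iff matrix_matrix_mult_def
        sum.distrib sum_distrib_left algebra_simps)
  then show ?thesis by (simp add: bilinear_conv_bounded_bilinear)
qed

interpretation matmul: bounded_bilinear "(**) :: real^'n^'m \<Rightarrow> real^'p^'n \<Rightarrow> real^'p^'m"
  by (rule bounded_bilinear_matrix_mult)

lemma open_invertible: "open {A :: real^'n^'n. invertible A}"
proof -
  have "continuous_on UNIV (det :: real^'n^'n \<Rightarrow> real)"
    unfolding det_def by (intro continuous_intros)
  then have "open (det -` (- {0}) :: (real^'n^'n) set)"
    by (intro open_vimage) auto
  then show ?thesis by (simp add: invertible_det_nz vimage_def Collect_neg_eq)
qed

lemma matrix_inv_mult [simp]:
  fixes A :: "real^'n^'n"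
  assumes "invertible A"
  shows "matrix_inv A ** A = mat 1" "A ** matrix_inv A = mat 1"
    "matrix_inv A ** (A ** B) = B" "A ** (matrix_inv A ** B) = B"
    "C ** matrix_inv A ** A = C" "C ** A ** matrix_inv A = C"
proof -
  show 1: "matrix_inv A ** A = mat 1" "A ** matrix_inv A = mat 1"
    using someI_ex[OF assms[unfolded invertible_def]] by (simp_all add: matrix_inv_def)
  show "matrix_inv A ** (A ** B) = B" "A ** (matrix_inv A ** B) = B"
    using 1 by (simp_all add: matrix_mul_assoc)
  show "C ** matrix_inv A ** A = C" "C ** A ** matrix_inv A = C"
    using 1 by (simp_all flip: matrix_mul_assoc)
qed

lemma matrix_inv_resolvent:
  fixes A B :: "real^'n^'n"
  assumes "invertible A" "invertible B"
  shows "matrix_inv A - matrix_inv B = (matrix_inv A ** (B - A)) ** matrix_inv B"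
  using assms by (simp add: matmul.diff_left matmul.diff_right)

lemma Ck_on_matrix_inv: "Ck_on k {A :: real^'n^'n. invertible A} matrix_inv"
  by (rule Ck_on_inverse_like[OF bounded_bilinear_matrix_mult open_invertible, of _ "\<lambda>A. A"])
    (auto simp: matrix_inv_resolvent intro: Ck_on_id open_invertible)

lemma has_derivative_matrix_inv:
  fixes A :: "real^'n^'n"
  assumes "invertible A"
  shows "(matrix_inv has_derivative (\<lambda>H. - (matrix_inv A ** H ** matrix_inv A))) (at A)"
  by (rule has_derivative_inverse_like[OF bounded_bilinear_matrix_mult open_invertible, of _ "\<lambda>A. A"])
    (use assms in \<open>auto simp: matrix_inv_resolvent\<close>)

section \<open>Representatives of projective matrices\<close>

lemma GL4_simps [simp]:
  "carrier GL4 = {A. invertible A}" "A \<otimes>\<^bsub>GL4\<^esub> B = A ** B" "\<one>\<^bsub>GL4\<^esub> = mat 1"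
  by (simp_all add: GL4_def)

interpretation PGL: group PGL4 by (rule group_PGL4)

lemma pgl_eq: "pgl A = {c *\<^sub>R A | c. c \<noteq> 0}"
  by (auto simp: pgl_def r_coset_def scalars4_def scaleR_mat_mult)

lemma mem_pgl: "B \<in> pgl A \<longleftrightarrow> (\<exists>c. c \<noteq> 0 \<and> B = c *\<^sub>R A)"
  by (auto simp: pgl_eq)

lemma self_mem_pgl [simp]: "A \<in> pgl A"
  unfolding mem_pgl by (rule exI[of _ 1]) simp

lemma pgl_scaleR: "c \<noteq> 0 \<Longrightarrow> pgl (c *\<^sub>R A) = pgl A"
proof -
  assume c: "c \<noteq> 0"
  have "\<exists>d. k *\<^sub>R A = d *\<^sub>R c *\<^sub>R A \<and> d \<noteq> 0" if "k \<noteq> 0" for k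
    by (rule exI[of _ "k / c"]) (use c that in auto)
  then show ?thesis using c by (auto simp: pgl_eq)
qed

lemma pgl_eq_iff: "pgl A = pgl B \<longleftrightarrow> (\<exists>c. c \<noteq> 0 \<and> B = c *\<^sub>R A)"
  using pgl_scaleR self_mem_pgl mem_pgl by metis

lemma mem_pgl_eq: "B \<in> pgl A \<Longrightarrow> pgl B = pgl A"
  using pgl_scaleR by (auto simp: mem_pgl)

lemma carrier_PGL4: "carrier PGL4 = pgl ` {A. invertible A}"
  by (auto simp: PGL4_def FactGroup_def RCOSETS_def pgl_def)

lemma pgl_closed [simp]: "invertible A \<Longrightarrow> pgl A \<in> carrier PGL4"
  by (auto simp: carrier_PGL4)

lemma pgl_mult: "invertible A \<Longrightarrow> invertible B \<Longrightarrow> pgl A \<otimes>\<^bsub>PGL4\<^esub> pgl B = pgl (A ** B)"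
  using normal.rcos_sum[OF scalars4_normal, of A B] by (simp add: PGL4_def FactGroup_def pgl_def)

lemma invertible_mat_1 [simp]: "invertible (mat 1 :: real^'n^'n)"
  by (simp add: invertible_det_nz)

lemma pgl_one: "\<one>\<^bsub>PGL4\<^esub> = pgl (mat 1)"
proof -
  have "pgl (mat 1) \<otimes>\<^bsub>PGL4\<^esub> pgl (mat 1) = pgl (mat 1)" by (simp add: pgl_mult)
  then show ?thesis using PGL.l_cancel_one'[of "pgl (mat 1)" "pgl (mat 1)"] by simp
qed

lemma invertible_matrix_inv [simp]:
  fixes A :: "real^'n^'n" shows "invertible A \<Longrightarrow> invertible (matrix_inv A)"
  by (metis invertible_def matrix_inv_mult(1,2))

lemma matrix_inv_unique:
  fixes A B :: "real^'n^'n"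
  assumes "A ** B = mat 1" shows "matrix_inv A = B"
proof -
  have "invertible A" using assms matrix_left_right_inverse[of A B] by (auto simp: invertible_def)
  then have "matrix_inv A ** (A ** B) = B" by simp
  then show ?thesis using assms by simp
qed

lemma matrix_inv_matrix_mult:
  fixes A B :: "real^'n^'n"
  assumes "invertible A" "invertible B"
  shows "matrix_inv (A ** B) = matrix_inv B ** matrix_inv A"
  by (rule matrix_inv_unique) (use assms in \<open>simp add: matrix_mul_assoc\<close>)

lemma matrix_inv_matrix_inv [simp]:
  fixes A :: "real^'n^'n" shows "invertible A \<Longrightarrow> matrix_inv (matrix_inv A) = A"
  by (rule matrix_inv_unique) simp

lemma matrix_inv_scaleR:
  fixes A :: "real^'n^'n"
  assumes "c \<noteq> 0" "invertible A"
  shows "invertible (c *\<^sub>R A)" "matrix_inv (c *\<^sub>R A) = inverse c *\<^sub>R matrix_inv A"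
proof -
  have 1: "(c *\<^sub>R A) ** (inverse c *\<^sub>R matrix_inv A) = mat 1"
    using assms by (simp add: matmul.scaleR_left matmul.scaleR_right)
  then show "invertible (c *\<^sub>R A)"
    using matrix_left_right_inverse invertible_def by blast
  show "matrix_inv (c *\<^sub>R A) = inverse c *\<^sub>R matrix_inv A" using 1 by (rule matrix_inv_unique)
qed

lemma pgl_inv: "invertible A \<Longrightarrow> inv\<^bsub>PGL4\<^esub> (pgl A) = pgl (matrix_inv A)"
  by (rule PGL.inv_equality) (auto simp: pgl_mult pgl_one)

lemma pgl_conj:
  "invertible h \<Longrightarrow> invertible A \<Longrightarrow>
    pgl h \<otimes>\<^bsub>PGL4\<^esub> pgl A \<otimes>\<^bsub>PGL4\<^esub> inv\<^bsub>PGL4\<^esub> (pgl h) = pgl (h ** A ** matrix_inv h)"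
  by (simp add: pgl_inv pgl_mult invertible_mult)

lemma Ad_pgl: "invertible A \<Longrightarrow> Ad (pgl A) X = A ** X ** matrix_inv A"
proof -
  assume A: "invertible A"
  have "(SOME B. B \<in> pgl A) \<in> pgl A" using self_mem_pgl by (rule someI)
  then obtain c where "c \<noteq> 0" "(SOME B. B \<in> pgl A) = c *\<^sub>R A" by (auto simp: mem_pgl)
  then show ?thesis using A
    by (simp add: Ad_def Let_def matrix_inv_scaleR matmul.scaleR_left matmul.scaleR_right)
qed

lemma openin_PGL4_top:
  "openin PGL4_top Q \<longleftrightarrow> Q \<subseteq> carrier PGL4 \<and> open {A. invertible A \<and> pgl A \<in> Q}"
  unfolding PGL4_top_def openin_quotient_topology
  by (auto simp: carrier_PGL4 openin_open_eq open_invertible)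

text \<open>\<open>pgl\<close> is an open map: the saturation of \<open>Q\<close> is the union of
  its nonzero multiples, each of which is open.\<close>

lemma openin_PGL4_top_image:
  assumes "open Q" "Q \<subseteq> {A. invertible A}"
  shows "openin PGL4_top (pgl ` Q)"
proof -
  have "{A. invertible A \<and> pgl A \<in> pgl ` Q} = (\<Union>c\<in>-{0}. (*\<^sub>R) c ` Q)"
  proof (intro equalityI subsetI)
    fix A assume "A \<in> {A. invertible A \<and> pgl A \<in> pgl ` Q}"
    then obtain B where "B \<in> Q" "pgl B = pgl A" by auto
    then show "A \<in> (\<Union>c\<in>-{0}. (*\<^sub>R) c ` Q)" by (auto simp: pgl_eq_iff)
  next
    fix A assume "A \<in> (\<Union>c\<in>-{0}. (*\<^sub>R) c ` Q)"
    then obtain c B where "c \<noteq> 0" "B \<in> Q" "A = c *\<^sub>R B" by auto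
    then show "A \<in> {A. invertible A \<and> pgl A \<in> pgl ` Q}"
      using assms by (auto simp: pgl_scaleR matrix_inv_scaleR)
  qed
  moreover have "open (\<Union>c\<in>-{0}. (*\<^sub>R) c ` Q)"
    using assms by (intro open_UN) (auto intro: open_scaling)
  ultimately show ?thesis using assms by (auto simp: openin_PGL4_top)
qed

section \<open>Representations of the free group\<close>

lemma (in group) letter_val_closed: "a \<in> carrier G \<Longrightarrow> b \<in> carrier G \<Longrightarrow> letter_val G a b l \<in> carrier G"
  by (simp add: letter_val_def)

lemma word_val_Nil [simp]: "word_val G a b [] = \<one>\<^bsub>G\<^esub>"
  by (simp add: word_val_def)

lemma word_val_Cons: "word_val G a b (l # w) = letter_val G a b l \<otimes>\<^bsub>G\<^esub> word_val G a b w"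
  by (simp add: word_val_def)

lemma (in group) word_val_closed: "a \<in> carrier G \<Longrightarrow> b \<in> carrier G \<Longrightarrow> word_val G a b w \<in> carrier G"
  by (induction w) (auto simp: word_val_Cons letter_val_closed)

lemma (in group) word_val_append:
  "a \<in> carrier G \<Longrightarrow> b \<in> carrier G \<Longrightarrow> word_val G a b (u @ w) = word_val G a b u \<otimes> word_val G a b w"
  by (induction u) (auto simp: word_val_Cons letter_val_closed word_val_closed m_assoc)

definition inv_letter :: "bool \<times> bool \<Rightarrow> bool \<times> bool" where
  "inv_letter l = (fst l, \<not> snd l)"

lemma (in group) letter_val_inv_letter:
  "a \<in> carrier G \<Longrightarrow> b \<in> carrier G \<Longrightarrow> letter_val G a b (inv_letter l) = inv (letter_val G a b l)"
  by (simp add: letter_val_def inv_letter_def Let_def)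

lemma (in group) word_val_rev:
  "a \<in> carrier G \<Longrightarrow> b \<in> carrier G \<Longrightarrow>
    word_val G a b (rev (map inv_letter w)) = inv (word_val G a b w)"
  by (induction w)
    (auto simp: word_val_Cons word_val_append letter_val_closed word_val_closed letter_val_inv_letter
      inv_mult_group)

lemma not_successively:
  "\<not> successively P w \<Longrightarrow> \<exists>u l m v. w = u @ l # m # v \<and> \<not> P l m"
proof (induction P w rule: successively.induct)
  case (3 P x y xs)
  show ?case
  proof (cases "P x y")
    case True
    with 3 obtain u l m v where "y # xs = u @ l # m # v" "\<not> P l m" by auto
    then show ?thesis by (metis append_Cons)
  qed (metis append_Nil)
qed auto

text \<open>A word representing the identity of a free group cancels to the empty word, so it represents
  the identity in every other group.\<close>

lemma word_val_one_transfer: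
  assumes "group G" "group H" "free_on_pair G F a b" "p \<in> carrier H" "q \<in> carrier H"
    and "word_val G a b w = \<one>\<^bsub>G\<^esub>"
  shows "word_val H p q w = \<one>\<^bsub>H\<^esub>"
  using assms(6)
proof (induction w rule: length_induct)
  case (1 w)
  interpret G: group G by fact
  interpret H: group H by fact
  have ab: "a \<in> carrier G" "b \<in> carrier G" using assms(3) by (auto simp: free_on_pair_def)
  note Gl = G.letter_val_closed[OF ab] and Gw = G.word_val_closed[OF ab]
  note Hl = H.letter_val_closed[OF assms(4,5)] and Hw = H.word_val_closed[OF assms(4,5)]
  show ?case
  proof (cases "w = []")
    case False
    then have "\<not> reduced_word w" using 1 assms(3) by (auto simp: free_on_pair_def)
    then obtain u l m v where w: "w = u @ l # m # v" and lm: "fst l = fst m" "snd l \<noteq> snd m"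
      unfolding reduced_word_def using not_successively by blast
    have m: "m = inv_letter l" using lm by (cases m) (auto simp: inv_letter_def)
    have canc: "word_val K p q (u @ l # m # v) = word_val K p q (u @ v)"
      if "group K" "p \<in> carrier K" "q \<in> carrier K" for K :: "('x, 'y) monoid_scheme" and p q
    proof -
      interpret K: group K by fact
      note Kl = K.letter_val_closed[OF that(2,3)] and Kw = K.word_val_closed[OF that(2,3)]
      have "letter_val K p q l \<otimes>\<^bsub>K\<^esub> (inv\<^bsub>K\<^esub> letter_val K p q l \<otimes>\<^bsub>K\<^esub> word_val K p q v)
          = word_val K p q v"
        using Kl Kw by (simp flip: K.m_assoc)
      then show ?thesis
        by (simp add: K.word_val_append[OF that(2,3)] word_val_Cons m
            K.letter_val_inv_letter[OF that(2,3)])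
    qed
    have "word_val G a b (u @ v) = \<one>\<^bsub>G\<^esub>"
      using 1(2) canc[OF assms(1) ab] by (simp add: w)
    then have "word_val H p q (u @ v) = \<one>\<^bsub>H\<^esub>" using 1(1) by (auto simp: w)
    then show ?thesis using canc[OF assms(2,4,5)] by (simp add: w)
  qed simp
qed

section \<open>Representations of the fibre group as pairs of matrices\<close>

locale fibre = normal F G for F :: "'g set" and G :: "('g, 'm) monoid_scheme" (structure) +
  fixes a b :: 'g
  assumes free: "free_on_pair G F a b"
begin

lemma ab_carrier: "a \<in> carrier G" "b \<in> carrier G" and F_generate: "F = generate G {a, b}"
  using free by (auto simp: free_on_pair_def)

lemma ab_mem: "a \<in> F" "b \<in> F"
  unfolding F_generate by (auto intro: generate.incl)

lemma F_closed: "g \<in> F \<Longrightarrow> h \<in> F \<Longrightarrow> g \<otimes> h \<in> F" "g \<in> F \<Longrightarrow> inv g \<in> F" "\<one> \<in> F"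
  by auto

lemma F_induct [consumes 1, case_names one a b inv mult]:
  assumes "g \<in> F" "P \<one>" "P a" "P b" "\<And>g. g \<in> F \<Longrightarrow> P g \<Longrightarrow> P (inv g)"
    "\<And>g h. g \<in> F \<Longrightarrow> h \<in> F \<Longrightarrow> P g \<Longrightarrow> P h \<Longrightarrow> P (g \<otimes> h)"
  shows "P g"
proof -
  have "g \<in> generate G {a, b}" using assms(1) F_generate by simp
  then have "g \<in> F \<and> P g"
    by (induction rule: generate.induct) (use assms ab_mem in auto)
  then show ?thesis ..
qed

lemma F_word: "g \<in> F \<Longrightarrow> \<exists>w. word_val G a b w = g"
proof (induction rule: F_induct)
  case one
  show ?case by (rule exI[of _ "[]"]) simp
next
  case a
  show ?case by (rule exI[of _ "[(True, True)]"]) (use ab_carrier in \<open>simp add: word_val_def letter_val_def\<close>)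
next
  case b
  show ?case by (rule exI[of _ "[(False, True)]"]) (use ab_carrier in \<open>simp add: word_val_def letter_val_def\<close>)
next
  case (inv g)
  then show ?case using word_val_rev[OF ab_carrier] by metis
next
  case (mult g h)
  then show ?case using word_val_append[OF ab_carrier] by metis
qed

lemma word_val_mem: "word_val G a b w \<in> F"
  by (induction w) (auto simp: word_val_Cons letter_val_def Let_def ab_mem)

lemma Reps_closed: "\<sigma> \<in> Reps G F \<Longrightarrow> g \<in> F \<Longrightarrow> \<sigma> g \<in> carrier PGL4"
  by (auto simp: Reps_def hom_def)

lemma Reps_mult: "\<sigma> \<in> Reps G F \<Longrightarrow> g \<in> F \<Longrightarrow> h \<in> F \<Longrightarrow> \<sigma> (g \<otimes> h) = \<sigma> g \<otimes>\<^bsub>PGL4\<^esub> \<sigma> h"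
  by (auto simp: Reps_def hom_def)

lemma Reps_one: assumes "\<sigma> \<in> Reps G F" shows "\<sigma> \<one> = \<one>\<^bsub>PGL4\<^esub>"
proof -
  have "\<sigma> \<one> \<otimes>\<^bsub>PGL4\<^esub> \<sigma> \<one> = \<sigma> \<one>" using Reps_mult[OF assms, of \<one> \<one>] by simp
  then show ?thesis using Reps_closed[OF assms, of \<one>] by simp
qed

lemma Reps_inv: assumes "\<sigma> \<in> Reps G F" "g \<in> F" shows "\<sigma> (inv g) = inv\<^bsub>PGL4\<^esub> (\<sigma> g)"
proof -
  have "\<sigma> (inv g) \<otimes>\<^bsub>PGL4\<^esub> \<sigma> g = \<one>\<^bsub>PGL4\<^esub>"
    using Reps_mult[OF assms(1), of "inv g" g] Reps_one[OF assms(1)] assms(2) mem_carrier by simp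
  then show ?thesis using Reps_closed[OF assms(1)] assms(2) by (simp add: PGL.inv_equality)
qed

lemma Reps_eqI:
  assumes "\<sigma> \<in> Reps G F" "\<tau> \<in> Reps G F" "\<sigma> a = \<tau> a" "\<sigma> b = \<tau> b"
  shows "\<sigma> = \<tau>"
proof (rule extensionalityI[of _ F])
  show "\<sigma> \<in> extensional F" "\<tau> \<in> extensional F" using assms by (auto simp: Reps_def)
  show "\<sigma> g = \<tau> g" if "g \<in> F" for g
    using that by (induction rule: F_induct) (simp_all add: assms Reps_one Reps_inv Reps_mult)
qed

text \<open>The universal property of a free group, obtained by evaluating in \<open>PGL4\<close> a
  word chosen for each element. The choice is immaterial: two words for one element combine to a
  word, \<open>w\<close> followed by the formal inverse of \<open>w'\<close>, with value one, and
  this relation transfers to \<open>PGL4\<close>.\<close>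

lemma Reps_exists:
  assumes "p \<in> carrier PGL4" "q \<in> carrier PGL4"
  shows "\<exists>\<sigma>\<in>Reps G F. \<sigma> a = p \<and> \<sigma> b = q"
proof -
  define v where "v w = word_val PGL4 p q w" for w
  define wd where "wd g = (SOME w. word_val G a b w = g)" for g
  have wd: "word_val G a b (wd g) = g" if "g \<in> F" for g
    unfolding wd_def using F_word[OF that] by (rule someI_ex)
  have vc: "v w \<in> carrier PGL4" for w using PGL.word_val_closed[OF assms] by (simp add: v_def)
  have eq: "v w = v w'" if "word_val G a b w = word_val G a b w'" for w w'
  proof -
    have "word_val G a b (w @ rev (map inv_letter w')) = \<one>"
      using that word_val_mem mem_carrier by (simp add: word_val_append[OF ab_carrier] word_val_rev[OF ab_carrier])
    then have "v (w @ rev (map inv_letter w')) = \<one>\<^bsub>PGL4\<^esub>"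
      unfolding v_def by (rule word_val_one_transfer[OF is_group group_PGL4 free assms])
    then have "v w \<otimes>\<^bsub>PGL4\<^esub> inv\<^bsub>PGL4\<^esub> (v w') = \<one>\<^bsub>PGL4\<^esub>"
      by (simp add: v_def PGL.word_val_append[OF assms] PGL.word_val_rev[OF assms])
    then show ?thesis using vc by (metis PGL.inv_closed PGL.inv_equality PGL.inv_inv)
  qed
  define \<sigma> where "\<sigma> = (\<lambda>g\<in>F. v (wd g))"
  have "\<sigma> (g \<otimes> h) = \<sigma> g \<otimes>\<^bsub>PGL4\<^esub> \<sigma> h" if "g \<in> F" "h \<in> F" for g h
  proof -
    have "v (wd (g \<otimes> h)) = v (wd g @ wd h)"
      by (rule eq) (use that wd F_closed in \<open>simp add: word_val_append[OF ab_carrier]\<close>)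
    then show ?thesis using that F_closed by (simp add: \<sigma>_def v_def PGL.word_val_append[OF assms])
  qed
  then have "\<sigma> \<in> Reps G F" by (auto simp: Reps_def hom_def \<sigma>_def vc)
  moreover have "v (wd a) = v [(True, True)]" "v (wd b) = v [(False, True)]"
    by (rule eq; use wd ab_mem ab_carrier in \<open>simp add: word_val_def letter_val_def\<close>)+
  then have "\<sigma> a = p" "\<sigma> b = q"
    using assms ab_mem by (simp_all add: \<sigma>_def v_def word_val_def letter_val_def)
  ultimately show ?thesis by blast
qed

abbreviation rep :: "mat4 \<times> mat4 \<Rightarrow> 'g \<Rightarrow> mat4 set" where "rep \<equiv> rep_of G F a b"
abbreviation pt :: "mat4 \<times> mat4 \<Rightarrow> ('g \<Rightarrow> mat4 set) set" where "pt X \<equiv> conj_class F (rep X)"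
abbreviation GL2 :: "(mat4 \<times> mat4) set" where "GL2 \<equiv> carrier GL4 \<times> carrier GL4"

lemma inj_on_Reps: "inj_on (\<lambda>\<sigma>. (\<sigma> a, \<sigma> b)) (Reps G F)"
  by (auto intro!: inj_onI intro: Reps_eqI)

lemma rep_eqI:
  assumes "\<sigma> \<in> Reps G F" "\<sigma> a = pgl A" "\<sigma> b = pgl B"
  shows "rep (A, B) = \<sigma>"
  using the_inv_into_f_f[OF inj_on_Reps assms(1)] assms(2,3) by (simp add: rep_of_def)

lemma rep_props:
  assumes "X \<in> GL2"
  shows "rep X \<in> Reps G F" "rep X a = pgl (fst X)" "rep X b = pgl (snd X)"
proof -
  obtain \<sigma> where \<sigma>: "\<sigma> \<in> Reps G F" "\<sigma> a = pgl (fst X)" "\<sigma> b = pgl (snd X)"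
    using Reps_exists[of "pgl (fst X)" "pgl (snd X)"] assms by auto
  then show "rep X \<in> Reps G F" "rep X a = pgl (fst X)" "rep X b = pgl (snd X)"
    using rep_eqI[OF \<sigma>] by simp_all
qed

lemma Reps_cases:
  assumes "\<sigma> \<in> Reps G F"
  obtains X where "X \<in> GL2" "\<sigma> = rep X" "\<sigma> a = pgl (fst X)" "\<sigma> b = pgl (snd X)"
proof -
  obtain A B where "invertible A" "\<sigma> a = pgl A" "invertible B" "\<sigma> b = pgl B"
    using Reps_closed[OF assms] ab_mem by (metis (no_types, lifting) carrier_PGL4 image_iff mem_Collect_eq)
  then show ?thesis using that[of "(A, B)"] rep_eqI[OF assms] by auto
qed

definition conj_rep :: "mat4 set \<Rightarrow> ('g \<Rightarrow> mat4 set) \<Rightarrow> 'g \<Rightarrow> mat4 set" where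
  "conj_rep h \<sigma> = (\<lambda>g\<in>F. h \<otimes>\<^bsub>PGL4\<^esub> \<sigma> g \<otimes>\<^bsub>PGL4\<^esub> inv\<^bsub>PGL4\<^esub> h)"

lemma conj_class_eq: "conj_class F \<sigma> = (\<lambda>h. conj_rep h \<sigma>) ` carrier PGL4"
  by (auto simp: conj_class_def conj_rep_def)

lemma conj_rep_Reps:
  assumes "h \<in> carrier PGL4" "\<sigma> \<in> Reps G F" shows "conj_rep h \<sigma> \<in> Reps G F"
proof -
  have "inv\<^bsub>PGL4\<^esub> h \<otimes>\<^bsub>PGL4\<^esub> (h \<otimes>\<^bsub>PGL4\<^esub> y) = y" if "y \<in> carrier PGL4" for y
    using assms(1) that by (simp flip: PGL.m_assoc)
  then show ?thesis
    using assms Reps_closed[OF assms(2)]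
    by (auto simp: Reps_def hom_def conj_rep_def PGL.m_assoc Reps_mult[OF assms(2)])
qed

lemma conj_rep_conj_rep:
  assumes "h \<in> carrier PGL4" "k \<in> carrier PGL4" "\<sigma> \<in> Reps G F"
  shows "conj_rep h (conj_rep k \<sigma>) = conj_rep (h \<otimes>\<^bsub>PGL4\<^esub> k) \<sigma>"
  using assms Reps_closed[OF assms(3)]
  by (auto simp: conj_rep_def fun_eq_iff PGL.m_assoc PGL.inv_mult_group)

lemma conj_rep_one: "\<sigma> \<in> Reps G F \<Longrightarrow> conj_rep \<one>\<^bsub>PGL4\<^esub> \<sigma> = \<sigma>"
  by (rule extensionalityI[of _ F]) (auto simp: conj_rep_def Reps_closed, auto simp: Reps_def)

lemma conj_class_eq_iff:
  assumes \<sigma>: "\<sigma> \<in> Reps G F" and \<tau>: "\<tau> \<in> Reps G F"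
  shows "conj_class F \<sigma> = conj_class F \<tau> \<longleftrightarrow> (\<exists>h\<in>carrier PGL4. \<tau> = conj_rep h \<sigma>)"
proof
  assume "conj_class F \<sigma> = conj_class F \<tau>"
  moreover have "\<tau> \<in> conj_class F \<tau>"
    unfolding conj_class_eq using conj_rep_one[OF \<tau>] by (metis PGL.one_closed image_eqI)
  ultimately show "\<exists>h\<in>carrier PGL4. \<tau> = conj_rep h \<sigma>" by (auto simp: conj_class_eq)
next
  assume "\<exists>h\<in>carrier PGL4. \<tau> = conj_rep h \<sigma>"
  then obtain h where h: "h \<in> carrier PGL4" "\<tau> = conj_rep h \<sigma>" by blast
  have "conj_rep k \<sigma> = conj_rep (k \<otimes>\<^bsub>PGL4\<^esub> inv\<^bsub>PGL4\<^esub> h) \<tau>" if "k \<in> carrier PGL4" for k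
    using that h \<sigma> by (simp add: conj_rep_conj_rep PGL.m_assoc)
  moreover have "conj_rep k \<tau> = conj_rep (k \<otimes>\<^bsub>PGL4\<^esub> h) \<sigma>" if "k \<in> carrier PGL4" for k
    using that h \<sigma> by (simp add: conj_rep_conj_rep)
  ultimately show "conj_class F \<sigma> = conj_class F \<tau>"
    unfolding conj_class_eq using h(1)
    by (intro equalityI image_subsetI) (metis PGL.inv_closed PGL.m_closed imageI)+
qed

end

text \<open>The orbit relation of conjugation by \<open>GL4\<close> combined with independent
  nonzero rescaling of the two entries. On invertible pairs its classes correspond exactly to
  conjugacy classes of representations, see \<open>pt_eq_iff\<close>, so it replaces the character
  variety in matrix computations.\<close>

definition sim :: "mat4 \<times> mat4 \<Rightarrow> mat4 \<times> mat4 \<Rightarrow> bool" where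
  "sim X Y \<longleftrightarrow> (\<exists>h c d. invertible h \<and> c \<noteq> 0 \<and> d \<noteq> 0 \<and>
     Y = (c *\<^sub>R (h ** fst X ** matrix_inv h), d *\<^sub>R (h ** snd X ** matrix_inv h)))"

context fibre
begin

lemma pt_eq_iff:
  assumes "X \<in> GL2" "Y \<in> GL2"
  shows "pt X = pt Y \<longleftrightarrow> sim X Y"
proof -
  have i: "invertible (fst X)" "invertible (snd X)" "invertible (fst Y)" "invertible (snd Y)"
    using assms by auto
  have "pt X = pt Y \<longleftrightarrow> (\<exists>h. invertible h \<and> rep Y = conj_rep (pgl h) (rep X))"
    using rep_props(1)[OF assms(1)] rep_props(1)[OF assms(2)]
    by (subst conj_class_eq_iff) (auto simp: carrier_PGL4)
  also have "\<dots> \<longleftrightarrow> (\<exists>h. invertible h \<and> pgl (fst Y) = pgl (h ** fst X ** matrix_inv h) \<and>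
      pgl (snd Y) = pgl (h ** snd X ** matrix_inv h))"
  proof (intro ex_cong1 conj_cong refl)
    fix h :: mat4 assume h: "invertible h"
    have *: "conj_rep (pgl h) (rep X) a = pgl (h ** fst X ** matrix_inv h)"
      "conj_rep (pgl h) (rep X) b = pgl (h ** snd X ** matrix_inv h)"
      using h i by (simp_all add: conj_rep_def ab_mem rep_props(2,3)[OF assms(1)] pgl_conj)
    show "rep Y = conj_rep (pgl h) (rep X) \<longleftrightarrow> pgl (fst Y) = pgl (h ** fst X ** matrix_inv h) \<and>
      pgl (snd Y) = pgl (h ** snd X ** matrix_inv h)"
      using Reps_eqI[OF rep_props(1)[OF assms(2)] conj_rep_Reps[OF _ rep_props(1)[OF assms(1)]], of "pgl h"]
        rep_props[OF assms(2)] h * by auto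
  qed
  also have "\<dots> \<longleftrightarrow> sim X Y"
    unfolding sim_def pgl_eq_iff[of _ "fst Y"] pgl_eq_iff[of _ "snd Y"]
      eq_commute[of "pgl (fst Y)"] eq_commute[of "pgl (snd Y)"] by (cases Y) auto
  finally show ?thesis .
qed

lemma pt_image: "conj_class F ` Reps G F = pt ` GL2"
proof -
  have "Reps G F = rep ` GL2"
  proof (intro equalityI subsetI)
    fix \<sigma> assume "\<sigma> \<in> Reps G F"
    then obtain X where "X \<in> GL2" "\<sigma> = rep X" by (rule Reps_cases)
    then show "\<sigma> \<in> rep ` GL2" by (rule image_eqI[rotated])
  next
    fix \<sigma> assume "\<sigma> \<in> rep ` GL2"
    then show "\<sigma> \<in> Reps G F" using rep_props(1) by (elim imageE) simp
  qed
  then show ?thesis by (simp add: image_image)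
qed

lemma open_GL2: "open GL2"
  using open_invertible by (auto intro: open_Times)

text \<open>Openness is tested on matrix pairs. From left to right this is continuity of
  \<open>pgl\<close>; the converse needs that \<open>pgl\<close> is open, so that a box of matrices
  around a point of the preimage maps to an open box in the product of the quotient
  topologies.\<close>

lemma openin_Reps_top:
  "openin (Reps_top G F a b) Q \<longleftrightarrow> Q \<subseteq> Reps G F \<and> open {X \<in> GL2. rep X \<in> Q}"
proof
  assume "openin (Reps_top G F a b) Q"
  then obtain V where V: "openin (prod_topology PGL4_top PGL4_top) V"
    and Q: "Q = (\<lambda>\<sigma>. (\<sigma> a, \<sigma> b)) -` V \<inter> Reps G F"
    by (auto simp: Reps_top_def openin_pullback_topology)
  have "\<exists>N. open N \<and> X \<in> N \<and> N \<subseteq> {X \<in> GL2. rep X \<in> Q}" if X: "X \<in> GL2" "rep X \<in> Q" for X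
  proof -
    have "(pgl (fst X), pgl (snd X)) \<in> V" using X rep_props[OF X(1)] by (simp add: Q)
    then obtain S T where ST: "openin PGL4_top S" "openin PGL4_top T" "pgl (fst X) \<in> S" "pgl (snd X) \<in> T"
      "S \<times> T \<subseteq> V"
      using V unfolding openin_prod_topology_alt by meson
    let ?N = "{A. invertible A \<and> pgl A \<in> S} \<times> {A. invertible A \<and> pgl A \<in> T}"
    have "open ?N" using ST by (auto simp: openin_PGL4_top intro: open_Times)
    moreover have "X \<in> ?N" using X ST by (cases X) auto
    moreover have "?N \<subseteq> {X \<in> GL2. rep X \<in> Q}"
    proof
      fix Y assume Y: "Y \<in> ?N"
      then have "Y \<in> GL2" "(pgl (fst Y), pgl (snd Y)) \<in> V" using ST(5) by auto
      then show "Y \<in> {X \<in> GL2. rep X \<in> Q}" using rep_props[of Y] by (simp add: Q)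
    qed
    ultimately show ?thesis by blast
  qed
  then have "open {X \<in> GL2. rep X \<in> Q}" by (subst open_subopen) blast
  then show "Q \<subseteq> Reps G F \<and> open {X \<in> GL2. rep X \<in> Q}" using Q by blast
next
  assume Q: "Q \<subseteq> Reps G F \<and> open {X \<in> GL2. rep X \<in> Q}"
  define V where "V = (\<lambda>X. (pgl (fst X), pgl (snd X))) ` {X \<in> GL2. rep X \<in> Q}"
  have "openin (prod_topology PGL4_top PGL4_top) V"
    unfolding openin_prod_topology_alt
  proof (intro allI impI)
    fix p q assume "(p, q) \<in> V"
    then obtain X where X: "X \<in> {X \<in> GL2. rep X \<in> Q}" "p = pgl (fst X)" "q = pgl (snd X)"
      by (auto simp: V_def)
    obtain S T where ST: "open S" "open T" "X \<in> S \<times> T" "S \<times> T \<subseteq> {X \<in> GL2. rep X \<in> Q}"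
      using open_prod_elim[OF conjunct2[OF Q] X(1)] .
    have "S \<times> T \<subseteq> GL2" using ST(4) by blast
    then have "S \<subseteq> {A. invertible A}" "T \<subseteq> {A. invertible A}"
      using ST(3) by (auto simp: subset_iff)
    then have "openin PGL4_top (pgl ` S)" "openin PGL4_top (pgl ` T)"
      using openin_PGL4_top_image ST(1,2) by auto
    moreover have "p \<in> pgl ` S" "q \<in> pgl ` T" using ST(3) X(2,3) by auto
    moreover have "pgl ` S \<times> pgl ` T \<subseteq> V"
    proof (intro subsetI, elim SigmaE imageE, hypsubst)
      fix A B assume "A \<in> S" "B \<in> T"
      then have "(A, B) \<in> {X \<in> GL2. rep X \<in> Q}" using ST(4) by blast
      then show "(pgl A, pgl B) \<in> V" unfolding V_def by (rule image_eqI[rotated]) simp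
    qed
    ultimately show "\<exists>U V'. openin PGL4_top U \<and> openin PGL4_top V' \<and> p \<in> U \<and> q \<in> V' \<and> U \<times> V' \<subseteq> V"
      by blast
  qed
  moreover have "Q = (\<lambda>\<sigma>. (\<sigma> a, \<sigma> b)) -` V \<inter> Reps G F"
  proof (intro equalityI subsetI)
    fix \<sigma> assume s: "\<sigma> \<in> Q"
    then have "\<sigma> \<in> Reps G F" using Q by blast
    then obtain X where "X \<in> GL2" "\<sigma> = rep X" "\<sigma> a = pgl (fst X)" "\<sigma> b = pgl (snd X)" by (rule Reps_cases)
    with s have "(\<sigma> a, \<sigma> b) \<in> V" unfolding V_def by (intro image_eqI[of _ _ X]) simp_all
    with \<open>\<sigma> \<in> Reps G F\<close> show "\<sigma> \<in> (\<lambda>\<sigma>. (\<sigma> a, \<sigma> b)) -` V \<inter> Reps G F" by simp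
  next
    fix \<sigma> assume "\<sigma> \<in> (\<lambda>\<sigma>. (\<sigma> a, \<sigma> b)) -` V \<inter> Reps G F"
    then obtain X where "\<sigma> \<in> Reps G F" "\<sigma> a = pgl (fst X)" "\<sigma> b = pgl (snd X)" "rep X \<in> Q"
      by (auto simp: V_def)
    then show "\<sigma> \<in> Q" using rep_eqI[of \<sigma> "fst X" "snd X"] by simp
  qed
  ultimately show "openin (Reps_top G F a b) Q"
    unfolding Reps_top_def openin_pullback_topology by blast
qed

lemma topspace_Reps_top: "topspace (Reps_top G F a b) = Reps G F"
proof
  show "topspace (Reps_top G F a b) \<subseteq> Reps G F"
    using openin_Reps_top openin_topspace by blast
  have "{X \<in> GL2. rep X \<in> Reps G F} = GL2" using rep_props by auto
  then have "openin (Reps_top G F a b) (Reps G F)"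
    using openin_Reps_top open_GL2 by auto
  then show "Reps G F \<subseteq> topspace (Reps_top G F a b)" by (rule openin_subset)
qed

lemma openin_char_variety:
  "openin (char_variety G F a b) U \<longleftrightarrow> U \<subseteq> pt ` GL2 \<and> open {X \<in> GL2. pt X \<in> U}"
proof -
  have "{X \<in> GL2. rep X \<in> {\<sigma> \<in> Reps G F. conj_class F \<sigma> \<in> U}} = {X \<in> GL2. pt X \<in> U}"
    using rep_props(1) by blast
  then show ?thesis
    unfolding char_variety_def openin_quotient_topology topspace_Reps_top pt_image openin_Reps_top
    by auto
qed

end

section \<open>Conjugation of pairs of matrices\<close>

lemma mat4_trace [simp]:
  fixes A B :: mat4
  shows "trace (A + B) = trace A + trace B" "trace (A - B) = trace A - trace B"
    "trace (c *\<^sub>R A) = c * trace A" "trace (mat 1 :: mat4) = 4" "trace (0 :: mat4) = 0"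
    "trace (- A) = - trace A"
  by (simp_all add: trace_def sum.distrib sum_subtractf sum_distrib_left mat_def sum_negf)

lemma mat4_one_neq_zero [simp]: "mat 1 \<noteq> (0 :: mat4)" "0 \<noteq> (mat 1 :: mat4)"
  using mat4_trace(4,5) by (metis zero_neq_numeral)+

lemma bounded_linear_trace: "bounded_linear (trace :: mat4 \<Rightarrow> real)"
  by (auto intro!: linearI simp: linear_conv_bounded_linear[symmetric])

lemma trace_conj:
  fixes h A :: mat4
  assumes h: "invertible h" shows "trace (h ** A ** matrix_inv h) = trace A"
proof -
  have "trace (h ** A ** matrix_inv h) = trace (matrix_inv h ** (h ** A))" by (rule trace_mul_sym)
  then show ?thesis using h by simp
qed

lemma det_scaleR4: "det (c *\<^sub>R A) = c ^ 4 * det (A :: mat4)"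
proof -
  have "c *\<^sub>R A = (\<chi> i. c *s (A $ i))" by (simp add: vec_eq_iff)
  then show ?thesis using det_rows_mul[of "\<lambda>_. c" "\<lambda>i. A $ i"] by simp
qed

lemma det_conj:
  fixes h A :: mat4
  assumes h: "invertible h" shows "det (h ** A ** matrix_inv h) = det A"
proof -
  have "det h * det (matrix_inv h) = 1" using h by (simp flip: det_mul)
  then show ?thesis by (simp add: det_mul)
qed

definition conj_scale :: "mat4 \<Rightarrow> real \<Rightarrow> real \<Rightarrow> mat4 \<times> mat4 \<Rightarrow> mat4 \<times> mat4" where
  "conj_scale h c d X = (c *\<^sub>R (h ** fst X ** matrix_inv h), d *\<^sub>R (h ** snd X ** matrix_inv h))"

lemma sim_iff: "sim X Y \<longleftrightarrow> (\<exists>h c d. invertible h \<and> c \<noteq> 0 \<and> d \<noteq> 0 \<and> Y = conj_scale h c d X)"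
  by (simp add: sim_def conj_scale_def)

lemma conj_scale_comp:
  assumes "invertible h" "invertible k"
  shows "conj_scale h c d (conj_scale k c' d' X) = conj_scale (h ** k) (c * c') (d * d') X"
  using assms
  by (simp add: conj_scale_def matrix_inv_matrix_mult matmul.scaleR_left matmul.scaleR_right matrix_mul_assoc)

lemma matrix_inv_mat_1 [simp]: "matrix_inv (mat 1 :: real^'n^'n) = mat 1"
  by (rule matrix_inv_unique) simp

lemma conj_scale_one [simp]: "conj_scale (mat 1) 1 1 X = X"
  by (simp add: conj_scale_def)

lemma conj_scale_inverse:
  assumes "invertible h" "c \<noteq> 0" "d \<noteq> 0"
  shows "conj_scale (matrix_inv h) (inverse c) (inverse d) (conj_scale h c d X) = X"
    "conj_scale h c d (conj_scale (matrix_inv h) (inverse c) (inverse d) X) = X"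
  using assms by (simp_all add: conj_scale_comp)

lemma conj_scale_scaleR:
  assumes "invertible h" "k \<noteq> 0"
  shows "conj_scale (k *\<^sub>R h) c d = conj_scale h c d"
  using assms by (simp add: conj_scale_def fun_eq_iff matrix_inv_scaleR matmul.scaleR_left matmul.scaleR_right)

lemma bounded_linear_conj_scale: "bounded_linear (conj_scale h c d)"
proof -
  have "linear (conj_scale h c d)"
    by (rule linearI) (simp_all add: conj_scale_def matmul.add_left matmul.add_right
        matmul.scaleR_left matmul.scaleR_right scaleR_add_right)
  then show ?thesis by (simp add: linear_conv_bounded_linear)
qed

lemma sim_refl: "sim X X"
  unfolding sim_iff using conj_scale_one invertible_mat_1 by (metis one_neq_zero)

lemma sim_sym: "sim X Y \<Longrightarrow> sim Y X"
  unfolding sim_iff using conj_scale_inverse(1) by (metis inverse_zero_imp_zero invertible_matrix_inv)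

lemma sim_trans: "sim X Y \<Longrightarrow> sim Y Z \<Longrightarrow> sim X Z"
  unfolding sim_iff using conj_scale_comp by (metis invertible_mult mult_eq_0_iff)

lemma conj_scale_GL2:
  assumes "invertible h" "c \<noteq> 0" "d \<noteq> 0" "X \<in> carrier GL4 \<times> carrier GL4"
  shows "conj_scale h c d X \<in> carrier GL4 \<times> carrier GL4"
  using assms by (auto simp: conj_scale_def matrix_inv_scaleR invertible_mult)

lemma sim_GL2: "sim X Y \<Longrightarrow> X \<in> carrier GL4 \<times> carrier GL4 \<Longrightarrow> Y \<in> carrier GL4 \<times> carrier GL4"
  using conj_scale_GL2 by (auto simp: sim_iff simp del: GL4_simps)

section \<open>A slice for the conjugation action\<close>

text \<open>The hypothesis \<open>rigid\<close> is what the limit of a sequence of conjugating matrices, normalised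
  to norm one, satisfies: it makes the action of \<open>PGL4\<close> both locally free and proper near the pair.\<close>

locale rigid_pair =
  fixes A0 B0 :: mat4
  assumes inv0: "invertible A0" "invertible B0"
    and rigid: "\<And>g c d. g \<noteq> 0 \<Longrightarrow> \<bar>c\<bar> = 1 \<Longrightarrow> \<bar>d\<bar> = 1 \<Longrightarrow> g ** A0 = c *\<^sub>R (A0 ** g) \<Longrightarrow>
      g ** B0 = d *\<^sub>R (B0 ** g) \<Longrightarrow> c = 1 \<and> d = 1 \<and> (\<exists>r. g = r *\<^sub>R mat 1)"
begin

definition X0 :: "mat4 \<times> mat4" where "X0 = (A0, B0)"

text \<open>The derivative at the identity of the orbit map of \<open>(A0, B0)\<close> under
  conjugation and the two rescalings. Scalar conjugators act trivially, so the matrix part is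
  restricted to trace zero in \<open>inf_dom\<close>.\<close>

definition inf_act :: "mat4 \<times> real \<times> real \<Rightarrow> mat4 \<times> mat4" where
  "inf_act z = (fst z ** A0 - A0 ** fst z + fst (snd z) *\<^sub>R A0,
                fst z ** B0 - B0 ** fst z + snd (snd z) *\<^sub>R B0)"

definition inf_dom :: "(mat4 \<times> real \<times> real) set" where
  "inf_dom = {z. trace (fst z) = 0}"

lemma linear_inf_act: "linear inf_act"
  by (rule linearI)
    (simp_all add: inf_act_def matmul.add_left matmul.add_right scaleR_add_left
      matmul.scaleR_left matmul.scaleR_right scaleR_diff_right scaleR_add_right)

lemma subspace_inf_dom: "subspace inf_dom"
  by (auto simp: subspace_def inf_dom_def)

text \<open>Multiplying by the inverse of \<open>A\<close> turns the commutator into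
  \<open>matrix_inv A ** Y ** A - Y\<close>, which has trace zero, and leaves
  \<open>4 * \<alpha>\<close> as the whole trace.\<close>

lemma scalar_zero:
  assumes "invertible A" "Y ** A - A ** Y + \<alpha> *\<^sub>R A = (0 :: mat4)"
  shows "\<alpha> = 0"
proof -
  have "matrix_inv A ** (Y ** A - A ** Y + \<alpha> *\<^sub>R A) = 0" using assms by simp
  then have "matrix_inv A ** Y ** A - Y + \<alpha> *\<^sub>R mat 1 = 0"
    using assms(1) by (simp add: matmul.add_right matmul.diff_right matmul.scaleR_right matrix_mul_assoc)
  then have "trace (matrix_inv A ** Y ** A - Y + \<alpha> *\<^sub>R mat 1) = 0" by simp
  moreover have "trace (matrix_inv A ** Y ** A) = trace Y"
    using trace_conj[of "matrix_inv A" Y] assms(1) by simp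
  ultimately show ?thesis by simp
qed

text \<open>Local freeness of the action: the rescaling parts vanish by taking traces, and then
  \<open>rigid\<close> with both signs equal to 1 makes the matrix part a scalar of trace
  zero.\<close>

lemma inj_inf_act: "inj_on inf_act inf_dom"
proof (rule inj_onI)
  fix z w assume zw: "z \<in> inf_dom" "w \<in> inf_dom" "inf_act z = inf_act w"
  define y where "y = z - w"
  have y: "y \<in> inf_dom" using zw subspace_inf_dom by (simp add: y_def subspace_diff)
  have 0: "inf_act y = 0" using zw linear_inf_act by (simp add: y_def linear_diff)
  then have s: "fst (snd y) = 0" "snd (snd y) = 0"
    using scalar_zero[OF inv0(1)] scalar_zero[OF inv0(2)] by (auto simp: inf_act_def zero_prod_def)
  have "fst y = 0"
  proof (rule ccontr)
    assume n: "fst y \<noteq> 0"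
    obtain r where "fst y = r *\<^sub>R mat 1"
      using rigid[OF n, of 1 1] 0 s by (auto simp: inf_act_def zero_prod_def)
    with y n show False by (simp add: inf_dom_def)
  qed
  with s have "y = 0" by (cases y) (auto simp: zero_prod_def)
  then show "z = w" by (simp add: y_def)
qed

text \<open>Any left inverse of \<open>inf_act\<close> splits \<open>mat4 \<times> mat4\<close> into
  the 17 orbit directions and its kernel \<open>slice\<close>, of dimension 15; \<open>proj\<close>
  is the projection onto \<open>slice\<close> along the orbit directions.\<close>

definition inf_inv :: "mat4 \<times> mat4 \<Rightarrow> mat4 \<times> real \<times> real" where
  "inf_inv = (SOME g. g ` UNIV \<subseteq> inf_dom \<and> linear g \<and> (\<forall>v\<in>inf_dom. g (inf_act v) = v))"

lemma inf_inv: "inf_inv e \<in> inf_dom" "linear inf_inv" "z \<in> inf_dom \<Longrightarrow> inf_inv (inf_act z) = z"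
proof -
  have "inf_inv ` UNIV \<subseteq> inf_dom \<and> linear inf_inv \<and> (\<forall>v\<in>inf_dom. inf_inv (inf_act v) = v)"
    using someI_ex[OF linear_exists_left_inverse_on[OF linear_inf_act subspace_inf_dom inj_inf_act]]
    unfolding inf_inv_def[symmetric] .
  then show "inf_inv e \<in> inf_dom" "linear inf_inv" "z \<in> inf_dom \<Longrightarrow> inf_inv (inf_act z) = z" by auto
qed

definition slice :: "(mat4 \<times> mat4) set" where "slice = {e. inf_inv e = 0}"

definition proj :: "mat4 \<times> mat4 \<Rightarrow> mat4 \<times> mat4" where "proj e = e - inf_act (inf_inv e)"

lemma linear_proj: "linear proj"
  unfolding proj_def
  by (rule linearI) (simp_all add: linear_add linear_scale linear_inf_act inf_inv scaleR_diff_right)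

lemma subspace_slice: "subspace slice"
  unfolding slice_def using inf_inv(2) by (rule linear_subspace_kernel)

lemma inf_act_0 [simp]: "inf_act 0 = 0" using linear_inf_act by (rule linear_0)
lemma inf_inv_0 [simp]: "inf_inv 0 = 0" using inf_inv(2) by (rule linear_0)

lemma proj_slice: "proj e \<in> slice" "s \<in> slice \<Longrightarrow> proj s = s"
  by (simp_all add: slice_def proj_def linear_diff inf_inv)

lemma range_proj: "range proj = slice"
proof (intro equalityI subsetI)
  fix s assume "s \<in> slice"
  then show "s \<in> range proj" using proj_slice(2) by (intro range_eqI[of _ _ s]) simp
qed (use proj_slice(1) in auto)

text \<open>One vector \<open>e\<close> carries both the conjugating data, read off by
  \<open>inf_inv\<close>, and a point of the slice, given by \<open>proj\<close>. So source and
  target have equal dimension, and since \<open>e\<close> is the sum of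
  \<open>inf_act (inf_inv e)\<close> and \<open>proj e\<close>, the derivative at 0 is the
  identity.\<close>

definition param :: "mat4 \<times> mat4 \<Rightarrow> mat4 \<times> mat4" where
  "param e = conj_scale (mat 1 + fst (inf_inv e)) (1 + fst (snd (inf_inv e))) (1 + snd (snd (inf_inv e)))
     (X0 + proj e)"

definition param_dom :: "(mat4 \<times> mat4) set" where
  "param_dom = {e. invertible (mat 1 + fst (inf_inv e)) \<and> 1 + fst (snd (inf_inv e)) \<noteq> 0 \<and>
     1 + snd (snd (inf_inv e)) \<noteq> 0}"

lemma bl: "bounded_linear inf_inv" "bounded_linear proj" "bounded_linear inf_act"
  using inf_inv(2) linear_proj linear_inf_act by (simp_all add: linear_conv_bounded_linear)

lemmas bl_comp =
  bounded_linear_compose[OF bounded_linear_fst bl(1)]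
  bounded_linear_compose[OF bounded_linear_fst bounded_linear_compose[OF bounded_linear_snd bl(1)]]
  bounded_linear_compose[OF bounded_linear_snd bounded_linear_compose[OF bounded_linear_snd bl(1)]]
  bounded_linear_compose[OF bounded_linear_fst bl(2)]
  bounded_linear_compose[OF bounded_linear_snd bl(2)]

lemma open_param_dom: "open param_dom"
proof -
  have "param_dom = (\<lambda>e. mat 1 + fst (inf_inv e)) -` {A. invertible A} \<inter>
      (\<lambda>e. 1 + fst (snd (inf_inv e))) -` (- {0}) \<inter> (\<lambda>e. 1 + snd (snd (inf_inv e))) -` (- {0})"
    by (auto simp: param_dom_def)
  moreover have "open ((\<lambda>e. mat 1 + fst (inf_inv e)) -` {A. invertible A})"
    by (intro open_vimage open_invertible continuous_intros linear_continuous_on bl_comp)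
  moreover have "open ((\<lambda>e. 1 + fst (snd (inf_inv e))) -` (- {0}))"
    "open ((\<lambda>e. 1 + snd (snd (inf_inv e))) -` (- {0}))"
    by (intro open_vimage continuous_intros linear_continuous_on bl_comp; simp)+
  ultimately show ?thesis by auto
qed

lemma smooth_param: "smooth_on param_dom param"
  unfolding smooth_on_def
proof (intro conjI allI open_param_dom)
  fix k
  note S = open_param_dom
  have l: "Ck_on k param_dom h" if "bounded_linear h" for h :: "mat4 \<times> mat4 \<Rightarrow> 'b::real_normed_vector"
    using that S by (rule Ck_on_linear)
  have Y: "Ck_on k param_dom (\<lambda>e. mat 1 + fst (inf_inv e))"
    by (intro Ck_on_add Ck_on_const l bl_comp S)
  have I: "Ck_on k param_dom (\<lambda>e. matrix_inv (mat 1 + fst (inf_inv e)))"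
    by (rule Ck_on_compose[OF S Ck_on_matrix_inv Y]) (auto simp: param_dom_def)
  note mm = Ck_on_bilinear[OF bounded_bilinear_matrix_mult S] Ck_on_bilinear[OF bounded_bilinear_scaleR S]
  have "Ck_on k param_dom (\<lambda>e.
     ((1 + fst (snd (inf_inv e))) *\<^sub>R ((mat 1 + fst (inf_inv e)) ** (A0 + fst (proj e)) ** matrix_inv (mat 1 + fst (inf_inv e))),
      (1 + snd (snd (inf_inv e))) *\<^sub>R ((mat 1 + fst (inf_inv e)) ** (B0 + snd (proj e)) ** matrix_inv (mat 1 + fst (inf_inv e)))))"
    by (intro Ck_on_Pair mm Ck_on_add Ck_on_const l bl_comp S I)
  then show "Ck_on k param_dom param"
    by (simp add: param_def[abs_def] conj_scale_def X0_def)
qed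

lemma param_derivative: "(param has_derivative (\<lambda>v. v)) (at 0)"
proof -
  have *: "((\<lambda>e. (1 + \<alpha> e) *\<^sub>R ((mat 1 + Y e) ** (A + s e) ** matrix_inv (mat 1 + Y e)))
      has_derivative (\<lambda>v. Y v ** A - A ** Y v + \<alpha> v *\<^sub>R A + s v)) (at 0)"
    if "bounded_linear \<alpha>" "bounded_linear Y" "bounded_linear s"
    for \<alpha> :: "mat4 \<times> mat4 \<Rightarrow> real" and Y s :: "mat4 \<times> mat4 \<Rightarrow> mat4" and A
  proof -
    have 0: "\<alpha> 0 = 0" "Y 0 = 0" "s 0 = 0" using that by (auto dest: bounded_linear.linear linear_0)
    have d: "(\<alpha> has_derivative \<alpha>) (at 0)" "(Y has_derivative Y) (at 0)" "(s has_derivative s) (at 0)"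
      using that bounded_linear_imp_has_derivative by blast+
    have i: "(matrix_inv has_derivative (\<lambda>H. - H)) (at (mat 1 + Y 0))"
      using has_derivative_matrix_inv[OF invertible_mat_1[where 'n=4]] by (simp add: 0)
    have dY: "((\<lambda>e. mat 1 + Y e) has_derivative Y) (at 0)"
      using has_derivative_add[OF has_derivative_const d(2)] by simp
    have i': "((\<lambda>e. matrix_inv (mat 1 + Y e)) has_derivative (\<lambda>v. - Y v)) (at 0)"
      using has_derivative_compose[OF dY i] by simp
    have ds: "((\<lambda>e. A + s e) has_derivative s) (at 0)"
      using has_derivative_add[OF has_derivative_const d(3)] by simp
    have da: "((\<lambda>e. 1 + \<alpha> e) has_derivative \<alpha>) (at 0)"
      using has_derivative_add[OF has_derivative_const d(1)] by simp
    have "((\<lambda>e. (1 + \<alpha> e) *\<^sub>R ((mat 1 + Y e) ** (A + s e) ** matrix_inv (mat 1 + Y e)))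
      has_derivative (\<lambda>v. (1 + \<alpha> 0) *\<^sub>R ((mat 1 + Y 0) ** (A + s 0) ** (- Y v) +
         ((mat 1 + Y 0) ** s v + Y v ** (A + s 0)) ** matrix_inv (mat 1 + Y 0)) +
         \<alpha> v *\<^sub>R ((mat 1 + Y 0) ** (A + s 0) ** matrix_inv (mat 1 + Y 0)))) (at 0)"
      by (intro bounded_bilinear.FDERIV[OF bounded_bilinear_scaleR] da
          bounded_bilinear.FDERIV[OF bounded_bilinear_matrix_mult] dY ds i')
    then show ?thesis
      by (simp add: 0 matmul.minus_right algebra_simps)
  qed
  have "(param has_derivative (\<lambda>v.
      (fst (inf_inv v) ** A0 - A0 ** fst (inf_inv v) + fst (snd (inf_inv v)) *\<^sub>R A0 + fst (proj v),
       fst (inf_inv v) ** B0 - B0 ** fst (inf_inv v) + snd (snd (inf_inv v)) *\<^sub>R B0 + snd (proj v)))) (at 0)"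
    unfolding param_def[abs_def] conj_scale_def X0_def fst_add snd_add fst_conv snd_conv
    by (intro has_derivative_Pair * bl_comp)
  moreover have "(fst (inf_inv v) ** A0 - A0 ** fst (inf_inv v) + fst (snd (inf_inv v)) *\<^sub>R A0 + fst (proj v),
       fst (inf_inv v) ** B0 - B0 ** fst (inf_inv v) + snd (snd (inf_inv v)) *\<^sub>R B0 + snd (proj v)) = v" for v
    by (simp add: proj_def inf_act_def prod_eq_iff)
  ultimately show ?thesis by simp
qed

lemma zero_param_dom: "0 \<in> param_dom"
  by (simp add: param_dom_def)

lemma param_slice: "s \<in> slice \<Longrightarrow> param s = X0 + s"
  using proj_slice(2)[of s] by (simp add: param_def slice_def)

lemma sim_param: "e \<in> param_dom \<Longrightarrow> sim (param e) (X0 + proj e)"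
  unfolding param_def param_dom_def by (rule sim_sym) (auto simp: sim_iff)

text \<open>Nearby slice points can only be related by group elements near the identity, where
  \<open>param\<close> is injective. A violating sequence has conjugators that may be normalised to
  norm one; a limit of them satisfies the assumptions of \<open>rigid\<close> and is therefore a
  scalar, so that after dividing by scalars the conjugators do tend to the identity.\<close>

lemma slice_unique:
  assumes U: "open U" "0 \<in> U" "inj_on param U"
  shows "\<exists>\<epsilon>>0. \<forall>s\<in>slice. \<forall>t\<in>slice. norm s < \<epsilon> \<longrightarrow> norm t < \<epsilon> \<longrightarrow> X0 + s \<in> carrier GL4 \<times> carrier GL4 \<longrightarrow>
      sim (X0 + s) (X0 + t) \<longrightarrow> s = t"
proof (rule ccontr)
  assume "\<not> ?thesis"
  then have ex: "\<exists>s t h c d. s \<in> slice \<and> t \<in> slice \<and> norm s < e \<and> norm t < e \<and>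
      X0 + s \<in> carrier GL4 \<times> carrier GL4 \<and> invertible h \<and> c \<noteq> 0 \<and> d \<noteq> 0 \<and>
      X0 + t = conj_scale h c d (X0 + s) \<and> s \<noteq> t" if "e > 0" for e :: real
    using that unfolding sim_iff by meson
  have "\<exists>s t h c d. s \<in> slice \<and> t \<in> slice \<and> norm s < inverse (real (Suc n)) \<and> norm t < inverse (real (Suc n)) \<and>
      X0 + s \<in> carrier GL4 \<times> carrier GL4 \<and> invertible h \<and> c \<noteq> 0 \<and> d \<noteq> 0 \<and>
      X0 + t = conj_scale h c d (X0 + s) \<and> s \<noteq> t" for n
    by (rule ex) simp
  then obtain s t h c d where
    s: "\<And>n. s n \<in> slice" "\<And>n. norm (s n) < inverse (real (Suc n))"
      "\<And>n. X0 + s n \<in> carrier GL4 \<times> carrier GL4"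
    and t: "\<And>n. t n \<in> slice" "\<And>n. norm (t n) < inverse (real (Suc n))"
    and h: "\<And>n. invertible (h n)" and cd: "\<And>n. c n \<noteq> (0::real)" "\<And>n. d n \<noteq> (0::real)"
    and eq: "\<And>n. X0 + t n = conj_scale (h n) (c n) (d n) (X0 + s n)" and ne: "\<And>n. s n \<noteq> t n"
    by metis
  have lim0: "s \<longlonglongrightarrow> 0" "t \<longlonglongrightarrow> 0"
    by (rule Lim_null_comparison[OF always_eventually LIMSEQ_inverse_real_of_nat], rule allI,
        rule less_imp_le, rule s(2) t(2))+
  have h0: "h n \<noteq> 0" for n using h[of n] by (auto simp: invertible_def)
  define g where "g n = inverse (norm (h n)) *\<^sub>R h n" for n
  have g: "norm (g n) = 1" "invertible (g n)" for n
    using h0[of n] h[of n] by (auto simp: g_def matrix_inv_scaleR)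
  have eqg: "X0 + t n = conj_scale (g n) (c n) (d n) (X0 + s n)" for n
    using eq[of n] h[of n] h0[of n] by (simp add: g_def conj_scale_scaleR)
  have eqA: "A0 + fst (t n) = c n *\<^sub>R (g n ** (A0 + fst (s n)) ** matrix_inv (g n))" for n
    using arg_cong[OF eqg[of n], of fst] by (simp add: conj_scale_def X0_def)
  have eqB: "B0 + snd (t n) = d n *\<^sub>R (g n ** (B0 + snd (s n)) ** matrix_inv (g n))" for n
    using arg_cong[OF eqg[of n], of snd] by (simp add: conj_scale_def X0_def)
  \<comment> \<open>Conjugation preserves the determinant and rescaling by \<open>c n\<close>
    multiplies it by the fourth power of \<open>c n\<close>, while both matrices tend to the same
    invertible one; so the absolute values of the rescalings tend to 1.\<close>
  have det_lim: "(\<lambda>n. \<bar>c n\<bar>) \<longlonglongrightarrow> 1"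
    if A: "invertible A" and p: "p \<longlonglongrightarrow> 0" "q \<longlonglongrightarrow> 0" and i: "\<And>n. invertible (A + p n)"
      and e: "\<And>n. A + q n = c n *\<^sub>R (g n ** (A + p n) ** matrix_inv (g n))" for A p q and c :: "nat \<Rightarrow> real"
  proof -
    have cd: "continuous_on UNIV (det :: mat4 \<Rightarrow> real)" unfolding det_def by (intro continuous_intros)
    have d: "(\<lambda>n. det (A + r n)) \<longlonglongrightarrow> det A" if "r \<longlonglongrightarrow> 0" for r
    proof -
      have "(\<lambda>n. A + r n) \<longlonglongrightarrow> A + 0" using that by (intro tendsto_intros)
      then show ?thesis using continuous_on_tendsto_compose[OF cd] by simp
    qed
    have c4: "c n ^ 4 = det (A + q n) / det (A + p n)" for n
      using i[of n] g(2)[of n] by (simp add: e det_scaleR4 det_conj invertible_det_nz)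
    have "(\<lambda>n. c n ^ 4) \<longlonglongrightarrow> det A / det A"
      unfolding c4 using A p d by (intro tendsto_divide) (auto simp: invertible_det_nz)
    then have "(\<lambda>n. sqrt (sqrt (c n ^ 4))) \<longlonglongrightarrow> sqrt (sqrt 1)"
      using A by (intro tendsto_real_sqrt) (simp add: invertible_det_nz)
    moreover have "sqrt (sqrt (x ^ 4)) = \<bar>x\<bar>" for x :: real
    proof -
      have "sqrt (x ^ 4) = x\<^sup>2"
        by (rule real_sqrt_unique) (auto simp: power2_eq_square power4_eq_xxxx)
      then show ?thesis by simp
    qed
    ultimately show ?thesis by simp
  qed
  have abs1: "(\<lambda>n. \<bar>c n\<bar>) \<longlonglongrightarrow> 1" "(\<lambda>n. \<bar>d n\<bar>) \<longlonglongrightarrow> 1"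
    using s(3) eqA eqB tendsto_fst[OF lim0(1)] tendsto_fst[OF lim0(2)] tendsto_snd[OF lim0(1)]
      tendsto_snd[OF lim0(2)] inv0
    by (intro det_lim[of A0 "\<lambda>n. fst (s n)" "\<lambda>n. fst (t n)" c] det_lim[of B0 "\<lambda>n. snd (s n)" "\<lambda>n. snd (t n)" d];
        simp add: X0_def mem_Times_iff)+
  have bc: "bounded (range c)" "bounded (range d)"
    using convergent_imp_bounded[OF abs1(1)] convergent_imp_bounded[OF abs1(2)]
    by (auto simp: bounded_iff)
  have "bounded (range g)" using g(1) by (auto simp: bounded_iff intro!: exI[of _ 1])
  then have "bounded (range g \<times> range c \<times> range d)" using bc by (intro bounded_Times)
  then have "bounded (range (\<lambda>n. (g n, c n, d n)))" by (rule bounded_subset) auto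
  then obtain l r where r: "strict_mono (r :: nat \<Rightarrow> nat)" and l: "((\<lambda>n. (g n, c n, d n)) \<circ> r) \<longlonglongrightarrow> l"
    using bounded_imp_convergent_subsequence by blast
  define g0 c0 d0 where "g0 = fst l" "c0 = fst (snd l)" "d0 = snd (snd l)"
  have lim: "(\<lambda>n. g (r n)) \<longlonglongrightarrow> g0" "(\<lambda>n. c (r n)) \<longlonglongrightarrow> c0" "(\<lambda>n. d (r n)) \<longlonglongrightarrow> d0"
    using tendsto_fst[OF l] tendsto_fst[OF tendsto_snd[OF l]] tendsto_snd[OF tendsto_snd[OF l]]
    by (simp_all add: g0_c0_d0_def o_def)
  have limst: "(\<lambda>n. s (r n)) \<longlonglongrightarrow> 0" "(\<lambda>n. t (r n)) \<longlonglongrightarrow> 0"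
    using LIMSEQ_subseq_LIMSEQ[OF lim0(1) r] LIMSEQ_subseq_LIMSEQ[OF lim0(2) r] by (simp_all add: o_def)
  have c0: "\<bar>c0\<bar> = 1" and d0: "\<bar>d0\<bar> = 1"
    using LIMSEQ_unique[OF tendsto_rabs[OF lim(2)]] LIMSEQ_unique[OF tendsto_rabs[OF lim(3)]]
      LIMSEQ_subseq_LIMSEQ[OF abs1(1) r] LIMSEQ_subseq_LIMSEQ[OF abs1(2) r] by (auto simp: o_def)
  have g0: "norm g0 = 1" using LIMSEQ_unique[OF tendsto_norm[OF lim(1)]] g(1) by auto
  \<comment> \<open>A limit of matrices of norm one might be singular, so the inverse of
    \<open>g (r n)\<close> is cleared before passing to the limit.\<close>
  have comm: "c0 *\<^sub>R (g0 ** A) = A ** g0"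
    if p: "p \<longlonglongrightarrow> 0" "q \<longlonglongrightarrow> 0" and c: "(\<lambda>n. c n) \<longlonglongrightarrow> c0"
      and e: "\<And>n. A + q n = c n *\<^sub>R (g (r n) ** (A + p n) ** matrix_inv (g (r n)))"
    for A p q c and c0 :: real
  proof -
    have "c n *\<^sub>R (g (r n) ** (A + p n)) = (A + q n) ** g (r n)" for n
      using g(2)[of "r n"] by (simp add: e matmul.scaleR_left)
    moreover have "(\<lambda>n. c n *\<^sub>R (g (r n) ** (A + p n))) \<longlonglongrightarrow> c0 *\<^sub>R (g0 ** (A + 0))"
      by (intro tendsto_intros matmul.tendsto lim p c)
    moreover have "(\<lambda>n. (A + q n) ** g (r n)) \<longlonglongrightarrow> (A + 0) ** g0"
      by (intro tendsto_intros matmul.tendsto lim p)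
    ultimately show ?thesis using LIMSEQ_unique by auto
  qed
  have cc: "c0 * c0 = 1" "d0 * d0 = 1" using c0 d0 by (metis abs_mult_self_eq mult_1)+
  have limp: "(\<lambda>n. fst (s (r n))) \<longlonglongrightarrow> 0" "(\<lambda>n. fst (t (r n))) \<longlonglongrightarrow> 0"
      "(\<lambda>n. snd (s (r n))) \<longlonglongrightarrow> 0" "(\<lambda>n. snd (t (r n))) \<longlonglongrightarrow> 0"
    using tendsto_fst[OF limst(1)] tendsto_fst[OF limst(2)] tendsto_snd[OF limst(1)] tendsto_snd[OF limst(2)]
    by simp_all
  have "c0 *\<^sub>R (g0 ** A0) = A0 ** g0"
    by (rule comm[OF limp(1,2) lim(2)]) (rule eqA)
  then have rA: "g0 ** A0 = c0 *\<^sub>R (A0 ** g0)" using cc(1) by (metis scaleR_one scaleR_scaleR)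
  have "d0 *\<^sub>R (g0 ** B0) = B0 ** g0"
    by (rule comm[OF limp(3,4) lim(3)]) (rule eqB)
  then have rB: "g0 ** B0 = d0 *\<^sub>R (B0 ** g0)" using cc(2) by (metis scaleR_one scaleR_scaleR)
  obtain k where k: "c0 = 1" "d0 = 1" "g0 = k *\<^sub>R mat 1" "k \<noteq> 0"
  proof -
    have nz: "g0 \<noteq> 0" using g0 by auto
    then have "c0 = 1 \<and> d0 = 1 \<and> (\<exists>r. g0 = r *\<^sub>R mat 1)" using rigid[OF _ c0 d0 rA rB] by blast
    with nz show ?thesis using that by auto
  qed
  \<comment> \<open>The limit of the conjugators is \<open>k\<close> times the identity. Dividing by
    a quarter of the trace moves it to the identity and at the same time makes the difference from
    \<open>mat 1\<close> traceless, as \<open>inf_dom\<close> requires.\<close>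
  define \<tau> where "\<tau> n = trace (g (r n)) / 4" for n
  have \<tau>: "\<tau> \<longlonglongrightarrow> k"
    using tendsto_divide[OF bounded_linear.tendsto[OF bounded_linear_trace lim(1)] tendsto_const, of 4] k
    by (simp add: \<tau>_def[abs_def])
  define z where "z n = (inverse (\<tau> n) *\<^sub>R g (r n) - mat 1, c (r n) - 1, d (r n) - 1)" for n
  have "z \<longlonglongrightarrow> (inverse k *\<^sub>R g0 - mat 1, c0 - 1, d0 - 1)"
    unfolding z_def by (intro tendsto_intros \<tau> lim k)
  then have z0: "z \<longlonglongrightarrow> 0" using k by (simp add: zero_prod_def)
  \<comment> \<open>\<open>e n\<close> is the parameter whose conjugating part is \<open>z n\<close>
    and whose slice part is \<open>s (r n)\<close>; eventually \<open>param (e n)\<close> is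
    \<open>X0 + t (r n)\<close>, which is also the value of \<open>param\<close> at
    \<open>t (r n)\<close>.\<close>
  define e where "e n = inf_act (z n) + s (r n)" for n
  have "e \<longlonglongrightarrow> inf_act 0 + 0"
    unfolding e_def by (intro tendsto_intros limst bounded_linear.tendsto[OF bl(3)] z0)
  then have e0: "e \<longlonglongrightarrow> 0" by simp
  have "\<forall>\<^sub>F n in sequentially. e n \<in> U" using e0 U(1,2) by (rule topological_tendstoD)
  moreover have "\<forall>\<^sub>F n in sequentially. t (r n) \<in> U" using limst(2) U(1,2) by (rule topological_tendstoD)
  moreover have "\<forall>\<^sub>F n in sequentially. \<tau> n \<noteq> 0" using \<tau> k(4) by (rule tendsto_imp_eventually_ne)
  ultimately have "\<forall>\<^sub>F n in sequentially. False"
  proof eventually_elim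
    case (elim n)
    have zd: "z n \<in> inf_dom" using elim(3) by (simp add: z_def inf_dom_def \<tau>_def)
    have gi: "inf_inv (e n) = z n"
      using s(1)[of "r n"] by (simp add: e_def linear_add inf_inv zd slice_def)
    have pe: "proj (e n) = s (r n)" by (simp only: proj_def gi) (simp add: e_def)
    have "param (e n) = conj_scale (inverse (\<tau> n) *\<^sub>R g (r n)) (c (r n)) (d (r n)) (X0 + s (r n))"
      by (simp only: param_def gi pe) (simp add: z_def)
    also have "\<dots> = X0 + t (r n)" using g(2) elim(3) by (simp add: conj_scale_scaleR eqg)
    also have "\<dots> = param (t (r n))" using t(1) by (simp add: param_slice)
    finally have et: "e n = t (r n)" using U(3) elim by (auto dest: inj_onD)
    then have "z n = 0" using gi t(1)[of "r n"] by (simp add: slice_def)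
    then show False using et ne[of "r n"] by (simp add: e_def)
  qed
  then show False by simp
qed

lemma X0_GL2: "X0 \<in> carrier GL4 \<times> carrier GL4"
  using inv0 by (simp add: X0_def)

text \<open>\<open>\<Phi>\<close> sends a pair to the unique small slice element whose translate by
  \<open>X0\<close> is similar to it, so it is constant on orbits by construction. Near a given pair
  it is \<open>proj\<close> after the local inverse \<open>\<psi>\<close> of \<open>param\<close>
  after one fixed conjugation and rescaling that moves the pair into the slice; this formula gives
  smoothness and the rank everywhere on the saturated set \<open>W\<close>.\<close>

lemma slice_chart:
  obtains W \<Phi> where "open W" "W \<subseteq> carrier GL4 \<times> carrier GL4" "X0 \<in> W" "\<Phi> X0 = 0"
    "\<And>X Y. X \<in> W \<Longrightarrow> sim X Y \<Longrightarrow> Y \<in> W \<and> \<Phi> Y = \<Phi> X"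
    "\<And>X Y. X \<in> W \<Longrightarrow> Y \<in> W \<Longrightarrow> \<Phi> X = \<Phi> Y \<Longrightarrow> sim X Y"
    "smooth_on W \<Phi>" "\<And>X. X \<in> W \<Longrightarrow> range (frechet_derivative \<Phi> (at X)) = slice"
    "openin (top_of_set slice) (\<Phi> ` W)" "\<And>s. s \<in> \<Phi> ` W \<Longrightarrow> X0 + s \<in> W \<and> \<Phi> (X0 + s) = s"
    "frechet_derivative \<Phi> (at X0) = proj"
proof -
  have "frechet_derivative param (at 0) = (\<lambda>v. v)"
    using frechet_derivative_at[OF param_derivative] by simp
  then have "inj (frechet_derivative param (at 0))" by simp
  then obtain U V \<psi> where U: "open U" "U \<subseteq> param_dom" "0 \<in> U" "open V" "homeomorphism U V param \<psi>"
    and \<psi>: "smooth_on V \<psi>" and bij: "\<And>y. y \<in> V \<Longrightarrow> bij (frechet_derivative \<psi> (at y))"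
    using smooth_inverse_function[OF smooth_param zero_param_dom] by metis
  have hU: "\<psi> (param e) = e" "param e \<in> V" if "e \<in> U" for e using U(5) that by (auto simp: homeomorphism_def)
  have hV: "param (\<psi> y) = y" "\<psi> y \<in> U" if "y \<in> V" for y using U(5) that by (auto simp: homeomorphism_def)
  have "inj_on param U" using hU(1) by (metis inj_onI)
  then obtain \<epsilon>1 where \<epsilon>1: "\<epsilon>1 > 0" "\<And>s t. s \<in> slice \<Longrightarrow> t \<in> slice \<Longrightarrow> norm s < \<epsilon>1 \<Longrightarrow> norm t < \<epsilon>1 \<Longrightarrow>
      X0 + s \<in> carrier GL4 \<times> carrier GL4 \<Longrightarrow> sim (X0 + s) (X0 + t) \<Longrightarrow> s = t"
    using slice_unique[OF U(1,3)] by meson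
  obtain \<epsilon>2 where \<epsilon>2: "\<epsilon>2 > 0" "ball 0 \<epsilon>2 \<subseteq> U" using U(1,3) openE by blast
  have GLo: "open (carrier GL4 \<times> carrier GL4 :: (mat4 \<times> mat4) set)"
    using open_invertible by (auto intro: open_Times)
  obtain \<epsilon>3 where \<epsilon>3: "\<epsilon>3 > 0" "ball X0 \<epsilon>3 \<subseteq> carrier GL4 \<times> carrier GL4"
    using openE[OF GLo X0_GL2] .
  \<comment> \<open>The three bounds ensure uniqueness of the slice point, containment in the domain
    \<open>U\<close> on which \<open>param\<close> is invertible, and invertibility of both
    matrices.\<close>
  define \<epsilon> where "\<epsilon> = min \<epsilon>1 (min \<epsilon>2 \<epsilon>3)"
  have \<epsilon>: "\<epsilon> > 0" using \<epsilon>1 \<epsilon>2 \<epsilon>3 by (simp add: \<epsilon>_def)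
  have sU: "s \<in> U" if "norm s < \<epsilon>" for s
    using that by (intro subsetD[OF \<epsilon>2(2)]) (simp add: \<epsilon>_def)
  have sGL: "X0 + s \<in> carrier GL4 \<times> carrier GL4" if "norm s < \<epsilon>" for s
    using \<epsilon>3 that by (intro subsetD[OF \<epsilon>3(2)]) (auto simp: \<epsilon>_def dist_norm)
  define W where "W = {X \<in> carrier GL4 \<times> carrier GL4. \<exists>s\<in>slice. norm s < \<epsilon> \<and> sim X (X0 + s)}"
  define \<Phi> where "\<Phi> X = (THE s. s \<in> slice \<and> norm s < \<epsilon> \<and> sim X (X0 + s))" for X
  have \<Phi>I: "\<Phi> X = s" if "s \<in> slice" "norm s < \<epsilon>" "sim X (X0 + s)" for X s
    unfolding \<Phi>_def
  proof (rule the_equality)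
    fix t assume t: "t \<in> slice \<and> norm t < \<epsilon> \<and> sim X (X0 + t)"
    then have "sim (X0 + t) (X0 + s)" using that sim_sym sim_trans by blast
    then show "t = s" using t that \<epsilon>1(2)[of t s] sGL[of t] by (simp add: \<epsilon>_def)
  qed (use that in auto)
  have WI: "X \<in> W" if "s \<in> slice" "norm s < \<epsilon>" "sim X (X0 + s)" for X s
    unfolding W_def using that sim_GL2[OF sim_sym[OF that(3)] sGL[OF that(2)]] by blast
  have WE: "\<exists>s. s \<in> slice \<and> norm s < \<epsilon> \<and> sim X (X0 + s) \<and> \<Phi> X = s" if "X \<in> W" for X
    using that \<Phi>I unfolding W_def by blast
  have im: "\<Phi> ` W = slice \<inter> ball 0 \<epsilon>"
  proof (intro equalityI subsetI)
    fix s assume "s \<in> slice \<inter> ball 0 \<epsilon>"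
    then have "s \<in> slice" "norm s < \<epsilon>" by auto
    then show "s \<in> \<Phi> ` W" using WI[OF _ _ sim_refl] \<Phi>I[OF _ _ sim_refl] by (metis image_eqI)
  qed (use WE in force)
  have loc: "\<exists>N. open N \<and> X \<in> N \<and> N \<subseteq> W \<and> (\<forall>Y\<in>N. \<Phi> Y = proj (\<psi> (conj_scale h c d Y)) \<and> conj_scale h c d Y \<in> V)"
    if X: "X \<in> carrier GL4 \<times> carrier GL4" and s: "s \<in> slice" "norm s < \<epsilon>" "X0 + s = conj_scale h c d X"
      and hcd: "invertible h" "c \<noteq> 0" "d \<noteq> 0" for X s h c d
  proof -
    let ?L = "conj_scale h c d"
    define N0 where "N0 = (carrier GL4 \<times> carrier GL4) \<inter> ?L -` V"
    define N where "N = N0 \<inter> (\<lambda>Y. proj (\<psi> (?L Y))) -` ball 0 \<epsilon>"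
    have N0: "open N0" unfolding N0_def
      by (intro open_Int GLo open_vimage U linear_continuous_on bounded_linear_conj_scale)
    have "continuous_on N0 (\<lambda>Y. proj (\<psi> (?L Y)))"
    proof (rule continuous_on_compose2[OF linear_continuous_on[OF bl(2), of UNIV]])
      show "continuous_on N0 (\<lambda>Y. \<psi> (?L Y))"
        by (rule continuous_on_compose2[of V \<psi>])
          (use U(5) in \<open>auto simp: homeomorphism_def N0_def intro: linear_continuous_on bounded_linear_conj_scale\<close>)
    qed auto
    then have "open N" unfolding N_def using N0 by (simp add: continuous_on_open_vimage Int_commute)
    moreover have "X \<in> N"
    proof -
      have "?L X = param s" using s by (simp add: param_slice)
      moreover have "s \<in> U" using s sU by blast
      ultimately show ?thesis using X hU s by (simp add: N_def N0_def proj_slice)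
    qed
    moreover have "Y \<in> W \<and> \<Phi> Y = proj (\<psi> (?L Y)) \<and> ?L Y \<in> V" if "Y \<in> N" for Y
    proof -
      have Y: "?L Y \<in> V" "norm (proj (\<psi> (?L Y))) < \<epsilon>" using that by (auto simp: N_def N0_def)
      have "sim Y (?L Y)" using hcd by (auto simp: sim_iff)
      moreover have "sim (?L Y) (X0 + proj (\<psi> (?L Y)))"
        using sim_param[of "\<psi> (?L Y)"] hV[OF Y(1)] U(2) by auto
      ultimately have "sim Y (X0 + proj (\<psi> (?L Y)))" by (rule sim_trans)
      then show ?thesis using Y WI \<Phi>I proj_slice(1) by blast
    qed
    ultimately show ?thesis by blast
  qed
  have sm: "Ck_on k N \<Phi>" and der: "X \<in> N \<Longrightarrow> (\<Phi> has_derivative (\<lambda>v. proj (frechet_derivative \<psi> (at (conj_scale h c d X)) (conj_scale h c d v)))) (at X)"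
    if N: "open N" "\<And>Y. Y \<in> N \<Longrightarrow> \<Phi> Y = proj (\<psi> (conj_scale h c d Y)) \<and> conj_scale h c d Y \<in> V" for N h c d k X
  proof -
    have psik: "Ck_on k V \<psi>" for k using \<psi> by (simp add: smooth_on_def)
    have "Ck_on k N (\<lambda>Y. \<psi> (conj_scale h c d Y))"
      by (rule Ck_on_compose[OF N(1) psik Ck_on_linear[OF bounded_linear_conj_scale N(1)]]) (use N in auto)
    then have "Ck_on k N (\<lambda>Y. proj (\<psi> (conj_scale h c d Y)))"
      by (rule Ck_on_bounded_linear[OF bl(2) N(1)])
    then show "Ck_on k N \<Phi>" by (rule Ck_on_cong[OF N(1), rotated]) (use N in auto)
    assume X: "X \<in> N"
    have "(\<psi> has_derivative frechet_derivative \<psi> (at (conj_scale h c d X))) (at (conj_scale h c d X))"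
      using Ck_on_SucD(1)[OF psik] N(2)[OF X] by blast
    then have "((\<lambda>Y. proj (\<psi> (conj_scale h c d Y))) has_derivative
        (\<lambda>v. proj (frechet_derivative \<psi> (at (conj_scale h c d X)) (conj_scale h c d v)))) (at X)"
      by (intro bounded_linear.has_derivative[OF bl(2)])
        (rule has_derivative_compose[OF bounded_linear_imp_has_derivative[OF bounded_linear_conj_scale]])
    then show "(\<Phi> has_derivative (\<lambda>v. proj (frechet_derivative \<psi> (at (conj_scale h c d X)) (conj_scale h c d v)))) (at X)"
      by (rule has_derivative_transform_within_open[OF _ N(1) X]) (use N in auto)
  qed
  define good where "good X N h c d \<longleftrightarrow> open N \<and> X \<in> N \<and> N \<subseteq> W \<and> invertible h \<and> c \<noteq> 0 \<and> d \<noteq> 0 \<and>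
      (\<forall>Y\<in>N. \<Phi> Y = proj (\<psi> (conj_scale h c d Y)) \<and> conj_scale h c d Y \<in> V)" for X N h c d
  have locW: "\<exists>N h c d. good X N h c d" if XW: "X \<in> W" for X
  proof -
    obtain s where s: "s \<in> slice" "norm s < \<epsilon>" "sim X (X0 + s)" using WE[OF XW] by blast
    have X: "X \<in> carrier GL4 \<times> carrier GL4" using XW by (simp add: W_def)
    obtain h c d where hcd: "invertible h" "c \<noteq> 0" "d \<noteq> 0" "X0 + s = conj_scale h c d X"
      using s(3) unfolding sim_iff by blast
    obtain N where "open N \<and> X \<in> N \<and> N \<subseteq> W \<and>
        (\<forall>Y\<in>N. \<Phi> Y = proj (\<psi> (conj_scale h c d Y)) \<and> conj_scale h c d Y \<in> V)"
      using loc[OF X s(1,2) hcd(4,1-3)] ..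
    then have "good X N h c d" using hcd(1-3) by (simp add: good_def)
    then show ?thesis by blast
  qed
  have oW: "open W"
  proof (subst open_subopen, intro ballI)
    fix X assume "X \<in> W"
    then obtain N h c d where "good X N h c d" using locW by blast
    then show "\<exists>T. open T \<and> X \<in> T \<and> T \<subseteq> W" unfolding good_def by blast
  qed
  have X0W: "X0 \<in> W" "\<Phi> X0 = 0"
    using WI[of 0 X0] \<Phi>I[of 0 X0] sim_refl \<epsilon> subspace_slice by (auto simp: subspace_0)
  show thesis
  proof (rule that[of W \<Phi>])
    show "open W" "X0 \<in> W" "\<Phi> X0 = 0" by fact+
    show "W \<subseteq> carrier GL4 \<times> carrier GL4" unfolding W_def by blast
    show "Y \<in> W \<and> \<Phi> Y = \<Phi> X" if XY: "X \<in> W" "sim X Y" for X Y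
    proof -
      obtain s where s: "s \<in> slice" "norm s < \<epsilon>" "sim X (X0 + s)" "\<Phi> X = s" using WE[OF XY(1)] by blast
      have "sim Y (X0 + s)" using s(3) XY(2) sim_sym sim_trans by blast
      then show ?thesis using s WI \<Phi>I by blast
    qed
    show "sim X Y" if XY: "X \<in> W" "Y \<in> W" "\<Phi> X = \<Phi> Y" for X Y
    proof -
      have "sim X (X0 + \<Phi> X)" "sim Y (X0 + \<Phi> X)" using WE[OF XY(1)] WE[OF XY(2)] XY(3) by auto
      then show ?thesis using sim_sym sim_trans by blast
    qed
    have "Ck_on k W \<Phi>" for k
    proof (rule Ck_on_local)
      fix X assume "X \<in> W"
      then obtain N h c d where "good X N h c d" using locW by blast
      then have N: "open N" "X \<in> N"
        "\<And>Y. Y \<in> N \<Longrightarrow> \<Phi> Y = proj (\<psi> (conj_scale h c d Y)) \<and> conj_scale h c d Y \<in> V"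
        unfolding good_def by blast+
      have "Ck_on k N \<Phi>" by (rule sm[OF N(1,3)])
      with N show "\<exists>N. open N \<and> X \<in> N \<and> Ck_on k N \<Phi>" by blast
    qed
    then show "smooth_on W \<Phi>" using oW by (simp add: smooth_on_def)
    show "range (frechet_derivative \<Phi> (at X)) = slice" if X: "X \<in> W" for X
    proof -
      obtain N h c d where "good X N h c d" using locW[OF X] by blast
      then have N: "open N" "X \<in> N" "invertible h" "c \<noteq> 0" "d \<noteq> 0"
        "\<And>Y. Y \<in> N \<Longrightarrow> \<Phi> Y = proj (\<psi> (conj_scale h c d Y)) \<and> conj_scale h c d Y \<in> V"
        unfolding good_def by blast+
      let ?D = "frechet_derivative \<psi> (at (conj_scale h c d X))"
      have "surj (conj_scale h c d)" using conj_scale_inverse(2)[OF N(3-5)] by (metis surjI)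
      moreover have "surj ?D" using bij N(2,6) bij_is_surj by blast
      moreover have "range (\<lambda>v. proj (?D (conj_scale h c d v))) = proj ` ?D ` range (conj_scale h c d)"
        by (simp add: image_image)
      ultimately have "range (\<lambda>v. proj (?D (conj_scale h c d v))) = range proj" by simp
      then show ?thesis
        using frechet_derivative_at[OF der[OF N(1,6,2)], symmetric] range_proj by simp
    qed
    show "openin (top_of_set slice) (\<Phi> ` W)" unfolding im by (simp add: openin_open_Int)
    show "X0 + s \<in> W \<and> \<Phi> (X0 + s) = s" if "s \<in> \<Phi> ` W" for s
      using that WI[OF _ _ sim_refl] \<Phi>I[OF _ _ sim_refl] unfolding im by auto
    show "frechet_derivative \<Phi> (at X0) = proj"
    proof -
      have "X0 = conj_scale (mat 1) 1 1 X0" by simp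
      then obtain N where N: "open N" "X0 \<in> N"
        "\<And>Y. Y \<in> N \<Longrightarrow> \<Phi> Y = proj (\<psi> (conj_scale (mat 1) 1 1 Y)) \<and> conj_scale (mat 1) 1 1 Y \<in> V"
        using loc[OF X0_GL2, of 0 "mat 1" 1 1] \<epsilon> subspace_slice by (auto simp: subspace_0)
      have X0V: "X0 \<in> V" using N(2,3) by fastforce
      have p0: "\<psi> X0 = 0" using hU(1)[OF U(3)] param_slice[of 0] subspace_slice by (simp add: subspace_0)
      have d: "(\<psi> has_derivative frechet_derivative \<psi> (at X0)) (at X0)"
        using Ck_on_SucD(1)[of 0 V \<psi>] \<psi> X0V unfolding smooth_on_def by blast
      have "((\<lambda>y. param (\<psi> y)) has_derivative (\<lambda>v. frechet_derivative \<psi> (at X0) v)) (at X0)"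
        using has_derivative_compose[OF d, of param "\<lambda>v. v"] param_derivative p0 by simp
      then have "((\<lambda>y. y) has_derivative (\<lambda>v. frechet_derivative \<psi> (at X0) v)) (at X0)"
        by (rule has_derivative_transform_within_open[OF _ U(4) X0V]) (use hV in auto)
      then have "frechet_derivative \<psi> (at X0) = (\<lambda>v. v)"
        using has_derivative_unique[OF _ has_derivative_ident] by auto
      then show ?thesis
        using frechet_derivative_at[OF der[OF N(1,3,2)], symmetric] by simp
    qed
  qed
qed

lemma proj_eq_0: "proj e = 0 \<Longrightarrow> \<exists>z\<in>inf_dom. e = inf_act z"
  using inf_inv(1)[of e] by (auto simp: proj_def)

end

section \<open>Lorentz geometry\<close>

lemma lorentz_commute: "lorentz u v = lorentz v u"
  by (simp add: lorentz_def algebra_simps)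

lemma lorentz_lin [simp]:
  "lorentz (u + v) w = lorentz u w + lorentz v w" "lorentz w (u + v) = lorentz w u + lorentz w v"
  "lorentz (u - v) w = lorentz u w - lorentz v w" "lorentz w (u - v) = lorentz w u - lorentz w v"
  "lorentz (c *\<^sub>R u) w = c * lorentz u w" "lorentz w (c *\<^sub>R u) = c * lorentz w u"
  "lorentz (- u) w = - lorentz u w" "lorentz w (- u) = - lorentz w u"
  "lorentz 0 w = 0" "lorentz w 0 = 0"
  by (simp_all add: lorentz_def algebra_simps)

lemma lorentz_sum: "finite S \<Longrightarrow> lorentz (\<Sum>v\<in>S. f v) w = (\<Sum>v\<in>S. lorentz (f v) w)"
  by (induction S rule: finite_induct) auto

lemma vec4_eq_0_iff: "(u :: real^4) = 0 \<longleftrightarrow> u$1 = 0 \<and> u$2 = 0 \<and> u$3 = 0 \<and> u$4 = 0"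
  by (simp add: vec_eq_iff forall_4)

lemma lorentz_nondegenerate: "(\<And>v. lorentz u v = 0) \<Longrightarrow> u = 0"
proof -
  assume *: "\<And>v. lorentz u v = 0"
  show "u = 0"
    using *[of "axis 1 1"] *[of "axis 2 1"] *[of "axis 3 1"] *[of "axis 4 1"]
    by (simp add: vec4_eq_0_iff lorentz_def axis_def)
qed

text \<open>The vector \<open>t$4 *\<^sub>R u - u$4 *\<^sub>R t\<close> has vanishing fourth
  coordinate, so the form on it is the sum of squares on the right, while bilinearity expands it to
  the left side. This plays the part of the reversed Cauchy-Schwarz inequality.\<close>

lemma lorentz_lagrange:
  "(t$4)\<^sup>2 * lorentz u u + (u$4)\<^sup>2 * lorentz t t - 2 * t$4 * u$4 * lorentz t u =
     (t$4 * u$1 - u$4 * t$1)\<^sup>2 + (t$4 * u$2 - u$4 * t$2)\<^sup>2 + (t$4 * u$3 - u$4 * t$3)\<^sup>2"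
  unfolding lorentz_def power2_eq_square by algebra

lemma lorentz_diag: "lorentz u u = (u$1)\<^sup>2 + (u$2)\<^sup>2 + (u$3)\<^sup>2 - (u$4)\<^sup>2"
  by (simp add: lorentz_def power2_eq_square)

lemma timelike_orth:
  assumes t: "lorentz t t < 0" and o: "lorentz t u = 0" and u: "u \<noteq> 0"
  shows "lorentz u u > 0"
proof (cases "u$4 = 0")
  case True
  then have "u$1 \<noteq> 0 \<or> u$2 \<noteq> 0 \<or> u$3 \<noteq> 0" using u by (auto simp: vec4_eq_0_iff)
  then have "0 < (u$1)\<^sup>2 + (u$2)\<^sup>2 + (u$3)\<^sup>2"
    by (auto simp: add_pos_nonneg add_nonneg_pos)
  with True show ?thesis by (simp add: lorentz_diag)
next
  case False
  have "0 \<le> (t$4)\<^sup>2 * lorentz u u + (u$4)\<^sup>2 * lorentz t t"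
    using lorentz_lagrange[of t u] o by simp
  moreover have "(u$4)\<^sup>2 * lorentz t t < 0" using False t by (simp add: mult_pos_neg)
  ultimately have "(t$4)\<^sup>2 * lorentz u u > 0" by linarith
  then show ?thesis by (metis less_eq_real_def mult_nonneg_nonpos not_less zero_le_power2)
qed

lemma null_nonzero4: "lorentz n n = 0 \<Longrightarrow> n \<noteq> 0 \<Longrightarrow> n$4 \<noteq> 0"
  using sum_power2_eq_zero_iff by (auto simp: lorentz_diag vec4_eq_0_iff add_nonneg_eq_0_iff)

lemma null_orth:
  assumes n: "lorentz n n = 0" "n \<noteq> 0" and o: "lorentz n u = 0"
  shows "lorentz u u \<ge> 0" "lorentz u u = 0 \<Longrightarrow> \<exists>k. u = k *\<^sub>R n"
proof -
  have n4: "n$4 \<noteq> 0" using null_nonzero4[OF n] .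
  have e: "(n$4)\<^sup>2 * lorentz u u =
     (n$4 * u$1 - u$4 * n$1)\<^sup>2 + (n$4 * u$2 - u$4 * n$2)\<^sup>2 + (n$4 * u$3 - u$4 * n$3)\<^sup>2"
    using lorentz_lagrange[of n u] n o by simp
  then have "(n$4)\<^sup>2 * lorentz u u \<ge> 0" by simp
  then show "lorentz u u \<ge> 0" using n4 by (simp add: zero_le_mult_iff)
  assume "lorentz u u = 0"
  with e have "n$4 * u$1 = u$4 * n$1" "n$4 * u$2 = u$4 * n$2" "n$4 * u$3 = u$4 * n$3"
    by (auto simp: add_nonneg_eq_0_iff)
  then have "u = (u$4 / n$4) *\<^sub>R n" using n4 by (simp add: vec_eq_iff forall_4 field_simps)
  then show "\<exists>k. u = k *\<^sub>R n" ..
qed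

lemma cauchy_schwarz_strict3:
  fixes a1 a2 a3 b1 b2 b3 \<alpha> \<beta> :: real
  assumes "a1\<^sup>2 + a2\<^sup>2 + a3\<^sup>2 < \<alpha>\<^sup>2" "b1\<^sup>2 + b2\<^sup>2 + b3\<^sup>2 \<le> \<beta>\<^sup>2" "\<alpha> > 0" "\<beta> > 0"
  shows "\<bar>a1 * b1 + a2 * b2 + a3 * b3\<bar> < \<alpha> * \<beta>"
proof -
  have "(a1\<^sup>2 + a2\<^sup>2 + a3\<^sup>2) * (b1\<^sup>2 + b2\<^sup>2 + b3\<^sup>2) - (a1 * b1 + a2 * b2 + a3 * b3)\<^sup>2
      = (a1 * b2 - a2 * b1)\<^sup>2 + (a1 * b3 - a3 * b1)\<^sup>2 + (a2 * b3 - a3 * b2)\<^sup>2"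
    by algebra
  then have "(a1 * b1 + a2 * b2 + a3 * b3)\<^sup>2 \<le> (a1\<^sup>2 + a2\<^sup>2 + a3\<^sup>2) * (b1\<^sup>2 + b2\<^sup>2 + b3\<^sup>2)"
    by (smt (verit) zero_le_power2)
  also have "\<dots> \<le> (a1\<^sup>2 + a2\<^sup>2 + a3\<^sup>2) * \<beta>\<^sup>2" using assms by (intro mult_left_mono) auto
  also have "\<dots> < \<alpha>\<^sup>2 * \<beta>\<^sup>2" using assms by (intro mult_strict_right_mono) auto
  finally have "\<bar>a1 * b1 + a2 * b2 + a3 * b3\<bar>\<^sup>2 < (\<alpha> * \<beta>)\<^sup>2" by (simp add: power_mult_distrib)
  then show ?thesis using assms by (meson mult_pos_pos order_less_imp_le power_less_imp_less_base)
qed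

definition fcone :: "(real^4) set" where
  "fcone = {u. lorentz u u \<le> 0 \<and> u$4 > 0}"

lemma fcone_lorentz_neg:
  assumes "p \<in> fcone" "q \<in> fcone" "lorentz p p < 0"
  shows "lorentz p q < 0"
  using cauchy_schwarz_strict3[of "p$1" "p$2" "p$3" "p$4" "q$1" "q$2" "q$3" "q$4"] assms
  by (auto simp: fcone_def lorentz_diag lorentz_def[of p q])

subsection \<open>Lorentz transformations\<close>

text \<open>The matrix \<open>J M\<^sup>T J\<close> with J = diag(1, 1, 1, -1): the adjoint for
  \<open>lorentz\<close>, hence the inverse when \<open>M\<close> is an isometry.\<close>

definition ladj :: "mat4 \<Rightarrow> mat4" where
  "ladj M = (\<chi> i j. (if i = 4 then -1 else 1) * (if j = 4 then -1 else 1) * M$j$i)"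

lemma lorentz_ladj: "lorentz (M *v u) v = lorentz u (ladj M *v v)" "lorentz u (M *v v) = lorentz (ladj M *v u) v"
  by (simp_all add: lorentz_def ladj_def matrix_vector_mult_def sum_4 algebra_simps)

lemma matrix_eqI_lorentz:
  assumes "\<And>u v. lorentz u (A *v v) = lorentz u (B *v v)" shows "A = (B :: mat4)"
proof -
  have "A *v v = B *v v" for v
  proof -
    have "lorentz (A *v v - B *v v) u = 0" for u
      using assms[of u v] by (simp add: lorentz_commute)
    then have "A *v v - B *v v = 0" by (rule lorentz_nondegenerate)
    then show ?thesis by simp
  qed
  then show ?thesis by (simp add: matrix_eq)
qed

lemma ladj_ladj [simp]: "ladj (ladj M) = M"
  by (simp add: ladj_def vec_eq_iff)

lemma ladj_mult: "ladj (M ** N) = ladj N ** ladj M"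
  by (rule matrix_eqI_lorentz) (simp add: matrix_vector_mul_assoc[symmetric] lorentz_ladj(2)[of _ "ladj _"]
      lorentz_ladj(2)[of _ "ladj (M ** N)"])

lemma ladj_scaleR: "ladj (c *\<^sub>R M) = c *\<^sub>R ladj M"
  by (simp add: ladj_def vec_eq_iff)

lemma O31_D: "A \<in> O31 \<Longrightarrow> lorentz (A *v u) (A *v v) = lorentz u v"
  by (simp add: O31_def)

lemma O31_ladj:
  assumes "A \<in> O31"
  shows "invertible A" "matrix_inv A = ladj A" "ladj A ** A = mat 1" "A ** ladj A = mat 1"
proof -
  show 1: "ladj A ** A = mat 1"
    by (rule matrix_eqI_lorentz)
      (simp add: matrix_vector_mul_assoc[symmetric] lorentz_ladj(1)[symmetric] O31_D[OF assms])
  then show 2: "A ** ladj A = mat 1" using matrix_left_right_inverse by blast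
  show "invertible A" using 1 2 invertible_def by blast
  show "matrix_inv A = ladj A" using 2 by (rule matrix_inv_unique)
qed

lemma O31_mult: "A \<in> O31 \<Longrightarrow> B \<in> O31 \<Longrightarrow> A ** B \<in> O31"
  by (simp add: O31_def matrix_vector_mul_assoc[symmetric])

lemma O31_inv: "A \<in> O31 \<Longrightarrow> matrix_inv A \<in> O31"
proof -
  assume A: "A \<in> O31"
  have "lorentz (matrix_inv A *v u) (matrix_inv A *v v) = lorentz (A *v (matrix_inv A *v u)) (A *v (matrix_inv A *v v))" for u v
    using O31_D[OF A] by simp
  then show ?thesis using O31_ladj(1)[OF A] by (simp add: O31_def matrix_vector_mul_assoc)
qed

lemma inv_vec [simp]:
  fixes A :: mat4
  assumes "invertible A"
  shows "matrix_inv A *v (A *v u) = u" "A *v (matrix_inv A *v u) = u"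
  using assms by (simp_all add: matrix_vector_mul_assoc)

text \<open>The adjoint of an isometry is its inverse, hence an isometry; applied to the time axis
  it gives the fourth row up to signs, a vector on which the form is -1.\<close>

lemma O31_row:
  assumes "A \<in> O31" shows "(A$4$1)\<^sup>2 + (A$4$2)\<^sup>2 + (A$4$3)\<^sup>2 = (A$4$4)\<^sup>2 - 1"
proof -
  have "lorentz (ladj A *v axis 4 1) (ladj A *v axis 4 1) = lorentz (axis 4 1) (axis 4 1)"
    using O31_D[OF O31_inv[OF assms]] O31_ladj(2)[OF assms] by simp
  then show ?thesis
    by (simp add: lorentz_diag ladj_def axis_def matrix_vector_mult_def sum_4)
qed

text \<open>The orthochronous group. Of all multiples of a matrix at most one lies in it, see
  \<open>O31p_scale_eq\<close>, which turns a projective representation into a linear one.\<close>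

definition O31p :: "mat4 set" where
  "O31p = {A \<in> O31. A$4$4 > 0}"

lemma O31p_fcone:
  assumes A: "A \<in> O31p" and u: "u \<in> fcone" shows "A *v u \<in> fcone"
proof -
  have "\<bar>A$4$1 * u$1 + A$4$2 * u$2 + A$4$3 * u$3\<bar> < A$4$4 * u$4"
    using O31_row[of A] A u by (intro cauchy_schwarz_strict3) (auto simp: O31p_def fcone_def lorentz_diag)
  then show ?thesis
    using A u O31_D[of A u u] by (auto simp: fcone_def O31p_def matrix_vector_mult_def sum_4)
qed

lemma axis4_fcone: "axis 4 1 \<in> fcone" "lorentz (axis 4 1) (axis 4 1) = -1"
  by (simp_all add: fcone_def lorentz_diag axis_def)

lemma mult_axis4: "(A *v axis 4 1) $ 4 = (A::mat4) $ 4 $ 4"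
  by (simp add: matrix_vector_mult_basis column_def)

lemma O31p_mult: "A \<in> O31p \<Longrightarrow> B \<in> O31p \<Longrightarrow> A ** B \<in> O31p"
proof -
  assume A: "A \<in> O31p" and B: "B \<in> O31p"
  have "(A *v (B *v axis 4 1)) \<in> fcone" by (intro O31p_fcone A B axis4_fcone)
  then have "(A ** B) $ 4 $ 4 > 0"
    unfolding mult_axis4[symmetric] by (simp add: fcone_def matrix_vector_mul_assoc)
  then show ?thesis using A B by (auto simp: O31p_def O31_mult)
qed

lemma O31p_O31: "A \<in> O31p \<Longrightarrow> A \<in> O31"
  by (simp add: O31p_def)

text \<open>On \<open>O31\<close> the square of the last entry is at least 1, so that entry cannot
  change sign on a connected set containing the identity.\<close>

lemma SO31_0_O31p: "SO31_0 \<subseteq> O31p"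
proof
  fix A assume "A \<in> SO31_0"
  then obtain T where T: "connected T" "T \<subseteq> O31" "mat 1 \<in> T" "A \<in> T"
    by (auto simp: SO31_0_def connected_component_def)
  define f where "f X = (X::mat4) $ 4 $ 4" for X
  have "connected (f ` T)"
    unfolding f_def using T(1) by (intro connected_continuous_image continuous_intros)
  moreover have "f X \<noteq> 0" if "X \<in> T" for X
    using O31_row[of X] T(2) that by (auto simp: f_def) (smt (verit) zero_le_power2 in_mono)
  then have "0 \<notin> f ` T" by force
  moreover have "1 \<in> f ` T" using T(3) by (auto simp: f_def mat_def intro!: image_eqI[of _ _ "mat 1"])
  ultimately have "f A > 0"
    using T(4) connectedD_interval[of "f ` T" "f A" 1 0] by (metis image_eqI linorder_not_less zero_le_one)
  then show "A \<in> O31p" using T by (auto simp: O31p_def f_def)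
qed

lemma O31p_scale_eq:
  assumes "A \<in> O31p" "c *\<^sub>R A \<in> O31p" shows "c = 1"
proof -
  have "c\<^sup>2 * lorentz (A *v axis 4 1) (A *v axis 4 1) = lorentz ((c *\<^sub>R A) *v axis 4 1) ((c *\<^sub>R A) *v axis 4 1)"
    by (simp add: scaleR_matrix_vector_assoc[symmetric] power2_eq_square)
  also have "\<dots> = -1" using O31_D[OF O31p_O31[OF assms(2)]] axis4_fcone by simp
  finally have "c\<^sup>2 = 1" using O31_D[OF O31p_O31[OF assms(1)]] axis4_fcone by simp
  moreover have "c > 0" using assms by (auto simp: O31p_def zero_less_mult_iff)
  ultimately show ?thesis by (simp add: power2_eq_1_iff)
qed

subsection \<open>Null frames\<close>

lemma lorentz_independent:
  assumes S: "finite S" "\<And>u. u \<in> S \<Longrightarrow> lorentz u u \<noteq> 0"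
    "\<And>u v. u \<in> S \<Longrightarrow> v \<in> S \<Longrightarrow> u \<noteq> v \<Longrightarrow> lorentz u v = 0"
  shows "independent S"
proof
  assume "dependent S"
  then obtain u w where w: "w \<in> S" "u w \<noteq> 0" "(\<Sum>v\<in>S. u v *\<^sub>R v) = 0"
    using dependent_finite[OF S(1)] by blast
  have "0 = lorentz (\<Sum>v\<in>S. u v *\<^sub>R v) w" by (simp add: w(3))
  also have "\<dots> = (\<Sum>v\<in>S. if v = w then u w * lorentz w w else 0)"
    unfolding lorentz_sum[OF S(1)] using S w by (intro sum.cong) auto
  also have "\<dots> = u w * lorentz w w" using S w by (simp add: sum.delta)
  finally show False using w S by simp
qed

lemma orth_exists:
  assumes "finite (S :: (real^4) set)" "card S < 4"
  shows "\<exists>y. y \<noteq> 0 \<and> (\<forall>u\<in>S. lorentz u y = 0)"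
proof -
  define J where "J u = (\<chi> i. if i = 4 then - u$4 else u$i)" for u :: "real^4"
  have J: "lorentz u y = J u \<bullet> y" for u y
    by (simp add: J_def lorentz_def inner_vec_def sum_4)
  have "dim (J ` S) \<le> card (J ` S)" using assms(1) by (intro dim_le_card') auto
  also have "\<dots> \<le> card S" using assms(1) by (rule card_image_le)
  finally have "dim (J ` S) < DIM(real^4)" using assms(2) by simp
  then obtain y where "y \<noteq> 0" "\<And>z. z \<in> span (J ` S) \<Longrightarrow> orthogonal y z"
    using orthogonal_to_subspace_exists by blast
  then show ?thesis
    by (intro exI[of _ y]) (auto simp: J orthogonal_def inner_commute[of _ y] span_base)
qed

text \<open>A basis adapted to the stabiliser of the null line of \<open>n\<close>: an orthonormal
  spacelike pair orthogonal to a null pair with product 1. The vector \<open>n - m\<close> is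
  timelike and \<open>n + m\<close> is spacelike.\<close>

definition nframe :: "real^4 \<Rightarrow> real^4 \<Rightarrow> real^4 \<Rightarrow> real^4 \<Rightarrow> bool" where
  "nframe e f n m \<longleftrightarrow> lorentz e e = 1 \<and> lorentz f f = 1 \<and> lorentz e f = 0 \<and> lorentz n n = 0 \<and>
     lorentz m m = 0 \<and> lorentz n m = 1 \<and> lorentz n e = 0 \<and> lorentz n f = 0 \<and> lorentz m e = 0 \<and>
     lorentz m f = 0"

text \<open>A nonzero remainder \<open>y\<close> is orthogonal to the frame, hence spacelike as it
  is orthogonal to the timelike \<open>n - m\<close>; then \<open>n - m\<close>,
  \<open>n + m\<close>, \<open>e\<close>, \<open>f\<close>, \<open>y\<close> would be five
  independent vectors in a space of dimension four.\<close>

lemma nframe_expand: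
  assumes "nframe e f n m"
  shows "u = lorentz u e *\<^sub>R e + lorentz u f *\<^sub>R f + lorentz u m *\<^sub>R n + lorentz u n *\<^sub>R m"
proof (rule ccontr)
  assume ne: "\<not> ?thesis"
  have r [simp]: "lorentz e e = 1" "lorentz f f = 1" "lorentz e f = 0" "lorentz n n = 0"
    "lorentz m m = 0" "lorentz n m = 1" "lorentz n e = 0" "lorentz n f = 0" "lorentz m e = 0"
    "lorentz m f = 0" "lorentz f e = 0" "lorentz m n = 1" "lorentz e n = 0" "lorentz f n = 0"
    "lorentz e m = 0" "lorentz f m = 0"
    using assms by (auto simp: nframe_def lorentz_commute)
  define y where "y = u - (lorentz u e *\<^sub>R e + lorentz u f *\<^sub>R f + lorentz u m *\<^sub>R n + lorentz u n *\<^sub>R m)"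
  have y: "lorentz y e = 0" "lorentz y f = 0" "lorentz y n = 0" "lorentz y m = 0"
    by (simp_all add: y_def)
  have y': "lorentz e y = 0" "lorentz f y = 0" "lorentz n y = 0" "lorentz m y = 0"
    using y lorentz_commute by metis+
  have "lorentz y y > 0"
    by (rule timelike_orth[of "n - m"]) (use y' ne in \<open>auto simp: y_def\<close>)
  define S where "S = {n - m, n + m, e, f, y}"
  have "independent S"
    by (rule lorentz_independent) (use \<open>lorentz y y > 0\<close> y y' in \<open>auto simp: S_def\<close>)
  then have "card S \<le> DIM(real^4)" using independent_bound by blast
  moreover have "card S = 5"
  proof -
    have d: "p \<noteq> q" if "lorentz p p \<noteq> lorentz p q" for p q using that by auto
    have "n - m \<noteq> n + m" "n - m \<noteq> e" "n - m \<noteq> f" "n - m \<noteq> y" "n + m \<noteq> e" "n + m \<noteq> f" "n + m \<noteq> y"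
      "e \<noteq> f" "e \<noteq> y" "f \<noteq> y"
      by (rule d; use y y' in simp)+
    then show ?thesis by (simp add: S_def)
  qed
  ultimately show False by simp
qed

lemma null_partner:
  assumes "lorentz n n = 0" "n \<noteq> 0" shows "\<exists>m. lorentz n m = 1"
proof -
  have "n$4 \<noteq> 0" using null_nonzero4[OF assms] .
  then show ?thesis
    by (intro exI[of _ "axis 4 (- inverse (n$4))"]) (simp add: lorentz_def axis_def)
qed

lemma nframe_complete_null:
  assumes "lorentz e e = 1" "lorentz f f = 1" "lorentz e f = 0" "lorentz n n = 0" "n \<noteq> 0"
    "lorentz n e = 0" "lorentz n f = 0"
  shows "\<exists>m. nframe e f n m"
proof -
  have r [simp]: "lorentz e e = 1" "lorentz f f = 1" "lorentz e f = 0" "lorentz n n = 0"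
    "lorentz n e = 0" "lorentz n f = 0" "lorentz f e = 0" "lorentz e n = 0" "lorentz f n = 0"
    using assms by (auto simp: lorentz_commute)
  obtain k where k: "lorentz n k = 1" using null_partner assms by blast
  define y where "y = k - lorentz k e *\<^sub>R e - lorentz k f *\<^sub>R f"
  have y: "lorentz y e = 0" "lorentz y f = 0" "lorentz n y = 1" "lorentz y n = 1"
    using k lorentz_commute[of k n] by (simp_all add: y_def)
  \<comment> \<open>Since \<open>n\<close> is null and has product 1 with \<open>y\<close>, removing
    half of \<open>lorentz y y\<close> along \<open>n\<close> makes \<open>y\<close> null and keeps
    the other products.\<close>
  show ?thesis
    by (rule exI[of _ "y - (lorentz y y / 2) *\<^sub>R n"]) (simp add: nframe_def y)
qed

lemma spacelike_normalize:
  assumes "lorentz u u > 0" obtains c where "c \<noteq> 0" "lorentz (c *\<^sub>R u) (c *\<^sub>R u) = 1"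
proof (rule that[of "1 / sqrt (lorentz u u)"])
  show "lorentz ((1 / sqrt (lorentz u u)) *\<^sub>R u) ((1 / sqrt (lorentz u u)) *\<^sub>R u) = 1"
    using assms by (simp flip: mult.assoc)
qed (use assms in simp)

lemma nframe_complete_spacelike:
  assumes "lorentz s s = 1" "lorentz n n = 0" "n \<noteq> 0" "lorentz n s = 0"
  shows "\<exists>e m. nframe s e n m"
proof -
  obtain k where k: "lorentz n k = 1" using null_partner assms by blast
  have k': "lorentz k n = 1" "lorentz s n = 0" using k assms by (simp_all add: lorentz_commute)
  define j where "j = k - lorentz k s *\<^sub>R s"
  have j: "lorentz j s = 0" "lorentz n j = 1" "lorentz j n = 1"
    using k k' assms by (simp_all add: j_def)
  have "card {s, n, j} \<le> 3" by (simp add: card_insert_if)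
  then obtain y where y: "y \<noteq> 0" "lorentz s y = 0" "lorentz n y = 0" "lorentz j y = 0"
    using orth_exists[of "{s, n, j}"] by auto
  define m where "m = j - (lorentz j j / 2) *\<^sub>R n"
  have m: "lorentz m m = 0" "lorentz n m = 1" "lorentz m n = 1" "lorentz m y = 0"
    using j y assms by (simp_all add: m_def)
  have "lorentz y y > 0"
    by (rule timelike_orth[of "n - m"]) (use m y assms in auto)
  then obtain c where c: "c \<noteq> 0" "lorentz (c *\<^sub>R y) (c *\<^sub>R y) = 1" by (rule spacelike_normalize)
  show ?thesis
    using nframe_complete_null[of s "c *\<^sub>R y" n] assms c y by auto
qed

lemma nframe_exists:
  assumes "lorentz n n = 0" "n \<noteq> 0" shows "\<exists>e f m. nframe e f n m"
proof -
  obtain k where k: "lorentz n k = 1" using null_partner assms by blast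
  have k': "lorentz k n = 1" using k by (simp add: lorentz_commute)
  have "card {n, k} \<le> 2" by (simp add: card_insert_if)
  then obtain y where y: "y \<noteq> 0" "lorentz n y = 0" "lorentz k y = 0"
    using orth_exists[of "{n, k}"] by auto
  have "lorentz y y > 0"
    by (rule timelike_orth[of "n - (k - (lorentz k k / 2) *\<^sub>R n)"]) (use k k' y assms in auto)
  then obtain c where c: "c \<noteq> 0" "lorentz (c *\<^sub>R y) (c *\<^sub>R y) = 1" by (rule spacelike_normalize)
  show ?thesis
    using nframe_complete_spacelike[of "c *\<^sub>R y" n] assms c y by auto
qed

lemma O31_eigen_nonzero: "A \<in> O31 \<Longrightarrow> A *v n = \<xi> *\<^sub>R n \<Longrightarrow> n \<noteq> 0 \<Longrightarrow> \<xi> \<noteq> 0"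
  using inv_vec(1)[OF O31_ladj(1), of A n] by (metis matrix_vector_mult_0_right scaleR_zero_left)

lemma O31_orth_eigen:
  assumes "A \<in> O31" "A *v n = \<xi> *\<^sub>R n" "n \<noteq> 0" "lorentz n v = 0"
  shows "lorentz n (A *v v) = 0" "lorentz (A *v v) n = 0"
proof -
  have "\<xi> * lorentz n (A *v v) = lorentz (A *v n) (A *v v)" using assms(2) by simp
  also have "\<dots> = 0" using O31_D[OF assms(1)] assms(4) by simp
  finally show "lorentz n (A *v v) = 0" using O31_eigen_nonzero[OF assms(1-3)] by simp
  then show "lorentz (A *v v) n = 0" by (simp add: lorentz_commute)
qed

text \<open>For an orthogonal matrix with rows \<open>(p, q)\<close> and \<open>(r, t)\<close> these
  are the identities that make its square a rotation: the diagonal entries of the square differ by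
  \<open>p\<^sup>2 - t\<^sup>2\<close>, and the off-diagonal ones add up to
  \<open>(p + t) * (q + r)\<close>.\<close>

lemma orthogonal_2x2:
  fixes p q r t :: real
  assumes "p\<^sup>2 + q\<^sup>2 = 1" "r\<^sup>2 + t\<^sup>2 = 1" "p * r + q * t = 0"
  shows "p\<^sup>2 = t\<^sup>2" "(p + t) * (q + r) = 0"
proof -
  have "(p * r)\<^sup>2 = (q * t)\<^sup>2" using assms(3) by (metis add_eq_0_iff power2_minus)
  then have "p\<^sup>2 * r\<^sup>2 = q\<^sup>2 * t\<^sup>2" by (simp only: power_mult_distrib)
  moreover have "r\<^sup>2 = 1 - t\<^sup>2" "q\<^sup>2 = 1 - p\<^sup>2" using assms by simp_all
  ultimately have "p\<^sup>2 * (1 - t\<^sup>2) = (1 - p\<^sup>2) * t\<^sup>2" by metis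
  then show "p\<^sup>2 = t\<^sup>2" by (simp add: algebra_simps)
  then consider "t = p" | "t = - p" using power2_eq_iff by metis
  then show "(p + t) * (q + r) = 0" using assms(3) by cases (auto simp: algebra_simps)
qed

text \<open>On the Euclidean plane \<open>n\<^sup>\<bottom> / n\<close> the stabiliser of a null line \<open>\<real> n\<close> acts by orthogonal maps;
  squares act by rotations and therefore commute there.\<close>

definition rot_along :: "real^4 \<Rightarrow> real^4 \<Rightarrow> real^4 \<Rightarrow> mat4 \<Rightarrow> bool" where
  "rot_along e f n A \<longleftrightarrow> (\<exists>\<kappa> c s p q. A *v n = \<kappa> *\<^sub>R n \<and> A *v e = c *\<^sub>R e + s *\<^sub>R f + p *\<^sub>R n \<and>
     A *v f = (- s) *\<^sub>R e + c *\<^sub>R f + q *\<^sub>R n)"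

lemma square_rot_along:
  assumes fr: "nframe e f n m" and A: "A \<in> O31" "A *v n = \<xi> *\<^sub>R n"
  shows "rot_along e f n (A ** A)"
proof -
  have n: "n \<noteq> 0" "lorentz n n = 0" "lorentz n e = 0" "lorentz n f = 0" "lorentz e e = 1" "lorentz f f = 1" "lorentz e f = 0"
    using fr by (auto simp: nframe_def)
  note o = O31_orth_eigen(2)[OF A n(1)]
  define p q r t p' r' where "p = lorentz (A *v e) e" "q = lorentz (A *v e) f"
    "r = lorentz (A *v f) e" "t = lorentz (A *v f) f" "p' = lorentz (A *v e) m" "r' = lorentz (A *v f) m"
  have E: "A *v e = p *\<^sub>R e + q *\<^sub>R f + p' *\<^sub>R n" "A *v f = r *\<^sub>R e + t *\<^sub>R f + r' *\<^sub>R n"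
    using nframe_expand[OF fr, of "A *v e"] nframe_expand[OF fr, of "A *v f"] o[OF n(3)] o[OF n(4)]
    by (simp_all add: p_q_r_t_p'_r'_def)
  have z: "lorentz e n = 0" "lorentz f n = 0" "lorentz f e = 0" using n lorentz_commute by metis+
  have "p\<^sup>2 + q\<^sup>2 = 1"
    using O31_D[OF A(1), of e e] unfolding E by (simp add: n z power2_eq_square)
  moreover have "r\<^sup>2 + t\<^sup>2 = 1"
    using O31_D[OF A(1), of f f] unfolding E by (simp add: n z power2_eq_square)
  moreover have "p * r + q * t = 0"
    using O31_D[OF A(1), of e f] unfolding E by (simp add: n z mult.commute[of r] mult.commute[of t])
  ultimately have pt: "p\<^sup>2 = t\<^sup>2" "(p + t) * (q + r) = 0" by (rule orthogonal_2x2)+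
  have "(A ** A) *v n = (\<xi> * \<xi>) *\<^sub>R n"
    by (simp add: matrix_vector_mul_assoc[symmetric] A matrix_vector_mult_scaleR)
  moreover have "(A ** A) *v e = (p\<^sup>2 + q * r) *\<^sub>R e + (p * q + q * t) *\<^sub>R f + (p * p' + q * r' + p' * \<xi>) *\<^sub>R n"
    by (simp add: matrix_vector_mul_assoc[symmetric] E A matrix_vector_mult_scaleR matrix_vector_right_distrib
        scaleR_add_right scaleR_add_left power2_eq_square)
  moreover have "(A ** A) *v f = (- (p * q + q * t)) *\<^sub>R e + (p\<^sup>2 + q * r) *\<^sub>R f + (r * p' + t * r' + r' * \<xi>) *\<^sub>R n"
  proof -
    have "(A ** A) *v f = (r * p + t * r) *\<^sub>R e + (r * q + t\<^sup>2) *\<^sub>R f + (r * p' + t * r' + r' * \<xi>) *\<^sub>R n"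
      by (simp add: matrix_vector_mul_assoc[symmetric] E A matrix_vector_mult_scaleR matrix_vector_right_distrib
        scaleR_add_right scaleR_add_left power2_eq_square)
    moreover have "r * p + t * r = - (p * q + q * t)" using pt(2) by (simp add: algebra_simps)
    moreover have "r * q + t\<^sup>2 = p\<^sup>2 + q * r" using pt(1) by simp
    ultimately show ?thesis by simp
  qed
  ultimately show ?thesis unfolding rot_along_def by blast
qed

lemma rot_along_commute:
  assumes fr: "nframe e f n m" and A: "rot_along e f n A" and B: "rot_along e f n B" and v: "lorentz v n = 0"
  shows "\<exists>k. A *v (B *v v) - B *v (A *v v) = k *\<^sub>R n"
proof -
  obtain \<kappa> c s p q where a: "A *v n = \<kappa> *\<^sub>R n" "A *v e = c *\<^sub>R e + s *\<^sub>R f + p *\<^sub>R n"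
    "A *v f = (- s) *\<^sub>R e + c *\<^sub>R f + q *\<^sub>R n" using A unfolding rot_along_def by blast
  obtain \<kappa>' c' s' p' q' where b: "B *v n = \<kappa>' *\<^sub>R n" "B *v e = c' *\<^sub>R e + s' *\<^sub>R f + p' *\<^sub>R n"
    "B *v f = (- s') *\<^sub>R e + c' *\<^sub>R f + q' *\<^sub>R n" using B unfolding rot_along_def by blast
  have "v = lorentz v e *\<^sub>R e + lorentz v f *\<^sub>R f + lorentz v m *\<^sub>R n"
    using nframe_expand[OF fr, of v] v by simp
  then obtain x y z where v: "v = x *\<^sub>R e + y *\<^sub>R f + z *\<^sub>R n" by blast
  note sm = a b matrix_vector_mult_scaleR matrix_vector_right_distrib matrix_vector_mult_diff_distrib
  have "A *v (B *v v) - B *v (A *v v) =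
     (x * (c' * p + s' * q + p' * \<kappa> - (c * p' + s * q' + p * \<kappa>')) +
      y * (- s' * p + c' * q + q' * \<kappa> - (- s * p' + c * q' + q * \<kappa>'))) *\<^sub>R n"
    unfolding v by (simp add: sm) (simp add: algebra_simps)
  then show ?thesis by blast
qed

text \<open>The isometries acting trivially on \<open>n\<close> and on its orthogonal space modulo
  \<open>n\<close>: the translations of the horospheres at \<open>n\<close>.\<close>

definition unip_along :: "real^4 \<Rightarrow> mat4 \<Rightarrow> bool" where
  "unip_along n A \<longleftrightarrow> A \<in> O31 \<and> A *v n = n \<and> (\<forall>v. lorentz n v = 0 \<longrightarrow> (\<exists>k. A *v v = v + k *\<^sub>R n))"

text \<open>For \<open>w\<close> not orthogonal to \<open>n\<close>, the displacements
  \<open>p\<close> and \<open>q\<close> of \<open>w\<close> are orthogonal to \<open>n\<close>, and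
  invariance of the form determines both correction terms \<open>\<alpha>\<close> and
  \<open>\<beta>\<close> by the symmetric quantity \<open>lorentz p q\<close>. The remaining vectors
  are differences of two such \<open>w\<close>.\<close>

lemma unip_along_commute:
  assumes n: "lorentz n n = 0" "n \<noteq> 0" and A: "unip_along n A" and B: "unip_along n B"
  shows "A ** B = B ** A"
proof -
  have c1: "A *v (B *v w) = B *v (A *v w)" if w: "lorentz n w \<noteq> 0" for w
  proof -
    have O: "A \<in> O31" "B \<in> O31" and An: "A *v n = n" "B *v n = n" using A B by (auto simp: unip_along_def)
    define p q where "p = A *v w - w" "q = B *v w - w"
    have Aw: "A *v w = w + p" "B *v w = w + q" by (simp_all add: p_q_def)
    have "lorentz n p = lorentz (A *v n) (A *v w) - lorentz n w" "lorentz n q = lorentz (B *v n) (B *v w) - lorentz n w"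
      by (simp_all add: p_q_def An)
    then have np: "lorentz n p = 0" "lorentz n q = 0" using O by (simp_all add: O31_D)
    obtain \<alpha> where \<alpha>: "A *v q = q + \<alpha> *\<^sub>R n" using A np by (auto simp: unip_along_def)
    obtain \<beta> where \<beta>: "B *v p = p + \<beta> *\<^sub>R n" using B np by (auto simp: unip_along_def)
    have "lorentz (A *v q) (A *v w) = lorentz q w" "lorentz (B *v p) (B *v w) = lorentz p w"
      using O by (simp_all add: O31_D)
    then have "lorentz q p + \<alpha> * lorentz n w = 0" "lorentz p q + \<beta> * lorentz n w = 0"
      using np by (simp_all add: \<alpha> \<beta> Aw)
    then have "\<alpha> = \<beta>" using w by (metis add_left_cancel lorentz_commute mult_right_cancel)
    then show ?thesis by (simp add: Aw \<alpha> \<beta> matrix_vector_right_distrib add_ac)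
  qed
  obtain m where m: "lorentz n m = 1" using null_partner[OF n] by blast
  have "A *v (B *v w) = B *v (A *v w)" for w
  proof (cases "lorentz n w = 0")
    case True
    then have "A *v (B *v (w + m)) = B *v (A *v (w + m))" using m by (intro c1) simp
    then show ?thesis using c1[of m] m by (simp add: matrix_vector_right_distrib)
  qed (rule c1)
  then show ?thesis by (simp add: matrix_eq matrix_vector_mul_assoc[symmetric])
qed

definition mcomm :: "mat4 \<Rightarrow> mat4 \<Rightarrow> mat4" where
  "mcomm A B = A ** B ** matrix_inv A ** matrix_inv B"

lemma inv_eigen:
  assumes "A \<in> O31" "A *v n = \<xi> *\<^sub>R n" "n \<noteq> 0"
  shows "matrix_inv A *v n = inverse \<xi> *\<^sub>R n"
proof -
  have "\<xi> *\<^sub>R (matrix_inv A *v n) = n"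
    using inv_vec(1)[OF O31_ladj(1)[OF assms(1)], of n] assms(2) by (simp add: matrix_vector_mult_scaleR)
  then show ?thesis using O31_eigen_nonzero[OF assms] by (metis inverse_unique scaleR_left_imp_eq scaleR_scaleR scaleR_one right_inverse)
qed

lemma mcomm_unip:
  assumes fr: "nframe e f n m" and A: "A \<in> O31" "rot_along e f n A" and B: "B \<in> O31" "rot_along e f n B"
  shows "unip_along n (mcomm A B)"
proof -
  have n: "n \<noteq> 0" using fr by (auto simp: nframe_def)
  obtain \<kappa> where \<kappa>: "A *v n = \<kappa> *\<^sub>R n" using A(2) by (auto simp: rot_along_def)
  obtain \<nu> where \<nu>: "B *v n = \<nu> *\<^sub>R n" using B(2) by (auto simp: rot_along_def)
  have nz: "\<kappa> \<noteq> 0" "\<nu> \<noteq> 0" using O31_eigen_nonzero A(1) B(1) \<kappa> \<nu> n by blast+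
  note i = inv_eigen[OF A(1) \<kappa> n] inv_eigen[OF B(1) \<nu> n]
  have "mcomm A B *v n = n"
    using nz by (simp add: mcomm_def matrix_vector_mul_assoc[symmetric] i \<kappa> \<nu> matrix_vector_mult_scaleR field_simps)
  moreover have "\<exists>k. mcomm A B *v v = v + k *\<^sub>R n" if v: "lorentz n v = 0" for v
  proof -
    define w where "w = matrix_inv A *v (matrix_inv B *v v)"
    have "lorentz w n = 0" unfolding w_def
      by (rule O31_orth_eigen(2)[OF O31_inv[OF A(1)] i(1) n])
        (rule O31_orth_eigen(1)[OF O31_inv[OF B(1)] i(2) n v])
    then obtain k where k: "A *v (B *v w) - B *v (A *v w) = k *\<^sub>R n"
      using rot_along_commute[OF fr A(2) B(2)] by blast
    have "B *v (A *v w) = v" using O31_ladj(1)[OF A(1)] O31_ladj(1)[OF B(1)] by (simp add: w_def)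
    moreover have "mcomm A B *v v = A *v (B *v w)" by (simp add: mcomm_def w_def matrix_vector_mul_assoc matrix_mul_assoc)
    ultimately show ?thesis using k by (intro exI[of _ k]) (simp add: algebra_simps)
  qed
  ultimately show ?thesis
    using A B by (simp add: unip_along_def mcomm_def O31_mult O31_inv)
qed

text \<open>The stabiliser of a null line is virtually metabelian, which a free group is not.\<close>

lemma null_line_commutators:
  assumes n: "lorentz n n = 0" "n \<noteq> 0" and P: "P \<in> O31" "P *v n = \<xi> *\<^sub>R n" and Q: "Q \<in> O31" "Q *v n = \<mu> *\<^sub>R n"
  defines "P2 \<equiv> P ** P" and "Q2 \<equiv> Q ** Q"
  shows "mcomm P2 Q2 ** mcomm P2 (matrix_inv Q2) = mcomm P2 (matrix_inv Q2) ** mcomm P2 Q2"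
proof -
  obtain e f m where fr: "nframe e f n m" using nframe_exists[OF n] by blast
  have O: "P2 \<in> O31" "Q2 \<in> O31" "matrix_inv Q2 \<in> O31" using P Q by (simp_all add: P2_def Q2_def O31_mult O31_inv)
  have "rot_along e f n P2" "rot_along e f n Q2"
    unfolding P2_def Q2_def by (rule square_rot_along[OF fr]; fact)+
  moreover have "matrix_inv Q2 = matrix_inv Q ** matrix_inv Q"
    unfolding Q2_def using O31_ladj(1)[OF Q(1)] by (simp add: matrix_inv_matrix_mult)
  then have "rot_along e f n (matrix_inv Q2)"
    using square_rot_along[OF fr O31_inv[OF Q(1)] inv_eigen[OF Q n(2)]] by simp
  ultimately show ?thesis
    by (intro unip_along_commute[OF n] mcomm_unip[OF fr] O)
qed

subsection \<open>Fixed vectors and one-parameter groups\<close>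

definition ltwist :: "real^4 \<Rightarrow> real^4" where
  "ltwist u = (\<chi> i. if i = 4 then - u$4 else u$i)"

lemma lorentz_ltwist: "lorentz u y = ltwist u \<bullet> y"
  by (simp add: ltwist_def lorentz_def inner_vec_def sum_4)

lemma linear_ltwist: "linear ltwist" and inj_ltwist: "inj ltwist"
proof -
  show "linear ltwist" by (rule linearI) (simp_all add: ltwist_def vec_eq_iff)
  have "ltwist (ltwist u) = u" for u by (simp add: ltwist_def vec_eq_iff)
  then show "inj ltwist" by (metis injI)
qed

definition perp :: "(real^4) set \<Rightarrow> (real^4) set" where
  "perp E = {v. \<forall>u\<in>E. lorentz u v = 0}"

lemma subspace_perp: "subspace (perp E)"
  by (auto simp: perp_def subspace_def)

lemma dim_perp: "subspace E \<Longrightarrow> dim (perp E) + dim E = 4"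
proof -
  assume E: "subspace E"
  have "perp E = {y \<in> UNIV. \<forall>x\<in>ltwist ` E. orthogonal x y}"
    by (auto simp: perp_def lorentz_ltwist orthogonal_def)
  moreover have "dim {y \<in> UNIV. \<forall>x\<in>ltwist ` E. orthogonal x y} + dim (ltwist ` E) = dim (UNIV :: (real^4) set)"
    by (rule dim_subspace_orthogonal_to_vectors) (auto intro: linear_subspace_image linear_ltwist E)
  moreover have "dim (ltwist ` E) = dim E"
    by (rule dim_image_eq[OF linear_ltwist]) (use inj_ltwist in \<open>auto intro: inj_on_subset\<close>)
  ultimately show ?thesis by simp
qed

text \<open>16 is the number of entries, each bounded by the norm of the column containing
  it.\<close>

lemma mat4_norm_le:
  assumes "\<And>j. norm ((A :: mat4) *v axis j 1) \<le> K" shows "norm A \<le> 16 * K"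
proof -
  have e: "\<bar>A$i$j\<bar> \<le> K" for i j
    using component_le_norm_cart[of "A *v axis j 1" i] assms[of j]
    by (simp add: matrix_vector_mult_basis column_def)
  have "norm A \<le> (\<Sum>i\<in>UNIV. norm (A$i))" unfolding norm_vec_def by (rule L2_set_le_sum) simp
  also have "\<dots> \<le> (\<Sum>i\<in>(UNIV::4 set). \<Sum>j\<in>(UNIV::4 set). \<bar>A$i$j\<bar>)"
    by (intro sum_mono norm_le_l1_cart)
  also have "\<dots> \<le> (\<Sum>i\<in>(UNIV::4 set). \<Sum>j\<in>(UNIV::4 set). K)" by (intro sum_mono e)
  finally show ?thesis by simp
qed

text \<open>Reversing the form along \<open>t\<close> makes it definite: on the sum of a multiple of
  \<open>t\<close> and a vector orthogonal to \<open>t\<close>, \<open>q\<close> is a sum of two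
  nonnegative terms. The stabiliser of \<open>t\<close> preserves \<open>q\<close>, and comparison
  with the Euclidean norm on the unit sphere bounds every column.\<close>

lemma timelike_stabiliser_bounded:
  assumes t: "lorentz t t < 0"
  shows "\<exists>K. \<forall>A\<in>O31. A *v t = t \<longrightarrow> norm A \<le> K"
proof -
  define q where "q u = 2 * (lorentz t u)\<^sup>2 - lorentz t t * lorentz u u" for u
  have pos: "q u > 0" if "u \<noteq> 0" for u
  proof -
    define c where "c = lorentz t u / lorentz t t"
    define w where "w = u - c *\<^sub>R t"
    have tw: "lorentz t w = 0" "lorentz w t = 0" using t by (simp_all add: w_def c_def lorentz_commute[of u])
    have u: "u = w + c *\<^sub>R t" by (simp add: w_def)
    have "q u = (c * lorentz t t)\<^sup>2 - lorentz t t * lorentz w w"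
      unfolding q_def by (subst u)+ (simp add: tw power2_eq_square algebra_simps)
    moreover have "(c * lorentz t t)\<^sup>2 - lorentz t t * lorentz w w > 0"
    proof (cases "w = 0")
      case True
      then have "c * lorentz t t \<noteq> 0" using u that t by auto
      then show ?thesis using True by simp
    next
      case False
      then have "lorentz t t * lorentz w w < 0" using timelike_orth[OF t tw(1)] t by (simp add: mult_neg_pos)
      then show ?thesis using zero_le_power2[of "c * lorentz t t"] by linarith
    qed
    ultimately show ?thesis by simp
  qed
  have cont: "continuous_on S q" for S
    unfolding q_def lorentz_def by (intro continuous_intros)
  have cs: "compact (sphere (0::real^4) 1)" by simp
  have ne: "sphere (0::real^4) 1 \<noteq> {}" by simp
  obtain u0 where u0: "u0 \<in> sphere 0 1" "\<And>u. u \<in> sphere 0 1 \<Longrightarrow> q u0 \<le> q u"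
    using continuous_attains_inf[OF cs ne cont] by blast
  obtain u1 where u1: "\<And>u. u \<in> sphere 0 1 \<Longrightarrow> q u \<le> q u1"
    using continuous_attains_sup[OF cs ne cont] by blast
  have q0: "q u0 > 0" using u0 pos[of u0] by force
  have lower: "q u0 * (norm u)\<^sup>2 \<le> q u" for u
  proof (cases "u = 0")
    case False
    have "q u0 \<le> q ((1 / norm u) *\<^sub>R u)" using False by (intro u0) simp
    also have "\<dots> = (1 / norm u)\<^sup>2 * q u" by (simp add: q_def power2_eq_square algebra_simps)
    finally show ?thesis using False by (simp add: field_simps)
  qed (simp add: q_def)
  have "norm A \<le> 16 * sqrt (q u1 / q u0)" if A: "A \<in> O31" "A *v t = t" for A
  proof (rule mat4_norm_le)
    fix j :: 4
    have "q (A *v axis j 1) = q (axis j 1)"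
      using O31_D[OF A(1), of t "axis j 1"] O31_D[OF A(1)] A(2) by (simp add: q_def)
    then have "q u0 * (norm (A *v axis j 1))\<^sup>2 \<le> q u1"
      using lower[of "A *v axis j 1"] u1[of "axis j 1"] by simp
    then have "(norm (A *v axis j 1))\<^sup>2 \<le> q u1 / q u0" using q0 by (simp add: field_simps)
    then show "norm (A *v axis j 1) \<le> sqrt (q u1 / q u0)" by (rule real_le_rsqrt)
  qed
  then show ?thesis by blast
qed

text \<open>Projectively, the future cone in the orthogonal space of \<open>s\<close> is a compact
  convex set preserved by \<open>B\<close>, so Brouwer's theorem gives a fixed ray; its eigenvalue
  is positive since \<open>B\<close> preserves the future. The value \<open>s = 0\<close> stands for
  the absence of a constraint.\<close>

lemma cone_eigenvector:
  assumes B: "B \<in> O31p" "B *v s = s" and s: "lorentz s s = 1 \<or> s = 0"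
  obtains n \<xi> where "n \<in> fcone" "lorentz n s = 0" "\<xi> > 0" "B *v n = \<xi> *\<^sub>R n"
proof -
  \<comment> \<open>Where the fourth coordinate is 1, the ball of radius 1 about
    \<open>axis 4 1\<close> is exactly the set on which the form is nonpositive.\<close>
  define K where "K = {u. u$4 = 1} \<inter> {u. lorentz u s = 0} \<inter> cball (axis 4 1) 1"
  have K: "u \<in> K \<longleftrightarrow> u$4 = 1 \<and> lorentz u s = 0 \<and> lorentz u u \<le> 0" for u
  proof -
    have "(dist (axis 4 1) u)\<^sup>2 = (u$1)\<^sup>2 + (u$2)\<^sup>2 + (u$3)\<^sup>2" if "u$4 = 1"
      using that by (simp add: dist_norm norm_vec_def L2_set_def sum_4 axis_def)
    moreover have "dist (axis 4 1) u \<le> 1 \<longleftrightarrow> (dist (axis 4 1) u)\<^sup>2 \<le> 1"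
      by (simp add: power2_le_iff_abs_le[of 1, simplified] abs_square_le_1)
    ultimately show ?thesis by (auto simp: K_def lorentz_diag)
  qed
  have "closed {u::real^4. u$4 = 1}" "closed {u. lorentz u s = 0}"
    unfolding lorentz_def by (intro closed_Collect_eq continuous_intros)+
  then have "compact K" unfolding K_def by (intro closed_Int_compact) auto
  moreover have "convex K"
    unfolding K_def by (intro convex_Int convex_cball) (auto simp: convex_def algebra_simps)
  moreover have "K \<noteq> {}"
  proof -
    define w where "w = axis 4 1 - lorentz (axis 4 1) s *\<^sub>R s"
    have ws: "lorentz w s = 0" using s by (auto simp: w_def)
    have "lorentz w w = - 1 - (lorentz (axis 4 1) s)\<^sup>2"
      using s axis4_fcone(2) by (auto simp: w_def lorentz_commute[of s "axis 4 1"] power2_eq_square)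
    then have w: "lorentz w w < 0" by (smt (verit) zero_le_power2)
    have "w$4 \<noteq> 0"
    proof
      assume "w$4 = 0"
      then have "lorentz w w \<ge> 0" by (simp add: lorentz_diag)
      with w show False by simp
    qed
    then have "(1 / w$4) *\<^sub>R w \<in> K" using w ws by (simp add: K divide_nonpos_nonneg)
    then show ?thesis by blast
  qed
  moreover have Bc: "B *v u \<in> fcone" if "u \<in> K" for u
    using O31p_fcone[OF B(1)] that by (simp add: K fcone_def)
  define f where "f u = (1 / (B *v u)$4) *\<^sub>R (B *v u)" for u
  have "continuous_on K f"
    unfolding f_def using Bc by (intro continuous_intros) (force simp: fcone_def)+
  moreover have "f \<in> K \<rightarrow> K"
  proof
    fix u assume u: "u \<in> K"
    have "lorentz (B *v u) s = 0" using O31_D[OF O31p_O31[OF B(1)], of u s] B(2) u by (simp add: K)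
    then show "f u \<in> K" using Bc[OF u] by (simp add: K f_def fcone_def divide_nonpos_nonneg)
  qed
  ultimately obtain n where n: "n \<in> K" "f n = n" using brouwer by metis
  have p: "(B *v n)$4 > 0" using Bc[OF n(1)] by (simp add: fcone_def)
  have "(B *v n)$4 *\<^sub>R f n = B *v n" using p by (simp add: f_def)
  then show ?thesis using that[of n "(B *v n)$4"] n p by (simp add: K fcone_def)
qed

text \<open>The image of \<open>m\<close> is forced: its products with \<open>e\<close>,
  \<open>f\<close> and \<open>n\<close> follow from invariance, and its remaining coefficient
  \<open>- ((p\<^sup>2 + q\<^sup>2) / 2)\<close> from being null.\<close>

lemma parabolic_form:
  assumes fr: "nframe e f n m" and B: "B \<in> O31" "B *v n = n" "B *v e = e + p *\<^sub>R n" "B *v f = f + q *\<^sub>R n"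
  shows "B *v u = u + (lorentz u e * p + lorentz u f * q) *\<^sub>R n
    - lorentz u n *\<^sub>R (p *\<^sub>R e + q *\<^sub>R f + ((p\<^sup>2 + q\<^sup>2) / 2) *\<^sub>R n)"
proof -
  have r [simp]: "lorentz e e = 1" "lorentz f f = 1" "lorentz e f = 0" "lorentz n n = 0"
    "lorentz m m = 0" "lorentz n m = 1" "lorentz n e = 0" "lorentz n f = 0" "lorentz m e = 0"
    "lorentz m f = 0" "lorentz f e = 0" "lorentz m n = 1" "lorentz e n = 0" "lorentz f n = 0"
    "lorentz e m = 0" "lorentz f m = 0"
    using fr by (auto simp: nframe_def lorentz_commute)
  define z where "z = B *v m"
  have zn: "lorentz z n = 1" using O31_D[OF B(1), of m n] B by (simp add: z_def)
  have ze: "lorentz z e = - p" using O31_D[OF B(1), of m e] B zn by (simp add: z_def)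
  have zf: "lorentz z f = - q" using O31_D[OF B(1), of m f] B zn by (simp add: z_def)
  obtain k where z: "z = (- p) *\<^sub>R e + (- q) *\<^sub>R f + k *\<^sub>R n + m"
    using nframe_expand[OF fr, of z] zn ze zf by (metis scaleR_one)
  have "lorentz z z = 0" using O31_D[OF B(1), of m m] by (simp add: z_def)
  then have "p\<^sup>2 + q\<^sup>2 + 2 * k = 0" by (simp add: z power2_eq_square)
  then have "2 * k = - (p\<^sup>2 + q\<^sup>2)" by (simp only: add_eq_0_iff)
  then have k: "k = - ((p\<^sup>2 + q\<^sup>2) / 2)" by (simp add: field_simps)
  define x1 x2 x3 x4 where "x1 = lorentz u e" "x2 = lorentz u f" "x3 = lorentz u m" "x4 = lorentz u n"
  have u: "u = x1 *\<^sub>R e + x2 *\<^sub>R f + x3 *\<^sub>R n + x4 *\<^sub>R m"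
    using nframe_expand[OF fr, of u] by (simp add: x1_x2_x3_x4_def)
  have "B *v u = x1 *\<^sub>R (e + p *\<^sub>R n) + x2 *\<^sub>R (f + q *\<^sub>R n) + x3 *\<^sub>R n + x4 *\<^sub>R z"
    unfolding u by (simp add: matrix_vector_right_distrib matrix_vector_mult_scaleR B z_def)
  also have "\<dots> = u + (x1 * p + x2 * q) *\<^sub>R n - x4 *\<^sub>R (p *\<^sub>R e + q *\<^sub>R f + ((p\<^sup>2 + q\<^sup>2) / 2) *\<^sub>R n)"
    unfolding u z k by (simp add: algebra_simps)
  finally show ?thesis by (simp add: x1_x2_x3_x4_def)
qed

lemma hyperbolic_form:
  assumes fr: "nframe e f n m" and B: "B \<in> O31" "B *v n = l *\<^sub>R n" "B *v e = e" "B *v f = f"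
  shows "B *v u = u + ((l - 1) * lorentz u m) *\<^sub>R n + ((inverse l - 1) * lorentz u n) *\<^sub>R m"
proof -
  have r [simp]: "lorentz e e = 1" "lorentz f f = 1" "lorentz e f = 0" "lorentz n n = 0"
    "lorentz m m = 0" "lorentz n m = 1" "lorentz n e = 0" "lorentz n f = 0" "lorentz m e = 0"
    "lorentz m f = 0" "lorentz f e = 0" "lorentz m n = 1" "lorentz e n = 0" "lorentz f n = 0"
    "lorentz e m = 0" "lorentz f m = 0"
    using fr by (auto simp: nframe_def lorentz_commute)
  have "n \<noteq> 0" using r(6) by force
  then have l: "l \<noteq> 0" using O31_eigen_nonzero[OF B(1,2)] by simp
  define z where "z = B *v m"
  have "l * lorentz z n = 1" using O31_D[OF B(1), of m n] B by (simp add: z_def)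
  then have zn: "lorentz z n = inverse l" using l by (simp add: field_simps)
  have ze: "lorentz z e = 0" using O31_D[OF B(1), of m e] B by (simp add: z_def)
  have zf: "lorentz z f = 0" using O31_D[OF B(1), of m f] B by (simp add: z_def)
  obtain k where z: "z = k *\<^sub>R n + inverse l *\<^sub>R m"
    using nframe_expand[OF fr, of z] zn ze zf by auto
  have "lorentz z z = 0" using O31_D[OF B(1), of m m] by (simp add: z_def)
  then have k: "k = 0" using l by (simp add: z)
  define x1 x2 x3 x4 where "x1 = lorentz u e" "x2 = lorentz u f" "x3 = lorentz u m" "x4 = lorentz u n"
  have u: "u = x1 *\<^sub>R e + x2 *\<^sub>R f + x3 *\<^sub>R n + x4 *\<^sub>R m"
    using nframe_expand[OF fr, of u] by (simp add: x1_x2_x3_x4_def)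
  have "B *v u = x1 *\<^sub>R e + x2 *\<^sub>R f + x3 *\<^sub>R l *\<^sub>R n + x4 *\<^sub>R z"
    unfolding u by (simp add: matrix_vector_right_distrib matrix_vector_mult_scaleR B z_def)
  also have "\<dots> = u + ((l - 1) * x3) *\<^sub>R n + ((inverse l - 1) * x4) *\<^sub>R m"
    unfolding u z k by (simp add: algebra_simps)
  finally show ?thesis by (simp add: x1_x2_x3_x4_def)
qed

section \<open>Discrete groups of hyperbolic isometries\<close>

definition outer :: "real^4 \<Rightarrow> real^4 \<Rightarrow> mat4" where
  "outer n m = (\<chi> i j. n$i * ltwist m $ j)"

lemma outer_apply: "outer n m *v u = lorentz u m *\<^sub>R n"
  by (simp add: outer_def vec_eq_iff matrix_vector_mult_def sum_4 ltwist_def lorentz_def algebra_simps)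

lemma subspace_inverse_image:
  fixes A :: mat4
  assumes E: "subspace E" and A: "invertible A" "\<And>u. u \<in> E \<Longrightarrow> A *v u \<in> E" and u: "u \<in> E"
  shows "matrix_inv A *v u \<in> E"
proof -
  have inj: "inj_on ((*v) A) E" using inv_vec(1)[OF A(1)] by (metis inj_on_inverseI)
  have "(*v) A ` E = E"
  proof (rule subspace_dim_equal)
    show "subspace ((*v) A ` E)" by (rule linear_subspace_image) (auto simp: E)
    show "subspace E" by (rule E)
    show "(*v) A ` E \<subseteq> E" using A by auto
    show "dim E \<le> dim ((*v) A ` E)"
      using dim_image_eq[of "(*v) A" E] inj E by (simp add: span_eq_iff[THEN iffD2])
  qed
  then obtain w where "w \<in> E" "u = A *v w" using u by auto
  then show ?thesis using A(1) by simp
qed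

lemma perp_invariant:
  assumes E: "subspace E" and A: "A \<in> O31" "\<And>u. u \<in> E \<Longrightarrow> A *v u \<in> E" and v: "v \<in> perp E"
  shows "A *v v \<in> perp E"
  unfolding perp_def
proof (intro CollectI ballI)
  fix u assume u: "u \<in> E"
  have i: "invertible A" using O31_ladj(1)[OF A(1)] .
  have "lorentz u (A *v v) = lorentz (A *v (matrix_inv A *v u)) (A *v v)" using i by simp
  also have "\<dots> = lorentz (matrix_inv A *v u) v" using O31_D[OF A(1)] by simp
  also have "\<dots> = 0" using subspace_inverse_image[OF E i A(2) u] v by (simp add: perp_def)
  finally show "lorentz u (A *v v) = 0" .
qed

lemma mat4_mult_bound: "\<exists>B>0. \<forall>(X :: mat4) (Y :: mat4). norm (X ** Y) \<le> norm X * norm Y * B"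
  by (rule matmul.pos_bounded)

lemma span_pair: "u \<in> span {v, w} \<longleftrightarrow> (\<exists>p q. u = p *\<^sub>R v + q *\<^sub>R w)"
proof -
  have "u \<in> span {v, w} \<longleftrightarrow> (\<exists>k l. u - k *\<^sub>R v = l *\<^sub>R w)"
    by (simp add: span_insert[of v] span_singleton image_iff)
  then show ?thesis by (metis (no_types, lifting) add.commute diff_add_cancel add_diff_cancel_left')
qed

text \<open>\<open>M_discrete\<close> expresses faithfulness and discreteness at once: only the
  identity is mapped near the identity matrix. The elements \<open>x\<close> and \<open>c\<close>
  stand for the meridian and the boundary of the fibre; \<open>x_free\<close> and
  \<open>c_free\<close> make them generate a free abelian group of rank two.\<close>

locale lorentz_rep = fibre F G a b for F :: "'g set" and G :: "('g, 'm) monoid_scheme" (structure) and a b +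
  fixes x c :: 'g and M :: "'g \<Rightarrow> mat4"
  assumes M_O31p: "g \<in> carrier G \<Longrightarrow> M g \<in> O31p"
    and M_mult: "g \<in> carrier G \<Longrightarrow> h \<in> carrier G \<Longrightarrow> M (g \<otimes> h) = M g ** M h"
    and M_discrete: "\<exists>\<epsilon>>0. \<forall>g\<in>carrier G. norm (M g - mat 1) < \<epsilon> \<longrightarrow> g = \<one>"
    and x_carrier: "x \<in> carrier G" and c_mem: "c \<in> F" and xc: "x \<otimes> c = c \<otimes> x"
    and x_free: "x [^] (i::int) \<in> F \<Longrightarrow> i = 0" and c_free: "c [^] (i::int) = \<one> \<Longrightarrow> i = 0"
begin

lemma M_O31: "g \<in> carrier G \<Longrightarrow> M g \<in> O31"
  using M_O31p O31p_O31 by blast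

lemma M_invertible: "g \<in> carrier G \<Longrightarrow> invertible (M g)"
  using M_O31 O31_ladj(1) by blast

lemma M_one: "M \<one> = mat 1"
proof -
  have "matrix_inv (M \<one>) ** (M \<one> ** M \<one>) = matrix_inv (M \<one>) ** M \<one>"
    using M_mult[of \<one> \<one>] by simp
  then show ?thesis using M_invertible[of \<one>] by simp
qed

lemma M_inv: "g \<in> carrier G \<Longrightarrow> M (inv g) = matrix_inv (M g)"
  by (rule matrix_inv_unique[symmetric]) (simp add: M_mult[symmetric] M_one)

lemma M_inj: "g \<in> carrier G \<Longrightarrow> h \<in> carrier G \<Longrightarrow> M g = M h \<Longrightarrow> g = h"
proof -
  assume g: "g \<in> carrier G" and h: "h \<in> carrier G" and e: "M g = M h"
  have "M (g \<otimes> inv h) = mat 1" using g h e M_invertible by (simp add: M_mult M_inv)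
  then have "g \<otimes> inv h = \<one>" using M_discrete g h by fastforce
  then show "g = h" using g h by (metis inv_closed inv_equality inv_inv)
qed

definition inford :: "'g \<Rightarrow> bool" where
  "inford g \<longleftrightarrow> g \<in> carrier G \<and> (\<forall>n::nat. n > 0 \<longrightarrow> g [^] n \<noteq> \<one>)"

lemma inford_square: "inford g \<Longrightarrow> inford (g \<otimes> g)"
proof -
  assume g: "inford g"
  then have "g \<otimes> g = g [^] (2::nat)" by (simp add: inford_def numeral_2_eq_2)
  then show ?thesis using g by (auto simp: inford_def nat_pow_pow)
qed

lemma word_val_replicate: "word_val G a b (replicate n (s, True)) = (if s then a else b) [^] n"
proof (induction n)
  case (Suc n)
  have "(if s then a else b) \<in> carrier G" using ab_carrier by simp
  then show ?case using Suc nat_pow_Suc2 by (auto simp: word_val_Cons letter_val_def)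
qed simp

lemma reduced_replicate: "reduced_word (replicate n l)"
  unfolding reduced_word_def
proof (induction n)
  case (Suc n)
  then show ?case by (cases n) auto
qed simp

lemma inford_ab: "inford a" "inford b"
proof -
  have "(if s then a else b) [^] n \<noteq> \<one>" if "n > 0" for n :: nat and s
    using free reduced_replicate[of n "(s, True)"] that
    unfolding free_on_pair_def word_val_replicate[symmetric] by auto
  from this[of _ True] this[of _ False] show "inford a" "inford b"
    using ab_carrier by (auto simp: inford_def)
qed

lemma M_pow_fixed: "g \<in> carrier G \<Longrightarrow> M g *v t = t \<Longrightarrow> M (g [^] (n::nat)) *v t = t"
  by (induction n) (simp_all add: M_one M_mult matrix_vector_mul_assoc[symmetric])

text \<open>The stabiliser of a timelike vector is compact, so its discrete subgroups are finite.\<close>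

lemma no_timelike_fixed:
  assumes g: "inford g" and t: "lorentz t t < 0" and f: "M g *v t = t"
  shows False
proof -
  have gG: "g \<in> carrier G" using g by (simp add: inford_def)
  obtain \<epsilon> where \<epsilon>: "\<epsilon> > 0" "\<And>h. h \<in> carrier G \<Longrightarrow> norm (M h - mat 1) < \<epsilon> \<Longrightarrow> h = \<one>"
    using M_discrete by blast
  obtain K where K: "\<And>A. A \<in> O31 \<Longrightarrow> A *v t = t \<Longrightarrow> norm A \<le> K"
    using timelike_stabiliser_bounded[OF t] by blast
  obtain B where B: "B > 0" "\<forall>(X :: mat4) (Y :: mat4). norm (X ** Y) \<le> norm X * norm Y * B"
    using mat4_mult_bound by blast
  define s where "s n = M (g [^] (n::nat))" for n
  have sO: "s n \<in> O31" "s n *v t = t" for n using gG f M_pow_fixed by (auto simp: s_def M_O31)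
  have "bounded (range s)" using K sO by (auto simp: bounded_iff)
  then obtain l r where r: "strict_mono (r :: nat \<Rightarrow> nat)" "(s \<circ> r) \<longlonglongrightarrow> l"
    using bounded_imp_convergent_subsequence by blast
  \<comment> \<open>The inverse of each \<open>s i\<close> is bounded by
    \<open>\<bar>K\<bar>\<close>, so \<open>\<delta>\<close> is scaled such that the quotient of two
    powers at distance below \<open>\<delta>\<close> is within \<open>\<epsilon>\<close> of the
    identity.\<close>
  define \<delta> where "\<delta> = \<epsilon> / ((\<bar>K\<bar> + 1) * B)"
  have \<delta>: "\<delta> > 0" using \<epsilon> B by (simp add: \<delta>_def)
  have "Cauchy (s \<circ> r)" using r(2) by (rule LIMSEQ_imp_Cauchy)
  then have "\<exists>N. \<forall>m\<ge>N. \<forall>n\<ge>N. norm ((s \<circ> r) m - (s \<circ> r) n) < \<delta>" using \<delta> by (rule CauchyD)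
  then obtain N where N: "\<forall>m\<ge>N. \<forall>n\<ge>N. norm (s (r m) - s (r n)) < \<delta>" by auto
  define i j where "i = r N" "j = r (Suc N)"
  have ij: "i < j" using r(1) by (simp add: i_j_def strict_mono_def)
  have d: "norm (s j - s i) < \<delta>" using N by (simp add: i_j_def)
  have "g [^] j = g [^] i \<otimes> g [^] (j - i)" using ij gG by (simp add: nat_pow_mult)
  then have sj: "s j = s i ** s (j - i)" using gG by (simp add: s_def M_mult)
  have inv: "invertible (s i)" using gG by (simp add: s_def M_invertible)
  have nK: "norm (matrix_inv (s i)) \<le> \<bar>K\<bar>"
    using K[of "matrix_inv (s i)"] O31_inv[OF sO(1)] sO(2)[of i] inv by (metis abs_ge_self inv_vec(1) order_trans)
  have "s (j - i) - mat 1 = matrix_inv (s i) ** (s j - s i)"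
    using inv by (simp add: sj matmul.diff_right)
  then have "norm (s (j - i) - mat 1) \<le> norm (matrix_inv (s i)) * norm (s j - s i) * B" using B(2) by metis
  also have "\<dots> \<le> (\<bar>K\<bar> + 1) * norm (s j - s i) * B"
    using nK B(1) by (intro mult_right_mono) auto
  also have "\<dots> < (\<bar>K\<bar> + 1) * \<delta> * B"
    using d B(1) by (intro mult_strict_right_mono mult_strict_left_mono) auto
  also have "\<dots> = \<epsilon>" using B(1) by (simp add: \<delta>_def)
  finally have "g [^] (j - i) = \<one>" using \<epsilon>(2) gG by (simp add: s_def)
  then show False using g ij by (simp add: inford_def)
qed

lemma M_sq: "g \<in> carrier G \<Longrightarrow> M (g \<otimes> g) *v u = M g *v (M g *v u)"
  by (simp add: M_mult matrix_vector_mul_assoc)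

text \<open>Only the squares are assumed to preserve the line, because a generator may interchange
  two null lines. Their own squares, the fourth powers \<open>p\<close> and \<open>q\<close>, have
  commutators \<open>U\<close> and \<open>V\<close> whose images commute; by faithfulness
  \<open>U\<close> and \<open>V\<close> commute, which is a nontrivial relation between
  \<open>a\<close> and \<open>b\<close>.\<close>

lemma no_common_null:
  assumes n: "lorentz n n = 0" "n \<noteq> 0" and A: "M (a \<otimes> a) *v n = k *\<^sub>R n" and B: "M (b \<otimes> b) *v n = l *\<^sub>R n"
  shows False
proof -
  note ab = ab_carrier
  define p q where "p = a [^] (4::nat)" "q = b [^] (4::nat)"
  have pq: "p \<in> carrier G" "q \<in> carrier G" using ab by (simp_all add: p_q_def)
  have p: "p = (a \<otimes> a) \<otimes> (a \<otimes> a)" "q = (b \<otimes> b) \<otimes> (b \<otimes> b)"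
    using ab by (simp_all add: p_q_def numeral_eq_Suc m_assoc)
  define U V where "U = p \<otimes> q \<otimes> inv p \<otimes> inv q" "V = p \<otimes> inv q \<otimes> inv p \<otimes> q"
  have UV: "U \<in> carrier G" "V \<in> carrier G" using pq by (simp_all add: U_V_def)
  have "M U = mcomm (M p) (M q)" "M V = mcomm (M p) (matrix_inv (M q))"
    using pq M_invertible by (simp_all add: U_V_def mcomm_def M_mult M_inv)
  moreover have "M p = M (a \<otimes> a) ** M (a \<otimes> a)" "M q = M (b \<otimes> b) ** M (b \<otimes> b)"
    using ab by (simp_all add: p M_mult)
  ultimately have "M U ** M V = M V ** M U"
    using null_line_commutators[OF n M_O31 A M_O31 B] ab by simp
  then have "U \<otimes> V = V \<otimes> U" using UV by (intro M_inj) (simp_all add: M_mult)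
  then have one: "U \<otimes> V \<otimes> (inv U \<otimes> inv V) = \<one>" using UV by (simp add: inv_mult_group[symmetric])
  define P Q P' Q' where "P = replicate 4 (True, True)" "Q = replicate 4 (False, True)"
    "P' = replicate 4 (True, False)" "Q' = replicate 4 (False, False)"
  have PQ: "word_val G a b P = p" "word_val G a b Q = q"
    by (simp_all add: P_Q_P'_Q'_def p_q_def word_val_replicate)
  have "P' = rev (map inv_letter P)" "Q' = rev (map inv_letter Q)"
    by (simp_all add: P_Q_P'_Q'_def inv_letter_def)
  then have PQ': "word_val G a b P' = inv p" "word_val G a b Q' = inv q"
    using PQ by (simp_all add: word_val_rev[OF ab])
  \<comment> \<open>The commutator of \<open>U\<close> and \<open>V\<close> spelled out; at every
    junction the blocks either involve different generators or repeat \<open>Q\<close>, so nothing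
    cancels.\<close>
  define w where "w = P @ Q @ P' @ Q' @ P @ Q' @ P' @ Q @ Q @ P @ Q' @ P' @ Q' @ P @ Q @ P'"
  have "word_val G a b w = U \<otimes> V \<otimes> (inv U \<otimes> inv V)"
    using pq by (simp add: w_def word_val_append[OF ab] PQ PQ' U_V_def inv_mult_group m_assoc)
  then have "word_val G a b w = \<one>" using one by simp
  moreover have "reduced_word w"
    by (simp add: w_def P_Q_P'_Q'_def reduced_word_def numeral_eq_Suc)
  moreover have "w \<noteq> []" by (simp add: w_def P_Q_P'_Q'_def)
  ultimately show False using free by (auto simp: free_on_pair_def)
qed

section \<open>Invariant subspaces of the fibre group\<close>

definition inv_sub :: "(real^4) set \<Rightarrow> bool" where
  "inv_sub E \<longleftrightarrow> subspace E \<and> (\<forall>u\<in>E. M a *v u \<in> E \<and> M b *v u \<in> E)"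

lemma inv_sub_perp: "inv_sub E \<Longrightarrow> inv_sub (perp E)"
  using perp_invariant M_O31 ab_carrier subspace_perp by (auto simp: inv_sub_def)

text \<open>The intersection of \<open>E\<close> with its orthogonal space is invariant and totally
  null; orthogonal null vectors are proportional, so a nonzero \<open>n\<close> would span an
  invariant null line.\<close>

lemma no_null_radical:
  assumes E: "inv_sub E" and n: "n \<in> E" "n \<in> perp E"
  shows "n = 0"
proof (rule ccontr)
  assume n0: "n \<noteq> 0"
  have nn: "lorentz n n = 0" using n by (auto simp: perp_def)
  have *: "\<exists>k. M (g \<otimes> g) *v n = k *\<^sub>R n" if g: "g \<in> {a, b}" for g
  proof -
    have gG: "g \<in> carrier G" using g ab_carrier by auto
    have "M g *v n \<in> perp E" "M g *v n \<in> E" using g n E inv_sub_perp[OF E] by (auto simp: inv_sub_def)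
    then have "lorentz n (M g *v n) = 0" "lorentz (M g *v n) (M g *v n) = 0" using n(1) by (auto simp: perp_def)
    then obtain k where "M g *v n = k *\<^sub>R n" using null_orth(2)[OF nn n0] by blast
    then show ?thesis using M_sq[OF gG] by (simp add: matrix_vector_mult_scaleR)
  qed
  then show False using no_common_null[OF nn n0] by blast
qed

text \<open>The plane spanned by \<open>n\<close> and \<open>m\<close> has just two null lines and
  an isometry permutes them, so its square preserves each. The two cannot both go to the line of
  \<open>m\<close>, as their product would become zero.\<close>

lemma swap_null_pair:
  assumes A: "A \<in> O31" and n: "lorentz n n = 0" "lorentz m m = 0" "lorentz n m \<noteq> 0"
    and E: "\<And>u. u \<in> E \<Longrightarrow> \<exists>p q. u = p *\<^sub>R n + q *\<^sub>R m" "n \<in> E" "m \<in> E" "\<And>u. u \<in> E \<Longrightarrow> A *v u \<in> E"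
  shows "\<exists>k. A *v (A *v n) = k *\<^sub>R n"
proof -
  have null: "\<exists>k. A *v u = k *\<^sub>R n \<or> A *v u = k *\<^sub>R m" if u: "u \<in> E" "lorentz u u = 0" for u
  proof -
    obtain p q where pq: "A *v u = p *\<^sub>R n + q *\<^sub>R m" using E u by blast
    have "lorentz (A *v u) (A *v u) = 0" using O31_D[OF A] u by simp
    then have "p = 0 \<or> q = 0" using n by (simp add: pq lorentz_commute[of m n])
    then show ?thesis using pq by auto
  qed
  obtain k where k: "A *v n = k *\<^sub>R n \<or> A *v n = k *\<^sub>R m" using null[OF E(2) n(1)] by blast
  obtain l where l: "A *v m = l *\<^sub>R n \<or> A *v m = l *\<^sub>R m" using null[OF E(3) n(2)] by blast
  consider "A *v n = k *\<^sub>R n" | "A *v n = k *\<^sub>R m" "A *v m = l *\<^sub>R n" | "A *v n = k *\<^sub>R m" "A *v m = l *\<^sub>R m"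
    using k l by blast
  then show ?thesis
  proof cases
    case 3
    have "lorentz n m = lorentz (A *v n) (A *v m)" using O31_D[OF A] by simp
    also have "\<dots> = 0" using 3 n by simp
    finally show ?thesis using n by simp
  qed (auto simp: matrix_vector_mult_scaleR)
qed

lemma no_invariant_plane_timelike:
  assumes E: "inv_sub E" "dim E = 2" and t: "t \<in> E" "lorentz t t < 0"
  shows False
proof -
  have sE: "subspace E" using E by (simp add: inv_sub_def)
  have "\<not> E \<subseteq> span {t}"
    using dim_subset[of E "span {t}"] E(2) dim_le_card'[of "{t}"] by auto
  then obtain w where w: "w \<in> E" "w \<notin> span {t}" by blast
  define v where "v = w - (lorentz w t / lorentz t t) *\<^sub>R t"
  have v: "v \<in> E" unfolding v_def using sE w t by (intro subspace_diff subspace_scale)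
  have "v \<noteq> 0" using w(2) by (auto simp: v_def span_singleton)
  moreover have tv: "lorentz v t = 0" "lorentz t v = 0"
    using t(2) by (simp_all add: v_def lorentz_commute[of t w])
  ultimately have vv: "lorentz v v > 0" using timelike_orth[OF t(2)] by blast
  \<comment> \<open>Chosen so that the sum and the difference of \<open>t\<close> and
    \<open>k *\<^sub>R v\<close> are null: they span the two null lines of the plane.\<close>
  define k where "k = sqrt (- lorentz t t / lorentz v v)"
  have k: "k * k * lorentz v v = - lorentz t t" "k \<noteq> 0"
    using vv t(2) by (auto simp: k_def divide_nonpos_pos)
  define n m where "n = t + k *\<^sub>R v" "m = t - k *\<^sub>R v"
  have nm: "lorentz n n = 0" "lorentz m m = 0" "lorentz n m = 2 * lorentz t t"
    using k tv by (simp_all add: n_m_def algebra_simps)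
  have nmE: "n \<in> E" "m \<in> E" unfolding n_m_def using sE t v by (auto intro: subspace_add subspace_diff subspace_scale)
  have "independent {t, v}"
    by (rule lorentz_independent) (use t(2) vv tv in auto)
  moreover have "t \<noteq> v" using t(2) vv by auto
  ultimately have "dim (span {t, v}) = 2" by (simp add: dim_eq_card_independent)
  then have "span {t, v} = E"
    using subspace_dim_equal[of "span {t, v}" E] span_minimal[of "{t, v}" E] sE t v E(2) by auto
  have exp: "\<exists>p q. u = p *\<^sub>R n + q *\<^sub>R m" if "u \<in> E" for u
  proof -
    have "u \<in> span {t, v}" using that \<open>span {t, v} = E\<close> by simp
    then obtain \<alpha> \<beta> where "u = \<alpha> *\<^sub>R t + \<beta> *\<^sub>R v" unfolding span_pair by blast
    then have "u = ((\<alpha> + \<beta> / k) / 2) *\<^sub>R n + ((\<alpha> - \<beta> / k) / 2) *\<^sub>R m"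
      using k(2) by (simp add: n_m_def vec_eq_iff field_simps)
    then show ?thesis by blast
  qed
  have "\<exists>k. M (g \<otimes> g) *v n = k *\<^sub>R n" if g: "g \<in> {a, b}" for g
    using swap_null_pair[of "M g" n m E] g M_O31 ab_carrier nm t(2) exp nmE E M_sq by (auto simp: inv_sub_def)
  moreover have "n \<noteq> 0" using nm t(2) by auto
  ultimately show False using no_common_null[OF nm(1)] by blast
qed

text \<open>Without a radical, \<open>E\<close> and its orthogonal space are complementary planes;
  splitting a timelike vector shows that one of them contains a timelike vector.\<close>

lemma no_invariant_plane:
  assumes E: "inv_sub E" "dim E = 2"
  shows False
proof -
  have s: "subspace E" "subspace (perp E)" using E subspace_perp by (auto simp: inv_sub_def)
  have d: "dim (perp E) = 2" using dim_perp[OF s(1)] E by simp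
  have "E \<inter> perp E = {0}" using no_null_radical[OF E(1)] s subspace_0 by blast
  then have "dim {u + v |u v. u \<in> E \<and> v \<in> perp E} = 4"
    using dim_sums_Int[OF s] E(2) d by simp
  then have "{u + v |u v. u \<in> E \<and> v \<in> perp E} = UNIV"
    using dim_eq_full[of "{u + v |u v. u \<in> E \<and> v \<in> perp E}"] subspace_sums[OF s] by (simp add: span_eq_iff[THEN iffD2])
  then obtain u v where uv: "axis 4 1 = u + v" "u \<in> E" "v \<in> perp E" by blast
  have "lorentz u v = 0" "lorentz v u = 0" using uv by (auto simp: perp_def lorentz_commute)
  then have "lorentz u u + lorentz v v = -1" using axis4_fcone(2) uv(1) by simp
  then consider "lorentz u u < 0" | "lorentz v v < 0" by linarith
  then show False
    using no_invariant_plane_timelike[OF E uv(2)] no_invariant_plane_timelike[OF inv_sub_perp[OF E(1)] d uv(3)]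
    by cases auto
qed

end

lemma half_power2_sum: "((s::real) + t)\<^sup>2 / 2 = s\<^sup>2 / 2 + s * t + t\<^sup>2 / 2"
  by (simp add: power2_sum add_divide_distrib)

context lorentz_rep
begin

section \<open>Commuting pairs generating a free abelian group of rank two\<close>

definition free_abelian :: "'g \<Rightarrow> 'g \<Rightarrow> bool" where
  "free_abelian p q \<longleftrightarrow> p \<in> carrier G \<and> q \<in> carrier G \<and> p \<otimes> q = q \<otimes> p \<and>
     (\<forall>(i::int) (j::int). p [^] i \<otimes> q [^] j = \<one> \<longrightarrow> i = 0 \<and> j = 0)"

lemma free_abelian_xc: "free_abelian x c"
proof -
  have cG: "c \<in> carrier G" using c_mem by simp
  have "i = 0 \<and> j = 0" if e: "x [^] i \<otimes> c [^] j = \<one>" for i j :: int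
  proof -
    have cj: "c [^] j \<in> F" using c_mem subgroup_axioms by (metis int_pow_closed subgroup.subset subgroup_int_pow_closed)
    have "x [^] i = inv (c [^] j)" using e x_carrier cG by (metis int_pow_closed inv_equality)
    then have "x [^] i \<in> F" using cj by simp
    then have "i = 0" by (rule x_free)
    then show ?thesis using e c_free cG by simp
  qed
  then show ?thesis using x_carrier cG xc by (simp add: free_abelian_def)
qed

lemma free_abelian_square: "free_abelian p q \<Longrightarrow> free_abelian (p \<otimes> p) (q \<otimes> q)"
proof -
  assume pq: "free_abelian p q"
  then have c: "p \<in> carrier G" "q \<in> carrier G" "p \<otimes> q = q \<otimes> p" by (auto simp: free_abelian_def)
  have sq: "g \<otimes> g = g [^] (2::int)" if "g \<in> carrier G" for g
    using that int_pow_mult[of g 1 1] by simp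
  have "i = 0 \<and> j = 0" if "(p \<otimes> p) [^] i \<otimes> (q \<otimes> q) [^] j = \<one>" for i j :: int
  proof -
    have "p [^] (2 * i) \<otimes> q [^] (2 * j) = \<one>" using that c by (simp add: sq int_pow_pow)
    then have "2 * i = 0 \<and> 2 * j = 0" using pq unfolding free_abelian_def by blast
    then show ?thesis by simp
  qed
  moreover have "(p \<otimes> p) \<otimes> (q \<otimes> q) = (q \<otimes> q) \<otimes> (p \<otimes> p)"
  proof -
    have *: "p \<otimes> (q \<otimes> q) = (q \<otimes> q) \<otimes> p" using c by (metis m_assoc)
    have "(p \<otimes> p) \<otimes> (q \<otimes> q) = p \<otimes> (p \<otimes> (q \<otimes> q))" using c by (simp add: m_assoc)
    also have "\<dots> = p \<otimes> ((q \<otimes> q) \<otimes> p)" by (simp only: *)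
    also have "\<dots> = (p \<otimes> (q \<otimes> q)) \<otimes> p" using c(1,2) by (simp add: m_assoc)
    also have "\<dots> = ((q \<otimes> q) \<otimes> p) \<otimes> p" by (simp only: *)
    also have "\<dots> = (q \<otimes> q) \<otimes> (p \<otimes> p)" using c(1,2) by (simp add: m_assoc)
    finally show ?thesis .
  qed
  ultimately show ?thesis using c by (simp add: free_abelian_def)
qed

lemma free_abelian_inford: "free_abelian p q \<Longrightarrow> inford q"
proof -
  assume pq: "free_abelian p q"
  have "n = 0" if "q [^] n = \<one>" for n :: nat
  proof -
    have "p [^] (0::int) \<otimes> q [^] (int n) = \<one>" using that pq by (simp add: free_abelian_def int_pow_int)
    then have "int n = 0" using pq unfolding free_abelian_def by blast
    then show ?thesis by simp
  qed
  then show ?thesis using pq by (auto simp: inford_def free_abelian_def)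
qed

text \<open>A one-parameter group of isometries has no discrete subgroup of rank two: by Dirichlet's
  theorem integer combinations of two parameters come arbitrarily close to zero.\<close>

lemma one_parameter_contradiction:
  fixes f :: "real \<Rightarrow> mat4"
  assumes pq: "free_abelian p q" and f_add: "\<And>s t. f (s + t) = f s ** f t" and f_cont: "isCont f 0"
    and p: "M p = f \<sigma>" and q: "M q = f \<tau>"
  shows False
proof -
  have c: "p \<in> carrier G" "q \<in> carrier G" using pq by (auto simp: free_abelian_def)
  have f0: "f 0 = mat 1"
  proof -
    have "f \<sigma> ** f 0 = f \<sigma>" by (simp flip: f_add)
    then have "matrix_inv (M p) ** (M p ** f 0) = matrix_inv (M p) ** M p" by (simp add: p)
    then show ?thesis using M_invertible[OF c(1)] by simp
  qed
  have nat: "M (g [^] (n::nat)) = f (real n * s)" if "g \<in> carrier G" "M g = f s" for g n s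
  proof (induction n)
    case (Suc n)
    then show ?case using that by (simp add: M_mult f_add[symmetric] algebra_simps)
  qed (use that in \<open>simp add: M_one f0\<close>)
  have int: "M (g [^] (i::int)) = f (real_of_int i * s)" if g: "g \<in> carrier G" "M g = f s" for g i s
  proof (cases i rule: int_cases2)
    case (nonneg n)
    then show ?thesis using nat[OF g, of n] by (simp add: int_pow_int)
  next
    case n: (nonpos n)
    have "M (g [^] i) = matrix_inv (f (real n * s))"
      using nat[OF g, of n] g by (simp add: n int_pow_neg int_pow_int M_inv)
    also have "\<dots> = f (- (real n * s))"
      by (rule matrix_inv_unique) (simp add: f_add[symmetric] f0)
    finally show ?thesis by (simp add: n)
  qed
  obtain \<epsilon> where \<epsilon>: "\<epsilon> > 0" "\<And>h. h \<in> carrier G \<Longrightarrow> norm (M h - mat 1) < \<epsilon> \<Longrightarrow> h = \<one>"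
    using M_discrete by blast
  obtain \<delta> where \<delta>: "\<delta> > 0" "\<And>t. \<bar>t\<bar> < \<delta> \<Longrightarrow> norm (f t - mat 1) < \<epsilon>"
    using f_cont[unfolded continuous_at_eps_delta] \<epsilon>(1) by (metis f0 dist_norm diff_zero real_norm_def)
  have "\<exists>(i::int) (j::int). \<not> (i = 0 \<and> j = 0) \<and> \<bar>real_of_int i * \<sigma> + real_of_int j * \<tau>\<bar> < \<delta>"
  proof (cases "\<tau> = 0")
    case True
    then show ?thesis using \<delta> by (intro exI[of _ 0] exI[of _ 1]) simp
  next
    case False
    \<comment> \<open>With \<open>N\<close> above \<open>\<bar>\<tau>\<bar> / \<delta>\<close>, an
      integer multiple of \<open>\<sigma> / \<tau>\<close> within \<open>1 / N\<close> of an integer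
      becomes, after multiplication by \<open>\<tau>\<close>, an integer combination of
      \<open>\<sigma>\<close> and \<open>\<tau>\<close> of absolute value below
      \<open>\<delta>\<close>.\<close>
    obtain N :: nat where N: "\<bar>\<tau>\<bar> / \<delta> < real N" using reals_Archimedean2 by blast
    have N0: "N > 0" using N False \<delta> by (cases N) (auto simp: divide_less_0_iff not_less)
    obtain h k where k: "0 < k" "\<bar>real_of_int k * (\<sigma> / \<tau>) - real_of_int h\<bar> < 1 / real N"
      using Dirichlet_approx[OF N0, of "\<sigma> / \<tau>"] by metis
    have "\<bar>real_of_int k * \<sigma> + real_of_int (- h) * \<tau>\<bar> = \<bar>\<tau>\<bar> * \<bar>real_of_int k * (\<sigma> / \<tau>) - real_of_int h\<bar>"
      using False by (simp add: abs_mult[symmetric] field_simps)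
    also have "\<dots> < \<bar>\<tau>\<bar> * (1 / real N)" using k(2) False by (intro mult_strict_left_mono) auto
    also have "\<dots> < \<delta>" using N N0 \<delta> by (simp add: field_simps)
    finally show ?thesis using k(1) by (intro exI[of _ k] exI[of _ "- h"]) simp
  qed
  then obtain i j :: int where ij: "\<not> (i = 0 \<and> j = 0)" "\<bar>real_of_int i * \<sigma> + real_of_int j * \<tau>\<bar> < \<delta>" by blast
  have "M (p [^] i \<otimes> q [^] j) = f (real_of_int i * \<sigma> + real_of_int j * \<tau>)"
    using c int[OF c(1) p] int[OF c(2) q] by (simp add: M_mult f_add)
  then have "p [^] i \<otimes> q [^] j = \<one>" using \<epsilon>(2) \<delta>(2)[OF ij(2)] c by simp
  then show False using pq ij(1) unfolding free_abelian_def by blast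
qed

text \<open>Both isometries are translations along the axis joining the null lines of
  \<open>n\<close> and \<open>m\<close>. Built from the orthogonal idempotents \<open>N1\<close> and
  \<open>N2\<close>, the matrix \<open>g t\<close> is the translation scaling \<open>n\<close> by
  \<open>exp t\<close> and \<open>m\<close> by \<open>exp (- t)\<close>, so the parameters are
  logarithms of eigenvalues.\<close>

lemma hyperbolic_contradiction:
  assumes pq: "free_abelian p q" and fr: "nframe e f n m"
    and P: "M p *v e = e" "M p *v f = f" "M p *v n = k *\<^sub>R n" "k > 0"
    and Q: "M q *v e = e" "M q *v f = f" "M q *v n = l *\<^sub>R n" "l > 0"
  shows False
proof -
  have c: "p \<in> carrier G" "q \<in> carrier G" using pq by (auto simp: free_abelian_def)
  have r [simp]: "lorentz n n = 0" "lorentz m m = 0" "lorentz n m = 1" "lorentz m n = 1"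
    using fr by (auto simp: nframe_def lorentz_commute)
  define N1 N2 where "N1 = outer n m" "N2 = outer m n"
  have N: "N1 ** N1 = N1" "N1 ** N2 = 0" "N2 ** N1 = 0" "N2 ** N2 = N2"
    by (simp_all add: matrix_eq matrix_vector_mul_assoc[symmetric] N1_N2_def outer_apply)
  define g where "g t = mat 1 + (exp t - 1) *\<^sub>R N1 + (exp (- t) - 1) *\<^sub>R N2" for t :: real
  have form: "B = g (ln k)" if "B \<in> O31" "B *v e = e" "B *v f = f" "B *v n = k *\<^sub>R n" "k > 0" for B k
    using that(5) hyperbolic_form[OF fr that(1,4,2,3)]
    by (simp add: matrix_eq g_def N1_N2_def outer_apply matrix_vector_mult_add_rdistrib
        scaleR_matrix_vector_assoc[symmetric] exp_minus)
  have "g (s + t) = g s ** g t" for s t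
  proof -
    have "(mat 1 + k *\<^sub>R N1 + l *\<^sub>R N2) ** (mat 1 + k' *\<^sub>R N1 + l' *\<^sub>R N2)
        = mat 1 + (k + k' + k * k') *\<^sub>R N1 + (l + l' + l * l') *\<^sub>R N2" for k l k' l'
      by (simp add: matmul.add_left matmul.add_right matmul.scaleR_left matmul.scaleR_right N
          scaleR_add_left scaleR_add_right add_ac mult.commute)
    then have "g s ** g t = mat 1 + ((exp s - 1) + (exp t - 1) + (exp s - 1) * (exp t - 1)) *\<^sub>R N1
        + ((exp (- s) - 1) + (exp (- t) - 1) + (exp (- s) - 1) * (exp (- t) - 1)) *\<^sub>R N2"
      unfolding g_def .
    moreover have e: "(exp s - 1) + (exp t - 1) + (exp s - 1) * (exp t - 1) = exp (s + t) - 1" for s t :: real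
      by (simp add: exp_add algebra_simps)
    have "- s + - t = - (s + t)" by simp
    ultimately show ?thesis unfolding g_def e by (simp only: )
  qed
  moreover have "isCont g 0" unfolding g_def by (intro continuous_intros)
  moreover have "M p = g (ln k)" "M q = g (ln l)" using form P Q M_O31 c by auto
  ultimately show False using one_parameter_contradiction[OF pq] by blast
qed

text \<open>The cube of \<open>N\<close> is zero and \<open>g t\<close> is the exponential of
  \<open>t *\<^sub>R N\<close>: isometries that fix \<open>n\<close> and \<open>e\<close> and move
  \<open>f\<close> by a multiple of \<open>n\<close> form one one-parameter group, parametrised by
  that multiple.\<close>

lemma parabolic_contradiction:
  assumes pq: "free_abelian p q" and fr: "nframe e f n m"
    and P: "M p *v e = e" "M p *v n = n" "M p *v f = f + \<alpha> *\<^sub>R n"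
    and Q: "M q *v e = e" "M q *v n = n" "M q *v f = f + \<beta> *\<^sub>R n"
  shows False
proof -
  have c: "p \<in> carrier G" "q \<in> carrier G" using pq by (auto simp: free_abelian_def)
  have r [simp]: "lorentz n n = 0" "lorentz f f = 1" "lorentz n f = 0" "lorentz f n = 0"
    using fr by (auto simp: nframe_def lorentz_commute)
  define N where "N = outer n f - outer f n"
  have Na: "N *v u = lorentz u f *\<^sub>R n - lorentz u n *\<^sub>R f" for u
    by (simp add: N_def matrix_vector_mult_diff_rdistrib outer_apply)
  have N3: "N ** (N ** N) = 0"
    by (simp add: matrix_eq matrix_vector_mul_assoc[symmetric] Na)
  define g where "g t = mat 1 + t *\<^sub>R N + (t\<^sup>2 / 2) *\<^sub>R (N ** N)" for t :: real
  have form: "B = g t" if "B \<in> O31" "B *v e = e" "B *v n = n" "B *v f = f + t *\<^sub>R n" for B t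
    using parabolic_form[OF fr that(1,3), of 0 t] that
    by (simp add: matrix_eq g_def matrix_vector_mult_add_rdistrib scaleR_matrix_vector_assoc[symmetric]
        matrix_vector_mul_assoc[symmetric] Na) (simp add: algebra_simps)
  have "g (s + t) = g s ** g t" for s t
  proof -
    have N4: "N ** N ** N = 0" "N ** N ** (N ** N) = 0" using N3 by (simp_all add: matrix_mul_assoc)
    have "(mat 1 + k *\<^sub>R N + k' *\<^sub>R (N ** N)) ** (mat 1 + l *\<^sub>R N + l' *\<^sub>R (N ** N))
        = mat 1 + (k + l) *\<^sub>R N + (k' + k * l + l') *\<^sub>R (N ** N)" for k l k' l'
      by (simp add: matmul.add_left matmul.add_right matmul.scaleR_left matmul.scaleR_right N3 N4
          scaleR_add_left scaleR_add_right add_ac mult.commute)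
    then have "g s ** g t = mat 1 + (s + t) *\<^sub>R N + (s\<^sup>2 / 2 + s * t + t\<^sup>2 / 2) *\<^sub>R (N ** N)"
      unfolding g_def .
    then show ?thesis unfolding g_def[of "s + t"] half_power2_sum by (rule sym)
  qed
  moreover have "isCont g 0" unfolding g_def by (intro continuous_intros) simp
  moreover have "M p = g \<alpha>" "M q = g \<beta>" using form P Q M_O31 c by auto
  ultimately show False using one_parameter_contradiction[OF pq] by blast
qed

lemma isometry_scale: "A \<in> O31 \<Longrightarrow> A *v u = k *\<^sub>R u \<Longrightarrow> lorentz u u \<noteq> 0 \<Longrightarrow> k * k = 1"
  using O31_D[of A u u] by simp

text \<open>The eigenvector in the cone cannot be timelike: its eigenvalue would be 1, and an
  element of infinite order fixes no timelike vector.\<close>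

lemma null_cone_eigenvector:
  assumes g: "inford g" and s: "M g *v s = s" "lorentz s s = 1 \<or> s = 0"
  obtains n \<xi> where "n \<noteq> 0" "lorentz n n = 0" "lorentz n s = 0" "\<xi> > 0" "M g *v n = \<xi> *\<^sub>R n"
proof -
  have gG: "g \<in> carrier G" using g by (simp add: inford_def)
  obtain n \<xi> where n: "n \<in> fcone" "lorentz n s = 0" "\<xi> > 0" "M g *v n = \<xi> *\<^sub>R n"
    using cone_eigenvector[OF M_O31p[OF gG] s] .
  have "lorentz n n = 0"
  proof (rule ccontr)
    assume "lorentz n n \<noteq> 0"
    moreover from this have "\<xi> * \<xi> = 1" using isometry_scale[OF M_O31[OF gG] n(4)] by blast
    then have "\<xi> = 1" using n(3) by (simp add: square_eq_1_iff)
    ultimately show False using no_timelike_fixed[OF g, of n] n by (auto simp: fcone_def)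
  qed
  moreover have "n \<noteq> 0" using n(1) by (auto simp: fcone_def)
  ultimately show ?thesis using that n by blast
qed

text \<open>On the orthogonal space of \<open>s\<close> the two act as commuting isometries of the
  hyperbolic plane. The eigenvalue \<open>\<xi>\<close> of \<open>Q\<close> on a null vector
  separates the hyperbolic case from the parabolic one; in both, commuting puts the squares of
  \<open>P\<close> and \<open>Q\<close> into the same one-parameter group, squaring being what
  removes reflections.\<close>

lemma no_fixed_spacelike:
  assumes pq: "free_abelian p q" and s: "lorentz s s = 1" and Ps: "M p *v s = s" and Qs: "M q *v s = s"
  shows False
proof -
  have c: "p \<in> carrier G" "q \<in> carrier G" using pq by (auto simp: free_abelian_def)
  define P Q where "P = M p" "Q = M q"
  have PO: "P \<in> O31" "Q \<in> O31" using c by (simp_all add: P_Q_def M_O31)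
  have PQ: "P *v (Q *v u) = Q *v (P *v u)" for u
    using pq by (simp add: P_Q_def matrix_vector_mul_assoc M_mult[symmetric] free_abelian_def)
  have fx: "P *v s = s" "Q *v s = s" using Ps Qs by (simp_all add: P_Q_def)
  have sq: "M (p \<otimes> p) *v u = P *v (P *v u)" "M (q \<otimes> q) *v u = Q *v (Q *v u)" for u
    using c by (simp_all add: P_Q_def M_sq)
  obtain n \<xi> where n: "n \<noteq> 0" "lorentz n n = 0" "lorentz n s = 0" "\<xi> > 0" "Q *v n = \<xi> *\<^sub>R n"
    using null_cone_eigenvector[OF free_abelian_inford[OF pq] Qs] s unfolding P_Q_def by metis
  obtain e m where fr: "nframe s e n m" using nframe_complete_spacelike[OF s n(2,1,3)] by blast
  note expand = nframe_expand[OF fr]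
  have r [simp]: "lorentz s s = 1" "lorentz e e = 1" "lorentz s e = 0" "lorentz n n = 0"
    "lorentz m m = 0" "lorentz n m = 1" "lorentz n s = 0" "lorentz n e = 0" "lorentz m s = 0"
    "lorentz m e = 0" "lorentz e s = 0" "lorentz m n = 1" "lorentz s n = 0" "lorentz e n = 0"
    "lorentz s m = 0" "lorentz e m = 0"
    using fr by (auto simp: nframe_def lorentz_commute)
  have pres: "lorentz (P *v u) s = lorentz u s" "lorentz (Q *v u) s = lorentz u s" for u
    using O31_D[OF PO(1), of u s] O31_D[OF PO(2), of u s] fx by simp_all
  have Qn: "\<xi> * lorentz (Q *v u) n = lorentz u n" for u
    using O31_D[OF PO(2), of u n] n(5) by simp
  have unit: "\<exists>\<eta> \<kappa>. \<eta> * \<eta> = 1 \<and> u = \<eta> *\<^sub>R e + \<kappa> *\<^sub>R n"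
    if "lorentz u u = 1" "lorentz u s = 0" "lorentz u n = 0" for u
  proof -
    define \<eta> \<kappa> where "\<eta> = lorentz u e" "\<kappa> = lorentz u m"
    have u: "u = \<eta> *\<^sub>R e + \<kappa> *\<^sub>R n" using expand[of u] that by (simp add: \<eta>_\<kappa>_def)
    have "lorentz (\<eta> *\<^sub>R e + \<kappa> *\<^sub>R n) (\<eta> *\<^sub>R e + \<kappa> *\<^sub>R n) = \<eta> * \<eta>" by simp
    then have "\<eta> * \<eta> = 1" using that(1) u by metis
    then show ?thesis using u by blast
  qed
  have mt: "lorentz (n - m) (n - m) < 0" by simp
  have infq2: "inford (q \<otimes> q)" using free_abelian_inford[OF pq] by (rule inford_square)
  show False
  proof (cases "\<xi> = 1")
    case False
    then have xi: "\<xi> * \<xi> \<noteq> 1" using n(4) by (simp add: square_eq_1_iff)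
    have Pn: "\<exists>\<mu>. P *v n = \<mu> *\<^sub>R n"
    proof -
      have QPn: "Q *v (P *v n) = \<xi> *\<^sub>R (P *v n)" by (simp add: PQ[symmetric] n(5) matrix_vector_mult_scaleR)
      have "lorentz (P *v n) n = (\<xi> * \<xi>) * lorentz (P *v n) n"
        using O31_D[OF PO(2), of "P *v n" n] by (simp add: QPn n(5))
      then have "lorentz n (P *v n) = 0" using xi by (simp add: lorentz_commute[of n])
      moreover have "lorentz (P *v n) (P *v n) = 0" using O31_D[OF PO(1)] by simp
      ultimately show ?thesis using null_orth(2)[OF n(2,1)] by blast
    qed
    then obtain \<mu> where \<mu>: "P *v n = \<mu> *\<^sub>R n" by blast
    have \<mu>0: "\<mu> \<noteq> 0" using O31_eigen_nonzero[OF PO(1) \<mu> n(1)] .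
    have "lorentz (Q *v e) n = 0" using Qn[of e] n(4) by simp
    moreover have "lorentz (Q *v e) (Q *v e) = 1" using O31_D[OF PO(2)] by simp
    ultimately obtain \<eta> \<kappa> where \<eta>: "\<eta> * \<eta> = 1" "Q *v e = \<eta> *\<^sub>R e + \<kappa> *\<^sub>R n"
      using unit[of "Q *v e"] pres(2)[of e] by auto
    define \<kappa>' where "\<kappa>' = \<eta> * \<kappa> + \<kappa> * \<xi>"
    have Q2e: "Q *v (Q *v e) = e + \<kappa>' *\<^sub>R n"
      using \<eta>(1) by (simp add: \<eta>(2) matrix_vector_right_distrib matrix_vector_mult_scaleR n(5) \<kappa>'_def scaleR_add_left scaleR_add_right)
    have Q2n: "Q *v (Q *v n) = (\<xi> * \<xi>) *\<^sub>R n" by (simp add: n(5) matrix_vector_mult_scaleR)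
    \<comment> \<open>\<open>z\<close> solves \<open>\<kappa>' + z * (\<xi> * \<xi>) = z\<close>, so
      that \<open>e + z *\<^sub>R n\<close> is a unit vector fixed by the square of
      \<open>Q\<close>.\<close>
    define z where "z = \<kappa>' / (1 - \<xi> * \<xi>)"
    define v where "v = e + z *\<^sub>R n"
    have "\<kappa>' + z * (\<xi> * \<xi>) = z" using xi by (simp add: z_def field_simps)
    then have Q2v: "Q *v (Q *v v) = v"
      by (simp add: v_def matrix_vector_right_distrib matrix_vector_mult_scaleR Q2e n(5))
        (simp add: scaleR_add_left[symmetric] mult_ac)
    have v: "lorentz v v = 1" "lorentz s v = 0" "lorentz v s = 0" "lorentz n v = 0" "lorentz v n = 0"
      by (simp_all add: v_def)
    obtain m' where fr': "nframe s v n m'"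
      using nframe_complete_null[of s v n] v n by auto
    have "\<mu> * lorentz (P *v v) n = lorentz (P *v v) (P *v n)" by (simp add: \<mu>)
    also have "\<dots> = 0" using O31_D[OF PO(1), of v n] v by simp
    finally have "lorentz (P *v v) n = 0" using \<mu>0 by simp
    moreover have "lorentz (P *v v) (P *v v) = 1" using O31_D[OF PO(1)] v by simp
    ultimately obtain \<theta> \<zeta> where \<theta>: "\<theta> * \<theta> = 1" "P *v v = \<theta> *\<^sub>R e + \<zeta> *\<^sub>R n"
      using unit[of "P *v v"] pres(1)[of v] v by auto
    define \<zeta>' where "\<zeta>' = \<zeta> - \<theta> * z"
    have Pv: "P *v v = \<theta> *\<^sub>R v + \<zeta>' *\<^sub>R n" unfolding \<theta>(2) by (simp add: v_def \<zeta>'_def algebra_simps)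
    have "Q *v (Q *v (P *v v)) = P *v v" by (simp add: PQ[symmetric] Q2v)
    then have "\<zeta>' * (\<xi> * \<xi>) = \<zeta>'"
      using n(1) by (simp add: Pv matrix_vector_right_distrib matrix_vector_mult_scaleR Q2v n(5) mult_ac)
    then have "\<zeta>' = 0" using xi by simp
    then have "P *v (P *v v) = v" using \<theta>(1) by (simp add: Pv matrix_vector_mult_scaleR)
    moreover have "P *v (P *v n) = (\<mu> * \<mu>) *\<^sub>R n" by (simp add: \<mu> matrix_vector_mult_scaleR)
    moreover have "\<mu> * \<mu> > 0" "\<xi> * \<xi> > 0" using \<mu>0 n(4) by (auto simp: zero_less_mult_iff linorder_neq_iff)
    ultimately show False
      using hyperbolic_contradiction[OF free_abelian_square[OF pq] fr', where k = "\<mu> * \<mu>" and l = "\<xi> * \<xi>"]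
        fx Q2v Q2n by (simp add: sq)
  next
    case True
    then have Q1: "Q *v n = n" using n(5) by simp
    have "lorentz (Q *v e) n = 0" using Qn[of e] True by simp
    moreover have "lorentz (Q *v e) (Q *v e) = 1" using O31_D[OF PO(2)] by simp
    ultimately obtain \<eta> \<kappa> where \<eta>: "\<eta> * \<eta> = 1" "Q *v e = \<eta> *\<^sub>R e + \<kappa> *\<^sub>R n"
      using unit[of "Q *v e"] pres(2)[of e] by auto
    define \<beta> where "\<beta> = \<eta> * \<kappa> + \<kappa>"
    have Q2e: "Q *v (Q *v e) = e + \<beta> *\<^sub>R n"
      using \<eta>(1) by (simp add: \<eta>(2) matrix_vector_right_distrib matrix_vector_mult_scaleR Q1 \<beta>_def scaleR_add_left scaleR_add_right)
    have Q2O: "Q ** Q \<in> O31" using PO by (simp add: O31_mult)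
    have Q2u: "Q *v (Q *v u) = u + (lorentz u e * \<beta>) *\<^sub>R n - lorentz u n *\<^sub>R (\<beta> *\<^sub>R e + (\<beta>\<^sup>2 / 2) *\<^sub>R n)" for u
      using parabolic_form[OF fr Q2O, of 0 \<beta> u] by (simp add: matrix_vector_mul_assoc[symmetric] Q1 fx Q2e)
    have \<beta>0: "\<beta> \<noteq> 0"
    proof
      assume "\<beta> = 0"
      then have "M (q \<otimes> q) *v (n - m) = n - m" by (simp add: sq Q2u)
      then show False using no_timelike_fixed[OF infq2 mt] by blast
    qed
    \<comment> \<open>\<open>D\<close> is the square of \<open>Q\<close> minus the identity. Its own
      square has rank one with image the line of \<open>n\<close>, so \<open>P\<close>, which
      commutes with it, preserves this line.\<close>
    define D where "D u = Q *v (Q *v u) - u" for u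
    have D: "D (D u) = (- (\<beta>\<^sup>2) * lorentz u n) *\<^sub>R n" for u
      by (simp add: D_def Q2u algebra_simps power2_eq_square)
    have PD: "P *v D u = D (P *v u)" for u
      by (simp add: D_def matrix_vector_mult_diff_distrib PQ)
    have "P *v D (D m) = D (D (P *v m))" by (simp add: PD)
    then have "(- (\<beta>\<^sup>2)) *\<^sub>R (P *v n) = (- (\<beta>\<^sup>2)) *\<^sub>R (lorentz (P *v m) n *\<^sub>R n)"
      unfolding D matrix_vector_mult_scaleR by (simp only: r scaleR_scaleR mult_1_right)
    then obtain \<mu> where \<mu>: "P *v n = \<mu> *\<^sub>R n" using \<beta>0 by (metis neg_equal_0_iff_equal scaleR_left_imp_eq zero_eq_power2)
    have \<mu>0: "\<mu> \<noteq> 0" using O31_eigen_nonzero[OF PO(1) \<mu> n(1)] .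
    have "\<mu> * lorentz (P *v e) n = lorentz (P *v e) (P *v n)" by (simp add: \<mu>)
    also have "\<dots> = 0" using O31_D[OF PO(1), of e n] by simp
    finally have "lorentz (P *v e) n = 0" using \<mu>0 by simp
    moreover have "lorentz (P *v e) (P *v e) = 1" using O31_D[OF PO(1)] by simp
    ultimately obtain \<theta> \<zeta> where \<theta>: "\<theta> * \<theta> = 1" "P *v e = \<theta> *\<^sub>R e + \<zeta> *\<^sub>R n"
      using unit[of "P *v e"] pres(1)[of e] by auto
    \<comment> \<open>Comparing coefficients of \<open>n\<close> identifies the eigenvalue
      \<open>\<mu>\<close> of \<open>P\<close> with the sign \<open>\<theta>\<close>, so
      \<open>\<mu>\<close> squares to 1.\<close>
    have "P *v D e = D (P *v e)" by (rule PD)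
    moreover have "D e = \<beta> *\<^sub>R n" "D (P *v e) = (\<theta> * \<beta>) *\<^sub>R n" by (simp_all add: D_def Q2u \<theta>(2))
    ultimately have "\<beta> * \<mu> = \<theta> * \<beta>" using n(1) by (simp add: matrix_vector_mult_scaleR \<mu>)
    then have "\<mu> = \<theta>" using \<beta>0 by simp
    then have "P *v (P *v n) = n" using \<theta>(1) by (simp add: \<mu> matrix_vector_mult_scaleR)
    moreover define \<alpha> where "\<alpha> = \<theta> * \<zeta> + \<zeta> * \<theta>"
    have "P *v (P *v e) = e + \<alpha> *\<^sub>R n"
      using \<theta>(1) \<mu> \<open>\<mu> = \<theta>\<close> unfolding \<alpha>_def scaleR_add_left by (simp add: \<theta>(2) matrix_vector_right_distrib matrix_vector_mult_scaleR scaleR_add_left scaleR_add_right)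
    ultimately show False
      using parabolic_contradiction[OF free_abelian_square[OF pq] fr, where \<alpha> = \<alpha> and \<beta> = \<beta>] fx Q1 Q2e by (simp add: sq)
  qed
qed

lemma no_invariant_line:
  assumes A: "M a *v u = k *\<^sub>R u" and B: "M b *v u = l *\<^sub>R u"
  shows "u = 0"
proof (rule ccontr)
  assume u: "u \<noteq> 0"
  note ab = ab_carrier
  have sqa: "M (a \<otimes> a) *v u = (k * k) *\<^sub>R u" "M (b \<otimes> b) *v u = (l * l) *\<^sub>R u"
    using ab by (simp_all add: M_sq A B matrix_vector_mult_scaleR)
  consider "lorentz u u = 0" | "lorentz u u < 0" | "lorentz u u > 0" by linarith
  then show False
  proof cases
    case 1
    then show ?thesis using no_common_null[OF _ u sqa] by simp
  next
    case 2
    then have "k * k = 1" using isometry_scale[OF M_O31[OF ab(1)] A] by simp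
    then show ?thesis using no_timelike_fixed[OF inford_square[OF inford_ab(1)] 2] sqa(1) by simp
  next
    case 3
    then obtain r where r: "r \<noteq> 0" "lorentz (r *\<^sub>R u) (r *\<^sub>R u) = 1" by (rule spacelike_normalize)
    define s where "s = r *\<^sub>R u"
    have s: "lorentz s s = 1" using r by (simp add: s_def)
    have kl: "k * k = 1" "l * l = 1"
      using isometry_scale[OF M_O31[OF ab(1)] A] isometry_scale[OF M_O31[OF ab(2)] B] 3 by auto
    have sgn: "\<exists>\<eta>. \<eta> * \<eta> = 1 \<and> M g *v s = \<eta> *\<^sub>R s" if "g \<in> F" for g
      using that
    proof (induction rule: F_induct)
      case one
      show ?case by (rule exI[of _ 1]) (simp add: M_one)
    next
      case a
      show ?case by (rule exI[of _ k]) (simp add: s_def A kl matrix_vector_mult_scaleR mult.commute)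
    next
      case b
      show ?case by (rule exI[of _ l]) (simp add: s_def B kl matrix_vector_mult_scaleR mult.commute)
    next
      case (inv g)
      then obtain \<eta> where \<eta>: "\<eta> * \<eta> = 1" "M g *v s = \<eta> *\<^sub>R s" by blast
      have "M (inv g) *v s = (\<eta> * \<eta>) *\<^sub>R (M (inv g) *v s)" using \<eta>(1) by simp
      also have "\<dots> = \<eta> *\<^sub>R (M (inv g) *v (M g *v s))" by (simp add: \<eta>(2) matrix_vector_mult_scaleR)
      also have "\<dots> = \<eta> *\<^sub>R s" using inv(1) M_invertible by (simp add: M_inv)
      finally show ?case using \<eta>(1) by blast
    next
      case (mult g h)
      then obtain \<eta> \<theta> where "\<eta> * \<eta> = 1" "M g *v s = \<eta> *\<^sub>R s" "\<theta> * \<theta> = 1" "M h *v s = \<theta> *\<^sub>R s" by blast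
      then show ?case using mult(1,2)
        by (intro exI[of _ "\<eta> * \<theta>"])
          (simp add: M_mult matrix_vector_mul_assoc[symmetric] matrix_vector_mult_scaleR mult_ac)
    qed
    define X where "X = M x"
    have gX: "\<exists>\<eta>. M g *v (X *v s) = \<eta> *\<^sub>R (X *v s)" if g: "g \<in> F" for g
    proof -
      have cg: "inv x \<otimes> g \<otimes> x \<in> F" using inv_op_closed1[OF x_carrier g] .
      then obtain \<eta> where \<eta>: "M (inv x \<otimes> g \<otimes> x) *v s = \<eta> *\<^sub>R s" using sgn by blast
      have "g \<otimes> x = x \<otimes> (inv x \<otimes> g \<otimes> x)" using g x_carrier by (simp flip: m_assoc)
      then have "M g ** X = X ** M (inv x \<otimes> g \<otimes> x)"
        using g cg x_carrier by (simp add: X_def M_mult[symmetric])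
      then have "M g *v (X *v s) = X *v (M (inv x \<otimes> g \<otimes> x) *v s)" by (simp add: matrix_vector_mul_assoc)
      then show ?thesis using \<eta> by (auto simp: matrix_vector_mult_scaleR)
    qed
    \<comment> \<open>\<open>F\<close> is normal, so each of its elements acts by a scalar on
      \<open>X *v s\<close> as well as on \<open>s\<close>. If the two were independent they would
      span an invariant plane.\<close>
    have "X *v s \<in> span {s}"
    proof (rule ccontr)
      assume ns: "X *v s \<notin> span {s}"
      define E where "E = span {s, X *v s}"
      have "s \<noteq> 0" using s by auto
      then have "independent {X *v s, s}"
        using ns independent_insertI[of "X *v s" "{s}"] by (simp add: insert_commute)
      moreover have "X *v s \<noteq> s" using ns by (metis span_base singletonI)
      ultimately have "dim E = 2" by (simp add: E_def insert_commute dim_eq_card_independent)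
      moreover have "inv_sub E"
        unfolding inv_sub_def
      proof (intro conjI ballI)
        fix w assume "w \<in> E"
        then obtain p q where w: "w = p *\<^sub>R s + q *\<^sub>R (X *v s)" unfolding E_def span_pair by blast
        have "M g *v w \<in> E" if g: "g \<in> F" for g
        proof -
          obtain \<eta> \<theta> where e: "M g *v s = \<eta> *\<^sub>R s" "M g *v (X *v s) = \<theta> *\<^sub>R (X *v s)"
            using sgn[OF g] gX[OF g] by blast
          show ?thesis unfolding w matrix_vector_right_distrib matrix_vector_mult_scaleR e E_def span_pair
            by (metis scaleR_scaleR)
        qed
        then show "M a *v w \<in> E" "M b *v w \<in> E" using ab_mem by auto
      qed (simp add: E_def)
      ultimately show False using no_invariant_plane by blast
    qed
    then obtain \<kappa> where \<kappa>: "X *v s = \<kappa> *\<^sub>R s" by (auto simp: span_singleton)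
    then have "\<kappa> * \<kappa> = 1" using isometry_scale[OF M_O31[OF x_carrier]] s by (simp add: X_def)
    then have "M (x \<otimes> x) *v s = s" using \<kappa> x_carrier by (simp add: M_sq X_def matrix_vector_mult_scaleR)
    moreover obtain \<eta> where "\<eta> * \<eta> = 1" "M c *v s = \<eta> *\<^sub>R s" using sgn[OF c_mem] by blast
    then have "M (c \<otimes> c) *v s = s" using c_mem by (simp add: M_sq matrix_vector_mult_scaleR)
    ultimately show False
      using no_fixed_spacelike[OF free_abelian_square[OF free_abelian_xc] s] by blast
  qed
qed

section \<open>Irreducibility and the scalar commutant\<close>

lemma inv_sub_dim1: assumes E: "inv_sub E" "dim E = 1" shows False
proof -
  obtain u where u: "u \<in> E" "u \<noteq> 0" using E dim_eq_0[of E] by auto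
  have sE: "subspace E" using E by (simp add: inv_sub_def)
  have "span {u} = E"
    using subspace_dim_equal[of "span {u}" E] span_minimal[of "{u}" E] sE u E(2) by (simp add: dim_singleton)
  then have "\<exists>k. w = k *\<^sub>R u" if "w \<in> E" for w using that by (auto simp: span_singleton)
  moreover have "M a *v u \<in> E" "M b *v u \<in> E" using E u by (auto simp: inv_sub_def)
  ultimately obtain k l where "M a *v u = k *\<^sub>R u" "M b *v u = l *\<^sub>R u" by blast
  then have "u = 0" by (rule no_invariant_line)
  with u show False by simp
qed

lemma irreducible:
  assumes E: "inv_sub E" "u \<in> E" "u \<noteq> 0" shows "E = UNIV"
proof -
  have sE: "subspace E" using E by (simp add: inv_sub_def)
  have d: "dim E \<le> 4" using dim_subset_UNIV[of E] by simp
  have "dim E \<noteq> 0" using E by auto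
  moreover have "dim E \<noteq> 1" "dim E \<noteq> 2" using inv_sub_dim1 no_invariant_plane E by auto
  moreover have "dim E \<noteq> 3" using inv_sub_dim1[OF inv_sub_perp[OF E(1)]] dim_perp[OF sE] by auto
  ultimately have "dim E = 4" using d by linarith
  then show ?thesis using dim_eq_full[of E] sE by (simp add: span_eq_iff[THEN iffD2])
qed

text \<open>The line of the null eigenvector \<open>n\<close> of \<open>M a\<close> is determined by
  \<open>M a\<close> and therefore kept by its commutant. For an eigenvalue \<xi> other than 1, any
  two \<xi>-eigenvectors are null and orthogonal, hence proportional. For eigenvalue 1, the square
  \<open>B\<close> of \<open>M a\<close> is parabolic, and the square of \<open>B\<close> minus the
  identity has the line of \<open>n\<close> as image.\<close>

lemma common_null_eigenvector:
  "\<exists>n. n \<noteq> 0 \<and> (\<forall>g. g ** M a = M a ** g \<longrightarrow> (\<exists>k. g *v n = k *\<^sub>R n))"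
proof -
  note ab = ab_carrier
  obtain n \<xi> where n: "n \<noteq> 0" "lorentz n n = 0" "\<xi> > 0" "M a *v n = \<xi> *\<^sub>R n"
    using null_cone_eigenvector[OF inford_ab(1), of 0] by auto
  define C where "C = M a"
  have CO: "C \<in> O31" using ab by (simp add: C_def M_O31)
  have Cn: "C *v n = \<xi> *\<^sub>R n" using n by (simp add: C_def)
  have "\<exists>k. g *v n = k *\<^sub>R n" if g: "g ** M a = M a ** g" for g
  proof -
    have gC: "g *v (C *v u) = C *v (g *v u)" for u using g by (simp add: C_def matrix_vector_mul_assoc)
    show ?thesis
    proof (cases "\<xi> = 1")
      case False
      then have xi: "\<xi> * \<xi> \<noteq> 1" using n(3) by (simp add: square_eq_1_iff)
      define v where "v = g *v n"
      have Cv: "C *v v = \<xi> *\<^sub>R v" by (simp add: v_def gC[symmetric] Cn matrix_vector_mult_scaleR)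
      have "lorentz v v = (\<xi> * \<xi>) * lorentz v v" "lorentz n v = (\<xi> * \<xi>) * lorentz n v"
        using O31_D[OF CO, of v v] O31_D[OF CO, of n v] by (simp_all add: Cv Cn)
      then have "lorentz v v = 0" "lorentz n v = 0" using xi by simp_all
      then show ?thesis using null_orth(2)[OF n(2,1)] by (simp add: v_def)
    next
      case True
      then have C1: "C *v n = n" using Cn by simp
      obtain e f m where fr: "nframe e f n m" using nframe_exists[OF n(2,1)] by blast
      have r [simp]: "lorentz e e = 1" "lorentz f f = 1" "lorentz e f = 0" "lorentz n n = 0"
        "lorentz m m = 0" "lorentz n m = 1" "lorentz n e = 0" "lorentz n f = 0" "lorentz m e = 0"
        "lorentz m f = 0" "lorentz f e = 0" "lorentz m n = 1" "lorentz e n = 0" "lorentz f n = 0"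
        "lorentz e m = 0" "lorentz f m = 0"
        using fr by (auto simp: nframe_def lorentz_commute)
      define B where "B = C ** C"
      have BO: "B \<in> O31" using CO by (simp add: B_def O31_mult)
      have BM: "B = M (a \<otimes> a)" using ab by (simp add: B_def C_def M_mult)
      have inf2: "inford (a \<otimes> a)" using inford_ab(1) by (rule inford_square)
      have nofix: "False" if "B *v t = t" "lorentz t t < 0" for t
        using no_timelike_fixed[OF inf2 that(2)] that(1) BM by simp
      have Bn: "B *v n = n" by (simp add: B_def matrix_vector_mul_assoc[symmetric] C1)
      have gB: "g *v (B *v u) = B *v (g *v u)" for u
        by (simp add: B_def matrix_vector_mul_assoc[symmetric] gC)
      have "rot_along e f n B" unfolding B_def by (rule square_rot_along[OF fr CO Cn])
      then obtain \<kappa> co si p q where B: "B *v e = co *\<^sub>R e + si *\<^sub>R f + p *\<^sub>R n"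
        "B *v f = (- si) *\<^sub>R e + co *\<^sub>R f + q *\<^sub>R n" unfolding rot_along_def by blast
      \<comment> \<open>A nontrivial rotation on the orthogonal space modulo \<open>n\<close> has,
        combined with the translation part of \<open>B\<close>, a fixed point in the Euclidean
        plane; it lifts to a timelike vector fixed by \<open>B\<close>, against infinite
        order.\<close>
      have cs: "co = 1 \<and> si = 0"
      proof (rule ccontr)
        assume ncs: "\<not> (co = 1 \<and> si = 0)"
        define \<Delta> where "\<Delta> = (1 - co)\<^sup>2 + si\<^sup>2"
        have D: "\<Delta> \<noteq> 0" using ncs by (auto simp: \<Delta>_def sum_power2_eq_zero_iff)
        define \<alpha> \<beta> \<gamma> where "\<alpha> = lorentz (B *v m) e" "\<beta> = lorentz (B *v m) f" "\<gamma> = lorentz (B *v m) m"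
        have "lorentz (B *v m) n = 1" using O31_D[OF BO, of m n] Bn by simp
        then have Bm: "B *v m = \<alpha> *\<^sub>R e + \<beta> *\<^sub>R f + \<gamma> *\<^sub>R n + m"
          using nframe_expand[OF fr, of "B *v m"] by (simp add: \<alpha>_\<beta>_\<gamma>_def)
        \<comment> \<open>Cramer's rule for the fixed point of the affine map with rotation part
          given by \<open>co\<close> and \<open>si\<close> and translation part
          \<open>(\<alpha>, \<beta>)\<close>; \<open>\<Delta>\<close> is the determinant.\<close>
        define y z where "y = ((1 - co) * \<alpha> - si * \<beta>) / \<Delta>" "z = (si * \<alpha> + (1 - co) * \<beta>) / \<Delta>"
        have yz: "\<alpha> + y * co - z * si = y" "\<beta> + y * si + z * co = z"
          using D by (simp_all add: y_z_def field_simps) (simp_all add: \<Delta>_def power2_eq_square algebra_simps)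
        define u where "u = m + y *\<^sub>R e + z *\<^sub>R f"
        have un: "lorentz u n = 1" "lorentz n u = 1" by (simp_all add: u_def)
        have "B *v u = (\<alpha> + y * co - z * si) *\<^sub>R e + (\<beta> + y * si + z * co) *\<^sub>R f + (\<gamma> + y * p + z * q) *\<^sub>R n + m"
          by (simp add: u_def matrix_vector_right_distrib matrix_vector_mult_scaleR Bm B algebra_simps)
        then have Bu: "B *v u = u + (\<gamma> + y * p + z * q) *\<^sub>R n" unfolding yz by (simp add: u_def add_ac)
        have "lorentz (B *v u) (B *v u) = lorentz u u" using O31_D[OF BO] by simp
        then have "2 * (\<gamma> + y * p + z * q) = 0" by (simp add: Bu un algebra_simps)
        then have "\<gamma> + y * p + z * q = 0" by simp
        \<comment> \<open>Invariance of the form has removed the \<open>n\<close>-component of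
          \<open>B *v u - u\<close>, so \<open>B\<close> fixes \<open>u\<close> and
          \<open>n\<close>; on this combination of them the form is -1.\<close>
        define t where "t = u - ((lorentz u u + 1) / 2) *\<^sub>R n"
        have "B *v t = t" using \<open>\<gamma> + y * p + z * q = 0\<close> by (simp add: t_def matrix_vector_mult_diff_distrib matrix_vector_mult_scaleR Bn Bu)
        moreover have "lorentz t t < 0" by (simp add: t_def un)
        ultimately show False by (rule nofix)
      qed
      have Bu: "B *v u = u + (lorentz u e * p + lorentz u f * q) *\<^sub>R n
          - lorentz u n *\<^sub>R (p *\<^sub>R e + q *\<^sub>R f + ((p\<^sup>2 + q\<^sup>2) / 2) *\<^sub>R n)" for u
        by (rule parabolic_form[OF fr BO Bn]) (use B cs in auto)
      define D where "D u = B *v u - u" for u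
      have DD: "D (D u) = (- (p\<^sup>2 + q\<^sup>2) * lorentz u n) *\<^sub>R n" for u
        by (simp add: D_def Bu algebra_simps power2_eq_square)
      have "p\<^sup>2 + q\<^sup>2 \<noteq> 0"
      proof
        assume "p\<^sup>2 + q\<^sup>2 = 0"
        then have "p = 0" "q = 0" by (simp_all add: sum_power2_eq_zero_iff)
        then have "B *v (n - m) = n - m" by (simp add: Bu)
        then show False by (rule nofix) simp
      qed
      moreover have "g *v D u = D (g *v u)" for u
        by (simp add: D_def matrix_vector_mult_diff_distrib gB)
      then have "g *v D (D m) = D (D (g *v m))" by simp
      then have "(- (p\<^sup>2 + q\<^sup>2)) *\<^sub>R (g *v n) = (- (p\<^sup>2 + q\<^sup>2)) *\<^sub>R (lorentz (g *v m) n *\<^sub>R n)"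
        by (simp add: DD matrix_vector_mult_scaleR)
      ultimately show ?thesis by (metis neg_equal_0_iff_equal scaleR_left_imp_eq)
    qed
  qed
  then show ?thesis using n(1) by blast
qed

text \<open>\<open>n\<close> gives \<open>g\<close> a real eigenvalue \<open>k\<close>; its
  eigenspace is nonzero and invariant under both generators, hence everything.\<close>

lemma commutant_scalar:
  assumes "g ** M a = M a ** g" "g ** M b = M b ** g"
  shows "\<exists>k. g = k *\<^sub>R mat 1"
proof -
  obtain n where n: "n \<noteq> 0" "\<forall>g. g ** M a = M a ** g \<longrightarrow> (\<exists>k. g *v n = k *\<^sub>R n)"
    using common_null_eigenvector by blast
  obtain k where k: "g *v n = k *\<^sub>R n" using n(2) assms(1) by blast
  define E where "E = {u. g *v u = k *\<^sub>R u}"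
  have "inv_sub E"
    unfolding inv_sub_def E_def
  proof (intro conjI ballI)
    show "subspace {u. g *v u = k *\<^sub>R u}"
      by (auto simp: subspace_def matrix_vector_right_distrib matrix_vector_mult_scaleR scaleR_add_right)
    fix u assume "u \<in> {u. g *v u = k *\<^sub>R u}"
    then have u: "g *v u = k *\<^sub>R u" by simp
    show "M a *v u \<in> {u. g *v u = k *\<^sub>R u}" "M b *v u \<in> {u. g *v u = k *\<^sub>R u}"
      using u assms by (simp_all add: matrix_vector_mul_assoc)
        (simp_all add: matrix_vector_mul_assoc[symmetric] matrix_vector_mult_scaleR)
  qed
  then have "E = UNIV" using irreducible[of E n] n(1) k by (simp add: E_def)
  then have "g *v u = k *\<^sub>R u" for u by (auto simp: E_def)
  then show ?thesis
    by (intro exI[of _ k]) (simp add: matrix_eq scaleR_matrix_vector_assoc[symmetric])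
qed

text \<open>A matrix \<open>g\<close> commuting with \<open>M a\<close> and \<open>M b\<close> up to sign is a similarity of the form, because its
  adjoint times \<open>g\<close> commutes with both; a similarity cannot reverse the sign of a time-oriented
  isometry.\<close>

lemma rigid:
  assumes g: "g \<noteq> 0" and k: "\<bar>k\<bar> = 1" "\<bar>l\<bar> = 1"
    and A: "g ** M a = k *\<^sub>R (M a ** g)" and B: "g ** M b = l *\<^sub>R (M b ** g)"
  shows "k = 1 \<and> l = 1 \<and> (\<exists>r. g = r *\<^sub>R mat 1)"
proof -
  note ab = ab_carrier
  have kk: "k * k = 1" "l * l = 1" using k by (metis abs_mult_self_eq mult_1)+
  \<comment> \<open>Taking adjoints, and using that the adjoint of \<open>C\<close> is its inverse,
    gives the same relation for \<open>ladj g\<close>; in the product the two factors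
    \<open>k\<close> multiply to 1.\<close>
  have comm: "(ladj g ** g) ** C = C ** (ladj g ** g)"
    if C: "C \<in> O31" "g ** C = k *\<^sub>R (C ** g)" "k * k = 1" for C k
  proof -
    note O = O31_ladj[OF C(1)]
    have "ladj C ** ladj g = k *\<^sub>R (ladj g ** ladj C)"
      using arg_cong[OF C(2), of ladj] by (simp add: ladj_mult ladj_scaleR)
    then have "C ** (ladj C ** ladj g) ** C = C ** (k *\<^sub>R (ladj g ** ladj C)) ** C" by simp
    then have "(C ** ladj C) ** ladj g ** C = k *\<^sub>R (C ** ladj g ** (ladj C ** C))"
      by (simp add: matrix_mul_assoc matmul.scaleR_left matmul.scaleR_right)
    then have gC: "ladj g ** C = k *\<^sub>R (C ** ladj g)" by (simp add: O)
    have "(ladj g ** g) ** C = ladj g ** (k *\<^sub>R (C ** g))" by (simp add: C(2) matrix_mul_assoc[symmetric])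
    also have "\<dots> = k *\<^sub>R ((ladj g ** C) ** g)" by (simp add: matmul.scaleR_right matrix_mul_assoc)
    also have "\<dots> = (k * k) *\<^sub>R (C ** ladj g ** g)" by (simp add: gC matmul.scaleR_left)
    finally show ?thesis by (simp add: C(3) matrix_mul_assoc)
  qed
  obtain \<kappa> where \<kappa>: "ladj g ** g = \<kappa> *\<^sub>R mat 1"
    using commutant_scalar[OF comm[OF M_O31[OF ab(1)] A kk(1)] comm[OF M_O31[OF ab(2)] B kk(2)]] by blast
  have sim: "lorentz (g *v u) (g *v v) = \<kappa> * lorentz u v" for u v
    by (simp add: lorentz_ladj(1) matrix_vector_mul_assoc \<kappa> scaleR_matrix_vector_assoc[symmetric])
  define E where "E = range ((*v) g)"
  have "inv_sub E"
    unfolding inv_sub_def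
  proof (intro conjI ballI)
    show "subspace E" unfolding E_def by (rule linear_subspace_image) auto
    fix u assume "u \<in> E"
    then obtain w where u: "u = g *v w" by (auto simp: E_def)
    have *: "C *v u \<in> E" if "g ** C = k *\<^sub>R (C ** g)" "k * k = 1" for C k
    proof -
      have "C *v u = k *\<^sub>R (g *v (C *v w))"
        using that by (simp add: u matrix_vector_mul_assoc that(1) scaleR_matrix_vector_assoc[symmetric])
      also have "\<dots> = g *v (k *\<^sub>R (C *v w))" by (simp add: matrix_vector_mult_scaleR)
      finally show ?thesis by (simp add: E_def)
    qed
    show "M a *v u \<in> E" "M b *v u \<in> E" using *[OF A kk(1)] *[OF B kk(2)] .
  qed
  moreover obtain w where w: "g *v w \<noteq> 0" using g by (auto simp: matrix_eq)
  ultimately have surj: "E = UNIV" using irreducible[of E "g *v w"] by (auto simp: E_def)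
  have g0: "g *v u \<noteq> 0" if "u \<noteq> 0" for u
  proof -
    have "surj ((*v) g)" using surj by (simp add: E_def)
    then have "inj ((*v) g)" using linear_surjective_imp_injective[of "(*v) g"] by simp
    then show ?thesis using that by (metis injD matrix_vector_mult_0_right)
  qed
  \<comment> \<open>Surjectivity excludes 0. A negative factor would turn two orthogonal spacelike
    vectors into two orthogonal timelike ones.\<close>
  have \<kappa>pos: "\<kappa> > 0"
  proof (rule ccontr)
    assume "\<not> \<kappa> > 0"
    then consider "\<kappa> = 0" | "\<kappa> < 0" by linarith
    then show False
    proof cases
      case 1
      obtain w where "axis 4 1 = g *v w" using surj by (auto simp: E_def)
      then show False using sim[of w w] 1 axis4_fcone(2) by simp
    next
      case 2
      have "lorentz (g *v axis 1 1) (g *v axis 1 1) < 0" "lorentz (g *v axis 1 1) (g *v axis 2 1) = 0"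
        "lorentz (g *v axis 2 1) (g *v axis 2 1) < 0"
        using 2 by (simp_all add: sim) (simp_all add: lorentz_def axis_def)
      then show False using timelike_orth[of "g *v axis 1 1" "g *v axis 2 1"] g0[of "axis 2 1"] by (simp add: axis_eq_0_iff)
    qed
  qed
  define w where "w = g *v axis 4 1"
  have w: "lorentz w w < 0" using \<kappa>pos by (simp add: w_def sim axis4_fcone)
  have w4: "w$4 \<noteq> 0"
  proof
    assume "w$4 = 0"
    then have "lorentz w w \<ge> 0" by (simp add: lorentz_diag)
    with w show False by simp
  qed
  \<comment> \<open>\<open>C\<close> keeps the time orientation, so
    \<open>lorentz (C *v z) z\<close> is negative for timelike \<open>z\<close>, in particular for
    \<open>w\<close> and for the time axis; as \<open>g\<close> is a similarity with positive
    factor, the relation between \<open>g\<close> and \<open>C\<close> evaluated on the axis forces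
    \<open>k > 0\<close>.\<close>
  have sgn: "k = 1" if C: "C \<in> O31p" "g ** C = k *\<^sub>R (C ** g)" and k: "\<bar>k\<bar> = 1" for C k
  proof -
    have "lorentz (C *v z) z < 0" if "z \<in> fcone" "lorentz z z < 0" for z
    proof -
      have "C *v z \<in> fcone" by (rule O31p_fcone[OF C(1) that(1)])
      then have "lorentz z (C *v z) < 0" by (rule fcone_lorentz_neg[OF that(1) _ that(2)])
      then show ?thesis by (simp add: lorentz_commute)
    qed
    note neg = this
    have "lorentz (C *v w) w < 0"
    proof (cases "w$4 > 0")
      case True
      then show ?thesis using neg[of w] w by (simp add: fcone_def)
    next
      case False
      moreover have "C *v (- w) = - (C *v w)" using matrix_vector_mult_scaleR[of C "-1" w] by simp
      ultimately show ?thesis using neg[of "- w"] w w4 by (simp add: fcone_def)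
    qed
    moreover have "lorentz (g *v (C *v axis 4 1)) w < 0"
      using neg[of "axis 4 1"] axis4_fcone \<kappa>pos by (simp add: w_def sim mult_pos_neg)
    moreover have "g *v (C *v axis 4 1) = k *\<^sub>R (C *v w)"
      by (simp add: w_def matrix_vector_mul_assoc C(2) scaleR_matrix_vector_assoc[symmetric])
    ultimately have "k > 0" by (simp add: mult_less_0_iff)
    then show ?thesis using k by simp
  qed
  have "k = 1" "l = 1" using sgn[OF M_O31p[OF ab(1)] A k(1)] sgn[OF M_O31p[OF ab(2)] B k(2)] .
  then show ?thesis using commutant_scalar[of g] A B by simp
qed

end

sublocale lorentz_rep \<subseteq> rigid_pair "M a" "M b"
proof
  show "invertible (M a)" "invertible (M b)" using M_invertible ab_carrier by auto
qed (rule rigid)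

section \<open>Charts of the character variety\<close>

context rigid_pair
begin

definition slice_chart_on :: "(mat4 \<times> mat4) set \<Rightarrow> (mat4 \<times> mat4 \<Rightarrow> mat4 \<times> mat4) \<Rightarrow> bool" where
  "slice_chart_on W \<Phi> \<longleftrightarrow> open W \<and> W \<subseteq> carrier GL4 \<times> carrier GL4 \<and> X0 \<in> W \<and>
    (\<forall>X Y. X \<in> W \<longrightarrow> sim X Y \<longrightarrow> Y \<in> W \<and> \<Phi> Y = \<Phi> X) \<and>
    (\<forall>X Y. X \<in> W \<longrightarrow> Y \<in> W \<longrightarrow> \<Phi> X = \<Phi> Y \<longrightarrow> sim X Y) \<and>
    smooth_on W \<Phi> \<and> (\<forall>X. X \<in> W \<longrightarrow> range (frechet_derivative \<Phi> (at X)) = slice) \<and>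
    openin (top_of_set slice) (\<Phi> ` W) \<and> (\<forall>s. s \<in> \<Phi> ` W \<longrightarrow> X0 + s \<in> W \<and> \<Phi> (X0 + s) = s) \<and>
    frechet_derivative \<Phi> (at X0) = proj"

lemma slice_chart_onD:
  assumes "slice_chart_on W \<Phi>"
  shows "open W" "W \<subseteq> carrier GL4 \<times> carrier GL4" "X0 \<in> W"
    and "X \<in> W \<Longrightarrow> sim X Y \<Longrightarrow> Y \<in> W \<and> \<Phi> Y = \<Phi> X"
    and "X \<in> W \<Longrightarrow> Y \<in> W \<Longrightarrow> \<Phi> X = \<Phi> Y \<Longrightarrow> sim X Y"
    and "smooth_on W \<Phi>" and "X \<in> W \<Longrightarrow> range (frechet_derivative \<Phi> (at X)) = slice"
    and "openin (top_of_set slice) (\<Phi> ` W)"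
    and "s \<in> \<Phi> ` W \<Longrightarrow> X0 + s \<in> W \<and> \<Phi> (X0 + s) = s"
    and "frechet_derivative \<Phi> (at X0) = proj"
  using assms unfolding slice_chart_on_def by blast+

lemma slice_chart_exists: "\<exists>W \<Phi>. slice_chart_on W \<Phi>"
proof (rule slice_chart)
  fix W \<Phi>
  assume *: "open W" "W \<subseteq> carrier GL4 \<times> carrier GL4" "X0 \<in> W" "\<Phi> X0 = 0"
    "\<And>X Y. X \<in> W \<Longrightarrow> sim X Y \<Longrightarrow> Y \<in> W \<and> \<Phi> Y = \<Phi> X"
    "\<And>X Y. X \<in> W \<Longrightarrow> Y \<in> W \<Longrightarrow> \<Phi> X = \<Phi> Y \<Longrightarrow> sim X Y"
    "smooth_on W \<Phi>" "\<And>X. X \<in> W \<Longrightarrow> range (frechet_derivative \<Phi> (at X)) = slice"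
    "openin (top_of_set slice) (\<Phi> ` W)" "\<And>s. s \<in> \<Phi> ` W \<Longrightarrow> X0 + s \<in> W \<and> \<Phi> (X0 + s) = s"
    "frechet_derivative \<Phi> (at X0) = proj"
  show ?thesis
    unfolding slice_chart_on_def
    by (rule exI[of _ W], rule exI[of _ \<Phi>], intro conjI allI impI) (fact * | use * in blast)+
qed

end

lemma linear_right_inverse_range:
  fixes f :: "'a::real_vector \<Rightarrow> 'b::real_vector"
  assumes "linear f" shows "\<exists>g. linear g \<and> (\<forall>v\<in>range f. f (g v) = v)"
  using linear_exists_right_inverse_on[OF assms subspace_UNIV] by auto

text \<open>Precomposing \<open>\<Phi>\<close> with the affine map given by a right inverse
  \<open>R\<close> of its derivative and adding \<open>w - Q w\<close>, the part transverse to
  \<open>V\<close>, gives a self-map \<open>\<Theta>\<close> of the ambient space with identity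
  derivative at \<open>v0\<close>; its local inverse yields the section.\<close>

lemma smooth_submersion_section:
  fixes \<Phi> :: "'a::euclidean_space \<Rightarrow> 'a"
  assumes \<Phi>: "smooth_on \<Omega> \<Phi>" and X0: "X0 \<in> \<Omega>" and V: "subspace V" "\<Phi> ` \<Omega> \<subseteq> V"
    and r: "range (frechet_derivative \<Phi> (at X0)) = V"
  shows "\<exists>\<xi> N \<xi>'. open N \<and> \<Phi> X0 \<in> N \<and> \<xi> (\<Phi> X0) = X0 \<and> \<xi> ` N \<subseteq> \<Omega> \<and>
    (\<xi> has_derivative \<xi>') (at (\<Phi> X0)) \<and> (\<forall>v\<in>N \<inter> V. \<Phi> (\<xi> v) = v)"
proof -
  define D v0 where "D = frechet_derivative \<Phi> (at X0)" "v0 = \<Phi> X0"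
  have \<Omega>: "open \<Omega>" and \<Phi>k: "Ck_on k \<Omega> \<Phi>" for k using \<Phi> by (auto simp: smooth_on_def)
  have der: "(\<Phi> has_derivative D) (at X0)" unfolding D_v0_def using Ck_on_SucD(1)[OF \<Phi>k X0] .
  have linD: "linear D" using der by (rule has_derivative_linear)
  obtain R where R: "linear R" "\<And>v. v \<in> V \<Longrightarrow> D (R v) = v"
    using linear_right_inverse_range[OF linD] r by (auto simp: D_v0_def)
  define Q where "Q w = D (R w)" for w
  have linQ: "linear Q" unfolding Q_def using linear_compose[OF R(1) linD] by (simp add: o_def)
  have QV: "Q w \<in> V" "v \<in> V \<Longrightarrow> Q v = v" for v w using r R(2) by (auto simp: Q_def D_v0_def)
  have bl: "bounded_linear R" "bounded_linear Q" using R(1) linQ by (simp_all add: linear_conv_bounded_linear)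
  define S where "S = (\<lambda>w. X0 + R (w - v0)) -` \<Omega>"
  have S: "open S" unfolding S_def
    by (intro open_vimage \<Omega> continuous_intros bounded_linear.continuous_on[OF bl(1)])
  have v0V: "v0 \<in> V" using V X0 by (auto simp: D_v0_def)
  have v0S: "v0 \<in> S" using X0 R(1) by (simp add: S_def linear_0)
  define \<Theta> where "\<Theta> w = \<Phi> (X0 + R (w - v0)) + (w - Q w)" for w
  have aff: "Ck_on k S (\<lambda>w. X0 + R (w - v0))" for k
  proof -
    have "Ck_on k S (\<lambda>w. (X0 - R v0) + R w)" by (intro Ck_on_add Ck_on_const Ck_on_linear bl S)
    then show ?thesis using R(1) by (simp add: linear_diff algebra_simps)
  qed
  have "Ck_on k S \<Theta>" for k
  proof -
    have "Ck_on k S (\<lambda>w. \<Phi> (X0 + R (w - v0)))"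
      by (rule Ck_on_compose[OF S \<Phi>k aff]) (auto simp: S_def)
    moreover have "Ck_on k S (\<lambda>w. w - Q w)"
      by (intro Ck_on_linear S bounded_linear_sub bounded_linear_ident bl)
    ultimately show ?thesis unfolding \<Theta>_def by (intro Ck_on_add S)
  qed
  then have sm: "smooth_on S \<Theta>" using S by (simp add: smooth_on_def)
  have affd: "((\<lambda>w. X0 + R (w - v0)) has_derivative R) (at v0)"
    by (auto intro!: derivative_eq_intros bounded_linear.has_derivative[OF bl(1)])
  have "(\<Phi> has_derivative D) (at (X0 + R (v0 - v0)))" using der R(1) by (simp add: linear_0)
  from has_derivative_compose[OF affd this]
  have "((\<lambda>w. \<Phi> (X0 + R (w - v0))) has_derivative Q) (at v0)" by (simp add: Q_def[abs_def])
  then have "(\<Theta> has_derivative (\<lambda>h. Q h + (h - Q h))) (at v0)"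
    unfolding \<Theta>_def by (intro has_derivative_add has_derivative_diff has_derivative_ident
        bounded_linear_imp_has_derivative[OF bl(2)])
  then have "frechet_derivative \<Theta> (at v0) = (\<lambda>h. h)" using frechet_derivative_at by fastforce
  then have "inj (frechet_derivative \<Theta> (at v0))" by simp
  then obtain U N \<eta> where U: "open U" "U \<subseteq> S" "v0 \<in> U" "open N" "homeomorphism U N \<Theta> \<eta>" "smooth_on N \<eta>"
    using smooth_inverse_function[OF sm v0S] by metis
  have \<Theta>v0: "\<Theta> v0 = v0" using QV(2)[OF v0V] R(1) by (simp add: \<Theta>_def linear_0 D_v0_def(2))
  have hU: "\<eta> (\<Theta> w) = w" "\<Theta> w \<in> N" if "w \<in> U" for w using U(5) that by (auto simp: homeomorphism_def)
  have hN: "\<Theta> (\<eta> y) = y" "\<eta> y \<in> U" if "y \<in> N" for y using U(5) that by (auto simp: homeomorphism_def)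
  have v0N: "v0 \<in> N" "\<eta> v0 = v0" using hU[OF U(3)] \<Theta>v0 by simp_all
  define \<xi> where "\<xi> v = X0 + R (\<eta> v - v0)" for v
  have \<xi>\<Omega>: "\<xi> v \<in> \<Omega>" if "v \<in> N" for v using hN(2)[OF that] U(2) by (auto simp: \<xi>_def S_def)
  have "\<Phi> (\<xi> v) = v" if v: "v \<in> N" "v \<in> V" for v
  proof -
    have "\<Phi> (\<xi> v) + (\<eta> v - Q (\<eta> v)) = v" using hN(1)[OF v(1)] by (simp add: \<Theta>_def \<xi>_def)
    then have e: "v - \<Phi> (\<xi> v) = \<eta> v - Q (\<eta> v)" by (simp add: algebra_simps)
    have "v - \<Phi> (\<xi> v) \<in> V" using V v \<xi>\<Omega>[OF v(1)] by (auto intro: subspace_diff)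
    \<comment> \<open>The defect lies in \<open>V\<close>, where \<open>Q\<close> is the identity,
      and has the form \<open>w - Q w\<close>, which \<open>Q\<close> kills.\<close>
    then have "v - \<Phi> (\<xi> v) = Q (v - \<Phi> (\<xi> v))" using QV(2) by simp
    also have "\<dots> = 0" unfolding e using linQ QV by (simp add: linear_diff)
    finally show ?thesis by simp
  qed
  moreover have "(\<eta> has_derivative frechet_derivative \<eta> (at v0)) (at v0)"
    using U(6) v0N(1) Ck_on_SucD(1)[of 0 N \<eta> v0] unfolding smooth_on_def by blast
  then have "(\<xi> has_derivative (\<lambda>h. R (frechet_derivative \<eta> (at v0) h))) (at v0)"
    unfolding \<xi>_def by (auto intro!: derivative_eq_intros bounded_linear.has_derivative[OF bl(1)])
  moreover have "\<xi> v0 = X0" using v0N R(1) by (simp add: \<xi>_def linear_0)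
  ultimately show ?thesis using U(4) v0N(1) \<xi>\<Omega> unfolding D_v0_def(2) by blast
qed

locale fibre_rep = fibre F G a b + rigid_pair "M a" "M b"
  for F :: "'g set" and G :: "('g, 'm) monoid_scheme" (structure) and a b and M :: "'g \<Rightarrow> mat4" +
  fixes \<rho> :: "'g \<Rightarrow> mat4 set"
  assumes inv_M: "g \<in> carrier G \<Longrightarrow> invertible (M g)"
    and \<rho>_M: "g \<in> carrier G \<Longrightarrow> \<rho> g = pgl (M g)"
    and \<rho>_hom: "\<rho> \<in> hom G PGL4"
begin

lemma restrict_Reps: "restrict \<rho> F \<in> Reps G F"
  using \<rho>_hom by (auto simp: Reps_def hom_def Pi_iff)

lemma rep_X0: "rep X0 = restrict \<rho> F"
  unfolding X0_def by (rule rep_eqI[OF restrict_Reps]) (simp_all add: ab_mem \<rho>_M ab_carrier)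

text \<open>\<open>\<kappa>\<close> reads \<open>\<Phi>\<close> off any pair in \<open>W\<close>
  representing the class, which is harmless as \<open>\<Phi>\<close> is constant on similarity
  classes; the inverse sends \<open>s\<close> to the class of \<open>X0 + s\<close>. As
  \<open>W\<close> is saturated it is the full preimage of \<open>U\<close>, so openness and
  smoothness are properties of \<open>\<Phi>\<close> on \<open>W\<close>.\<close>

lemma smooth_point_X0: "smooth_point G F a b (pt X0)"
proof -
  obtain W \<Phi> where W\<Phi>: "slice_chart_on W \<Phi>" using slice_chart_exists by blast
  have W: "open W" "W \<subseteq> GL2" "X0 \<in> W"
    and simW: "\<And>X Y. X \<in> W \<Longrightarrow> sim X Y \<Longrightarrow> Y \<in> W \<and> \<Phi> Y = \<Phi> X"
    and inj: "\<And>X Y. X \<in> W \<Longrightarrow> Y \<in> W \<Longrightarrow> \<Phi> X = \<Phi> Y \<Longrightarrow> sim X Y"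
    and sm: "smooth_on W \<Phi>" and ran: "\<And>X. X \<in> W \<Longrightarrow> range (frechet_derivative \<Phi> (at X)) = slice"
    and op: "openin (top_of_set slice) (\<Phi> ` W)"
    and sec: "\<And>s. s \<in> \<Phi> ` W \<Longrightarrow> X0 + s \<in> W \<and> \<Phi> (X0 + s) = s"
    using slice_chart_onD[OF W\<Phi>] by blast+
  define GG where "GG = GL2"
  have WG: "X \<in> GG" if "X \<in> W" for X unfolding GG_def using that W(2) by (rule subsetD[rotated])
  note pt_iff = pt_eq_iff[folded GG_def] and open_iff = openin_char_variety[folded GG_def]
  define U where "U = pt ` W"
  define \<kappa> where "\<kappa> u = \<Phi> (SOME X. X \<in> W \<and> pt X = u)" for u
  have \<kappa>: "\<kappa> (pt X) = \<Phi> X" if X: "X \<in> W" for X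
  proof -
    define Y where "Y = (SOME Y. Y \<in> W \<and> pt Y = pt X)"
    have "Y \<in> W \<and> pt Y = pt X" unfolding Y_def by (rule someI[of _ X]) (simp add: X)
    then have Y: "Y \<in> W" "pt Y = pt X" by blast+
    have "sim X Y" using pt_iff[OF WG[OF X] WG[OF Y(1)]] Y(2) by simp
    then have "\<Phi> Y = \<Phi> X" using simW[OF X] by blast
    then show ?thesis unfolding \<kappa>_def Y_def .
  qed
  have memU: "pt X \<in> U \<longleftrightarrow> X \<in> W" if X: "X \<in> GG" for X
  proof
    assume "pt X \<in> U"
    then obtain Y where "Y \<in> W" "pt X = pt Y" by (auto simp: U_def)
    then show "X \<in> W" using pt_iff[OF WG X, of Y] simW by simp
  qed (auto simp: U_def)
  have preU: "{X \<in> GG. pt X \<in> U} = W"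
    using memU WG by blast
  have opU: "openin (char_variety G F a b) U"
    unfolding open_iff preU using W(1) WG by (auto simp: U_def)
  have im: "\<kappa> ` U = \<Phi> ` W" using \<kappa> by (force simp: U_def)
  have top: "topspace (subtopology (char_variety G F a b) U) = U"
    using opU openin_subset by (auto simp: topspace_subtopology)
  define \<nu> where "\<nu> s = pt (X0 + s)" for s
  have \<nu>: "\<nu> (\<Phi> X) = pt X" "\<kappa> (\<nu> (\<Phi> X)) = \<Phi> X" if X: "X \<in> W" for X
  proof -
    have s: "X0 + \<Phi> X \<in> W" "\<Phi> (X0 + \<Phi> X) = \<Phi> X" using sec[of "\<Phi> X"] X by auto
    then have "sim X (X0 + \<Phi> X)" using inj[OF X s(1)] by simp
    then show "\<nu> (\<Phi> X) = pt X" using pt_iff[OF WG[OF X] WG[OF s(1)]] by (simp add: \<nu>_def)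
    then show "\<kappa> (\<nu> (\<Phi> X)) = \<Phi> X" using \<kappa>[OF X] by simp
  qed
  have "homeomorphic_maps (subtopology (char_variety G F a b) U) (top_of_set (\<kappa> ` U)) \<kappa> \<nu>"
    unfolding homeomorphic_maps_def
  proof (intro conjI ballI)
    show "continuous_map (subtopology (char_variety G F a b) U) (top_of_set (\<kappa> ` U)) \<kappa>"
      unfolding continuous_map top
    proof (intro conjI allI impI)
      show "\<kappa> ` U \<subseteq> topspace (top_of_set (\<kappa> ` U))" by simp
      fix Q assume "openin (top_of_set (\<kappa> ` U)) Q"
      then obtain Q' where Q': "open Q'" "Q = \<kappa> ` U \<inter> Q'" by (auto simp: openin_open)
      define Z where "Z = {u \<in> U. \<kappa> u \<in> Q}"
      have "{X \<in> GG. pt X \<in> Z} = W \<inter> \<Phi> -` Q'"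
      proof (intro equalityI subsetI)
        fix X assume "X \<in> {X \<in> GG. pt X \<in> Z}"
        then have "X \<in> GG" "pt X \<in> U" "\<kappa> (pt X) \<in> Q'" by (simp_all add: Z_def Q'(2))
        then show "X \<in> W \<inter> \<Phi> -` Q'" using memU[of X] \<kappa>[of X] by simp
      next
        fix X assume "X \<in> W \<inter> \<Phi> -` Q'"
        then have "X \<in> W" "\<Phi> X \<in> Q'" by simp_all
        then show "X \<in> {X \<in> GG. pt X \<in> Z}"
          using memU[of X] WG[of X] \<kappa>[of X] by (simp add: Z_def Q'(2) im)
      qed
      moreover have "open (W \<inter> \<Phi> -` Q')"
      proof -
        have "Ck_on 0 W \<Phi>" using sm by (simp only: smooth_on_def)
        then show ?thesis by (intro continuous_open_preimage W(1) Q'(1)) (rule Ck_on_continuous)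
      qed
      moreover have "Z \<subseteq> pt ` GG" using WG by (auto simp: Z_def U_def)
      ultimately have "openin (char_variety G F a b) Z" by (simp add: open_iff)
      then show "openin (subtopology (char_variety G F a b) U) {u \<in> U. \<kappa> u \<in> Q}"
        unfolding openin_subtopology Z_def by blast
    qed
    show "continuous_map (top_of_set (\<kappa> ` U)) (subtopology (char_variety G F a b) U) \<nu>"
      unfolding continuous_map
    proof (intro conjI allI impI)
      show "\<nu> ` topspace (top_of_set (\<kappa> ` U)) \<subseteq> topspace (subtopology (char_variety G F a b) U)"
        unfolding top im using \<nu> by (auto simp: U_def)
      fix Q assume "openin (subtopology (char_variety G F a b) U) Q"
      then obtain T where T: "openin (char_variety G F a b) T" "Q = T \<inter> U"
        unfolding openin_subtopology by blast
      have "openin (char_variety G F a b) Q" using T opU by auto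
      then have "open {X \<in> GG. pt X \<in> Q}" by (simp add: open_iff)
      then have "open ((\<lambda>s. X0 + s) -` {X \<in> GG. pt X \<in> Q})" by (intro open_vimage continuous_intros)
      moreover have "{s \<in> topspace (top_of_set (\<kappa> ` U)). \<nu> s \<in> Q} = \<kappa> ` U \<inter> (\<lambda>s. X0 + s) -` {X \<in> GG. pt X \<in> Q}"
      proof (intro equalityI subsetI)
        fix s assume "s \<in> {s \<in> topspace (top_of_set (\<kappa> ` U)). \<nu> s \<in> Q}"
        then have "s \<in> \<Phi> ` W" "pt (X0 + s) \<in> Q" by (simp_all add: im \<nu>_def)
        then show "s \<in> \<kappa> ` U \<inter> (\<lambda>s. X0 + s) -` {X \<in> GG. pt X \<in> Q}"
          using sec[of s] WG[of "X0 + s"] by (simp add: im)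
      qed (simp add: im \<nu>_def)
      ultimately show "openin (top_of_set (\<kappa> ` U)) {s \<in> topspace (top_of_set (\<kappa> ` U)). \<nu> s \<in> Q}"
        by (auto simp: openin_open)
    qed
    show "\<nu> (\<kappa> u) = u" if "u \<in> topspace (subtopology (char_variety G F a b) U)" for u
      using that \<nu>(1) \<kappa> unfolding top by (auto simp: U_def)
    show "\<kappa> (\<nu> s) = s" if "s \<in> topspace (top_of_set (\<kappa> ` U))" for s
      using that \<nu>(2) by (auto simp: im)
  qed
  then have homeo: "homeomorphic_map (subtopology (char_variety G F a b) U) (top_of_set (\<kappa> ` U)) \<kappa>"
    using homeomorphic_map_maps by blast
  have smk: "smooth_on W (\<lambda>X. \<kappa> (pt X))"
    using sm Ck_on_cong[OF W(1), of \<Phi> "\<lambda>X. \<kappa> (pt X)"] \<kappa> by (auto simp: smooth_on_def)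
  have smk1: "Ck_on (Suc 0) W (\<lambda>X. \<kappa> (pt X))" using smk by (simp only: smooth_on_def)
  have fd: "frechet_derivative (\<lambda>X. \<kappa> (pt X)) (at X) = frechet_derivative \<Phi> (at X)" if X: "X \<in> W" for X
  proof (rule frechet_derivative_transform_within_open[OF _ W(1) X \<kappa>])
    show "(\<lambda>X. \<kappa> (pt X)) differentiable at X"
      using Ck_on_SucD(1)[OF smk1 X] unfolding differentiable_def by blast
  qed
  have "char_chart G F a b U \<kappa> slice"
    unfolding char_chart_def Let_def GG_def[symmetric] preU
    using opU subspace_slice op homeo smk ran fd by (simp add: im)
  then show ?thesis unfolding smooth_point_def using W(3) by (auto simp: U_def)
qed

end

section \<open>The derivative at the holonomy of an arbitrary chart\<close>

locale chart_at = fibre_rep F G a b M \<rho>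
  for F :: "'g set" and G :: "('g, 'm) monoid_scheme" (structure) and a b M \<rho> +
  fixes U \<kappa> V
  assumes chart: "char_chart G F a b U \<kappa> V" and X0U: "pt X0 \<in> U"
begin

definition \<Omega> :: "(mat4 \<times> mat4) set" where "\<Omega> = {X \<in> GL2. pt X \<in> U}"
definition \<Phi> :: "mat4 \<times> mat4 \<Rightarrow> mat4 \<times> mat4" where "\<Phi> X = \<kappa> (pt X)"
definition D\<Phi> :: "mat4 \<times> mat4 \<Rightarrow> mat4 \<times> mat4" where "D\<Phi> = frechet_derivative \<Phi> (at X0)"

lemma chart_props:
  shows openU: "openin (char_variety G F a b) U" and subspaceV: "subspace V"
    and smooth_\<Phi>: "smooth_on \<Omega> \<Phi>" and range_\<Phi>: "X \<in> \<Omega> \<Longrightarrow> range (frechet_derivative \<Phi> (at X)) = V"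
    and inj_\<kappa>: "inj_on \<kappa> U" and \<kappa>V: "\<kappa> ` U \<subseteq> V"
proof -
  note c = chart[unfolded char_chart_def Let_def]
  show oU: "openin (char_variety G F a b) U" and "subspace V" using c by blast+
  show "smooth_on \<Omega> \<Phi>" using c unfolding \<Omega>_def \<Phi>_def[abs_def] by blast
  have "\<forall>X\<in>\<Omega>. range (frechet_derivative \<Phi> (at X)) = V"
    using c unfolding \<Omega>_def \<Phi>_def[abs_def] by blast
  then show "X \<in> \<Omega> \<Longrightarrow> range (frechet_derivative \<Phi> (at X)) = V" by (rule bspec)
  have "inj_on \<kappa> (topspace (subtopology (char_variety G F a b) U))"
    using c homeomorphic_imp_injective_map by blast
  then show "inj_on \<kappa> U" using openin_subset[OF oU] by (simp add: topspace_subtopology Int_absorb1)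
  have "openin (top_of_set V) (\<kappa> ` U)" using c by blast
  then show "\<kappa> ` U \<subseteq> V" using openin_imp_subset by blast
qed

lemma open_\<Omega>: "open \<Omega>" and Ck_\<Phi>: "Ck_on k \<Omega> \<Phi>"
  using smooth_\<Phi> by (auto simp: smooth_on_def)

lemma X0_\<Omega>: "X0 \<in> \<Omega>"
  using X0U X0_GL2 by (simp add: \<Omega>_def)

lemma \<Omega>_GL2: "X \<in> \<Omega> \<Longrightarrow> X \<in> GL2"
  unfolding \<Omega>_def by simp

lemma \<Phi>_derivative: "X \<in> \<Omega> \<Longrightarrow> (\<Phi> has_derivative frechet_derivative \<Phi> (at X)) (at X)"
  by (rule Ck_on_SucD(1)[OF Ck_\<Phi>])

lemma D\<Phi>: "(\<Phi> has_derivative D\<Phi>) (at X0)" "linear D\<Phi>" "range D\<Phi> = V"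
  using \<Phi>_derivative[OF X0_\<Omega>] range_\<Phi>[OF X0_\<Omega>] has_derivative_linear by (auto simp: D\<Phi>_def)

lemma \<Phi>_V: "X \<in> \<Omega> \<Longrightarrow> \<Phi> X \<in> V"
  using \<kappa>V by (auto simp: \<Phi>_def \<Omega>_def)

lemma \<Phi>_eq_iff: "X \<in> \<Omega> \<Longrightarrow> Y \<in> \<Omega> \<Longrightarrow> \<Phi> X = \<Phi> Y \<longleftrightarrow> pt X = pt Y"
  using inj_\<kappa> unfolding \<Phi>_def \<Omega>_def by (auto dest: inj_onD simp del: GL4_simps)

lemma sim_\<Omega>: assumes "X \<in> \<Omega>" "sim X Y" shows "Y \<in> \<Omega>" "\<Phi> Y = \<Phi> X"
proof -
  have Y: "Y \<in> GL2" by (rule sim_GL2[OF assms(2) \<Omega>_GL2[OF assms(1)]])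
  have e: "pt X = pt Y" using pt_eq_iff[OF \<Omega>_GL2[OF assms(1)] Y] assms(2) by simp
  show "Y \<in> \<Omega>" using assms(1) Y e unfolding \<Omega>_def by (simp del: GL4_simps)
  show "\<Phi> Y = \<Phi> X" using e by (simp add: \<Phi>_def)
qed

text \<open>Along the curve \<open>param (t *\<^sub>R inf_act z)\<close> the slice part is zero, so
  near time 0 it stays in the orbit of \<open>X0\<close> and \<open>\<Phi>\<close> is constant on
  it; its velocity at 0 is \<open>inf_act z\<close>.\<close>

lemma D\<Phi>_inf_act: assumes z: "z \<in> inf_dom" shows "D\<Phi> (inf_act z) = 0"
proof -
  define e where "e = inf_act z"
  define p where "p t = t *\<^sub>R e" for t :: real
  have pr: "proj (p t) = 0" for t
    using inf_inv(3)[OF z] by (simp add: p_def e_def proj_def linear_scale[OF inf_inv(2)] linear_scale[OF linear_inf_act])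
  have p0: "p 0 = 0" by (simp add: p_def)
  have "open (p -` param_dom)" unfolding p_def by (intro open_vimage open_param_dom continuous_intros)
  have "\<Phi> (param (p t)) = \<Phi> X0" if "t \<in> p -` param_dom" for t
  proof -
    have "sim X0 (param (p t))" using sim_sym[OF sim_param, of "p t"] that pr by simp
    then show ?thesis by (rule sim_\<Omega>(2)[OF X0_\<Omega>])
  qed
  note const = this
  have d: "(p has_derivative (\<lambda>t. t *\<^sub>R e)) (at 0)"
    unfolding p_def by (auto intro!: derivative_eq_intros)
  have d1: "(param has_derivative (\<lambda>v. v)) (at (p 0))" using param_derivative p0 by simp
  have "param (p 0) = X0" using param_slice[of 0] subspace_slice by (simp add: p0 subspace_0)
  then have d2: "(\<Phi> has_derivative D\<Phi>) (at (param (p 0)))" using D\<Phi>(1) by simp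
  have "((\<lambda>t. \<Phi> (param (p t))) has_derivative (\<lambda>t. D\<Phi> (t *\<^sub>R e))) (at 0)"
    using has_derivative_compose[OF has_derivative_compose[OF d d1] d2] .
  then have "((\<lambda>t. \<Phi> X0) has_derivative (\<lambda>t. D\<Phi> (t *\<^sub>R e))) (at 0)"
    by (rule has_derivative_transform_within_open[OF _ \<open>open (p -` param_dom)\<close>])
      (use const p0 zero_param_dom in auto)
  then have "(\<lambda>t. D\<Phi> (t *\<^sub>R e)) = (\<lambda>t. 0)" using has_derivative_unique has_derivative_const by blast
  from fun_cong[OF this, of 1] show ?thesis by (simp add: e_def)
qed

lemma local_section:
  "\<exists>\<xi> N \<xi>'. open N \<and> \<Phi> X0 \<in> N \<and> \<xi> (\<Phi> X0) = X0 \<and> \<xi> ` N \<subseteq> \<Omega> \<and>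
    (\<xi> has_derivative \<xi>') (at (\<Phi> X0)) \<and> (\<forall>v\<in>N \<inter> V. \<Phi> (\<xi> v) = v)"
  by (rule smooth_submersion_section[OF smooth_\<Phi> X0_\<Omega> subspaceV])
    (use \<Phi>_V range_\<Phi>[OF X0_\<Omega>] in auto)

text \<open>Any two charts differ by a map that is differentiable because of the local section, so the
  kernel can be computed in the chart given by the slice.\<close>

lemma D\<Phi>_kernel: assumes "D\<Phi> w = 0" shows "\<exists>z\<in>inf_dom. w = inf_act z"
proof -
  obtain \<xi> N \<xi>' where N: "open N" "\<Phi> X0 \<in> N" "\<xi> (\<Phi> X0) = X0" "\<xi> ` N \<subseteq> \<Omega>"
    and \<xi>': "(\<xi> has_derivative \<xi>') (at (\<Phi> X0))" and \<xi>: "\<And>v. v \<in> N \<Longrightarrow> v \<in> V \<Longrightarrow> \<Phi> (\<xi> v) = v"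
    using local_section by (metis IntI)
  obtain W \<Psi> where W\<Psi>: "slice_chart_on W \<Psi>" using slice_chart_exists by blast
  have W: "open W" "X0 \<in> W"
    and simW: "\<And>X Y. X \<in> W \<Longrightarrow> sim X Y \<Longrightarrow> Y \<in> W \<and> \<Psi> Y = \<Psi> X"
    and sm: "smooth_on W \<Psi>" and DP: "frechet_derivative \<Psi> (at X0) = proj"
    using slice_chart_onD[OF W\<Psi>] by blast+
  have dP: "(\<Psi> has_derivative proj) (at X0)"
    using Ck_on_SucD(1)[of 0 W \<Psi> X0] sm W(2) DP unfolding smooth_on_def by metis
  define T where "T = W \<inter> (\<Omega> \<inter> \<Phi> -` N)"
  have T: "open T" unfolding T_def
    using continuous_open_preimage[OF Ck_on_continuous[OF Ck_\<Phi>] open_\<Omega> N(1)] W(1) by auto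
  have eq: "\<Psi> (\<xi> (\<Phi> X)) = \<Psi> X" if X: "X \<in> T" for X
  proof -
    have X': "X \<in> W" "X \<in> \<Omega>" "\<Phi> X \<in> N" using X by (auto simp: T_def)
    have \<xi>X: "\<xi> (\<Phi> X) \<in> \<Omega>" using N(4) X'(3) by blast
    have "\<Phi> (\<xi> (\<Phi> X)) = \<Phi> X" using \<xi>[OF X'(3) \<Phi>_V[OF X'(2)]] .
    then have "pt X = pt (\<xi> (\<Phi> X))" using \<Phi>_eq_iff[OF X'(2) \<xi>X] by simp
    then have "sim X (\<xi> (\<Phi> X))" using pt_eq_iff[OF \<Omega>_GL2[OF X'(2)] \<Omega>_GL2[OF \<xi>X]] by simp
    then show ?thesis using simW[OF X'(1)] by blast
  qed
  have "(\<Psi> has_derivative proj) (at (\<xi> (\<Phi> X0)))" using dP N(3) by simp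
  then have "((\<lambda>X. \<Psi> (\<xi> (\<Phi> X))) has_derivative (\<lambda>w. proj (\<xi>' (D\<Phi> w)))) (at X0)"
    using has_derivative_compose[OF has_derivative_compose[OF D\<Phi>(1) \<xi>']] by blast
  then have "(\<Psi> has_derivative (\<lambda>w. proj (\<xi>' (D\<Phi> w)))) (at X0)"
    by (rule has_derivative_transform_within_open[OF _ T]) (use W X0_\<Omega> N(2) eq in \<open>auto simp: T_def\<close>)
  then have "proj = (\<lambda>w. proj (\<xi>' (D\<Phi> w)))" using dP has_derivative_unique by blast
  from fun_cong[OF this, of w] have "proj w = 0"
    using assms has_derivative_linear[OF \<xi>'] linear_proj by (simp add: linear_0)
  then show ?thesis by (rule proj_eq_0)
qed

end

section \<open>Velocities and cocycles\<close>

lemma PGL4_rep: "p \<in> carrier PGL4 \<Longrightarrow> B \<in> p \<Longrightarrow> p = pgl B \<and> invertible B"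
proof -
  assume p: "p \<in> carrier PGL4" and B: "B \<in> p"
  obtain A where A: "invertible A" "p = pgl A" using p by (auto simp: carrier_PGL4)
  then have "pgl B = p" "invertible B" using B mem_pgl_eq by (auto simp: mem_pgl matrix_inv_scaleR)
  then show ?thesis by simp
qed

lemma trace_component_derivative:
  assumes "(B has_vector_derivative X) (at 0)"
  shows "((\<lambda>t. (B t :: mat4) $ i $ j) has_vector_derivative X $ i $ j) (at 0)"
proof -
  have "bounded_linear (\<lambda>A :: mat4. A $ i $ j)"
    using bounded_linear_compose[OF bounded_linear_vec_nth bounded_linear_vec_nth] .
  then show ?thesis using bounded_linear.has_vector_derivative assms by blast
qed

text \<open>Two lifts differ by a scalar factor, which the quotient of their upper left entries
  shows to be differentiable; both entries equal 1 at time 0. So the velocities differ by a multiple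
  of the identity, and tracelessness makes it zero.\<close>

lemma pgl_velocity_unique:
  assumes X: "pgl_velocity p X" and Y: "pgl_velocity p Y" and p: "\<forall>\<^sub>F t in nhds 0. p t \<in> carrier PGL4"
  shows "X = Y"
proof -
  obtain B where B: "B 0 = mat 1" "\<forall>\<^sub>F t in nhds 0. B t \<in> p t" "(B has_vector_derivative X) (at 0)"
    using X by (auto simp: pgl_velocity_def)
  obtain C where C: "C 0 = mat 1" "\<forall>\<^sub>F t in nhds 0. C t \<in> p t" "(C has_vector_derivative Y) (at 0)"
    using Y by (auto simp: pgl_velocity_def)
  have tr: "trace X = 0" "trace Y = 0" using X Y by (auto simp: pgl_velocity_def sl4_def)
  define k where "k t = C t $ 1 $ 1 / B t $ 1 $ 1" for t
  have B1: "B 0 $ 1 $ 1 = 1" "C 0 $ 1 $ 1 = 1" by (simp_all add: B C mat_def)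
  have dB: "((\<lambda>t. B t $ 1 $ 1) has_real_derivative X $ 1 $ 1) (at 0)"
    "((\<lambda>t. C t $ 1 $ 1) has_real_derivative Y $ 1 $ 1) (at 0)"
    using trace_component_derivative[OF B(3)] trace_component_derivative[OF C(3)]
    by (simp_all add: has_real_derivative_iff_has_vector_derivative)
  have dk: "(k has_real_derivative Y $ 1 $ 1 - X $ 1 $ 1) (at 0)"
    unfolding k_def using dB B1 by (auto intro!: derivative_eq_intros)
  have ne: "\<forall>\<^sub>F t in nhds 0. B t $ 1 $ 1 \<noteq> 0"
  proof -
    have "isCont (\<lambda>t. B t $ 1 $ 1) 0" using DERIV_isCont[OF dB(1)] .
    then have "((\<lambda>t. B t $ 1 $ 1) \<longlongrightarrow> 1) (nhds 0)" using B1 by (simp add: isCont_def tendsto_nhds_iff)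
    then show ?thesis by (rule tendsto_imp_eventually_ne) simp
  qed
  have eq: "\<forall>\<^sub>F t in nhds 0. C t = k t *\<^sub>R B t"
    using B(2) C(2) p ne
  proof eventually_elim
    case (elim t)
    then have "pgl (B t) = pgl (C t)" using PGL4_rep by metis
    then obtain r where "C t = r *\<^sub>R B t" by (auto simp: pgl_eq_iff)
    then show ?case using elim(4) by (simp add: k_def)
  qed
  have "((\<lambda>t. k t *\<^sub>R B t) has_vector_derivative k 0 *\<^sub>R X + (Y $ 1 $ 1 - X $ 1 $ 1) *\<^sub>R B 0) (at 0)"
    using dk B(3) by (intro has_vector_derivative_scaleR)
  moreover have "(C has_vector_derivative k 0 *\<^sub>R X + (Y $ 1 $ 1 - X $ 1 $ 1) *\<^sub>R B 0) (at 0)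
      \<longleftrightarrow> ((\<lambda>t. k t *\<^sub>R B t) has_vector_derivative k 0 *\<^sub>R X + (Y $ 1 $ 1 - X $ 1 $ 1) *\<^sub>R B 0) (at 0)"
    by (rule has_vector_derivative_cong_ev) (use eq eventually_nhds_x_imp_x[OF eq] in auto)
  ultimately have "Y = k 0 *\<^sub>R X + (Y $ 1 $ 1 - X $ 1 $ 1) *\<^sub>R B 0"
    using vector_derivative_unique_at C(3) by blast
  then have e: "Y = X + (Y $ 1 $ 1 - X $ 1 $ 1) *\<^sub>R mat 1" using B1 by (simp add: k_def B(1))
  then have "trace Y = trace X + (Y $ 1 $ 1 - X $ 1 $ 1) * 4" by (metis mat4_trace(1,3,4))
  then show ?thesis using tr e by simp
qed

text \<open>Rescaling a differentiable lift makes its derivative traceless.\<close>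

lemma pgl_velocity_lift:
  assumes "B 0 = mat 1" "\<forall>\<^sub>F t in nhds 0. p t = pgl (B t)" "(B has_vector_derivative X) (at 0)"
  shows "pgl_velocity p (X - (trace X / 4) *\<^sub>R mat 1)"
proof -
  define k where "k = trace X / 4"
  define C where "C t = (1 - t * k) *\<^sub>R B t" for t
  have "((\<lambda>t. 1 - t * k) has_real_derivative - k) (at 0)" by (auto intro!: derivative_eq_intros)
  then have "(C has_vector_derivative (1 - 0 * k) *\<^sub>R X + (- k) *\<^sub>R B 0) (at 0)"
    unfolding C_def using assms(3) by (intro has_vector_derivative_scaleR)
  then have d: "(C has_vector_derivative X - k *\<^sub>R mat 1) (at 0)" by (simp add: assms(1))
  have "((\<lambda>t. 1 - t * k) \<longlongrightarrow> 1 - 0 * k) (nhds 0)" by (intro tendsto_intros filterlim_ident)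
  then have "\<forall>\<^sub>F t in nhds 0. 1 - t * k \<noteq> 0" by (rule tendsto_imp_eventually_ne) simp
  then have "\<forall>\<^sub>F t in nhds 0. C t \<in> p t"
    using assms(2)
  proof eventually_elim
    case (elim t)
    show ?case unfolding C_def elim(2) mem_pgl using elim(1) by blast
  qed
  moreover have "C 0 = mat 1" by (simp add: C_def assms(1))
  ultimately show ?thesis
    unfolding pgl_velocity_def sl4_def using d by (auto simp: k_def)
qed

lemma has_vector_derivative_matrix_mult:
  assumes "(B has_vector_derivative X) (at t)" "(C has_vector_derivative Y) (at t)"
  shows "((\<lambda>t. (B t :: mat4) ** (C t :: mat4)) has_vector_derivative B t ** Y + X ** C t) (at t)"
  using bounded_bilinear.has_vector_derivative[OF bounded_bilinear_matrix_mult assms] .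

lemma has_vector_derivative_const_mult:
  assumes "(B has_vector_derivative X) (at t)"
  shows "((\<lambda>t. K ** (B t :: mat4) ** L) has_vector_derivative K ** X ** L) (at t)"
  using bounded_linear.has_vector_derivative[OF bounded_linear_compose[OF matmul.bounded_linear_left matmul.bounded_linear_right] assms] .

lemma pgl_velocity_conj:
  assumes X: "pgl_velocity p X" and p: "\<forall>\<^sub>F t in nhds 0. p t \<in> carrier PGL4" and K: "invertible K"
  shows "pgl_velocity (\<lambda>t. pgl K \<otimes>\<^bsub>PGL4\<^esub> p t \<otimes>\<^bsub>PGL4\<^esub> inv\<^bsub>PGL4\<^esub> (pgl K)) (K ** X ** matrix_inv K)"
proof -
  obtain B where B: "B 0 = mat 1" "\<forall>\<^sub>F t in nhds 0. B t \<in> p t" "(B has_vector_derivative X) (at 0)"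
    using X by (auto simp: pgl_velocity_def)
  have t: "trace (K ** X ** matrix_inv K) = 0" using X K by (simp add: trace_conj pgl_velocity_def sl4_def)
  have "pgl_velocity (\<lambda>t. pgl K \<otimes>\<^bsub>PGL4\<^esub> p t \<otimes>\<^bsub>PGL4\<^esub> inv\<^bsub>PGL4\<^esub> (pgl K))
      (K ** X ** matrix_inv K - (trace (K ** X ** matrix_inv K) / 4) *\<^sub>R mat 1)"
  proof (rule pgl_velocity_lift)
    show "K ** B 0 ** matrix_inv K = mat 1" using K by (simp add: B)
    show "\<forall>\<^sub>F t in nhds 0. pgl K \<otimes>\<^bsub>PGL4\<^esub> p t \<otimes>\<^bsub>PGL4\<^esub> inv\<^bsub>PGL4\<^esub> (pgl K) = pgl (K ** B t ** matrix_inv K)"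
      using B(2) p
    proof eventually_elim
      case (elim t)
      then have "p t = pgl (B t)" "invertible (B t)" using PGL4_rep by blast+
      then show ?case using K by (simp add: pgl_conj)
    qed
    show "((\<lambda>t. K ** B t ** matrix_inv K) has_vector_derivative K ** X ** matrix_inv K) (at 0)"
      by (rule has_vector_derivative_const_mult[OF B(3)])
  qed
  then show ?thesis unfolding t by simp
qed

lemma pgl_velocity_mult:
  assumes X: "pgl_velocity p X" and p: "\<forall>\<^sub>F t in nhds 0. p t \<in> carrier PGL4"
    and Y: "pgl_velocity q Y" and q: "\<forall>\<^sub>F t in nhds 0. q t \<in> carrier PGL4"
  shows "pgl_velocity (\<lambda>t. p t \<otimes>\<^bsub>PGL4\<^esub> q t) (X + Y)"
proof -
  obtain B where B: "B 0 = mat 1" "\<forall>\<^sub>F t in nhds 0. B t \<in> p t" "(B has_vector_derivative X) (at 0)"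
    using X by (auto simp: pgl_velocity_def)
  obtain C where C: "C 0 = mat 1" "\<forall>\<^sub>F t in nhds 0. C t \<in> q t" "(C has_vector_derivative Y) (at 0)"
    using Y by (auto simp: pgl_velocity_def)
  have t: "trace (X + Y) = 0" using X Y by (simp add: pgl_velocity_def sl4_def)
  have "pgl_velocity (\<lambda>t. p t \<otimes>\<^bsub>PGL4\<^esub> q t) (X + Y - (trace (X + Y) / 4) *\<^sub>R mat 1)"
  proof (rule pgl_velocity_lift)
    show "B 0 ** C 0 = mat 1" by (simp add: B C)
    show "\<forall>\<^sub>F t in nhds 0. p t \<otimes>\<^bsub>PGL4\<^esub> q t = pgl (B t ** C t)"
      using B(2) p C(2) q
    proof eventually_elim
      case (elim t)
      then have "p t = pgl (B t)" "invertible (B t)" "q t = pgl (C t)" "invertible (C t)" using PGL4_rep by blast+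
      then show ?case by (simp add: pgl_mult)
    qed
    show "((\<lambda>t. B t ** C t) has_vector_derivative X + Y) (at 0)"
      using has_vector_derivative_matrix_mult[OF B(3) C(3)] by (simp add: B C add.commute)
  qed
  then show ?thesis unfolding t by simp
qed

lemma pgl_velocity_inv:
  assumes X: "pgl_velocity p X" and p: "\<forall>\<^sub>F t in nhds 0. p t \<in> carrier PGL4"
  shows "pgl_velocity (\<lambda>t. inv\<^bsub>PGL4\<^esub> (p t)) (- X)"
proof -
  obtain B where B: "B 0 = mat 1" "\<forall>\<^sub>F t in nhds 0. B t \<in> p t" "(B has_vector_derivative X) (at 0)"
    using X by (auto simp: pgl_velocity_def)
  have t: "trace (- X) = 0" using X by (simp add: pgl_velocity_def sl4_def)
  have "pgl_velocity (\<lambda>t. inv\<^bsub>PGL4\<^esub> (p t)) (- X - (trace (- X) / 4) *\<^sub>R mat 1)"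
  proof (rule pgl_velocity_lift)
    show "matrix_inv (B 0) = mat 1" by (simp add: B)
    show "\<forall>\<^sub>F t in nhds 0. inv\<^bsub>PGL4\<^esub> (p t) = pgl (matrix_inv (B t))"
      using B(2) p
    proof eventually_elim
      case (elim t)
      then have "p t = pgl (B t)" "invertible (B t)" using PGL4_rep by blast+
      then show ?case by (simp add: pgl_inv)
    qed
    have "(matrix_inv has_derivative (\<lambda>H. - H)) (at (B 0))"
      using has_derivative_matrix_inv[OF invertible_mat_1[where 'n=4]] by (simp add: B)
    from has_derivative_compose[OF B(3)[unfolded has_vector_derivative_def] this]
    show "((\<lambda>t. matrix_inv (B t)) has_vector_derivative - X) (at 0)"
      by (simp add: has_vector_derivative_def)
  qed
  then show ?thesis unfolding t by simp
qed

lemma pgl_velocity_cong: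
  assumes "pgl_velocity p X" and e: "\<forall>\<^sub>F t in nhds 0. p t = q t" shows "pgl_velocity q X"
proof -
  obtain B where B: "X \<in> sl4" "B 0 = mat 1" "\<forall>\<^sub>F t in nhds 0. B t \<in> p t" "(B has_vector_derivative X) (at 0)"
    using assms by (auto simp: pgl_velocity_def)
  have "\<forall>\<^sub>F t in nhds 0. B t \<in> q t" using B(3) e by eventually_elim simp
  then show ?thesis using B by (auto simp: pgl_velocity_def)
qed

section \<open>Cocycles of velocities of paths of representations\<close>

context fibre_rep
begin

lemma Ad_\<rho>: "g \<in> carrier G \<Longrightarrow> Ad (\<rho> g) X = M g ** X ** matrix_inv (M g)"
  by (simp add: \<rho>_M Ad_pgl inv_M)

lemma \<rho>_closed: "g \<in> carrier G \<Longrightarrow> \<rho> g \<in> carrier PGL4"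
  using \<rho>_hom by (auto simp: hom_def)

lemma \<rho>_mult: "g \<in> carrier G \<Longrightarrow> h \<in> carrier G \<Longrightarrow> \<rho> (g \<otimes> h) = \<rho> g \<otimes>\<^bsub>PGL4\<^esub> \<rho> h"
  using \<rho>_hom by (auto simp: hom_def)

lemma \<rho>_inv: "g \<in> carrier G \<Longrightarrow> \<rho> (inv g) = inv\<^bsub>PGL4\<^esub> (\<rho> g)"
  using group_hom.hom_inv[of G PGL4 \<rho> g] \<rho>_hom group_PGL4 by (simp add: group_hom_def group_hom_axioms_def is_group)

text \<open>The lift \<open>Y\<close> may start at any matrices representing the classes at time 0,
  not only at \<open>M a\<close> and \<open>M b\<close>.\<close>

definition lifts :: "real \<Rightarrow> (real \<Rightarrow> mat4 \<times> mat4) \<Rightarrow> (real \<Rightarrow> 'g \<Rightarrow> mat4 set) \<Rightarrow> bool" where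
  "lifts \<epsilon> Y \<sigma> \<longleftrightarrow> \<epsilon> > 0 \<and> (\<forall>k. Ck_on k {-\<epsilon><..<\<epsilon>} Y) \<and>
     (\<forall>t\<in>{-\<epsilon><..<\<epsilon>}. Y t \<in> GL2 \<and> \<sigma> t = rep (Y t))"

lemma smooth_rep_path_lifts:
  assumes "smooth_rep_path G F a b \<sigma>" obtains \<epsilon> Y where "lifts \<epsilon> Y \<sigma>"
proof -
  obtain \<epsilon> where \<epsilon>: "\<epsilon> > 0" "\<forall>t\<in>{-\<epsilon><..<\<epsilon>}. \<sigma> t \<in> Reps G F"
    and B: "\<forall>g\<in>{a, b}. \<exists>B. smooth_on {-\<epsilon><..<\<epsilon>} B \<and> (\<forall>t\<in>{-\<epsilon><..<\<epsilon>}. B t \<in> \<sigma> t g)"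
    using assms unfolding smooth_rep_path_def by blast
  obtain A B where AB: "smooth_on {-\<epsilon><..<\<epsilon>} A" "\<forall>t\<in>{-\<epsilon><..<\<epsilon>}. A t \<in> \<sigma> t a"
    "smooth_on {-\<epsilon><..<\<epsilon>} B" "\<forall>t\<in>{-\<epsilon><..<\<epsilon>}. B t \<in> \<sigma> t b" using B by auto
  have "lifts \<epsilon> (\<lambda>t. (A t, B t)) \<sigma>"
    unfolding lifts_def
  proof (intro conjI allI ballI)
    fix k show "Ck_on k {-\<epsilon><..<\<epsilon>} (\<lambda>t. (A t, B t))"
      using AB by (intro Ck_on_Pair) (auto simp: smooth_on_def)
  next
    fix t assume t: "t \<in> {-\<epsilon><..<\<epsilon>}"
    then have s: "\<sigma> t \<in> Reps G F" using \<epsilon> by blast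
    have "\<sigma> t a = pgl (A t) \<and> invertible (A t)" "\<sigma> t b = pgl (B t) \<and> invertible (B t)"
      using PGL4_rep Reps_closed[OF s] ab_mem AB t by blast+
    then show "(A t, B t) \<in> GL2" "\<sigma> t = rep (A t, B t)" using rep_eqI[OF s] by auto
  qed (rule \<epsilon>)
  then show ?thesis using that by blast
qed

definition lifts_word :: "(mat4 \<times> mat4 \<Rightarrow> mat4) \<Rightarrow> 'g \<Rightarrow> bool" where
  "lifts_word w g \<longleftrightarrow> (\<forall>k. Ck_on k GL2 w) \<and> (\<forall>X. X \<in> GL2 \<longrightarrow> invertible (w X) \<and> rep X g = pgl (w X))"

lemma lifts_wordD:
  assumes "lifts_word w g"
  shows "Ck_on k GL2 w" "X \<in> GL2 \<Longrightarrow> invertible (w X)" "X \<in> GL2 \<Longrightarrow> rep X g = pgl (w X)"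
  using assms unfolding lifts_word_def by blast+

lemma lifts_wordI:
  assumes "\<And>k. Ck_on k GL2 w" "\<And>X. X \<in> GL2 \<Longrightarrow> invertible (w X)" "\<And>X. X \<in> GL2 \<Longrightarrow> rep X g = pgl (w X)"
  shows "lifts_word w g"
  unfolding lifts_word_def using assms by (intro conjI allI impI)

text \<open>A word becomes a product of the two matrices and their inverses, a smooth map on all of
  \<open>GL2\<close>. It carries smoothness from the generators to every element of
  \<open>F\<close>, in particular to the conjugates of \<open>a\<close> and \<open>b\<close> by
  elements of \<open>G\<close>.\<close>

lemma word_lift:
  assumes "g \<in> F"
  shows "\<exists>w. lifts_word w g"
  using assms
proof (induction rule: F_induct)
  case one
  have "lifts_word (\<lambda>X. mat 1) \<one>"
    by (rule lifts_wordI)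
      (rule Ck_on_const[OF open_GL2], rule invertible_mat_1, simp only: Reps_one[OF rep_props(1)] pgl_one)
  then show ?case by (intro exI)
next
  case a
  have "lifts_word fst a"
    by (rule lifts_wordI) (rule Ck_on_linear[OF bounded_linear_fst open_GL2], auto simp: rep_props(2))
  then show ?case by (intro exI)
next
  case b
  have "lifts_word snd b"
    by (rule lifts_wordI) (rule Ck_on_linear[OF bounded_linear_snd open_GL2], auto simp: rep_props(3))
  then show ?case by (intro exI)
next
  case (inv g)
  then obtain w where w: "lifts_word w g" by blast
  have "lifts_word (\<lambda>X. matrix_inv (w X)) (inv g)"
  proof (rule lifts_wordI)
    fix k show "Ck_on k GL2 (\<lambda>X. matrix_inv (w X))"
      by (rule Ck_on_compose[OF open_GL2 Ck_on_matrix_inv lifts_wordD(1)[OF w]]) (use lifts_wordD(2)[OF w] in blast)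
  next
    fix X assume X: "X \<in> GL2"
    show "invertible (matrix_inv (w X))" using lifts_wordD(2)[OF w X] by simp
    show "rep X (inv g) = pgl (matrix_inv (w X))"
      using lifts_wordD(2,3)[OF w X] Reps_inv[OF rep_props(1)[OF X] inv(1)] by (simp add: pgl_inv)
  qed
  then show ?case by (intro exI)
next
  case (mult g h)
  obtain w v where w: "lifts_word w g" and v: "lifts_word v h" using mult by blast
  have "lifts_word (\<lambda>X. w X ** v X) (g \<otimes> h)"
  proof (rule lifts_wordI)
    fix k show "Ck_on k GL2 (\<lambda>X. w X ** v X)"
      by (rule Ck_on_bilinear[OF bounded_bilinear_matrix_mult open_GL2 lifts_wordD(1)[OF w] lifts_wordD(1)[OF v]])
  next
    fix X assume X: "X \<in> GL2"
    note i = lifts_wordD(2)[OF w X] lifts_wordD(2)[OF v X]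
    show "invertible (w X ** v X)" by (rule invertible_mult[OF i])
    show "rep X (g \<otimes> h) = pgl (w X ** v X)"
      using i lifts_wordD(3)[OF w X] lifts_wordD(3)[OF v X] Reps_mult[OF rep_props(1)[OF X] mult(1,2)]
      by (simp add: pgl_mult)
  qed
  then show ?case by (intro exI)
qed

lemma lifts_smooth_rep_path:
  assumes "lifts \<epsilon> Y \<sigma>" shows "smooth_rep_path G F a b \<sigma>"
  unfolding smooth_rep_path_def
proof (intro exI[of _ \<epsilon>] conjI ballI)
  let ?I = "{-\<epsilon><..<\<epsilon>}"
  have Y: "Ck_on k ?I Y" "t \<in> ?I \<Longrightarrow> Y t \<in> GL2 \<and> \<sigma> t = rep (Y t)" for k t
    using assms unfolding lifts_def by blast+
  show "\<epsilon> > 0" using assms by (simp add: lifts_def)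
  show "\<sigma> t \<in> Reps G F" if "t \<in> ?I" for t using Y(2)[OF that] rep_props(1) by simp
  fix g assume "g \<in> {a, b}"
  then have "g \<in> F" using ab_mem by auto
  then obtain w where w: "lifts_word w g" using word_lift by blast
  have "Ck_on k ?I (\<lambda>t. w (Y t))" for k
    by (rule Ck_on_compose[OF _ lifts_wordD(1)[OF w] Y(1)]) (use Y(2) in \<open>simp, blast\<close>)
  then have "smooth_on ?I (\<lambda>t. w (Y t))" by (simp add: smooth_on_def)
  moreover have "w (Y t) \<in> \<sigma> t g" if "t \<in> ?I" for t
    using Y(2)[OF that] lifts_wordD(3)[OF w, of "Y t"] by (simp del: GL4_simps)
  ultimately show "\<exists>B. smooth_on ?I B \<and> (\<forall>t\<in>?I. B t \<in> \<sigma> t g)" by blast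
qed

lemma eventually_interval: "\<epsilon> > 0 \<Longrightarrow> \<forall>\<^sub>F t in nhds (0::real). t \<in> {-\<epsilon><..<\<epsilon>}"
  by (intro eventually_nhds_in_open) auto

lemma liftsD:
  assumes "lifts \<epsilon> Y \<sigma>"
  shows "\<epsilon> > 0" "Ck_on k {-\<epsilon><..<\<epsilon>} Y" "t \<in> {-\<epsilon><..<\<epsilon>} \<Longrightarrow> Y t \<in> GL2" "t \<in> {-\<epsilon><..<\<epsilon>} \<Longrightarrow> \<sigma> t = rep (Y t)"
  using assms unfolding lifts_def by blast+

lemma lifts_eventually:
  assumes "lifts \<epsilon> Y \<sigma>" shows "\<forall>\<^sub>F t in nhds 0. \<sigma> t \<in> Reps G F"
  using eventually_interval[OF liftsD(1)[OF assms]]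
proof eventually_elim
  case (elim t)
  show ?case unfolding liftsD(4)[OF assms elim] by (rule rep_props(1)[OF liftsD(3)[OF assms elim]])
qed

lemma velocity_closed:
  assumes "lifts \<epsilon> Y \<sigma>" "g \<in> F"
  shows "\<forall>\<^sub>F t in nhds 0. \<sigma> t g \<otimes>\<^bsub>PGL4\<^esub> inv\<^bsub>PGL4\<^esub> (\<rho> g) \<in> carrier PGL4"
  using lifts_eventually[OF assms(1)]
proof eventually_elim
  case (elim t)
  then show ?case using Reps_closed assms(2) \<rho>_closed by simp
qed

lemma path_cocycle_unique:
  assumes "lifts \<epsilon> Y \<sigma>" "path_cocycle F \<rho> \<sigma> f" "path_cocycle F \<rho> \<sigma> f'"
  shows "f = f'"
proof
  fix g show "f g = f' g"
    using assms pgl_velocity_unique[OF _ _ velocity_closed[OF assms(1)]]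
    by (cases "g \<in> F") (auto simp: path_cocycle_def)
qed

end

context fibre_rep
begin

text \<open>The product and inverse rules for velocities spread existence from \<open>a\<close> and
  \<open>b\<close> to all of \<open>F\<close>; since a velocity is unique, the product rule becomes
  the cocycle identity for the chosen values.\<close>

lemma path_cocycle_exists:
  assumes l: "lifts \<epsilon> Y \<sigma>"
    and A: "pgl_velocity (\<lambda>t. \<sigma> t a \<otimes>\<^bsub>PGL4\<^esub> inv\<^bsub>PGL4\<^esub> (\<rho> a)) A"
    and B: "pgl_velocity (\<lambda>t. \<sigma> t b \<otimes>\<^bsub>PGL4\<^esub> inv\<^bsub>PGL4\<^esub> (\<rho> b)) B"
  shows "\<exists>f\<in>Z1 G F \<rho>. path_cocycle F \<rho> \<sigma> f \<and> f a = A \<and> f b = B"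
proof -
  define v where "v g t = \<sigma> t g \<otimes>\<^bsub>PGL4\<^esub> inv\<^bsub>PGL4\<^esub> (\<rho> g)" for g t
  note vc = velocity_closed[OF l, folded v_def]
  note ev = lifts_eventually[OF l] and cong = pgl_velocity_cong
  \<comment> \<open>With v(g) = \<sigma>(g) \<rho>(g)^-1 one has v(gh) = v(g) \<rho>(g) v(h)
    \<rho>(g)^-1, so the velocity at gh is that at g plus the adjoint image of that at h.\<close>
  have mult: "pgl_velocity (v (g \<otimes> h)) (X + Ad (\<rho> g) Y)"
    if g: "g \<in> F" "h \<in> F" and X: "pgl_velocity (v g) X" and Y: "pgl_velocity (v h) Y" for g h X Y
  proof -
    have K: "\<rho> g = pgl (M g)" "invertible (M g)" using g by (auto simp: \<rho>_M inv_M)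
    have c: "\<forall>\<^sub>F t in nhds 0. pgl (M g) \<otimes>\<^bsub>PGL4\<^esub> v h t \<otimes>\<^bsub>PGL4\<^esub> inv\<^bsub>PGL4\<^esub> (pgl (M g)) \<in> carrier PGL4"
      using vc[OF g(2)] by eventually_elim (use K in simp)
    have "pgl_velocity (\<lambda>t. v g t \<otimes>\<^bsub>PGL4\<^esub> (pgl (M g) \<otimes>\<^bsub>PGL4\<^esub> v h t \<otimes>\<^bsub>PGL4\<^esub> inv\<^bsub>PGL4\<^esub> (pgl (M g))))
        (X + M g ** Y ** matrix_inv (M g))"
      by (rule pgl_velocity_mult[OF X vc[OF g(1)] pgl_velocity_conj[OF Y vc[OF g(2)] K(2)] c])
    moreover have "\<forall>\<^sub>F t in nhds 0. v g t \<otimes>\<^bsub>PGL4\<^esub> (pgl (M g) \<otimes>\<^bsub>PGL4\<^esub> v h t \<otimes>\<^bsub>PGL4\<^esub> inv\<^bsub>PGL4\<^esub> (pgl (M g))) = v (g \<otimes> h) t"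
      using ev
    proof eventually_elim
      case (elim t)
      have s: "\<sigma> t g \<in> carrier PGL4" "\<sigma> t h \<in> carrier PGL4" using Reps_closed[OF elim] g by auto
      have r: "\<rho> g \<in> carrier PGL4" "\<rho> h \<in> carrier PGL4" using g \<rho>_closed by auto
      have "inv\<^bsub>PGL4\<^esub> (\<rho> g) \<otimes>\<^bsub>PGL4\<^esub> (\<rho> g \<otimes>\<^bsub>PGL4\<^esub> y) = y" if "y \<in> carrier PGL4" for y
        using r that by (simp flip: PGL.m_assoc)
      then show ?case
        using s r g by (simp add: v_def Reps_mult[OF elim] \<rho>_mult K(1)[symmetric] PGL.inv_mult_group PGL.m_assoc)
    qed
    ultimately show ?thesis using cong Ad_\<rho> g by simp
  qed
  have invv: "\<exists>Z. pgl_velocity (v (inv g)) Z" if g: "g \<in> F" and X: "pgl_velocity (v g) X" for g X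
  proof -
    have gG: "inv g \<in> carrier G" using g by simp
    have K: "\<rho> (inv g) = pgl (M (inv g))" "invertible (M (inv g))" using gG \<rho>_M inv_M by auto
    have c: "\<forall>\<^sub>F t in nhds 0. inv\<^bsub>PGL4\<^esub> (v g t) \<in> carrier PGL4"
      using vc[OF g] by eventually_elim simp
    have "pgl_velocity (\<lambda>t. pgl (M (inv g)) \<otimes>\<^bsub>PGL4\<^esub> inv\<^bsub>PGL4\<^esub> (v g t) \<otimes>\<^bsub>PGL4\<^esub> inv\<^bsub>PGL4\<^esub> (pgl (M (inv g))))
        (M (inv g) ** (- X) ** matrix_inv (M (inv g)))"
      by (rule pgl_velocity_conj[OF pgl_velocity_inv[OF X vc[OF g]] c K(2)])
    moreover have "\<forall>\<^sub>F t in nhds 0. pgl (M (inv g)) \<otimes>\<^bsub>PGL4\<^esub> inv\<^bsub>PGL4\<^esub> (v g t) \<otimes>\<^bsub>PGL4\<^esub> inv\<^bsub>PGL4\<^esub> (pgl (M (inv g))) = v (inv g) t"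
      using ev
    proof eventually_elim
      case (elim t)
      have s: "\<sigma> t g \<in> carrier PGL4" using Reps_closed[OF elim] g by auto
      have r: "\<rho> g \<in> carrier PGL4" using g \<rho>_closed by auto
      have "inv\<^bsub>PGL4\<^esub> (\<rho> g) \<otimes>\<^bsub>PGL4\<^esub> (\<rho> g \<otimes>\<^bsub>PGL4\<^esub> y) = y" if "y \<in> carrier PGL4" for y
        using r that by (simp flip: PGL.m_assoc)
      then show ?case
        using s r g by (simp add: v_def Reps_inv[OF elim] \<rho>_inv K(1)[symmetric] PGL.inv_mult_group PGL.m_assoc)
    qed
    ultimately show ?thesis using cong by blast
  qed
  have ex: "\<exists>X. pgl_velocity (v g) X" if "g \<in> F" for g
    using that
  proof (induction rule: F_induct)
    case one
    have "pgl_velocity (v \<one>) (0 - (trace (0::mat4) / 4) *\<^sub>R mat 1)"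
    proof (rule pgl_velocity_lift[where B = "\<lambda>t. mat 1"])
      show "\<forall>\<^sub>F t in nhds 0. v \<one> t = pgl (mat 1)"
        using ev
      proof eventually_elim
        case (elim t)
        have "\<rho> \<one> = \<one>\<^bsub>PGL4\<^esub>" using Reps_one[OF restrict_Reps] by simp
        then show ?case using Reps_one[OF elim] by (simp add: v_def pgl_one[symmetric])
      qed
    qed auto
    then show ?case by blast
  next
    case (inv g)
    then show ?case using invv by blast
  next
    case (mult g h)
    then show ?case using \<open>\<And>g h X Y. \<lbrakk>g \<in> F; h \<in> F; pgl_velocity (v g) X; pgl_velocity (v h) Y\<rbrakk> \<Longrightarrow> pgl_velocity (v (g \<otimes> h)) (X + Ad (\<rho> g) Y)\<close> by blast
  qed (use A B in \<open>auto simp: v_def[abs_def]\<close>)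
  define f where "f g = (if g \<in> F then SOME X. pgl_velocity (v g) X else 0)" for g
  have f: "pgl_velocity (v g) (f g)" if "g \<in> F" for g
    unfolding f_def using someI_ex[OF ex[OF that]] that by simp
  have uniq: "X = f g" if "g \<in> F" "pgl_velocity (v g) X" for g X
    using pgl_velocity_unique[OF that(2) f[OF that(1)] vc[OF that(1)]] .
  have "f \<in> Z1 G F \<rho>"
    unfolding Z1_def
  proof (intro CollectI conjI ballI allI impI)
    fix g h assume g: "g \<in> F" "h \<in> F"
    have "pgl_velocity (v (g \<otimes> h)) (f g + Ad (\<rho> g) (f h))" by (rule mult[OF g f[OF g(1)] f[OF g(2)]])
    then show "f (g \<otimes> h) = f g + Ad (\<rho> g) (f h)" using uniq[of "g \<otimes> h"] g by simp
  next
    fix g assume "g \<in> F" then show "f g \<in> sl4" using f by (simp add: pgl_velocity_def)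
  qed (simp add: f_def)
  moreover have "path_cocycle F \<rho> \<sigma> f"
    using f by (auto simp: path_cocycle_def v_def[abs_def] f_def)
  moreover have "f a = A" "f b = B" using uniq[of a A] uniq[of b B] A B ab_mem by (simp_all add: v_def[abs_def])
  ultimately show ?thesis by blast
qed

lemma Z1_D:
  assumes "f \<in> Z1 G F \<rho>"
  shows "g \<in> F \<Longrightarrow> trace (f g) = 0" "g \<notin> F \<Longrightarrow> f g = 0"
    "g \<in> F \<Longrightarrow> h \<in> F \<Longrightarrow> f (g \<otimes> h) = f g + M g ** f h ** matrix_inv (M g)"
  using assms by (auto simp: Z1_def sl4_def Ad_\<rho>)

lemma Z1_eqI:
  assumes f: "f \<in> Z1 G F \<rho>" and g: "f' \<in> Z1 G F \<rho>" and "f a = f' a" "f b = f' b"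
  shows "f = f'"
proof
  fix g
  have one: "h \<one> = 0" if "h \<in> Z1 G F \<rho>" for h
  proof -
    have "h (\<one> \<otimes> \<one>) = h \<one> + M \<one> ** h \<one> ** matrix_inv (M \<one>)" by (rule Z1_D(3)[OF that]) auto
    then have "M \<one> ** h \<one> ** matrix_inv (M \<one>) = 0" by simp
    then have "matrix_inv (M \<one>) ** (M \<one> ** h \<one> ** matrix_inv (M \<one>)) ** M \<one> = 0" by simp
    then show ?thesis using inv_M[of \<one>] by (simp add: matrix_mul_assoc)
  qed
  show "f g = f' g"
  proof (cases "g \<in> F")
    case True
    then show ?thesis
    proof (induction rule: F_induct)
      case (inv g)
      have i: "h (inv g) = - (M (inv g) ** h g ** matrix_inv (M (inv g)))" if "h \<in> Z1 G F \<rho>" for h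
        using Z1_D(3)[OF that, of "inv g" g] inv(1) one[OF that] by (simp add: eq_neg_iff_add_eq_0)
      show ?case using inv by (simp add: i[OF f] i[OF assms(2)])
    next
      case (mult g h)
      then show ?case by (simp add: Z1_D(3)[OF f] Z1_D(3)[OF assms(2)])
    qed (simp_all add: one assms)
  qed (simp add: Z1_D(2)[OF f] Z1_D(2)[OF g])
qed

text \<open>\<open>F\<close> is free, so any pair of invertible matrices defines a representation
  and no cocycle is obstructed: multiplying the generators by \<open>mat 1 + t *\<^sub>R A\<close>
  and \<open>mat 1 + t *\<^sub>R B\<close> realises every pair of traceless velocities.\<close>

lemma path_of_values:
  assumes "trace A = 0" "trace B = 0"
  shows "\<exists>\<epsilon> Y \<sigma> f. lifts \<epsilon> Y \<sigma> \<and> \<sigma> 0 = restrict \<rho> F \<and> f \<in> Z1 G F \<rho> \<and> path_cocycle F \<rho> \<sigma> f \<and> f a = A \<and> f b = B"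
proof -
  define Y where "Y t = ((mat 1 + t *\<^sub>R A) ** M a, (mat 1 + t *\<^sub>R B) ** M b)" for t :: real
  define \<sigma> where "\<sigma> t = rep (Y t)" for t
  have i: "invertible (M a)" "invertible (M b)" using inv0 by auto
  have Yk: "Ck_on k UNIV Y" for k
    unfolding Y_def
    by (intro Ck_on_Pair Ck_on_bilinear[OF bounded_bilinear_matrix_mult] Ck_on_add Ck_on_const
        Ck_on_linear[OF bounded_linear_scaleR_left]) auto
  have "open (Y -` GL2)"
    using open_vimage[OF open_GL2 Ck_on_continuous[OF Yk]] .
  moreover have Y0: "Y 0 = X0" by (simp add: Y_def X0_def)
  then have "0 \<in> Y -` GL2" using X0_GL2 by simp
  ultimately obtain \<epsilon> where \<epsilon>: "\<epsilon> > 0" "ball 0 \<epsilon> \<subseteq> Y -` GL2" using openE by blast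
  have I: "{-\<epsilon><..<\<epsilon>} = ball (0::real) \<epsilon>" by (auto simp: dist_real_def)
  have YGL: "Y t \<in> GL2" if "t \<in> {-\<epsilon><..<\<epsilon>}" for t using that \<epsilon>(2) unfolding I by blast
  have l: "lifts \<epsilon> Y \<sigma>"
    unfolding lifts_def using \<epsilon>(1) Ck_on_subset[OF Yk] YGL by (simp add: \<sigma>_def del: GL4_simps)
  have ev: "\<forall>\<^sub>F t in nhds 0. Y t \<in> GL2" using eventually_interval[OF \<epsilon>(1)] by eventually_elim (rule YGL)
  have d: "((\<lambda>t. mat 1 + t *\<^sub>R C) has_vector_derivative C) (at 0)" for C :: mat4
    by (auto intro!: derivative_eq_intros)
  have "pgl_velocity (\<lambda>t. \<sigma> t a \<otimes>\<^bsub>PGL4\<^esub> inv\<^bsub>PGL4\<^esub> (\<rho> a)) (A - (trace A / 4) *\<^sub>R mat 1)"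
  proof (rule pgl_velocity_lift[OF _ _ d])
    show "\<forall>\<^sub>F t in nhds 0. \<sigma> t a \<otimes>\<^bsub>PGL4\<^esub> inv\<^bsub>PGL4\<^esub> (\<rho> a) = pgl (mat 1 + t *\<^sub>R A)"
      using ev
    proof eventually_elim
      case (elim t)
      have "invertible ((mat 1 + t *\<^sub>R A) ** M a)" using elim by (simp add: Y_def)
      then show ?case using rep_props(2)[OF elim] i ab_carrier by (simp add: \<sigma>_def \<rho>_M Y_def pgl_inv pgl_mult)
    qed
  qed simp
  moreover have "pgl_velocity (\<lambda>t. \<sigma> t b \<otimes>\<^bsub>PGL4\<^esub> inv\<^bsub>PGL4\<^esub> (\<rho> b)) (B - (trace B / 4) *\<^sub>R mat 1)"
  proof (rule pgl_velocity_lift[OF _ _ d])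
    show "\<forall>\<^sub>F t in nhds 0. \<sigma> t b \<otimes>\<^bsub>PGL4\<^esub> inv\<^bsub>PGL4\<^esub> (\<rho> b) = pgl (mat 1 + t *\<^sub>R B)"
      using ev
    proof eventually_elim
      case (elim t)
      have "invertible ((mat 1 + t *\<^sub>R B) ** M b)" using elim by (simp add: Y_def)
      then show ?case using rep_props(3)[OF elim] i ab_carrier by (simp add: \<sigma>_def \<rho>_M Y_def pgl_inv pgl_mult)
    qed
  qed simp
  ultimately obtain f where "f \<in> Z1 G F \<rho>" "path_cocycle F \<rho> \<sigma> f" "f a = A" "f b = B"
    using path_cocycle_exists[OF l] assms by auto
  moreover have "\<sigma> 0 = restrict \<rho> F" by (simp add: \<sigma>_def Y0 rep_X0)
  ultimately show ?thesis using l by blast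
qed

end

section \<open>The tangent space and the action on it\<close>

context fibre_rep
begin

definition cob :: "mat4 \<Rightarrow> 'g \<Rightarrow> mat4" where
  "cob X = (\<lambda>g. if g \<in> F then X - Ad (\<rho> g) X else 0)"

lemma cob_apply: "g \<in> F \<Longrightarrow> cob X g = X - M g ** X ** matrix_inv (M g)"
  by (simp add: cob_def Ad_\<rho>)

lemma cob_add: "cob (X + Y) g = cob X g + cob Y g"
  by (cases "g \<in> F") (simp_all add: cob_apply matmul.add_left matmul.add_right, simp add: cob_def)

lemma cob_minus: "cob (- X) g = - cob X g"
  by (cases "g \<in> F") (simp_all add: cob_apply matmul.minus_left matmul.minus_right, simp add: cob_def)

lemma B1_cob: "B1 F \<rho> = cob ` {X. trace X = 0}"
  by (auto simp: B1_def cob_def[abs_def] sl4_def)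

lemma Z1_I:
  assumes "\<And>g. g \<in> F \<Longrightarrow> trace (f g) = 0" "\<And>g. g \<notin> F \<Longrightarrow> f g = 0"
    "\<And>g h. g \<in> F \<Longrightarrow> h \<in> F \<Longrightarrow> f (g \<otimes> h) = f g + M g ** f h ** matrix_inv (M g)"
  shows "f \<in> Z1 G F \<rho>"
  using assms by (simp add: Z1_def sl4_def Ad_\<rho>)

text \<open>The identity passes through \<open>Ad\<close> and \<open>\<rho>\<close> because
  \<open>\<rho>\<close> is multiplicative, while \<open>M\<close> picks representatives up to
  scalars, which conjugation does not see.\<close>

lemma conj_mult:
  assumes "g \<in> carrier G" "h \<in> carrier G"
  shows "M (g \<otimes> h) ** X ** matrix_inv (M (g \<otimes> h)) = M g ** (M h ** X ** matrix_inv (M h)) ** matrix_inv (M g)"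
proof -
  note i = inv_M[OF assms(1)] inv_M[OF assms(2)]
  have "Ad (\<rho> (g \<otimes> h)) X = Ad (pgl (M g ** M h)) X"
    using assms i by (simp add: \<rho>_mult \<rho>_M[OF assms(1)] \<rho>_M[OF assms(2)] pgl_mult)
  also have "\<dots> = (M g ** M h) ** X ** matrix_inv (M g ** M h)"
    using i by (intro Ad_pgl invertible_mult)
  finally show ?thesis using assms i by (simp add: Ad_\<rho> matrix_inv_matrix_mult matrix_mul_assoc)
qed

lemma cob_Z1:
  assumes "trace X = 0" shows "cob X \<in> Z1 G F \<rho>"
proof (rule Z1_I)
  fix g h assume g: "g \<in> F" "h \<in> F"
  then show "cob X (g \<otimes> h) = cob X g + M g ** cob X h ** matrix_inv (M g)"
    using conj_mult[of g h X] by (simp add: cob_apply matmul.diff_left matmul.diff_right)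
next
  fix g assume "g \<in> F"
  then show "trace (cob X g) = 0" using assms by (simp add: cob_apply trace_conj inv_M)
qed (simp add: cob_def)

lemma Z1_lincomb:
  assumes f: "f \<in> Z1 G F \<rho>" "f' \<in> Z1 G F \<rho>"
  shows "(\<lambda>g. r *\<^sub>R f g + s *\<^sub>R f' g) \<in> Z1 G F \<rho>"
proof (rule Z1_I)
  fix g h assume g: "g \<in> F" "h \<in> F"
  show "r *\<^sub>R f (g \<otimes> h) + s *\<^sub>R f' (g \<otimes> h) =
      r *\<^sub>R f g + s *\<^sub>R f' g + M g ** (r *\<^sub>R f h + s *\<^sub>R f' h) ** matrix_inv (M g)"
    using Z1_D(3)[OF f(1) g] Z1_D(3)[OF f(2) g]
    by (simp add: matmul.add_left matmul.add_right matmul.scaleR_left matmul.scaleR_right scaleR_add_right)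
qed (simp_all add: Z1_D(1,2)[OF f(1)] Z1_D(1,2)[OF f(2)])

lemma h1_class_cob: "h1_class F \<rho> f = (\<lambda>X g. f g + cob X g) ` {X. trace X = 0}"
  by (auto simp: h1_class_def B1_cob)

lemma h1_class_eqI:
  assumes "trace X = 0" "\<And>g. f' g = f g + cob X g"
  shows "h1_class F \<rho> f' = h1_class F \<rho> f"
proof -
  have 1: "(\<lambda>g. f' g + cob Y g) = (\<lambda>g. f g + cob (X + Y) g)" for Y
    by (simp add: assms(2) cob_add add.assoc)
  have 2: "(\<lambda>g. f g + cob Y g) = (\<lambda>g. f' g + cob (- X + Y) g)" for Y
    unfolding assms(2) cob_add cob_minus by simp
  show ?thesis
    unfolding h1_class_cob
  proof (intro equalityI image_subsetI)
    fix Y assume "Y \<in> {X :: mat4. trace X = 0}"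
    then have t: "trace (X + Y) = 0" "trace (- X + Y) = 0" using assms(1) mat4_trace(1,6) by simp_all
    show "(\<lambda>g. f' g + cob Y g) \<in> (\<lambda>X g. f g + cob X g) ` {X. trace X = 0}"
      by (rule image_eqI[where x = "X + Y"]) (rule 1, rule CollectI, rule t)
    show "(\<lambda>g. f g + cob Y g) \<in> (\<lambda>X g. f' g + cob X g) ` {X. trace X = 0}"
      by (rule image_eqI[where x = "- X + Y"]) (rule 2, rule CollectI, rule t)
  qed
qed

lemma self_h1_class: "f \<in> h1_class F \<rho> f"
  unfolding h1_class_cob by (rule image_eqI[of _ _ 0]) (auto simp: cob_def Ad_def)

end

section \<open>The isomorphism from the first cohomology to the tangent space\<close>

context chart_at
begin

text \<open>A cocycle value is a velocity translated back to the identity from the right;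
  multiplying by \<open>M a\<close> and \<open>M b\<close> gives the tangent vector at
  \<open>X0\<close> to which the derivative of the chart applies.\<close>

definition Dval :: "('g \<Rightarrow> mat4) \<Rightarrow> mat4 \<times> mat4" where
  "Dval f = D\<Phi> (f a ** M a, f b ** M b)"

definition D :: "('g \<Rightarrow> mat4) set \<Rightarrow> mat4 \<times> mat4" where
  "D z = Dval (SOME f. f \<in> z)"

lemma Dval_add: "Dval (\<lambda>g. f g + f' g) = Dval f + Dval f'"
  and Dval_scale: "Dval (\<lambda>g. r *\<^sub>R f g) = r *\<^sub>R Dval f"
  by (simp_all add: Dval_def matmul.add_left matmul.scaleR_left
      flip: linear_add[OF D\<Phi>(2)] linear_scale[OF D\<Phi>(2)] add_Pair scaleR_Pair)

text \<open>A coboundary is the infinitesimal conjugation by \<open>X\<close> without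
  rescaling.\<close>

lemma Dval_cob:
  assumes "trace X = 0" shows "Dval (cob X) = 0"
proof -
  have "(cob X a ** M a, cob X b ** M b) = inf_act (X, 0, 0)"
    using ab_mem inv0 by (simp add: cob_apply inf_act_def matmul.diff_left flip: matrix_mul_assoc)
  then show ?thesis using D\<Phi>_inf_act[of "(X, 0, 0)"] assms by (simp add: Dval_def inf_dom_def)
qed

lemma Dval_class:
  assumes "f' \<in> h1_class F \<rho> f" shows "Dval f' = Dval f"
  using assms unfolding h1_class_cob by (auto simp: Dval_add Dval_cob)

lemma D_class: "D (h1_class F \<rho> f) = Dval f"
  unfolding D_def by (rule Dval_class, rule someI[where P = "\<lambda>f'. f' \<in> h1_class F \<rho> f", OF self_h1_class])

lemma D\<Phi>_mod_scalars: "D\<Phi> (P - k *\<^sub>R M a, Q - l *\<^sub>R M b) = D\<Phi> (P, Q)"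
proof -
  have "(P - k *\<^sub>R M a, Q - l *\<^sub>R M b) = (P, Q) + inf_act (0, - k, - l)"
    by (simp add: inf_act_def)
  then show ?thesis using D\<Phi>_inf_act[of "(0, - k, - l)"] by (simp add: linear_add[OF D\<Phi>(2)] inf_dom_def)
qed

text \<open>The kernel of the derivative provides \<open>X\<close> and two scalars; comparing traces
  shows that the scalars vanish, so \<open>f\<close> and \<open>f'\<close> differ on the generators,
  hence everywhere, by the coboundary of \<open>X\<close>.\<close>

lemma Dval_inj:
  assumes f: "f \<in> Z1 G F \<rho>" and f': "f' \<in> Z1 G F \<rho>" and e: "Dval f = Dval f'"
  shows "h1_class F \<rho> f = h1_class F \<rho> f'"
proof -
  have "D\<Phi> ((f a ** M a, f b ** M b) - (f' a ** M a, f' b ** M b)) = 0"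
    using e unfolding linear_diff[OF D\<Phi>(2)] Dval_def by (rule right_minus_eq[THEN iffD2])
  from D\<Phi>_kernel[OF this] obtain z where z: "z \<in> inf_dom"
    "(f a ** M a, f b ** M b) - (f' a ** M a, f' b ** M b) = inf_act z" by blast
  obtain X k l where zX: "z = (X, k, l)" using prod_cases3 by blast
  have X: "trace X = 0" "(f a ** M a, f b ** M b) - (f' a ** M a, f' b ** M b) = inf_act (X, k, l)"
    using z by (simp_all add: zX inf_dom_def)
  have *: "f g = f' g + cob X g" if g: "g \<in> F"
    and m: "f g ** M g - f' g ** M g = X ** M g - M g ** X + m *\<^sub>R M g" for g m
  proof -
    have i: "invertible (M g)" using g by (simp add: inv_M)
    have "(f g ** M g - f' g ** M g) ** matrix_inv (M g) = (X ** M g - M g ** X + m *\<^sub>R M g) ** matrix_inv (M g)"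
      by (simp only: m)
    then have d: "f g - f' g = X - M g ** X ** matrix_inv (M g) + m *\<^sub>R mat 1"
      using i by (simp add: matmul.diff_left matmul.add_left matmul.scaleR_left flip: matrix_mul_assoc)
    have "trace (f g - f' g) = trace (X - M g ** X ** matrix_inv (M g) + m *\<^sub>R mat 1)" by (simp only: d)
    then have "m = 0" using Z1_D(1)[OF f g] Z1_D(1)[OF f' g] X(1) i by (simp add: trace_conj)
    then show ?thesis using d g by (simp add: cob_apply algebra_simps)
  qed
  have "f a = f' a + cob X a" by (rule *[of _ k]) (use X(2) ab_mem in \<open>simp_all add: inf_act_def\<close>)
  moreover have "f b = f' b + cob X b" by (rule *[of _ l]) (use X(2) ab_mem in \<open>simp_all add: inf_act_def\<close>)
  moreover have "(\<lambda>g. f' g + cob X g) \<in> Z1 G F \<rho>" using Z1_lincomb[OF f' cob_Z1[OF X(1)], of 1 1] by simp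
  ultimately have "f = (\<lambda>g. f' g + cob X g)" using Z1_eqI[OF f] by simp
  then show ?thesis by (intro h1_class_eqI[OF X(1)]) simp
qed

lemma Dval_surj:
  assumes "v \<in> V" shows "\<exists>f\<in>Z1 G F \<rho>. Dval f = v"
proof -
  have "v \<in> range D\<Phi>" using assms D\<Phi>(3) by simp
  then obtain P Q where v: "v = D\<Phi> (P, Q)" by (auto simp: image_iff)
  \<comment> \<open>Removing the scalar parts makes the values traceless, as cocycles require, and
    does not change the image under \<open>D\<Phi>\<close>.\<close>
  define k l where "k = trace (P ** matrix_inv (M a)) / 4" and "l = trace (Q ** matrix_inv (M b)) / 4"
  define A B where "A = P ** matrix_inv (M a) - k *\<^sub>R mat 1" and "B = Q ** matrix_inv (M b) - l *\<^sub>R mat 1"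
  have "trace A = 0" "trace B = 0" by (simp_all add: A_def B_def k_def l_def)
  from path_of_values[OF this] obtain f where f: "f \<in> Z1 G F \<rho>" "f a = A" "f b = B" by blast
  have "A ** M a = P - k *\<^sub>R M a" "B ** M b = Q - l *\<^sub>R M b"
    using inv0 by (simp_all add: A_def B_def matmul.diff_left matmul.scaleR_left flip: matrix_mul_assoc)
  then have "Dval f = v" using D\<Phi>_mod_scalars by (simp add: Dval_def f v)
  then show ?thesis using f(1) by blast
qed

lemma bij_betw_D: "bij_betw D (H1 G F \<rho>) V"
proof (rule bij_betw_imageI)
  show "inj_on D (H1 G F \<rho>)"
  proof (rule inj_onI)
    fix z z' assume "z \<in> H1 G F \<rho>" "z' \<in> H1 G F \<rho>" and e: "D z = D z'"
    then obtain f f' where f: "f \<in> Z1 G F \<rho>" "z = h1_class F \<rho> f" and f': "f' \<in> Z1 G F \<rho>" "z' = h1_class F \<rho> f'"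
      unfolding H1_def by blast
    have "Dval f = Dval f'" using e unfolding f(2) f'(2) D_class .
    then show "z = z'" unfolding f(2) f'(2) by (rule Dval_inj[OF f(1) f'(1)])
  qed
  show "D ` H1 G F \<rho> = V"
  proof (intro equalityI subsetI)
    fix v assume "v \<in> D ` H1 G F \<rho>"
    then obtain f where "v = D (h1_class F \<rho> f)" unfolding H1_def by blast
    then have "v \<in> range D\<Phi>" unfolding D_class Dval_def by (rule range_eqI)
    then show "v \<in> V" unfolding D\<Phi>(3) .
  next
    fix v assume "v \<in> V"
    from Dval_surj[OF this] obtain f where f: "f \<in> Z1 G F \<rho>" "Dval f = v" by blast
    then have "v = D (h1_class F \<rho> f)" unfolding D_class by simp
    then show "v \<in> D ` H1 G F \<rho>" unfolding H1_def using f(1) by blast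
  qed
qed

lemma path_in_U:
  assumes l: "lifts \<epsilon> Y \<sigma>" and \<sigma>0: "\<sigma> 0 = restrict \<rho> F"
  shows "\<exists>\<delta>>0. \<forall>t\<in>{-\<delta><..<\<delta>}. conj_class F (\<sigma> t) \<in> U"
proof -
  let ?I = "{-\<epsilon><..<\<epsilon>}"
  have 0: "0 \<in> ?I" using liftsD(1)[OF l] by simp
  have "open (?I \<inter> Y -` \<Omega>)"
    using continuous_open_preimage[OF Ck_on_continuous[OF liftsD(2)[OF l]] _ open_\<Omega>] by simp
  moreover have "Y 0 \<in> \<Omega>"
  proof -
    have "pt (Y 0) = pt X0" using liftsD(4)[OF l 0] \<sigma>0 rep_X0 by simp
    then show ?thesis using X0U liftsD(3)[OF l 0] unfolding \<Omega>_def by (simp del: GL4_simps)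
  qed
  ultimately obtain \<delta> where \<delta>: "\<delta> > 0" "ball 0 \<delta> \<subseteq> ?I \<inter> Y -` \<Omega>" using 0 openE by (metis IntI vimageI)
  have "conj_class F (\<sigma> t) \<in> U" if "t \<in> {-\<delta><..<\<delta>}" for t
  proof -
    have "t \<in> ball 0 \<delta>" using that by (auto simp: dist_real_def)
    then have t: "t \<in> ?I" "Y t \<in> \<Omega>" using \<delta>(2) by blast+
    then show ?thesis using liftsD(4)[OF l t(1)] unfolding \<Omega>_def by (simp del: GL4_simps)
  qed
  then show ?thesis using \<delta>(1) by blast
qed

lemma path_velocity:
  assumes l: "lifts \<epsilon> Y \<sigma>" and \<sigma>0: "\<sigma> 0 = restrict \<rho> F"
  shows "\<exists>f\<in>Z1 G F \<rho>. path_cocycle F \<rho> \<sigma> f \<and>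
    ((\<lambda>t. \<kappa> (conj_class F (\<sigma> t))) has_vector_derivative Dval f) (at 0)"
proof -
  let ?I = "{-\<epsilon><..<\<epsilon>}"
  have 0: "0 \<in> ?I" using liftsD(1)[OF l] by simp
  have iab: "invertible (M a)" "invertible (M b)" using inv0 by auto
  have r0: "rep (Y 0) = restrict \<rho> F" using liftsD(4)[OF l 0] \<sigma>0 by simp
  have "pgl (fst (Y 0)) = pgl (M a)" "pgl (snd (Y 0)) = pgl (M b)"
    using rep_props(2,3)[OF liftsD(3)[OF l 0]] ab_mem ab_carrier by (simp_all add: r0 \<rho>_M)
  \<comment> \<open>The given lift starts at multiples of \<open>M a\<close> and \<open>M b\<close>;
    rescaling it by the constants \<open>c\<close> and \<open>d\<close> moves its start to
    \<open>X0\<close>, where the derivative of \<open>\<Phi>\<close> is known.\<close>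
  then obtain c d where c: "c \<noteq> 0" "M a = c *\<^sub>R fst (Y 0)" and d: "d \<noteq> 0" "M b = d *\<^sub>R snd (Y 0)"
    by (auto simp: pgl_eq_iff)
  define S where "S p = (c *\<^sub>R fst p, d *\<^sub>R snd p)" for p :: "mat4 \<times> mat4"
  define B where "B t = S (Y t)" for t
  have linS: "bounded_linear S" unfolding S_def
    by (intro bounded_linear_Pair bounded_linear_scaleR_right[THEN bounded_linear_compose] bounded_linear_fst bounded_linear_snd)
  obtain Y' where Y': "(Y has_vector_derivative Y') (at 0)"
  proof -
    have "(Y has_derivative frechet_derivative Y (at 0)) (at 0)"
      by (rule Ck_on_SucD(1)[OF liftsD(2)[OF l] 0])
    then have "Y differentiable at 0" unfolding differentiable_def by blast
    then show ?thesis using that by (auto simp: vector_derivative_works)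
  qed
  obtain P Q where PQ: "S Y' = (P, Q)" by (meson surj_pair)
  have dB: "(B has_vector_derivative (P, Q)) (at 0)"
    using bounded_linear.has_vector_derivative[OF linS Y'] unfolding B_def PQ .
  have B0: "B 0 = X0" unfolding B_def S_def X0_def using c(2) d(2) by simp
  have pB: "pgl (fst (B t)) = pgl (fst (Y t))" "pgl (snd (B t)) = pgl (snd (Y t))" for t
    using c(1) d(1) by (simp_all add: B_def S_def pgl_scaleR)
  have \<sigma>: "\<sigma> t = rep (B t)" if t: "t \<in> ?I" for t
    using liftsD(4)[OF l t] pB[of t] by (simp add: rep_of_def)
  have Bi: "invertible (fst (B t))" "invertible (snd (B t))" if t: "t \<in> ?I" for t
  proof -
    have "invertible (fst (Y t))" "invertible (snd (Y t))" using liftsD(3)[OF l t] by auto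
    then have "pgl (fst (B t)) \<in> carrier PGL4" "pgl (snd (B t)) \<in> carrier PGL4" unfolding pB by simp_all
    then show "invertible (fst (B t))" "invertible (snd (B t))" using PGL4_rep self_mem_pgl by blast+
  qed
  define A1 B1 where "A1 = P ** matrix_inv (M a)" and "B1 = Q ** matrix_inv (M b)"
  have va: "pgl_velocity (\<lambda>t. \<sigma> t a \<otimes>\<^bsub>PGL4\<^esub> inv\<^bsub>PGL4\<^esub> (\<rho> a)) (A1 - (trace A1 / 4) *\<^sub>R mat 1)"
  proof (rule pgl_velocity_lift[where B = "\<lambda>t. fst (B t) ** matrix_inv (M a)"])
    show "fst (B 0) ** matrix_inv (M a) = mat 1" using iab by (simp add: B0 X0_def)
    show "\<forall>\<^sub>F t in nhds 0. \<sigma> t a \<otimes>\<^bsub>PGL4\<^esub> inv\<^bsub>PGL4\<^esub> (\<rho> a) = pgl (fst (B t) ** matrix_inv (M a))"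
      using eventually_interval[OF liftsD(1)[OF l]]
    proof eventually_elim
      case (elim t)
      have "\<sigma> t a = pgl (fst (B t))" using rep_props(2)[OF liftsD(3)[OF l elim]] liftsD(4)[OF l elim] pB[of t] by simp
      then show ?case using iab ab_carrier Bi[OF elim] by (simp add: \<rho>_M pgl_inv pgl_mult)
    qed
    have "((\<lambda>t. fst (B t)) has_vector_derivative P) (at 0)"
      using bounded_linear.has_vector_derivative[OF bounded_linear_fst dB] by simp
    from has_vector_derivative_const_mult[OF this, of "mat 1" "matrix_inv (M a)"]
    show "((\<lambda>t. fst (B t) ** matrix_inv (M a)) has_vector_derivative A1) (at 0)" by (simp add: A1_def)
  qed
  have vb: "pgl_velocity (\<lambda>t. \<sigma> t b \<otimes>\<^bsub>PGL4\<^esub> inv\<^bsub>PGL4\<^esub> (\<rho> b)) (B1 - (trace B1 / 4) *\<^sub>R mat 1)"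
  proof (rule pgl_velocity_lift[where B = "\<lambda>t. snd (B t) ** matrix_inv (M b)"])
    show "snd (B 0) ** matrix_inv (M b) = mat 1" using iab by (simp add: B0 X0_def)
    show "\<forall>\<^sub>F t in nhds 0. \<sigma> t b \<otimes>\<^bsub>PGL4\<^esub> inv\<^bsub>PGL4\<^esub> (\<rho> b) = pgl (snd (B t) ** matrix_inv (M b))"
      using eventually_interval[OF liftsD(1)[OF l]]
    proof eventually_elim
      case (elim t)
      have "\<sigma> t b = pgl (snd (B t))" using rep_props(3)[OF liftsD(3)[OF l elim]] liftsD(4)[OF l elim] pB[of t] by simp
      then show ?case using iab ab_carrier Bi[OF elim] by (simp add: \<rho>_M pgl_inv pgl_mult)
    qed
    have "((\<lambda>t. snd (B t)) has_vector_derivative Q) (at 0)"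
      using bounded_linear.has_vector_derivative[OF bounded_linear_snd dB] by simp
    from has_vector_derivative_const_mult[OF this, of "mat 1" "matrix_inv (M b)"]
    show "((\<lambda>t. snd (B t) ** matrix_inv (M b)) has_vector_derivative B1) (at 0)" by (simp add: B1_def)
  qed
  obtain f where f: "f \<in> Z1 G F \<rho>" "path_cocycle F \<rho> \<sigma> f"
    "f a = A1 - (trace A1 / 4) *\<^sub>R mat 1" "f b = B1 - (trace B1 / 4) *\<^sub>R mat 1"
    using path_cocycle_exists[OF l va vb] by blast
  have "f a ** M a = P - (trace A1 / 4) *\<^sub>R M a" "f b ** M b = Q - (trace B1 / 4) *\<^sub>R M b"
    using iab by (simp_all add: f A1_def B1_def matmul.diff_left matmul.scaleR_left flip: matrix_mul_assoc)
  then have Df: "Dval f = D\<Phi> (P, Q)" using D\<Phi>_mod_scalars by (simp add: Dval_def)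
  have "(\<Phi> has_derivative D\<Phi>) (at (B 0))" using D\<Phi>(1) B0 by simp
  from has_derivative_compose[OF dB[unfolded has_vector_derivative_def] this]
  have "((\<lambda>t. \<Phi> (B t)) has_vector_derivative D\<Phi> (P, Q)) (at 0)"
    unfolding has_vector_derivative_def linear_scale[OF D\<Phi>(2)] .
  then have "((\<lambda>t. \<kappa> (conj_class F (\<sigma> t))) has_vector_derivative D\<Phi> (P, Q)) (at 0)"
    by (rule has_vector_derivative_transform_within_open[where S = ?I]) (use 0 \<sigma> in \<open>auto simp: \<Phi>_def\<close>)
  then show ?thesis using f Df by auto
qed

lemma tangent_identification_D: "tangent_identification G F a b \<rho> \<kappa> V D"
  unfolding tangent_identification_def
proof (intro conjI ballI allI impI bij_betw_D)
  fix f f' :: "'g \<Rightarrow> mat4" and r s :: real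
  show "D (h1_class F \<rho> (\<lambda>g. r *\<^sub>R f g + s *\<^sub>R f' g)) = r *\<^sub>R D (h1_class F \<rho> f) + s *\<^sub>R D (h1_class F \<rho> f')"
    by (simp add: D_class Dval_add Dval_scale)
next
  fix \<sigma> assume "smooth_rep_path G F a b \<sigma>" and \<sigma>0: "\<sigma> 0 = restrict \<rho> F"
  then obtain \<epsilon> Y where "lifts \<epsilon> Y \<sigma>" using smooth_rep_path_lifts by blast
  from path_velocity[OF this \<sigma>0]
  show "\<exists>f\<in>Z1 G F \<rho>. path_cocycle F \<rho> \<sigma> f \<and>
      ((\<lambda>t. \<kappa> (conj_class F (\<sigma> t))) has_vector_derivative D (h1_class F \<rho> f)) (at 0)"
    by (simp add: D_class)
next
  fix f assume f: "f \<in> Z1 G F \<rho>"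
  obtain \<epsilon> Y \<sigma> f' where l: "lifts \<epsilon> Y \<sigma>" "\<sigma> 0 = restrict \<rho> F" "path_cocycle F \<rho> \<sigma> f'"
    and f': "f' \<in> Z1 G F \<rho>" "f' a = f a" "f' b = f b"
    using path_of_values[OF Z1_D(1)[OF f ab_mem(1)] Z1_D(1)[OF f ab_mem(2)]] by blast
  have "f' = f" by (rule Z1_eqI[OF f'(1) f f'(2,3)])
  then show "\<exists>\<sigma>. smooth_rep_path G F a b \<sigma> \<and> \<sigma> 0 = restrict \<rho> F \<and> path_cocycle F \<rho> \<sigma> f"
    using l lifts_smooth_rep_path by blast
qed

end

section \<open>The action on representations, cocycles and charts\<close>

context fibre_rep
begin

lemma conj_F: "\<gamma> \<in> carrier G \<Longrightarrow> g \<in> F \<Longrightarrow> inv \<gamma> \<otimes> g \<otimes> \<gamma> \<in> F"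
  by (rule inv_op_closed1)

lemma rep_act_Reps:
  assumes \<gamma>: "\<gamma> \<in> carrier G" and \<sigma>: "\<sigma> \<in> Reps G F"
  shows "rep_act G F \<rho> \<gamma> \<sigma> \<in> Reps G F"
  unfolding Reps_def
proof (intro IntI homI)
  have c: "\<rho> \<gamma> \<in> carrier PGL4" by (rule \<rho>_closed[OF \<gamma>])
  have s: "\<sigma> (inv \<gamma> \<otimes> g \<otimes> \<gamma>) \<in> carrier PGL4" if "g \<in> F" for g
    using Reps_closed[OF \<sigma> conj_F[OF \<gamma> that]] .
  show "rep_act G F \<rho> \<gamma> \<sigma> g \<in> carrier PGL4" if "g \<in> carrier (G\<lparr>carrier := F\<rparr>)" for g
    using that c s by (simp add: rep_act_def)
  fix g h assume "g \<in> carrier (G\<lparr>carrier := F\<rparr>)" "h \<in> carrier (G\<lparr>carrier := F\<rparr>)"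
  then have gh: "g \<in> F" "h \<in> F" by simp_all
  have canc: "inv\<^bsub>PGL4\<^esub> (\<rho> \<gamma>) \<otimes>\<^bsub>PGL4\<^esub> (\<rho> \<gamma> \<otimes>\<^bsub>PGL4\<^esub> y) = y" if "y \<in> carrier PGL4" for y
    using c that by (simp flip: PGL.m_assoc)
  have cancG: "\<gamma> \<otimes> (inv \<gamma> \<otimes> y) = y" if "y \<in> carrier G" for y
    using \<gamma> that by (simp flip: m_assoc)
  have e: "inv \<gamma> \<otimes> (g \<otimes> h) \<otimes> \<gamma> = (inv \<gamma> \<otimes> g \<otimes> \<gamma>) \<otimes> (inv \<gamma> \<otimes> h \<otimes> \<gamma>)"
    using \<gamma> gh by (simp add: m_assoc cancG)
  have "\<sigma> (inv \<gamma> \<otimes> (g \<otimes> h) \<otimes> \<gamma>) = \<sigma> (inv \<gamma> \<otimes> g \<otimes> \<gamma>) \<otimes>\<^bsub>PGL4\<^esub> \<sigma> (inv \<gamma> \<otimes> h \<otimes> \<gamma>)"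
    unfolding e by (rule Reps_mult[OF \<sigma> conj_F[OF \<gamma> gh(1)] conj_F[OF \<gamma> gh(2)]])
  then show "rep_act G F \<rho> \<gamma> \<sigma> (g \<otimes>\<^bsub>G\<lparr>carrier := F\<rparr>\<^esub> h) = rep_act G F \<rho> \<gamma> \<sigma> g \<otimes>\<^bsub>PGL4\<^esub> rep_act G F \<rho> \<gamma> \<sigma> h"
    using gh c s[OF gh(1)] s[OF gh(2)] by (simp add: rep_act_def canc PGL.m_assoc)
qed (simp add: rep_act_def)

lemma \<rho>_conj:
  assumes "\<gamma> \<in> carrier G" "g \<in> carrier G"
  shows "\<rho> \<gamma> \<otimes>\<^bsub>PGL4\<^esub> \<rho> (inv \<gamma> \<otimes> g \<otimes> \<gamma>) \<otimes>\<^bsub>PGL4\<^esub> inv\<^bsub>PGL4\<^esub> (\<rho> \<gamma>) = \<rho> g"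
proof -
  have c: "\<rho> \<gamma> \<in> carrier PGL4" "\<rho> g \<in> carrier PGL4" using assms by (auto intro: \<rho>_closed)
  have canc: "\<rho> \<gamma> \<otimes>\<^bsub>PGL4\<^esub> (inv\<^bsub>PGL4\<^esub> (\<rho> \<gamma>) \<otimes>\<^bsub>PGL4\<^esub> y) = y" if "y \<in> carrier PGL4" for y
    using c that by (simp flip: PGL.m_assoc)
  show ?thesis using assms c by (simp add: \<rho>_mult \<rho>_inv PGL.m_assoc canc)
qed

lemma rep_act_fixed: "\<gamma> \<in> carrier G \<Longrightarrow> rep_act G F \<rho> \<gamma> (restrict \<rho> F) = restrict \<rho> F"
  using conj_F \<rho>_conj by (auto simp: rep_act_def fun_eq_iff restrict_def)

text \<open>The values at \<open>a\<close> and \<open>b\<close> of the transformed representation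
  are words in the old ones, conjugated by \<open>M \<gamma>\<close>, so the action is covered by a
  smooth map of matrix pairs.\<close>

lemma act_lift:
  assumes \<gamma>: "\<gamma> \<in> carrier G"
  obtains \<alpha> where "\<forall>k. Ck_on k GL2 \<alpha>" "\<forall>X. X \<in> GL2 \<longrightarrow> \<alpha> X \<in> GL2 \<and> rep (\<alpha> X) = rep_act G F \<rho> \<gamma> (rep X)"
proof -
  obtain v where v: "lifts_word v (inv \<gamma> \<otimes> a \<otimes> \<gamma>)" using word_lift[OF conj_F[OF \<gamma> ab_mem(1)]] by blast
  obtain w where w: "lifts_word w (inv \<gamma> \<otimes> b \<otimes> \<gamma>)" using word_lift[OF conj_F[OF \<gamma> ab_mem(2)]] by blast
  define \<alpha> where "\<alpha> X = (M \<gamma> ** v X ** matrix_inv (M \<gamma>), M \<gamma> ** w X ** matrix_inv (M \<gamma>))" for X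
  have i: "invertible (M \<gamma>)" by (rule inv_M[OF \<gamma>])
  have lin: "bounded_linear (\<lambda>B. M \<gamma> ** B ** matrix_inv (M \<gamma>))"
    by (rule bounded_linear_compose[OF matmul.bounded_linear_left matmul.bounded_linear_right])
  have "Ck_on k GL2 \<alpha>" for k
    unfolding \<alpha>_def
    by (rule Ck_on_Pair[OF open_GL2 Ck_on_bounded_linear[OF lin open_GL2 lifts_wordD(1)[OF v]]
          Ck_on_bounded_linear[OF lin open_GL2 lifts_wordD(1)[OF w]]])
  moreover have "\<alpha> X \<in> GL2 \<and> rep (\<alpha> X) = rep_act G F \<rho> \<gamma> (rep X)" if X: "X \<in> GL2" for X
  proof
    note iv = lifts_wordD(2)[OF v X] lifts_wordD(2)[OF w X]
    show "\<alpha> X \<in> GL2" using iv i by (simp add: \<alpha>_def invertible_mult)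
    show "rep (\<alpha> X) = rep_act G F \<rho> \<gamma> (rep X)"
      unfolding \<alpha>_def
      by (rule rep_eqI[OF rep_act_Reps[OF \<gamma> rep_props(1)[OF X]]])
        (use ab_mem iv i lifts_wordD(3)[OF v X] lifts_wordD(3)[OF w X] in \<open>simp_all add: rep_act_def \<rho>_M[OF \<gamma>] pgl_conj\<close>)
  qed
  ultimately show ?thesis using that by blast
qed

lemma lifts_act:
  assumes l: "lifts \<epsilon> Y \<sigma>" and \<gamma>: "\<gamma> \<in> carrier G"
  shows "\<exists>Z. lifts \<epsilon> Z (\<lambda>t. rep_act G F \<rho> \<gamma> (\<sigma> t))"
proof -
  obtain \<alpha> where a1: "\<forall>k. Ck_on k GL2 \<alpha>" and a2: "\<forall>X. X \<in> GL2 \<longrightarrow> \<alpha> X \<in> GL2 \<and> rep (\<alpha> X) = rep_act G F \<rho> \<gamma> (rep X)"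
    using act_lift[OF \<gamma>] by blast
  have "lifts \<epsilon> (\<lambda>t. \<alpha> (Y t)) (\<lambda>t. rep_act G F \<rho> \<gamma> (\<sigma> t))"
    unfolding lifts_def
  proof (intro conjI allI ballI)
    show "\<epsilon> > 0" by (rule liftsD(1)[OF l])
    fix k show "Ck_on k {-\<epsilon><..<\<epsilon>} (\<lambda>t. \<alpha> (Y t))"
      by (rule Ck_on_compose[OF _ a1[rule_format] liftsD(2)[OF l]]) (simp, intro image_subsetI liftsD(3)[OF l])
  next
    fix t assume t: "t \<in> {-\<epsilon><..<\<epsilon>}"
    show "\<alpha> (Y t) \<in> GL2" "rep_act G F \<rho> \<gamma> (\<sigma> t) = rep (\<alpha> (Y t))"
      using a2[rule_format, OF liftsD(3)[OF l t]] liftsD(4)[OF l t] by simp_all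
  qed
  then show ?thesis by (rule exI[of "\<lambda>Z. lifts \<epsilon> Z (\<lambda>t. rep_act G F \<rho> \<gamma> (\<sigma> t))"])
qed

text \<open>With u = \<gamma>^-1 g \<gamma> one has \<rho>(g) = \<rho>(\<gamma>) \<rho>(u)
  \<rho>(\<gamma>)^-1, so the transformed path at g times \<rho>(g)^-1 is the conjugate by
  \<rho>(\<gamma>) of \<sigma>(u) \<rho>(u)^-1, and velocities are conjugated accordingly.\<close>

lemma path_cocycle_act:
  assumes l: "lifts \<epsilon> Y \<sigma>" and f: "path_cocycle F \<rho> \<sigma> f" and \<gamma>: "\<gamma> \<in> carrier G"
  shows "path_cocycle F \<rho> (\<lambda>t. rep_act G F \<rho> \<gamma> (\<sigma> t)) (cocycle_act G F \<rho> \<gamma> f)"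
  unfolding path_cocycle_def
proof (intro conjI allI impI ballI)
  fix g assume g: "g \<in> F"
  define u where "u = inv \<gamma> \<otimes> g \<otimes> \<gamma>"
  have u: "u \<in> F" unfolding u_def by (rule conj_F[OF \<gamma> g])
  have vu: "pgl_velocity (\<lambda>t. \<sigma> t u \<otimes>\<^bsub>PGL4\<^esub> inv\<^bsub>PGL4\<^esub> (\<rho> u)) (f u)"
    using f u by (simp add: path_cocycle_def)
  have c: "\<rho> \<gamma> \<in> carrier PGL4" "\<rho> u \<in> carrier PGL4" using \<gamma> u by (auto intro: \<rho>_closed)
  have canc: "inv\<^bsub>PGL4\<^esub> (\<rho> \<gamma>) \<otimes>\<^bsub>PGL4\<^esub> (\<rho> \<gamma> \<otimes>\<^bsub>PGL4\<^esub> y) = y" if "y \<in> carrier PGL4" for y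
    using c that by (simp flip: PGL.m_assoc)
  have \<rho>g: "\<rho> g = \<rho> \<gamma> \<otimes>\<^bsub>PGL4\<^esub> \<rho> u \<otimes>\<^bsub>PGL4\<^esub> inv\<^bsub>PGL4\<^esub> (\<rho> \<gamma>)" unfolding u_def using \<rho>_conj[OF \<gamma>, of g] g by simp
  have "pgl_velocity (\<lambda>t. \<rho> \<gamma> \<otimes>\<^bsub>PGL4\<^esub> (\<sigma> t u \<otimes>\<^bsub>PGL4\<^esub> inv\<^bsub>PGL4\<^esub> (\<rho> u)) \<otimes>\<^bsub>PGL4\<^esub> inv\<^bsub>PGL4\<^esub> (\<rho> \<gamma>))
      (M \<gamma> ** f u ** matrix_inv (M \<gamma>))"
    unfolding \<rho>_M[OF \<gamma>] by (rule pgl_velocity_conj[OF vu velocity_closed[OF l u] inv_M[OF \<gamma>]])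
  moreover have "cocycle_act G F \<rho> \<gamma> f g = M \<gamma> ** f u ** matrix_inv (M \<gamma>)"
    using g by (simp add: cocycle_act_def u_def Ad_\<rho>[OF \<gamma>])
  ultimately have v: "pgl_velocity (\<lambda>t. \<rho> \<gamma> \<otimes>\<^bsub>PGL4\<^esub> (\<sigma> t u \<otimes>\<^bsub>PGL4\<^esub> inv\<^bsub>PGL4\<^esub> (\<rho> u)) \<otimes>\<^bsub>PGL4\<^esub> inv\<^bsub>PGL4\<^esub> (\<rho> \<gamma>))
      (cocycle_act G F \<rho> \<gamma> f g)" by simp
  show "pgl_velocity (\<lambda>t. rep_act G F \<rho> \<gamma> (\<sigma> t) g \<otimes>\<^bsub>PGL4\<^esub> inv\<^bsub>PGL4\<^esub> (\<rho> g)) (cocycle_act G F \<rho> \<gamma> f g)"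
  proof (rule pgl_velocity_cong[OF v])
    show "\<forall>\<^sub>F t in nhds 0. \<rho> \<gamma> \<otimes>\<^bsub>PGL4\<^esub> (\<sigma> t u \<otimes>\<^bsub>PGL4\<^esub> inv\<^bsub>PGL4\<^esub> (\<rho> u)) \<otimes>\<^bsub>PGL4\<^esub> inv\<^bsub>PGL4\<^esub> (\<rho> \<gamma>)
        = rep_act G F \<rho> \<gamma> (\<sigma> t) g \<otimes>\<^bsub>PGL4\<^esub> inv\<^bsub>PGL4\<^esub> (\<rho> g)"
      using lifts_eventually[OF l]
    proof eventually_elim
      case (elim t)
      have "\<sigma> t u \<in> carrier PGL4" by (rule Reps_closed[OF elim u])
      then show ?case unfolding \<rho>g using g c by (simp add: rep_act_def u_def[symmetric] PGL.inv_mult_group PGL.m_assoc canc)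
    qed
  qed
qed (simp add: cocycle_act_def)

lemma FactGroup_nonempty: "C \<in> carrier (G Mod F) \<Longrightarrow> \<exists>\<gamma>. \<gamma> \<in> C"
  and FactGroup_carrier: "C \<in> carrier (G Mod F) \<Longrightarrow> \<gamma> \<in> C \<Longrightarrow> \<gamma> \<in> carrier G"
proof -
  assume "C \<in> carrier (G Mod F)"
  then obtain y where y: "y \<in> carrier G" "C = F #> y" by (auto simp: FactGroup_def RCOSETS_def)
  show "\<exists>\<gamma>. \<gamma> \<in> C" using rcos_self[OF y(1) subgroup_axioms] y(2) by blast
  show "\<gamma> \<in> carrier G" if "\<gamma> \<in> C"
    using that y r_coset_subset_G[OF subset y(1)] by blast
qed

lemma char_act_class:
  assumes "C \<in> carrier (G Mod F)" "\<gamma> \<in> C" "\<sigma> \<in> Reps G F"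
  shows "char_act G F \<rho> C (conj_class F \<sigma>) = conj_class F (rep_act G F \<rho> \<gamma> \<sigma>)"
  by (rule char_act_conj_class[OF normal_axioms \<rho>_hom assms(3,1,2)])

lemma char_act_fixed:
  assumes C: "C \<in> carrier (G Mod F)"
  shows "char_act G F \<rho> C (conj_class F (restrict \<rho> F)) = conj_class F (restrict \<rho> F)"
proof -
  obtain \<gamma> where \<gamma>: "\<gamma> \<in> C" using FactGroup_nonempty[OF C] by blast
  show ?thesis
    unfolding char_act_class[OF C \<gamma> restrict_Reps] rep_act_fixed[OF FactGroup_carrier[OF C \<gamma>]] ..
qed

end

context chart_at
begin

text \<open>Near the base point of \<open>V\<close>, the action in the chart is
  \<open>\<Phi>\<close> after \<open>\<alpha>\<close> after a local section \<open>\<xi>\<close>,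
  each differentiable where it is applied. The derivative is taken within \<open>V\<close> because
  the inverse of \<open>\<kappa>\<close> is meaningful only for points of \<open>V\<close>.\<close>

lemma action_differentiable:
  assumes C: "C \<in> carrier (G Mod F)"
  shows "\<exists>L. ((\<lambda>v. \<kappa> (char_act G F \<rho> C (inv_into U \<kappa> v))) has_derivative L) (at (\<Phi> X0) within V)"
proof -
  obtain \<gamma> where \<gamma>: "\<gamma> \<in> C" using FactGroup_nonempty[OF C] by blast
  note \<gamma>G = FactGroup_carrier[OF C \<gamma>]
  obtain \<alpha> where a1: "\<forall>k. Ck_on k GL2 \<alpha>" and a2: "\<forall>X. X \<in> GL2 \<longrightarrow> \<alpha> X \<in> GL2 \<and> rep (\<alpha> X) = rep_act G F \<rho> \<gamma> (rep X)"
    using act_lift[OF \<gamma>G] by blast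
  obtain \<xi> N \<xi>' where N: "open N" "\<Phi> X0 \<in> N" "\<xi> (\<Phi> X0) = X0" "\<xi> ` N \<subseteq> \<Omega>"
    and \<xi>': "(\<xi> has_derivative \<xi>') (at (\<Phi> X0))" and \<xi>: "\<forall>v\<in>N \<inter> V. \<Phi> (\<xi> v) = v"
    using local_section by blast
  have pt_\<alpha>: "pt (\<alpha> X) = char_act G F \<rho> C (pt X)" if X: "X \<in> GL2" for X
    using char_act_class[OF C \<gamma> rep_props(1)[OF X]] a2[rule_format, OF X] by simp
  have "pt (\<alpha> X0) = pt X0" using pt_\<alpha>[OF X0_GL2] char_act_fixed[OF C] by (simp add: rep_X0)
  then have \<alpha>0: "\<alpha> X0 \<in> \<Omega>" using a2[rule_format, OF X0_GL2] X0U unfolding \<Omega>_def by (simp del: GL4_simps)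
  have d2: "(\<alpha> has_derivative frechet_derivative \<alpha> (at X0)) (at (\<xi> (\<Phi> X0)))"
    using Ck_on_SucD(1)[OF a1[rule_format] X0_GL2] N(3) by simp
  have d3: "(\<Phi> has_derivative frechet_derivative \<Phi> (at (\<alpha> X0))) (at (\<alpha> (\<xi> (\<Phi> X0))))"
    using \<Phi>_derivative[OF \<alpha>0] N(3) by simp
  obtain L where L: "((\<lambda>v. \<Phi> (\<alpha> (\<xi> v))) has_derivative L) (at (\<Phi> X0))"
    using has_derivative_compose[OF has_derivative_compose[OF \<xi>' d2] d3] by blast
  obtain d where d: "d > 0" "ball (\<Phi> X0) d \<subseteq> N" using N(1,2) openE by blast
  have "((\<lambda>v. \<kappa> (char_act G F \<rho> C (inv_into U \<kappa> v))) has_derivative L) (at (\<Phi> X0) within V)"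
  proof (rule has_derivative_transform_within[OF has_derivative_at_withinI[OF L] d(1) \<Phi>_V[OF X0_\<Omega>]])
    fix v assume v: "v \<in> V" "dist v (\<Phi> X0) < d"
    have vN: "v \<in> N" using d(2) v(2) by (auto simp: dist_commute)
    have x: "\<xi> v \<in> \<Omega>" using N(4) vN by blast
    have U: "pt (\<xi> v) \<in> U" using x unfolding \<Omega>_def by (simp del: GL4_simps)
    have "v = \<kappa> (pt (\<xi> v))" using \<xi> vN v(1) by (simp add: \<Phi>_def)
    then have "inv_into U \<kappa> v = pt (\<xi> v)" using inv_into_f_f[OF inj_\<kappa> U] by simp
    then show "\<Phi> (\<alpha> (\<xi> v)) = \<kappa> (char_act G F \<rho> C (inv_into U \<kappa> v))"
      using pt_\<alpha>[OF \<Omega>_GL2[OF x]] by (simp add: \<Phi>_def)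
  qed
  then show ?thesis by (intro exI)
qed

text \<open>A path of representations realising \<open>f\<close> is transformed by \<gamma> into one
  realising \<open>cocycle_act G F \<rho> \<gamma> f\<close>; its chart coordinate is the action
  applied to the original coordinate curve, so the two ways to compute its velocity agree.\<close>

lemma action_velocity:
  assumes C: "C \<in> carrier (G Mod F)" and \<gamma>: "\<gamma> \<in> C" and f: "f \<in> Z1 G F \<rho>"
    and L: "((\<lambda>v. \<kappa> (char_act G F \<rho> C (inv_into U \<kappa> v))) has_derivative L) (at (\<Phi> X0) within V)"
  shows "L (Dval f) = Dval (cocycle_act G F \<rho> \<gamma> f)"
proof -
  note \<gamma>G = FactGroup_carrier[OF C \<gamma>]
  define T where "T v = \<kappa> (char_act G F \<rho> C (inv_into U \<kappa> v))" for v
  obtain \<epsilon> Y \<sigma> f' where l: "lifts \<epsilon> Y \<sigma>" and \<sigma>0: "\<sigma> 0 = restrict \<rho> F" and pc': "path_cocycle F \<rho> \<sigma> f'"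
    and f': "f' \<in> Z1 G F \<rho>" "f' a = f a" "f' b = f b"
    using path_of_values[OF Z1_D(1)[OF f ab_mem(1)] Z1_D(1)[OF f ab_mem(2)]] by blast
  have "f' = f" by (rule Z1_eqI[OF f'(1) f f'(2,3)])
  with pc' have pc: "path_cocycle F \<rho> \<sigma> f" by simp
  define y where "y t = \<kappa> (conj_class F (\<sigma> t))" for t
  obtain f1 where f1: "path_cocycle F \<rho> \<sigma> f1" "(y has_vector_derivative Dval f1) (at 0)"
    using path_velocity[OF l \<sigma>0] unfolding y_def by blast
  have dy: "(y has_vector_derivative Dval f) (at 0)" using f1(2) path_cocycle_unique[OF l f1(1) pc] by simp
  define \<tau> where "\<tau> t = rep_act G F \<rho> \<gamma> (\<sigma> t)" for t
  obtain Z where l': "lifts \<epsilon> Z \<tau>" using lifts_act[OF l \<gamma>G] unfolding \<tau>_def by blast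
  have \<tau>0: "\<tau> 0 = restrict \<rho> F" by (simp add: \<tau>_def \<sigma>0 rep_act_fixed[OF \<gamma>G])
  obtain f2 where f2: "path_cocycle F \<rho> \<tau> f2" "((\<lambda>t. \<kappa> (conj_class F (\<tau> t))) has_vector_derivative Dval f2) (at 0)"
    using path_velocity[OF l' \<tau>0] by blast
  have "f2 = cocycle_act G F \<rho> \<gamma> f"
    by (rule path_cocycle_unique[OF l' f2(1)]) (use path_cocycle_act[OF l pc \<gamma>G] in \<open>simp add: \<tau>_def[abs_def]\<close>)
  with f2(2) have d\<tau>: "((\<lambda>t. \<kappa> (conj_class F (\<tau> t))) has_vector_derivative Dval (cocycle_act G F \<rho> \<gamma> f)) (at 0)"
    by simp
  obtain \<delta> where \<delta>: "\<delta> > 0" "\<forall>t\<in>{-\<delta><..<\<delta>}. conj_class F (\<sigma> t) \<in> U" using path_in_U[OF l \<sigma>0] by blast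
  define \<eta> where "\<eta> = min \<epsilon> \<delta>"
  have \<eta>: "\<eta> > 0" using \<delta>(1) liftsD(1)[OF l] by (simp add: \<eta>_def)
  let ?J = "{-\<eta><..<\<eta>}"
  have J: "t \<in> {-\<epsilon><..<\<epsilon>}" "t \<in> {-\<delta><..<\<delta>}" if "t \<in> ?J" for t using that by (auto simp: \<eta>_def)
  have yU: "conj_class F (\<sigma> t) \<in> U" if "t \<in> ?J" for t using \<delta>(2) J(2)[OF that] by blast
  have TJ: "\<kappa> (conj_class F (\<tau> t)) = T (y t)" if t: "t \<in> ?J" for t
  proof -
    have "inv_into U \<kappa> (y t) = conj_class F (\<sigma> t)"
      unfolding y_def by (rule inv_into_f_f[OF inj_\<kappa> yU[OF t]])
    moreover have "\<sigma> t \<in> Reps G F"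
      unfolding liftsD(4)[OF l J(1)[OF t]] by (rule rep_props(1)[OF liftsD(3)[OF l J(1)[OF t]]])
    ultimately show ?thesis unfolding T_def \<tau>_def using char_act_class[OF C \<gamma>] by simp
  qed
  have y0: "y 0 = \<Phi> X0" by (simp add: y_def \<Phi>_def \<sigma>0 rep_X0)
  have yV: "y ` ?J \<subseteq> V" using yU \<kappa>V unfolding y_def by blast
  \<comment> \<open>The curve \<open>y\<close> stays in \<open>V\<close>, so the derivative within
    \<open>V\<close> restricts to its image and the chain rule applies.\<close>
  have L': "(T has_derivative L) (at (y 0) within y ` ?J)"
    using has_derivative_subset[OF L yV] unfolding T_def y0 .
  have yw: "(y has_derivative (\<lambda>t. t *\<^sub>R Dval f)) (at 0 within ?J)"
    using dy unfolding has_vector_derivative_def by (rule has_derivative_at_withinI)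
  have "((\<lambda>t. T (y t)) has_derivative (\<lambda>t. L (t *\<^sub>R Dval f))) (at 0 within ?J)"
    by (rule has_derivative_in_compose[OF yw L'])
  then have "((\<lambda>t. T (y t)) has_derivative (\<lambda>t. L (t *\<^sub>R Dval f))) (at 0)"
    using \<eta> by (subst (asm) at_within_open) auto
  then have "((\<lambda>t. T (y t)) has_vector_derivative L (Dval f)) (at 0)"
    unfolding has_vector_derivative_def linear_scale[OF has_derivative_linear[OF L]] .
  moreover have "((\<lambda>t. T (y t)) has_vector_derivative Dval (cocycle_act G F \<rho> \<gamma> f)) (at 0)"
    by (rule has_vector_derivative_transform_within_open[OF d\<tau>, where S = ?J]) (use \<eta> TJ in auto)
  ultimately show ?thesis by (rule vector_derivative_unique_at)
qed

text \<open>\<open>D\<close> evaluates a representative chosen from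
  \<open>h1_act G F \<rho> C z\<close>. Whatever is chosen comes from some element of the coset and
  some cocycle in the class, and \<open>action_velocity\<close> covers every such pair, so the
  choice does not matter.\<close>

lemma action_derivative:
  assumes C: "C \<in> carrier (G Mod F)"
    and L: "((\<lambda>v. \<kappa> (char_act G F \<rho> C (inv_into U \<kappa> v))) has_derivative L) (at (\<Phi> X0) within V)"
    and z: "z \<in> H1 G F \<rho>"
  shows "L (D z) = D (h1_act G F \<rho> C z)"
proof -
  obtain f where f: "f \<in> Z1 G F \<rho>" "z = h1_class F \<rho> f" using z unfolding H1_def by blast
  obtain \<gamma> where \<gamma>: "\<gamma> \<in> C" using FactGroup_nonempty[OF C] by blast
  define f' where "f' = (SOME f'. f' \<in> h1_act G F \<rho> C z)"
  have "cocycle_act G F \<rho> \<gamma> f \<in> h1_act G F \<rho> C z"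
    unfolding h1_act_def f(2) using \<gamma> self_h1_class by blast
  then have "f' \<in> h1_act G F \<rho> C z"
    unfolding f'_def by (rule someI[where P = "\<lambda>f'. f' \<in> h1_act G F \<rho> C z"])
  then obtain \<gamma>' f1 where \<gamma>': "\<gamma>' \<in> C" and f1: "f1 \<in> h1_class F \<rho> f" and f'e: "f' = cocycle_act G F \<rho> \<gamma>' f1"
    unfolding h1_act_def f(2) by blast
  obtain X where X: "trace X = 0" "f1 = (\<lambda>g. f g + cob X g)" using f1 unfolding h1_class_cob by blast
  have "f1 \<in> Z1 G F \<rho>" using Z1_lincomb[OF f(1) cob_Z1[OF X(1)], of 1 1] X(2) by simp
  then have "L (Dval f1) = Dval f'" unfolding f'e by (rule action_velocity[OF C \<gamma>' _ L])
  then show ?thesis unfolding f(2) D_class Dval_class[OF f1] unfolding D_def f'_def f(2) .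
qed

end

section \<open>The holonomy\<close>

lemma (in group) finite_generate_singleton:
  assumes a: "a \<in> carrier G" and i: "a [^] (i::int) = \<one>" "i \<noteq> 0"
  shows "finite (generate G {a})"
proof -
  have "a [^] k = a [^] (k mod i)" for k :: int
  proof -
    have "a [^] k = a [^] (i * (k div i) + k mod i)" by simp
    also have "\<dots> = (a [^] i) [^] (k div i) \<otimes> a [^] (k mod i)"
      using a by (simp only: int_pow_mult int_pow_pow)
    finally show ?thesis using a by (simp add: i(1))
  qed
  moreover have "k mod i \<in> {- \<bar>i\<bar>..\<bar>i\<bar>}" for k
    using i(2) abs_mod_less[of i k] by (simp add: abs_less_iff)
  ultimately have "generate G {a} \<subseteq> (\<lambda>k::int. a [^] k) ` {- \<bar>i\<bar>..\<bar>i\<bar>}"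
    unfolding generate_pow[OF a] by blast
  then show ?thesis by (rule finite_subset) simp
qed

lemma (in normal) infinite_order_mod:
  assumes x: "x \<in> carrier G" and gen: "carrier (G Mod H) = generate (G Mod H) {H #> x}"
    and inf: "infinite (carrier (G Mod H))" and i: "x [^] (i::int) \<in> H"
  shows "i = 0"
proof (rule ccontr)
  assume "i \<noteq> 0"
  interpret Q: group "G Mod H" by (rule factorgroup_is_group)
  have "H #> x \<in> carrier (G Mod H)" using x by (auto simp: FactGroup_def RCOSETS_def)
  moreover have "(H #> x) [^]\<^bsub>G Mod H\<^esub> i = \<one>\<^bsub>G Mod H\<^esub>"
    using FactGroup_int_pow[OF x] coset_join2[OF _ subgroup_axioms i] x by (simp add: FactGroup_def)
  ultimately have "finite (generate (G Mod H) {H #> x})" using \<open>i \<noteq> 0\<close> by (rule Q.finite_generate_singleton)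
  then show False using gen inf by simp
qed

lemma (in group) conj_nat_pow:
  assumes "g \<in> carrier G" "k \<in> carrier G"
  shows "(g \<otimes> k \<otimes> inv g) [^] (n::nat) = g \<otimes> k [^] n \<otimes> inv g"
proof (induction n)
  case (Suc n)
  have "inv g \<otimes> (g \<otimes> y) = y" if "y \<in> carrier G" for y using assms that by (simp flip: m_assoc)
  then show ?case using Suc assms by (simp add: m_assoc)
qed (use assms in simp)

context fibre
begin

lemma commutator_pow_nontrivial:
  assumes "n > 0" shows "(a \<otimes> b \<otimes> inv a \<otimes> inv b) [^] (n::nat) \<noteq> \<one>"
proof -
  define w where "w = [(True, True), (False, True), (True, False), (False, False)]"
  have "word_val G a b (concat (replicate n w)) = (a \<otimes> b \<otimes> inv a \<otimes> inv b) [^] n" for n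
  proof (induction n)
    case (Suc n)
    have "word_val G a b w = a \<otimes> b \<otimes> inv a \<otimes> inv b"
      using ab_carrier by (simp add: w_def word_val_Cons letter_val_def m_assoc)
    then have "word_val G a b (concat (replicate (Suc n) w)) =
        (a \<otimes> b \<otimes> inv a \<otimes> inv b) \<otimes> (a \<otimes> b \<otimes> inv a \<otimes> inv b) [^] n"
      using Suc ab_carrier by (simp add: word_val_append)
    then show ?case using ab_carrier nat_pow_Suc2[of "a \<otimes> b \<otimes> inv a \<otimes> inv b" n] by simp
  qed simp
  \<comment> \<open>Copies of \<open>w\<close> join without cancellation because \<open>w\<close>
    ends in the inverse of \<open>b\<close> and begins with \<open>a\<close>; the head is carried
    along in the induction for this reason.\<close>
  moreover have "reduced_word (concat (replicate n w)) \<and>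
      (n > 0 \<longrightarrow> concat (replicate n w) \<noteq> [] \<and> hd (concat (replicate n w)) = (True, True))" for n
  proof (induction n)
    case (Suc n)
    have "reduced_word w" "last w = (False, False)" "hd w = (True, True)" "w \<noteq> []"
      by (simp_all add: w_def reduced_word_def)
    then show ?case using Suc by (cases n) (auto simp: reduced_word_def successively_append_iff)
  qed (simp add: reduced_word_def)
  ultimately show ?thesis using free assms unfolding free_on_pair_def by metis
qed

lemma conj_commutator_infinite_order:
  assumes g: "g \<in> F" and c: "c = g \<otimes> (a \<otimes> b \<otimes> inv a \<otimes> inv b) \<otimes> inv g" and i: "c [^] (i::int) = \<one>"
  shows "i = 0"
proof (rule ccontr)
  assume "i \<noteq> 0"
  define k where "k = a \<otimes> b \<otimes> inv a \<otimes> inv b"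
  have G: "g \<in> carrier G" "k \<in> carrier G" "c \<in> carrier G" using g ab_carrier by (simp_all add: c k_def)
  have "c [^] nat \<bar>i\<bar> = \<one>"
  proof (cases "i \<ge> 0")
    case True
    then show ?thesis using i int_pow_int[of G c "nat i"] by simp
  next
    case False
    then have "c [^] (- i) = \<one>" using i G int_pow_neg[of c i] by simp
    then show ?thesis using False int_pow_int[of G c "nat (- i)"] by simp
  qed
  then have "g \<otimes> k [^] nat \<bar>i\<bar> \<otimes> inv g = \<one>" unfolding c k_def[symmetric] conj_nat_pow[OF G(1,2)] .
  then have "inv g \<otimes> (g \<otimes> k [^] nat \<bar>i\<bar> \<otimes> inv g) \<otimes> g = \<one>" using G by simp
  moreover have "inv g \<otimes> (g \<otimes> y) = y" if "y \<in> carrier G" for y using G that by (simp flip: m_assoc)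
  ultimately have "k [^] nat \<bar>i\<bar> = \<one>" using G by (simp add: m_assoc)
  then show False using commutator_pow_nontrivial[of "nat \<bar>i\<bar>"] \<open>i \<noteq> 0\<close> by (simp add: k_def)
qed

end

lemma O31p_pgl_eq:
  assumes "A \<in> O31p" "B \<in> O31p" "pgl A = pgl B" shows "A = B"
proof -
  obtain c where c: "B = c *\<^sub>R A" using assms(3) by (auto simp: pgl_eq_iff)
  then show ?thesis using O31p_scale_eq[OF assms(1), of c] assms(2) by simp
qed

text \<open>Every class in \<open>PSO31\<close> has exactly one orthochronous representative.
  Products of such matrices are orthochronous, so uniqueness makes the chosen lift multiplicative
  with no sign ambiguity.\<close>

lemma PSO31_lift:
  assumes "\<rho> \<in> hom G PGL4" "\<rho> ` carrier G \<subseteq> PSO31" "group G"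
  shows "\<exists>M. \<forall>g\<in>carrier G. M g \<in> O31p \<and> \<rho> g = pgl (M g) \<and>
    (\<forall>h\<in>carrier G. M (g \<otimes>\<^bsub>G\<^esub> h) = M g ** M h)"
proof -
  interpret group G by (rule assms(3))
  have "\<exists>A. A \<in> O31p \<and> \<rho> g = pgl A" if "g \<in> carrier G" for g
    using that assms(2) SO31_0_O31p unfolding PSO31_def by blast
  then obtain M where M: "\<And>g. g \<in> carrier G \<Longrightarrow> M g \<in> O31p \<and> \<rho> g = pgl (M g)" by metis
  have "M (g \<otimes>\<^bsub>G\<^esub> h) = M g ** M h" if g: "g \<in> carrier G" "h \<in> carrier G" for g h
  proof (rule O31p_pgl_eq)
    have i: "invertible (M g)" "invertible (M h)" using M g O31_ladj(1) O31p_O31 by blast+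
    show "M (g \<otimes>\<^bsub>G\<^esub> h) \<in> O31p" "M g ** M h \<in> O31p" using M g O31p_mult by auto
    have "pgl (M (g \<otimes>\<^bsub>G\<^esub> h)) = \<rho> g \<otimes>\<^bsub>PGL4\<^esub> \<rho> h" using M g hom_mult[OF assms(1)] by (metis m_closed)
    then show "pgl (M (g \<otimes>\<^bsub>G\<^esub> h)) = pgl (M g ** M h)" using M g i by (simp add: pgl_mult)
  qed
  then show ?thesis using M by blast
qed

lemma PGL4_discrete_lift:
  assumes "subtopology PGL4_top P = discrete_topology P" "pgl (mat 1) \<in> P"
  shows "\<exists>\<epsilon>>0. \<forall>A. norm (A - mat 1) < \<epsilon> \<longrightarrow> pgl A \<in> P \<longrightarrow> pgl A = pgl (mat 1)"
proof -
  have "openin (subtopology PGL4_top P) {pgl (mat 1)}" unfolding assms(1) using assms(2) by simp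
  then obtain Q where Q: "openin PGL4_top Q" "{pgl (mat 1)} = Q \<inter> P" unfolding openin_subtopology by blast
  have "open {A. invertible A \<and> pgl A \<in> Q}" using Q(1) by (simp add: openin_PGL4_top)
  moreover have "mat 1 \<in> {A. invertible A \<and> pgl A \<in> Q}" using Q(2) by auto
  ultimately obtain \<epsilon> where \<epsilon>: "\<epsilon> > 0" "ball (mat 1) \<epsilon> \<subseteq> {A. invertible A \<and> pgl A \<in> Q}" using openE by blast
  have "pgl A = pgl (mat 1)" if "norm (A - mat 1) < \<epsilon>" "pgl A \<in> P" for A
  proof -
    have "A \<in> ball (mat 1) \<epsilon>" using that(1) by (simp add: dist_norm norm_minus_commute)
    then have "pgl A \<in> Q \<inter> P" using \<epsilon>(2) that(2) by blast
    then show ?thesis unfolding Q(2)[symmetric] by simp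
  qed
  then show ?thesis using \<epsilon>(1) by blast
qed

text \<open>The peripheral condition supplies the commuting pair \<open>x\<close> and
  \<open>c\<close>; infinite order of \<open>x\<close> modulo \<open>F\<close> comes from the
  infinite cyclic quotient, and that of \<open>c\<close> from freeness. Discreteness of the image
  and injectivity of \<open>\<rho>\<close> combine to the condition that only the identity is mapped
  near \<open>mat 1\<close>.\<close>

lemma holonomy_fibre_rep:
  assumes fibration: "punctured_torus_bundle_group G F a b x \<phi> A"
    and hl: "holonomy_of_complete_structure G A \<rho>"
  shows "\<exists>M. fibre_rep F G a b M \<rho>"
proof -
  have gG: "group G" and Fn: "F \<lhd> G" and free: "free_on_pair G F a b" and x: "x \<in> carrier G"
    and gen: "carrier (G Mod F) = generate (G Mod F) {F #>\<^bsub>G\<^esub> x}" and inf: "infinite (carrier (G Mod F))"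
    and peripheral: "\<exists>g\<in>F. let c = g \<otimes>\<^bsub>G\<^esub> (a \<otimes>\<^bsub>G\<^esub> b \<otimes>\<^bsub>G\<^esub> inv\<^bsub>G\<^esub> a \<otimes>\<^bsub>G\<^esub> inv\<^bsub>G\<^esub> b) \<otimes>\<^bsub>G\<^esub> inv\<^bsub>G\<^esub> g
             in x \<otimes>\<^bsub>G\<^esub> c = c \<otimes>\<^bsub>G\<^esub> x"
    using fibration unfolding punctured_torus_bundle_group_def by blast+
  have \<rho>: "\<rho> \<in> hom G PGL4" "\<rho> ` carrier G \<subseteq> PSO31" "inj_on \<rho> (carrier G)"
    and disc: "subtopology PGL4_top (\<rho> ` carrier G) = discrete_topology (\<rho> ` carrier G)"
    using hl unfolding holonomy_of_complete_structure_def by blast+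
  interpret fibre F G a b by (intro fibre.intro Fn fibre_axioms.intro free)
  obtain g c where g: "g \<in> F" and c: "c = g \<otimes>\<^bsub>G\<^esub> (a \<otimes>\<^bsub>G\<^esub> b \<otimes>\<^bsub>G\<^esub> inv\<^bsub>G\<^esub> a \<otimes>\<^bsub>G\<^esub> inv\<^bsub>G\<^esub> b) \<otimes>\<^bsub>G\<^esub> inv\<^bsub>G\<^esub> g"
    and xc: "x \<otimes>\<^bsub>G\<^esub> c = c \<otimes>\<^bsub>G\<^esub> x" using peripheral unfolding Let_def by blast
  obtain M where M: "\<forall>g\<in>carrier G. M g \<in> O31p \<and> \<rho> g = pgl (M g) \<and>
      (\<forall>h\<in>carrier G. M (g \<otimes>\<^bsub>G\<^esub> h) = M g ** M h)"
    using PSO31_lift[OF \<rho>(1,2) gG] by blast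
  have \<rho>1: "\<rho> \<one>\<^bsub>G\<^esub> = pgl (mat 1)"
    using hom_one[OF \<rho>(1) gG group_PGL4] by (simp add: pgl_one)
  interpret lorentz_rep F G a b x c M
  proof
    show "M g \<in> O31p" if "g \<in> carrier G" for g using M that by blast
    show "M (g \<otimes>\<^bsub>G\<^esub> h) = M g ** M h" if "g \<in> carrier G" "h \<in> carrier G" for g h using M that by blast
    show "\<exists>\<epsilon>>0. \<forall>g\<in>carrier G. norm (M g - mat 1) < \<epsilon> \<longrightarrow> g = \<one>\<^bsub>G\<^esub>"
    proof -
      have "pgl (mat 1) \<in> \<rho> ` carrier G" unfolding \<rho>1[symmetric] by simp
      from PGL4_discrete_lift[OF disc this] obtain \<epsilon> where \<epsilon>: "\<epsilon> > 0"
        "\<forall>A. norm (A - mat 1) < \<epsilon> \<longrightarrow> pgl A \<in> \<rho> ` carrier G \<longrightarrow> pgl A = pgl (mat 1)" by blast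
      have "g = \<one>\<^bsub>G\<^esub>" if h: "g \<in> carrier G" "norm (M g - mat 1) < \<epsilon>" for g
      proof (rule inj_onD[OF \<rho>(3) _ h(1) one_closed])
        have e: "\<rho> g = pgl (M g)" using M h(1) by blast
        then have "pgl (M g) \<in> \<rho> ` carrier G" using h(1) by (metis imageI)
        then show "\<rho> g = \<rho> \<one>\<^bsub>G\<^esub>" unfolding e \<rho>1 using \<epsilon>(2) h(2) by blast
      qed
      then show ?thesis using \<epsilon>(1) by blast
    qed
    show "x \<in> carrier G" by (rule x)
    show "c \<in> F" unfolding c using g ab_mem F_closed by metis
    show "x \<otimes>\<^bsub>G\<^esub> c = c \<otimes>\<^bsub>G\<^esub> x" by (rule xc)
    show "i = 0" if "x [^]\<^bsub>G\<^esub> i \<in> F" for i :: int by (rule infinite_order_mod[OF x gen inf that])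
    show "i = 0" if "c [^]\<^bsub>G\<^esub> i = \<one>\<^bsub>G\<^esub>" for i :: int by (rule conj_commutator_infinite_order[OF g c that])
  qed
  have "fibre_rep F G a b M \<rho>"
  proof
    show "invertible (M g)" if "g \<in> carrier G" for g by (rule M_invertible[OF that])
    show "\<rho> g = pgl (M g)" if "g \<in> carrier G" for g using M that by blast
    show "\<rho> \<in> hom G PGL4" by (rule \<rho>(1))
  qed
  then show ?thesis by (intro exI)
qed

theorem theorem3p1:
  fixes \<Gamma> :: "('g, 'm) monoid_scheme" and F :: "'g set" and a b x :: 'g
    and \<phi> :: "'g \<Rightarrow> 'g" and A :: "int^2^2" and \<rho> :: "'g \<Rightarrow> mat4 set"
  assumes fibration: "punctured_torus_bundle_group \<Gamma> F a b x \<phi> A"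
    and holonomy: "holonomy_of_complete_structure \<Gamma> A \<rho>"
  shows "let P = conj_class F (restrict \<rho> F) in
    smooth_point \<Gamma> F a b P \<and>
    (\<forall>C\<in>carrier (\<Gamma> Mod F). char_act \<Gamma> F \<rho> C P = P) \<and>
    (\<forall>U \<kappa> V. char_chart \<Gamma> F a b U \<kappa> V \<longrightarrow> P \<in> U \<longrightarrow>
      (\<exists>D. tangent_identification \<Gamma> F a b \<rho> \<kappa> V D \<and>
        (\<forall>C\<in>carrier (\<Gamma> Mod F). \<exists>L.
          ((\<lambda>v. \<kappa> (char_act \<Gamma> F \<rho> C (inv_into U \<kappa> v))) has_derivative L) (at (\<kappa> P) within V) \<and>
          (\<forall>z\<in>H1 \<Gamma> F \<rho>. L (D z) = D (h1_act \<Gamma> F \<rho> C z)))))"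
proof -
  obtain M where M: "fibre_rep F \<Gamma> a b M \<rho>" using holonomy_fibre_rep[OF fibration holonomy] by blast
  interpret fibre_rep F \<Gamma> a b M \<rho> by (rule M)
  have P: "conj_class F (restrict \<rho> F) = pt X0" by (simp add: rep_X0)
  have "\<exists>D. tangent_identification \<Gamma> F a b \<rho> \<kappa> V D \<and>
        (\<forall>C\<in>carrier (\<Gamma> Mod F). \<exists>L.
          ((\<lambda>v. \<kappa> (char_act \<Gamma> F \<rho> C (inv_into U \<kappa> v))) has_derivative L) (at (\<kappa> (pt X0)) within V) \<and>
          (\<forall>z\<in>H1 \<Gamma> F \<rho>. L (D z) = D (h1_act \<Gamma> F \<rho> C z)))"
    if "char_chart \<Gamma> F a b U \<kappa> V" "pt X0 \<in> U" for U \<kappa> V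
  proof -
    interpret chart_at F \<Gamma> a b M \<rho> U \<kappa> V by (intro chart_at.intro M chart_at_axioms.intro that)
    have "\<kappa> (pt X0) = \<Phi> X0" by (simp add: \<Phi>_def)
    moreover have "\<exists>L. ((\<lambda>v. \<kappa> (char_act \<Gamma> F \<rho> C (inv_into U \<kappa> v))) has_derivative L) (at (\<Phi> X0) within V) \<and>
          (\<forall>z\<in>H1 \<Gamma> F \<rho>. L (D z) = D (h1_act \<Gamma> F \<rho> C z))"
      if C: "C \<in> carrier (\<Gamma> Mod F)" for C
    proof -
      obtain L where L: "((\<lambda>v. \<kappa> (char_act \<Gamma> F \<rho> C (inv_into U \<kappa> v))) has_derivative L) (at (\<Phi> X0) within V)"
        using action_differentiable[OF C] by blast
      show ?thesis by (intro exI[of _ L] conjI ballI L) (rule action_derivative[OF C L])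
    qed
    ultimately show ?thesis by (intro exI[of _ D] conjI ballI tangent_identification_D) (simp only:)
  qed
  then show ?thesis
    unfolding Let_def P
    by (intro conjI ballI allI impI smooth_point_X0 char_act_fixed[unfolded P])
qed

end
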